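(* Let $\mathcal{A}$ be an essentially small hereditary abelian category, linear over the finite field $\mathbf{k}=\mathbb{F}_q$, with finite morphism and extension spaces, and let $\mathbf{v}=\sqrt{q}$. The $\mathbb{Q}(\mathbf{v})$-vector space $\mathcal{H}_{\Delta}(\mathcal{A})$ with basis $\{[M]\mid [M]\in\mathrm{Iso}(\mathcal{A})\}$, endowed with the multiplication $$[A]*[B]=\sum_{[M]\in\mathrm{Iso}(\mathcal{A})}\widehat{F}_{AB}^M\cdot[M],$$ is an associative algebra with unit $[0]$ (it is called the $\Delta$-Hall algebra of $\mathcal{A}$).
   Context: $\mathcal{A}$ is an essentially small hereditary $\mathbf{k}$-linear abelian category with $|\mathrm{Hom}_{\mathcal{A}}(M,N)|<\infty$ and $|\mathrm{Ext}^1_{\mathcal{A}}(M,N)|<\infty$ for all $M,N$. $\mathrm{Iso}(\mathcal{A})$ is the set of isomorphism classes $[M]$ of objects; $a_M=|\mathrm{Aut}(M)|$. Hall number: $F_{AB}^M=|\{X\subseteq M\mid X\cong B,\ M/X\cong A\}|$. Euler form: $\langle M,N\rangle=\dim_{\mathbf{k}}\mathrm{Hom}_{\mathcal{A}}(M,N)-\dim_{\mathbf{k}}\mathrm{Ext}^1_{\mathcal{A}}(M,N)$. For $L,I,N\in\mathcal{A}$ put $\langle L,I,N\rangle=\langle L,I\rangle+\langle I,I\rangle+\langle I,N\rangle-\langle L,N\rangle$. The $\Delta$-Hall number of $A,B,M\in\mathcal{A}$ is $$\widehat{F}^M_{AB}=\sum_{[L],[I],[N]\in\mathrm{Iso}(\mathcal{A})}\mathbf{v}^{\langle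 L,I,N\rangle}\cdot\frac{a_La_Ia_N}{a_M}\cdot F_{LI}^B\,F_{NL}^M\,F_{IN}^A .$$ *)

theory Defs
  imports
    Complex_Main
    "HOL-Algebra.Generated_Fields"
    "HOL-Algebra.Algebraic_Closure_Type"
    "Jordan_Normal_Form.Missing_VectorSpace"
begin

section \<open>Linear categories\<close>

text \<open>The objects and the arrows of a category form subsets of HOL types, so such a category is
  small.  \<open>Plus\<close>, \<open>ZeroArr\<close> and \<open>Scale\<close> carry the linear structure of the Hom-spaces.\<close>

record ('o, 'm, 'k) lincat =
  Obj :: "'o set"
  Arr :: "'m set"
  Dom :: "'m \<Rightarrow> 'o"
  Cod :: "'m \<Rightarrow> 'o"
  Idt :: "'o \<Rightarrow> 'm"
  Comp :: "'m \<Rightarrow> 'm \<Rightarrow> 'm"  (infixl \<open>\<cdot>\<index>\<close> 70)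
  Plus :: "'m \<Rightarrow> 'm \<Rightarrow> 'm"
  ZeroArr :: "'o \<Rightarrow> 'o \<Rightarrow> 'm"
  Scale :: "'k \<Rightarrow> 'm \<Rightarrow> 'm"

definition Hom :: "('o, 'm, 'k) lincat \<Rightarrow> 'o \<Rightarrow> 'o \<Rightarrow> 'm set" where
  "Hom C A B = {f \<in> Arr C. Dom C f = A \<and> Cod C f = B}"

text \<open>The fields \<open>mult\<close> and \<open>one\<close> of a module record are irrelevant for its module structure.\<close>

definition HomSpace :: "('o, 'm, 'k) lincat \<Rightarrow> 'o \<Rightarrow> 'o \<Rightarrow> ('k, 'm) module" where
  "HomSpace C A B =
    \<lparr>carrier = Hom C A B, monoid.mult = undefined, one = undefined,
     zero = ZeroArr C A B, add = Plus C, module.smult = Scale C\<rparr>"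

locale category =
  fixes C :: "('o, 'm, 'k) lincat" (structure)
  assumes Dom_in_Obj: "f \<in> Arr C \<Longrightarrow> Dom C f \<in> Obj C"
    and Cod_in_Obj: "f \<in> Arr C \<Longrightarrow> Cod C f \<in> Obj C"
    and Idt_in_Hom: "A \<in> Obj C \<Longrightarrow> Idt C A \<in> Hom C A A"
    and Comp_in_Hom: "f \<in> Hom C A B \<Longrightarrow> g \<in> Hom C B D \<Longrightarrow> g \<cdot> f \<in> Hom C A D"
    and Comp_Idt: "f \<in> Hom C A B \<Longrightarrow> f \<cdot> Idt C A = f"
    and Idt_Comp: "f \<in> Hom C A B \<Longrightarrow> Idt C B \<cdot> f = f"
    and Comp_assoc: "f \<in> Hom C A B \<Longrightarrow> g \<in> Hom C B D \<Longrightarrow> h \<in> Hom C D E \<Longrightarrow>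
           (h \<cdot> g) \<cdot> f = h \<cdot> (g \<cdot> f)"

locale linear_category = category C + field K
  for K :: "'k ring" and C :: "('o, 'm, 'k) lincat" (structure) +
  assumes Hom_vectorspace: "A \<in> Obj C \<Longrightarrow> B \<in> Obj C \<Longrightarrow> vectorspace K (HomSpace C A B)"
    and Comp_Plus: "f \<in> Hom C A B \<Longrightarrow> f' \<in> Hom C A B \<Longrightarrow> g \<in> Hom C B D \<Longrightarrow>
           g \<cdot> Plus C f f' = Plus C (g \<cdot> f) (g \<cdot> f')"
    and Plus_Comp: "f \<in> Hom C A B \<Longrightarrow> g \<in> Hom C B D \<Longrightarrow> g' \<in> Hom C B D \<Longrightarrow>
           Plus C g g' \<cdot> f = Plus C (g \<cdot> f) (g' \<cdot> f)"
    and Comp_Scale: "c \<in> carrier K \<Longrightarrow> f \<in> Hom C A B \<Longrightarrow> g \<in> Hom C B D \<Longrightarrow>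
           g \<cdot> Scale C c f = Scale C c (g \<cdot> f)"
    and Scale_Comp: "c \<in> carrier K \<Longrightarrow> f \<in> Hom C A B \<Longrightarrow> g \<in> Hom C B D \<Longrightarrow>
           Scale C c g \<cdot> f = Scale C c (g \<cdot> f)"


section \<open>Abelian categories\<close>

definition is_iso :: "('o, 'm, 'k) lincat \<Rightarrow> 'm \<Rightarrow> bool" where
  "is_iso C f \<longleftrightarrow> f \<in> Arr C \<and>
    (\<exists>g \<in> Hom C (Cod C f) (Dom C f).
       g \<cdot>\<^bsub>C\<^esub> f = Idt C (Dom C f) \<and> f \<cdot>\<^bsub>C\<^esub> g = Idt C (Cod C f))"

definition isomorphic :: "('o, 'm, 'k) lincat \<Rightarrow> 'o \<Rightarrow> 'o \<Rightarrow> bool" where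
  "isomorphic C A B \<longleftrightarrow> (\<exists>f \<in> Hom C A B. is_iso C f)"

definition is_mono :: "('o, 'm, 'k) lincat \<Rightarrow> 'm \<Rightarrow> bool" where
  "is_mono C f \<longleftrightarrow> f \<in> Arr C \<and>
    (\<forall>T \<in> Obj C. \<forall>g \<in> Hom C T (Dom C f). \<forall>h \<in> Hom C T (Dom C f).
       f \<cdot>\<^bsub>C\<^esub> g = f \<cdot>\<^bsub>C\<^esub> h \<longrightarrow> g = h)"

definition is_epi :: "('o, 'm, 'k) lincat \<Rightarrow> 'm \<Rightarrow> bool" where
  "is_epi C f \<longleftrightarrow> f \<in> Arr C \<and>
    (\<forall>T \<in> Obj C. \<forall>g \<in> Hom C (Cod C f) T. \<forall>h \<in> Hom C (Cod C f) T.
       g \<cdot>\<^bsub>C\<^esub> f = h \<cdot>\<^bsub>C\<^esub> f \<longrightarrow> g = h)"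

definition is_zero_object :: "('o, 'm, 'k) lincat \<Rightarrow> 'o \<Rightarrow> bool" where
  "is_zero_object C Z \<longleftrightarrow> Z \<in> Obj C \<and>
    (\<forall>A \<in> Obj C. (\<exists>!f. f \<in> Hom C Z A) \<and> (\<exists>!f. f \<in> Hom C A Z))"

definition is_kernel :: "('o, 'm, 'k) lincat \<Rightarrow> 'm \<Rightarrow> 'm \<Rightarrow> bool" where
  "is_kernel C k f \<longleftrightarrow> f \<in> Arr C \<and> k \<in> Hom C (Dom C k) (Dom C f) \<and>
    f \<cdot>\<^bsub>C\<^esub> k = ZeroArr C (Dom C k) (Cod C f) \<and>
    (\<forall>T \<in> Obj C. \<forall>g \<in> Hom C T (Dom C f). f \<cdot>\<^bsub>C\<^esub> g = ZeroArr C T (Cod C f) \<longrightarrow>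
       (\<exists>!u. u \<in> Hom C T (Dom C k) \<and> k \<cdot>\<^bsub>C\<^esub> u = g))"

definition is_cokernel :: "('o, 'm, 'k) lincat \<Rightarrow> 'm \<Rightarrow> 'm \<Rightarrow> bool" where
  "is_cokernel C c f \<longleftrightarrow> f \<in> Arr C \<and> c \<in> Hom C (Cod C f) (Cod C c) \<and>
    c \<cdot>\<^bsub>C\<^esub> f = ZeroArr C (Dom C f) (Cod C c) \<and>
    (\<forall>T \<in> Obj C. \<forall>g \<in> Hom C (Cod C f) T. g \<cdot>\<^bsub>C\<^esub> f = ZeroArr C (Dom C f) T \<longrightarrow>
       (\<exists>!u. u \<in> Hom C (Cod C c) T \<and> u \<cdot>\<^bsub>C\<^esub> c = g))"

text \<open>A biproduct of \<open>A\<close> and \<open>B\<close> is given by its two injections and its two projections.\<close>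

definition is_biproduct ::
    "('o, 'm, 'k) lincat \<Rightarrow> 'o \<Rightarrow> 'o \<Rightarrow> 'm \<times> 'm \<times> 'm \<times> 'm \<Rightarrow> bool" where
  "is_biproduct C A B = (\<lambda>(i1, i2, p1, p2).
    \<exists>S \<in> Obj C. i1 \<in> Hom C A S \<and> i2 \<in> Hom C B S \<and> p1 \<in> Hom C S A \<and> p2 \<in> Hom C S B \<and>
      p1 \<cdot>\<^bsub>C\<^esub> i1 = Idt C A \<and> p2 \<cdot>\<^bsub>C\<^esub> i2 = Idt C B \<and>
      p1 \<cdot>\<^bsub>C\<^esub> i2 = ZeroArr C B A \<and> p2 \<cdot>\<^bsub>C\<^esub> i1 = ZeroArr C A B \<and>
      Plus C (i1 \<cdot>\<^bsub>C\<^esub> p1) (i2 \<cdot>\<^bsub>C\<^esub> p2) = Idt C S)"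

locale abelian_category = linear_category K C
  for K :: "'k ring" and C :: "('o, 'm, 'k) lincat" (structure) +
  assumes zero_object_exists: "\<exists>Z. is_zero_object C Z"
    and biproduct_exists: "A \<in> Obj C \<Longrightarrow> B \<in> Obj C \<Longrightarrow> \<exists>b. is_biproduct C A B b"
    and kernel_exists: "f \<in> Arr C \<Longrightarrow> \<exists>k. is_kernel C k f"
    and cokernel_exists: "f \<in> Arr C \<Longrightarrow> \<exists>c. is_cokernel C c f"
    and mono_is_kernel: "is_mono C f \<Longrightarrow> \<exists>g. is_kernel C f g"
    and epi_is_cokernel: "is_epi C f \<Longrightarrow> \<exists>g. is_cokernel C f g"


section \<open>The Yoneda space of extensions of degree one\<close>

text \<open>A pair \<open>(i, p)\<close> in \<open>ses C M N\<close> stands for a short exact sequence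
  \<open>0 \<rightarrow> N \<rightarrow> E \<rightarrow> M \<rightarrow> 0\<close> with \<open>E = Dom C p\<close>.\<close>

definition ses :: "('o, 'm, 'k) lincat \<Rightarrow> 'o \<Rightarrow> 'o \<Rightarrow> ('m \<times> 'm) set" where
  "ses C M N = {(i, p). Dom C i = N \<and> Cod C p = M \<and> is_kernel C i p \<and> is_cokernel C p i}"

text \<open>Morphisms of short exact sequences with prescribed outer components \<open>a\<close> and \<open>c\<close>.
  If \<open>c\<close> is an identity, \<open>e'\<close> is the pushout of \<open>e\<close> along \<open>a\<close>; if \<open>a\<close> is an
  identity, \<open>e\<close> is the pullback of \<open>e'\<close> along \<open>c\<close> (Mac Lane, Homology, III.1).\<close>

definition ses_map ::
    "('o, 'm, 'k) lincat \<Rightarrow> 'm \<times> 'm \<Rightarrow> 'm \<Rightarrow> 'm \<Rightarrow> 'm \<times> 'm \<Rightarrow> bool" where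
  "ses_map C e a c e' \<longleftrightarrow>
    (\<exists>b \<in> Hom C (Dom C (snd e)) (Dom C (snd e')).
       b \<cdot>\<^bsub>C\<^esub> fst e = fst e' \<cdot>\<^bsub>C\<^esub> a \<and> snd e' \<cdot>\<^bsub>C\<^esub> b = c \<cdot>\<^bsub>C\<^esub> snd e)"

definition ses_equiv ::
    "('o, 'm, 'k) lincat \<Rightarrow> 'o \<Rightarrow> 'o \<Rightarrow> (('m \<times> 'm) \<times> ('m \<times> 'm)) set" where
  "ses_equiv C M N = {(e, e'). e \<in> ses C M N \<and> e' \<in> ses C M N \<and>
    (\<exists>h \<in> Hom C (Dom C (snd e)) (Dom C (snd e')).
       is_iso C h \<and> h \<cdot>\<^bsub>C\<^esub> fst e = fst e' \<and> snd e' \<cdot>\<^bsub>C\<^esub> h = snd e)}"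

definition Ext1 :: "('o, 'm, 'k) lincat \<Rightarrow> 'o \<Rightarrow> 'o \<Rightarrow> ('m \<times> 'm) set set" where
  "Ext1 C M N = ses C M N // ses_equiv C M N"

definition biproduct :: "('o, 'm, 'k) lincat \<Rightarrow> 'o \<Rightarrow> 'o \<Rightarrow> 'm \<times> 'm \<times> 'm \<times> 'm" where
  "biproduct C A B = (SOME b. is_biproduct C A B b)"

definition inj1 :: "('o, 'm, 'k) lincat \<Rightarrow> 'o \<Rightarrow> 'o \<Rightarrow> 'm" where
  "inj1 C A B = (case biproduct C A B of (i1, i2, p1, p2) \<Rightarrow> i1)"

definition inj2 :: "('o, 'm, 'k) lincat \<Rightarrow> 'o \<Rightarrow> 'o \<Rightarrow> 'm" where
  "inj2 C A B = (case biproduct C A B of (i1, i2, p1, p2) \<Rightarrow> i2)"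

definition proj1 :: "('o, 'm, 'k) lincat \<Rightarrow> 'o \<Rightarrow> 'o \<Rightarrow> 'm" where
  "proj1 C A B = (case biproduct C A B of (i1, i2, p1, p2) \<Rightarrow> p1)"

definition proj2 :: "('o, 'm, 'k) lincat \<Rightarrow> 'o \<Rightarrow> 'o \<Rightarrow> 'm" where
  "proj2 C A B = (case biproduct C A B of (i1, i2, p1, p2) \<Rightarrow> p2)"

definition direct_sum_arr :: "('o, 'm, 'k) lincat \<Rightarrow> 'm \<Rightarrow> 'm \<Rightarrow> 'm" where
  "direct_sum_arr C f g = Plus C
     (inj1 C (Cod C f) (Cod C g) \<cdot>\<^bsub>C\<^esub> f \<cdot>\<^bsub>C\<^esub> proj1 C (Dom C f) (Dom C g))
     (inj2 C (Cod C f) (Cod C g) \<cdot>\<^bsub>C\<^esub> g \<cdot>\<^bsub>C\<^esub> proj2 C (Dom C f) (Dom C g))"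

definition direct_sum_ses ::
    "('o, 'm, 'k) lincat \<Rightarrow> 'm \<times> 'm \<Rightarrow> 'm \<times> 'm \<Rightarrow> 'm \<times> 'm" where
  "direct_sum_ses C e e' =
     (direct_sum_arr C (fst e) (fst e'), direct_sum_arr C (snd e) (snd e'))"

definition diagonal :: "('o, 'm, 'k) lincat \<Rightarrow> 'o \<Rightarrow> 'm" where
  "diagonal C M = Plus C (inj1 C M M) (inj2 C M M)"

definition codiagonal :: "('o, 'm, 'k) lincat \<Rightarrow> 'o \<Rightarrow> 'm" where
  "codiagonal C N = Plus C (proj1 C N N) (proj2 C N N)"

text \<open>Baer sum: the direct sum of two extensions is pulled back along the diagonal of \<open>M\<close> and
  the result \<open>d\<close> is pushed out along the codiagonal of \<open>N\<close>.\<close>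

definition Baer_sum :: "('o, 'm, 'k) lincat \<Rightarrow> 'o \<Rightarrow> 'o \<Rightarrow>
    ('m \<times> 'm) set \<Rightarrow> ('m \<times> 'm) set \<Rightarrow> ('m \<times> 'm) set" where
  "Baer_sum C M N x y = {e \<in> ses C M N. \<exists>e1 \<in> x. \<exists>e2 \<in> y.
     \<exists>d \<in> ses C M (Cod C (inj1 C N N)).
       ses_map C d (Idt C (Cod C (inj1 C N N))) (diagonal C M) (direct_sum_ses C e1 e2) \<and>
       ses_map C d (codiagonal C N) (Idt C M) e}"

definition Ext_scale :: "('o, 'm, 'k) lincat \<Rightarrow> 'o \<Rightarrow> 'o \<Rightarrow>
    'k \<Rightarrow> ('m \<times> 'm) set \<Rightarrow> ('m \<times> 'm) set" where
  "Ext_scale C M N c x =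
     {e \<in> ses C M N. \<exists>e0 \<in> x. ses_map C e0 (Scale C c (Idt C N)) (Idt C M) e}"

definition split_ses :: "('o, 'm, 'k) lincat \<Rightarrow> 'o \<Rightarrow> 'o \<Rightarrow> ('m \<times> 'm) set" where
  "split_ses C M N =
     {e \<in> ses C M N. \<exists>s \<in> Hom C M (Dom C (snd e)). snd e \<cdot>\<^bsub>C\<^esub> s = Idt C M}"

definition ExtSpace :: "('o, 'm, 'k) lincat \<Rightarrow> 'o \<Rightarrow> 'o \<Rightarrow> ('k, ('m \<times> 'm) set) module" where
  "ExtSpace C M N =
    \<lparr>carrier = Ext1 C M N, monoid.mult = undefined, one = undefined,
     zero = split_ses C M N, add = Baer_sum C M N, module.smult = Ext_scale C M N\<rparr>"


section \<open>Hereditary categories\<close>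

text \<open>Exactness at the middle term: \<open>f\<close> factors as an epimorphism followed by a kernel of \<open>g\<close>,
  i.e.\ the image of \<open>f\<close> is the kernel of \<open>g\<close>.\<close>

definition exact_pair :: "('o, 'm, 'k) lincat \<Rightarrow> 'm \<Rightarrow> 'm \<Rightarrow> bool" where
  "exact_pair C f g \<longleftrightarrow>
    (\<exists>k e. is_kernel C k g \<and> is_epi C e \<and> Cod C e = Dom C k \<and> f = k \<cdot>\<^bsub>C\<^esub> e)"

text \<open>A triple \<open>(a, b, c)\<close> in \<open>two_ext C M N\<close> stands for an exact sequence
  \<open>0 \<rightarrow> N \<rightarrow> E \<rightarrow> F \<rightarrow> M \<rightarrow> 0\<close>.\<close>

definition two_ext :: "('o, 'm, 'k) lincat \<Rightarrow> 'o \<Rightarrow> 'o \<Rightarrow> ('m \<times> 'm \<times> 'm) set" where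
  "two_ext C M N = {(a, b, c). Dom C a = N \<and> Cod C c = M \<and>
     is_mono C a \<and> exact_pair C a b \<and> exact_pair C b c \<and> is_epi C c}"

definition two_ext_step ::
    "('o, 'm, 'k) lincat \<Rightarrow> 'o \<Rightarrow> 'o \<Rightarrow> (('m \<times> 'm \<times> 'm) \<times> ('m \<times> 'm \<times> 'm)) set" where
  "two_ext_step C M N = {((a, b, c), (a', b', c')).
     (a, b, c) \<in> two_ext C M N \<and> (a', b', c') \<in> two_ext C M N \<and>
     (\<exists>f \<in> Hom C (Dom C b) (Dom C b'). \<exists>g \<in> Hom C (Dom C c) (Dom C c').
        f \<cdot>\<^bsub>C\<^esub> a = a' \<and> g \<cdot>\<^bsub>C\<^esub> b = b' \<cdot>\<^bsub>C\<^esub> f \<and> c' \<cdot>\<^bsub>C\<^esub> g = c)}"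

definition two_ext_equiv ::
    "('o, 'm, 'k) lincat \<Rightarrow> 'o \<Rightarrow> 'o \<Rightarrow> (('m \<times> 'm \<times> 'm) \<times> ('m \<times> 'm \<times> 'm)) set" where
  "two_ext_equiv C M N = (two_ext_step C M N \<union> (two_ext_step C M N)\<inverse>)\<^sup>*"

definition Ext2 :: "('o, 'm, 'k) lincat \<Rightarrow> 'o \<Rightarrow> 'o \<Rightarrow> ('m \<times> 'm \<times> 'm) set set" where
  "Ext2 C M N = two_ext C M N // two_ext_equiv C M N"

text \<open>The zero class, represented by \<open>0 \<rightarrow> N = N \<rightarrow> M = M \<rightarrow> 0\<close> with zero map in the middle.\<close>

definition Ext2_zero :: "('o, 'm, 'k) lincat \<Rightarrow> 'o \<Rightarrow> 'o \<Rightarrow> ('m \<times> 'm \<times> 'm) set" where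
  "Ext2_zero C M N = two_ext_equiv C M N `` {(Idt C N, ZeroArr C N M, Idt C M)}"

locale hereditary_category = abelian_category K C
  for K :: "'k ring" and C :: "('o, 'm, 'k) lincat" (structure) +
  assumes hereditary: "M \<in> Obj C \<Longrightarrow> N \<in> Obj C \<Longrightarrow> Ext2 C M N = {Ext2_zero C M N}"

locale finitary_hereditary_category = hereditary_category K C
  for K :: "'k ring" and C :: "('o, 'm, 'k) lincat" (structure) +
  assumes finite_field: "finite (carrier K)"
    and finite_Hom: "M \<in> Obj C \<Longrightarrow> N \<in> Obj C \<Longrightarrow> finite (Hom C M N)"
    and finite_Ext1: "M \<in> Obj C \<Longrightarrow> N \<in> Obj C \<Longrightarrow> finite (Ext1 C M N)"


section \<open>Hall numbers\<close>

definition iso_class :: "('o, 'm, 'k) lincat \<Rightarrow> 'o \<Rightarrow> 'o set" where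
  "iso_class C M = {T \<in> Obj C. isomorphic C M T}"

definition Iso :: "('o, 'm, 'k) lincat \<Rightarrow> 'o set set" where
  "Iso C = iso_class C ` Obj C"

definition rep :: "'o set \<Rightarrow> 'o" where
  "rep m = (SOME M. M \<in> m)"

definition Aut :: "('o, 'm, 'k) lincat \<Rightarrow> 'o \<Rightarrow> 'm set" where
  "Aut C M = {f \<in> Hom C M M. is_iso C f}"

text \<open>A subobject is an equivalence class of monomorphisms.\<close>

definition mono_equiv :: "('o, 'm, 'k) lincat \<Rightarrow> 'o \<Rightarrow> ('m \<times> 'm) set" where
  "mono_equiv C M = {(i, j). is_mono C i \<and> is_mono C j \<and> Cod C i = M \<and> Cod C j = M \<and>
     (\<exists>h \<in> Hom C (Dom C i) (Dom C j). is_iso C h \<and> j \<cdot>\<^bsub>C\<^esub> h = i)}"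

definition subobjects :: "('o, 'm, 'k) lincat \<Rightarrow> 'o \<Rightarrow> 'm set set" where
  "subobjects C M = {i. is_mono C i \<and> Cod C i = M} // mono_equiv C M"

definition Hall_number :: "('o, 'm, 'k) lincat \<Rightarrow> 'o \<Rightarrow> 'o \<Rightarrow> 'o \<Rightarrow> nat" where
  "Hall_number C A B M = card {T \<in> subobjects C M.
     \<exists>i \<in> T. isomorphic C (Dom C i) B \<and>
       (\<exists>p. is_cokernel C p i \<and> isomorphic C (Cod C p) A)}"

definition Euler_form :: "'k ring \<Rightarrow> ('o, 'm, 'k) lincat \<Rightarrow> 'o \<Rightarrow> 'o \<Rightarrow> int" where
  "Euler_form K C M N =
     int (vectorspace.dim K (HomSpace C M N)) - int (vectorspace.dim K (ExtSpace C M N))"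

definition Euler_form3 :: "'k ring \<Rightarrow> ('o, 'm, 'k) lincat \<Rightarrow> 'o \<Rightarrow> 'o \<Rightarrow> 'o \<Rightarrow> int" where
  "Euler_form3 K C L I N =
     Euler_form K C L I + Euler_form K C I I + Euler_form K C I N - Euler_form K C L N"

definition sqrt_q :: "'k ring \<Rightarrow> real" where
  "sqrt_q K = sqrt (real (card (carrier K)))"

definition Delta_term ::
    "'k ring \<Rightarrow> ('o, 'm, 'k) lincat \<Rightarrow> 'o \<Rightarrow> 'o \<Rightarrow> 'o \<Rightarrow> 'o \<Rightarrow> 'o \<Rightarrow> 'o \<Rightarrow> real" where
  "Delta_term K C A B M L I N =
     sqrt_q K powi Euler_form3 K C L I N
     * (real (card (Aut C L)) * real (card (Aut C I)) * real (card (Aut C N))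
        / real (card (Aut C M)))
     * real (Hall_number C L I B) * real (Hall_number C N L M) * real (Hall_number C I N A)"

definition Delta_support ::
    "'k ring \<Rightarrow> ('o, 'm, 'k) lincat \<Rightarrow> 'o \<Rightarrow> 'o \<Rightarrow> 'o \<Rightarrow> ('o set \<times> 'o set \<times> 'o set) set" where
  "Delta_support K C A B M = {(l, i, n). l \<in> Iso C \<and> i \<in> Iso C \<and> n \<in> Iso C \<and>
     Delta_term K C A B M (rep l) (rep i) (rep n) \<noteq> 0}"

text \<open>The sum over all triples of isomorphism classes, restricted to its nonzero terms.\<close>

definition Delta_Hall_number ::
    "'k ring \<Rightarrow> ('o, 'm, 'k) lincat \<Rightarrow> 'o \<Rightarrow> 'o \<Rightarrow> 'o \<Rightarrow> real" where
  "Delta_Hall_number K C A B M =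
     (\<Sum>(l, i, n) \<in> Delta_support K C A B M. Delta_term K C A B M (rep l) (rep i) (rep n))"


section \<open>The algebra\<close>

text \<open>The field \<open>\<rat>(v)\<close>, as the subfield of the reals generated by \<open>v = sqrt q\<close>.\<close>

definition Qv :: "'k ring \<Rightarrow> real ring" where
  "Qv K = ring_of_type_algebra\<lparr>carrier := generate_field ring_of_type_algebra {sqrt_q K}\<rparr>"

text \<open>The locale \<^locale>\<open>algebra\<close> of the library is restricted to commutative algebras.\<close>

locale associative_algebra = module R M + ring M
  for R (structure) and M (structure) +
  assumes smult_mult_left: "\<lbrakk>a \<in> carrier R; x \<in> carrier M; y \<in> carrier M\<rbrakk> \<Longrightarrow>
        (a \<odot>\<^bsub>M\<^esub> x) \<otimes>\<^bsub>M\<^esub> y = a \<odot>\<^bsub>M\<^esub> (x \<otimes>\<^bsub>M\<^esub> y)"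
    and smult_mult_right: "\<lbrakk>a \<in> carrier R; x \<in> carrier M; y \<in> carrier M\<rbrakk> \<Longrightarrow>
        x \<otimes>\<^bsub>M\<^esub> (a \<odot>\<^bsub>M\<^esub> y) = a \<odot>\<^bsub>M\<^esub> (x \<otimes>\<^bsub>M\<^esub> y)"

text \<open>The basis vector \<open>[M]\<close> of the free vector space on \<^term>\<open>Iso C\<close>, whose elements are
  finitely supported functions on \<^term>\<open>Iso C\<close> (extended by zero).\<close>

definition class_vec :: "('o, 'm, 'k) lincat \<Rightarrow> 'o \<Rightarrow> 'o set \<Rightarrow> real" where
  "class_vec C M = (\<lambda>c. if c = iso_class C M then 1 else 0)"

definition zero_object :: "('o, 'm, 'k) lincat \<Rightarrow> 'o" where
  "zero_object C = (SOME Z. is_zero_object C Z)"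

definition Delta_Hall_algebra ::
    "'k ring \<Rightarrow> ('o, 'm, 'k) lincat \<Rightarrow> (real, 'o set \<Rightarrow> real) module" where
  "Delta_Hall_algebra K C =
    \<lparr>carrier = {x. finite {c. x c \<noteq> 0} \<and> {c. x c \<noteq> 0} \<subseteq> Iso C \<and> range x \<subseteq> carrier (Qv K)},
     monoid.mult = (\<lambda>x y c. if c \<in> Iso C
       then \<Sum>a | x a \<noteq> 0. \<Sum>b | y b \<noteq> 0.
              x a * y b * Delta_Hall_number K C (rep a) (rep b) (rep c)
       else 0),
     one = class_vec C (zero_object C),
     zero = (\<lambda>c. 0),
     add = (\<lambda>x y c. x c + y c),
     module.smult = (\<lambda>r x c. r * x c)\<rparr>"

end

theory Submission
  imports Defs "HOL-Analysis.Analysis"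
begin

text \<open>Write \<open>e(M, N) = |Hom(M, N)| / |Ext(M, N)|\<close>, so that \<open>v\<close> to the power of the Euler form is the
  square root of \<open>e\<close>, and let \<open>S(A, B; M)\<close> be the number of short exact sequences
  \<open>0 \<rightarrow> B \<rightarrow> M \<rightarrow> A \<rightarrow> 0\<close>, that is, the Hall number times \<open>|Aut A| |Aut B|\<close>. Since \<open>e\<close> is
  multiplicative on short exact sequences, the Delta-Hall number of \<open>A, B, M\<close> is \<open>sqrt e(B, A) / |Aut M|\<close>
  times the sum of \<open>S(L, I; B) S(N, L; M) S(I, N; A) / e(L, N)\<close> over \<open>L, I, N\<close>, weighted by the
  inverse orders of the automorphism groups. In an iterated product the middle object \<open>M\<close> occurs in two
  short exact sequences, and Green's formula eliminates it. Reassociating filtrations then turns both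
  iterated products into the same weighted sum over six subquotients.

  Green's formula and the multiplicativity of \<open>e\<close> use heredity only through one lifting property: the
  image factorization of a morphism \<open>b\<close> with kernel \<open>N\<close> and cokernel \<open>M\<close> comes from an extension of
  \<open>M\<close> by the domain of \<open>b\<close>. As there are no projectives, extension groups are computed by
  epimorphisms that efface the finitely many extension classes in question.\<close>

section \<open>Linear categories and duality\<close>

text \<open>A term with \<open>L\<close>, \<open>I\<close>, \<open>N\<close> describes a cyclic
  exact sequence from \<open>A\<close> to \<open>B\<close> to \<open>M\<close> and back to
  \<open>A\<close>, with successive images \<open>I\<close>, \<open>L\<close>, \<open>N\<close>. In
  the common form of the iterated products, each of the six subquotients belongs to exactly two of
  the four objects \<open>A\<close>, \<open>B\<close>, \<open>D\<close>, \<open>Y\<close>, one for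
  each pair; this symmetry is why the two sides agree. The square roots in
  \<open>(A * B) * D\<close> combine to the constant sqrt(e(B,A) e(D,A) e(D,B)) and a correction
  1/e(D,I); in \<open>A * (B * D)\<close> the same constant occurs with 1/e(I,A). Hence only
  integral powers of e remain to be compared. There may be infinitely many isomorphism classes, so
  the weighted sums take values in the extended nonnegative reals: all exchanges of summation are
  then legitimate, and finiteness enters only on returning to real structure constants. A choice
  that is unique up to unique isomorphism has total weight 1; associativity of filtrations is a
  double count over a relation whose fibres are of this kind, and in Green's formula one of the two
  fibres is of this kind while the other has weight 1/e.\<close>

lemma Hom_iff: "f \<in> Hom C A B \<longleftrightarrow> f \<in> Arr C \<and> Dom C f = A \<and> Cod C f = B"
  by (simp add: Hom_def)

text \<open>Source, target and composition are reversed, so \<open>ZeroArr\<close> has to swap its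
  arguments as well. The simplification rules below match dual notions with each other; every later
  result then yields its mirror image by instantiating the locale at
  \<open>op_cat C\<close>.\<close>

definition op_cat :: "('o, 'm, 'k) lincat \<Rightarrow> ('o, 'm, 'k) lincat" where
  "op_cat C = C\<lparr>Dom := Cod C, Cod := Dom C, Comp := (\<lambda>f g. g \<cdot>\<^bsub>C\<^esub> f),
     ZeroArr := (\<lambda>A B. ZeroArr C B A)\<rparr>"

lemma op_cat_sel [simp]:
  "Obj (op_cat C) = Obj C" "Arr (op_cat C) = Arr C" "Dom (op_cat C) = Cod C"
  "Cod (op_cat C) = Dom C" "Idt (op_cat C) = Idt C" "f \<cdot>\<^bsub>op_cat C\<^esub> g = g \<cdot>\<^bsub>C\<^esub> f"
  "Plus (op_cat C) = Plus C" "ZeroArr (op_cat C) A B = ZeroArr C B A"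
  "Scale (op_cat C) = Scale C"
  by (simp_all add: op_cat_def)

lemma Hom_op [simp]: "Hom (op_cat C) A B = Hom C B A"
  by (auto simp: Hom_def)

lemma HomSpace_op [simp]: "HomSpace (op_cat C) A B = HomSpace C B A"
  by (simp add: HomSpace_def)

lemma is_mono_op [simp]: "is_mono (op_cat C) f = is_epi C f"
  by (simp add: is_mono_def is_epi_def)

lemma is_epi_op [simp]: "is_epi (op_cat C) f = is_mono C f"
  by (simp add: is_mono_def is_epi_def)

lemma is_iso_op [simp]: "is_iso (op_cat C) f = is_iso C f"
  by (auto simp: is_iso_def)

lemma is_kernel_op [simp]: "is_kernel (op_cat C) k f = is_cokernel C k f"
  by (simp add: is_kernel_def is_cokernel_def)

lemma is_cokernel_op [simp]: "is_cokernel (op_cat C) k f = is_kernel C k f"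
  by (simp add: is_kernel_def is_cokernel_def)

lemma is_zero_object_op [simp]: "is_zero_object (op_cat C) Z = is_zero_object C Z"
  by (auto simp: is_zero_object_def)

lemma is_biproduct_op:
  "is_biproduct C A B (i1, i2, p1, p2) \<Longrightarrow> is_biproduct (op_cat C) A B (p1, p2, i1, i2)"
  by (auto simp: is_biproduct_def)

lemma ses_op [simp]: "(p, i) \<in> ses (op_cat C) N M \<longleftrightarrow> (i, p) \<in> ses C M N"
  by (auto simp: ses_def)

context category
begin

lemma Comp_Arr [simp]:
  assumes "f \<in> Arr C" "g \<in> Arr C" "Dom C g = Cod C f"
  shows "g \<cdot> f \<in> Arr C" "Dom C (g \<cdot> f) = Dom C f" "Cod C (g \<cdot> f) = Cod C g"
  using Comp_in_Hom[of f "Dom C f" "Cod C f" g "Cod C g"] assms by (auto simp: Hom_iff)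

lemma Idt_Arr [simp]:
  assumes "A \<in> Obj C"
  shows "Idt C A \<in> Arr C" "Dom C (Idt C A) = A" "Cod C (Idt C A) = A"
  using Idt_in_Hom[OF assms] by (auto simp: Hom_iff)

lemma DomCod_Obj [simp]: "f \<in> Arr C \<Longrightarrow> Dom C f \<in> Obj C" "f \<in> Arr C \<Longrightarrow> Cod C f \<in> Obj C"
  by (auto intro: Dom_in_Obj Cod_in_Obj)

lemma Comp_Idt_right [simp]: "f \<in> Arr C \<Longrightarrow> Dom C f = A \<Longrightarrow> f \<cdot> Idt C A = f"
  using Comp_Idt[of f A "Cod C f"] by (simp add: Hom_iff)

lemma Comp_Idt_left [simp]: "f \<in> Arr C \<Longrightarrow> Cod C f = A \<Longrightarrow> Idt C A \<cdot> f = f"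
  using Idt_Comp[of f "Dom C f" A] by (simp add: Hom_iff)

lemma assoc [simp]:
  assumes "f \<in> Arr C" "g \<in> Arr C" "h \<in> Arr C" "Dom C g = Cod C f" "Dom C h = Cod C g"
  shows "(h \<cdot> g) \<cdot> f = h \<cdot> (g \<cdot> f)"
  using Comp_assoc[of f "Dom C f" "Cod C f" g "Cod C g" h "Cod C h"] assms by (auto simp: Hom_iff)

text \<open>Turns an equation between composites into a rewrite rule that also applies when further
  arrows are composed on the right, as needed for right-nested normal forms.\<close>

lemma reassoc:
  assumes "g \<cdot> f = h" "f \<in> Arr C" "g \<in> Arr C" "Dom C g = Cod C f"
    and "x \<in> Arr C" "Cod C x = Dom C f"
  shows "g \<cdot> (f \<cdot> x) = h \<cdot> x"
  using assms assoc[of x f g] by simp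

lemma category_op: "category (op_cat C)"
  by unfold_locales (auto simp: Hom_iff)

end

section \<open>Additive arithmetic of arrows\<close>

context linear_category

begin

lemma is_field: "field K"
  by unfold_locales

text \<open>The ambient Hom-space is read off from the first argument, which spares later formulas
  the two objects. The value is meaningful only for parallel arrows.\<close>

definition Minus :: "'m \<Rightarrow> 'm \<Rightarrow> 'm" where
  "Minus f g = f \<ominus>\<^bsub>HomSpace C (Dom C f) (Cod C f)\<^esub> g"

lemma HomSpace_sel [simp]:
  "carrier (HomSpace C A B) = Hom C A B" "f \<oplus>\<^bsub>HomSpace C A B\<^esub> g = Plus C f g"
  "\<zero>\<^bsub>HomSpace C A B\<^esub> = ZeroArr C A B" "c \<odot>\<^bsub>HomSpace C A B\<^esub> f = Scale C c f"
  by (simp_all add: HomSpace_def)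

lemma ZeroArr_Arr [simp]:
  assumes "A \<in> Obj C" "B \<in> Obj C"
  shows "ZeroArr C A B \<in> Arr C" "Dom C (ZeroArr C A B) = A" "Cod C (ZeroArr C A B) = B"
proof -
  interpret V: vectorspace K "HomSpace C A B" using assms by (rule Hom_vectorspace)
  from V.zero_closed show "ZeroArr C A B \<in> Arr C" "Dom C (ZeroArr C A B) = A"
    "Cod C (ZeroArr C A B) = B" by (auto simp: Hom_iff)
qed

lemma Plus_Arr [simp]:
  assumes "f \<in> Arr C" "g \<in> Arr C" "Dom C f = Dom C g" "Cod C f = Cod C g"
  shows "Plus C f g \<in> Arr C" "Dom C (Plus C f g) = Dom C g" "Cod C (Plus C f g) = Cod C g"
proof -
  interpret V: vectorspace K "HomSpace C (Dom C f) (Cod C f)"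
    using assms by (intro Hom_vectorspace) auto
  from V.a_closed[of f g] assms show "Plus C f g \<in> Arr C" "Dom C (Plus C f g) = Dom C g"
    "Cod C (Plus C f g) = Cod C g" by (auto simp: Hom_iff)
qed

lemma Scale_Arr [simp]:
  assumes "f \<in> Arr C" "c \<in> carrier K"
  shows "Scale C c f \<in> Arr C" "Dom C (Scale C c f) = Dom C f" "Cod C (Scale C c f) = Cod C f"
proof -
  interpret V: vectorspace K "HomSpace C (Dom C f) (Cod C f)"
    using assms by (intro Hom_vectorspace) auto
  from V.smult_closed[of c f] assms show "Scale C c f \<in> Arr C"
    "Dom C (Scale C c f) = Dom C f" "Cod C (Scale C c f) = Cod C f" by (auto simp: Hom_iff)
qed

lemma Minus_Arr [simp]:
  assumes "f \<in> Arr C" "g \<in> Arr C" "Dom C f = Dom C g" "Cod C f = Cod C g"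
  shows "Minus f g \<in> Arr C" "Dom C (Minus f g) = Dom C g" "Cod C (Minus f g) = Cod C g"
proof -
  interpret V: vectorspace K "HomSpace C (Dom C f) (Cod C f)"
    using assms by (intro Hom_vectorspace) auto
  from V.minus_closed[of f g] assms show "Minus f g \<in> Arr C" "Dom C (Minus f g) = Dom C g"
    "Cod C (Minus f g) = Cod C g" by (auto simp: Hom_iff Minus_def)
qed

lemma Plus_comm:
  assumes "f \<in> Arr C" "g \<in> Arr C" "Dom C f = Dom C g" "Cod C f = Cod C g"
  shows "Plus C f g = Plus C g f"
proof -
  interpret V: vectorspace K "HomSpace C (Dom C f) (Cod C f)"
    using assms by (intro Hom_vectorspace) auto
  show ?thesis using V.a_comm[of f g] assms by (auto simp: Hom_iff)
qed

lemma Plus_Zero [simp]: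
  assumes "f \<in> Arr C"
  shows "Dom C f = A \<Longrightarrow> Cod C f = B \<Longrightarrow> Plus C f (ZeroArr C A B) = f"
    and "Dom C f = A \<Longrightarrow> Cod C f = B \<Longrightarrow> Plus C (ZeroArr C A B) f = f"
proof -
  interpret V: vectorspace K "HomSpace C (Dom C f) (Cod C f)"
    using assms by (intro Hom_vectorspace) auto
  show "Dom C f = A \<Longrightarrow> Cod C f = B \<Longrightarrow> Plus C f (ZeroArr C A B) = f"
    "Dom C f = A \<Longrightarrow> Cod C f = B \<Longrightarrow> Plus C (ZeroArr C A B) f = f"
    using V.r_zero[of f] V.l_zero[of f] assms by (auto simp: Hom_iff)
qed

lemma Minus_Plus_cancel:
  assumes "f \<in> Arr C" "g \<in> Arr C" "Dom C f = Dom C g" "Cod C f = Cod C g"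
  shows "Minus (Plus C f g) g = f" "Plus C (Minus f g) g = f" "Plus C g (Minus f g) = f"
    "Minus (Plus C g f) g = f"
proof -
  interpret V: vectorspace K "HomSpace C (Dom C f) (Cod C f)"
    using assms by (intro Hom_vectorspace) auto
  have m: "f \<in> carrier (HomSpace C (Dom C f) (Cod C f))"
    "g \<in> carrier (HomSpace C (Dom C f) (Cod C f))" using assms by (auto simp: Hom_iff)
  let ?V = "HomSpace C (Dom C f) (Cod C f)"
  have "(f \<oplus>\<^bsub>?V\<^esub> g) \<ominus>\<^bsub>?V\<^esub> g = f" "(f \<ominus>\<^bsub>?V\<^esub> g) \<oplus>\<^bsub>?V\<^esub> g = f"
    using m by (simp_all add: V.minus_eq V.a_assoc V.r_neg V.l_neg del: HomSpace_sel)
  then show 1: "Minus (Plus C f g) g = f" "Plus C (Minus f g) g = f"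
    using assms by (simp_all add: Minus_def)
  then show "Plus C g (Minus f g) = f" "Minus (Plus C g f) g = f"
    using assms by (simp_all add: Plus_comm[of g])
qed

lemma Plus_left_cancel:
  assumes "f \<in> Arr C" "g \<in> Arr C" "h \<in> Arr C" "Dom C f = Dom C g" "Cod C f = Cod C g"
    "Dom C h = Dom C g" "Cod C h = Cod C g"
  shows "Plus C h f = Plus C h g \<longleftrightarrow> f = g"
  using assms Minus_Plus_cancel(4)[of f h] Minus_Plus_cancel(4)[of g h] by metis

lemma Minus_eq_Zero_iff:
  assumes "f \<in> Arr C" "g \<in> Arr C" "Dom C f = Dom C g" "Cod C f = Cod C g"
  shows "Minus f g = ZeroArr C (Dom C g) (Cod C g) \<longleftrightarrow> f = g"
  using Minus_Plus_cancel(2)[of f g] Minus_Plus_cancel(1)[of "ZeroArr C (Dom C g) (Cod C g)" g]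
    assms by (metis DomCod_Obj(1,2) Plus_Zero(2) ZeroArr_Arr)

lemma Comp_Plus_distrib [simp]:
  assumes "f \<in> Arr C" "g \<in> Arr C" "Dom C f = Dom C g" "Cod C f = Cod C g" "h \<in> Arr C"
  shows "Dom C h = Cod C g \<Longrightarrow> h \<cdot> Plus C f g = Plus C (h \<cdot> f) (h \<cdot> g)"
    and "Cod C h = Dom C g \<Longrightarrow> Plus C f g \<cdot> h = Plus C (f \<cdot> h) (g \<cdot> h)"
  using Comp_Plus[of f "Dom C g" "Cod C g" g h "Cod C h"]
    Plus_Comp[of h "Dom C h" "Dom C g" f "Cod C g" g] assms by (auto simp: Hom_iff)

lemma Comp_Minus_distrib [simp]:
  assumes "f \<in> Arr C" "g \<in> Arr C" "Dom C f = Dom C g" "Cod C f = Cod C g" "h \<in> Arr C"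
  shows "Dom C h = Cod C g \<Longrightarrow> h \<cdot> Minus f g = Minus (h \<cdot> f) (h \<cdot> g)"
    and "Cod C h = Dom C g \<Longrightarrow> Minus f g \<cdot> h = Minus (f \<cdot> h) (g \<cdot> h)"
proof -
  assume h: "Dom C h = Cod C g"
  have "h \<cdot> f = Plus C (h \<cdot> Minus f g) (h \<cdot> g)"
    using Comp_Plus_distrib(1)[of "Minus f g" g h] assms h by (simp add: Minus_Plus_cancel)
  then show "h \<cdot> Minus f g = Minus (h \<cdot> f) (h \<cdot> g)"
    using assms h by (simp add: Minus_Plus_cancel del: Comp_Plus_distrib)
next
  assume h: "Cod C h = Dom C g"
  have "f \<cdot> h = Plus C (Minus f g \<cdot> h) (g \<cdot> h)"
    using Comp_Plus_distrib(2)[of "Minus f g" g h] assms h by (simp add: Minus_Plus_cancel)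
  then show "Minus f g \<cdot> h = Minus (f \<cdot> h) (g \<cdot> h)"
    using assms h by (simp add: Minus_Plus_cancel del: Comp_Plus_distrib)
qed

lemma Minus_self: "f \<in> Arr C \<Longrightarrow> Minus f f = ZeroArr C (Dom C f) (Cod C f)"
  by (simp add: Minus_eq_Zero_iff)

text \<open>A zero arrow is a difference \<open>Minus z z\<close>, and composition distributes over
  differences.\<close>

lemma Comp_Zero [simp]:
  assumes "f \<in> Arr C"
  shows "A \<in> Obj C \<Longrightarrow> Dom C f = B \<Longrightarrow> f \<cdot> ZeroArr C A B = ZeroArr C A (Cod C f)"
    and "D \<in> Obj C \<Longrightarrow> Cod C f = B \<Longrightarrow> ZeroArr C B D \<cdot> f = ZeroArr C (Dom C f) D"
proof -
  assume a: "A \<in> Obj C" "Dom C f = B"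
  let ?z = "ZeroArr C A B"
  have "f \<cdot> ?z = f \<cdot> Minus ?z ?z" using a assms by (auto simp: Minus_self simp del: Comp_Minus_distrib)
  also have "\<dots> = ZeroArr C A (Cod C f)"
    using a assms by (subst Comp_Minus_distrib) (auto simp: Minus_self)
  finally show "f \<cdot> ?z = ZeroArr C A (Cod C f)" .
next
  assume a: "D \<in> Obj C" "Cod C f = B"
  let ?z = "ZeroArr C B D"
  have "?z \<cdot> f = Minus ?z ?z \<cdot> f" using a assms by (auto simp: Minus_self simp del: Comp_Minus_distrib)
  also have "\<dots> = ZeroArr C (Dom C f) D"
    using a assms by (subst Comp_Minus_distrib) (auto simp: Minus_self)
  finally show "?z \<cdot> f = ZeroArr C (Dom C f) D" .
qed

lemma Comp_Scale_distrib [simp]: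
  assumes "f \<in> Arr C" "g \<in> Arr C" "Dom C g = Cod C f" "c \<in> carrier K"
  shows "g \<cdot> Scale C c f = Scale C c (g \<cdot> f)" "Scale C c g \<cdot> f = Scale C c (g \<cdot> f)"
  by (rule Comp_Scale Scale_Comp; use assms in \<open>simp add: Hom_iff\<close>)+

lemma linear_category_op: "linear_category K (op_cat C)"
  by (intro linear_category.intro category_op is_field linear_category_axioms.intro)
    (simp_all add: Hom_vectorspace Hom_iff)

end

section \<open>Abelian categories\<close>

context abelian_category
begin

lemma isoI:
  assumes "f \<in> Arr C" "g \<in> Arr C" "Dom C g = Cod C f" "Cod C g = Dom C f"
    "g \<cdot> f = Idt C (Dom C f)" "f \<cdot> g = Idt C (Cod C f)"
  shows "is_iso C f"
  using assms by (auto simp: is_iso_def Hom_iff)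

lemma isoE:
  assumes "is_iso C f"
  obtains g where "g \<in> Arr C" "Dom C g = Cod C f" "Cod C g = Dom C f"
    "g \<cdot> f = Idt C (Dom C f)" "f \<cdot> g = Idt C (Cod C f)" "is_iso C g"
proof -
  obtain g where g: "g \<in> Hom C (Cod C f) (Dom C f)" "g \<cdot> f = Idt C (Dom C f)"
    "f \<cdot> g = Idt C (Cod C f)" using assms unfolding is_iso_def by blast
  moreover have "f \<in> Arr C" using assms by (simp add: is_iso_def)
  ultimately show ?thesis using that[of g] isoI[of g f] by (auto simp: Hom_iff)
qed

lemma iso_Arr: "is_iso C f \<Longrightarrow> f \<in> Arr C"
  by (simp add: is_iso_def)

lemma iso_Idt [simp]: "A \<in> Obj C \<Longrightarrow> is_iso C (Idt C A)"
  by (rule isoI[of _ "Idt C A"]) auto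

lemma iso_Comp:
  assumes "is_iso C f" "is_iso C g" "Dom C g = Cod C f"
  shows "is_iso C (g \<cdot> f)"
proof -
  note [simp] = iso_Arr[OF assms(1)] iso_Arr[OF assms(2)]
  obtain f' where f': "f' \<in> Arr C" "Dom C f' = Cod C f" "Cod C f' = Dom C f"
    "f' \<cdot> f = Idt C (Dom C f)" "f \<cdot> f' = Idt C (Cod C f)" using assms(1) by (rule isoE)
  obtain g' where g': "g' \<in> Arr C" "Dom C g' = Cod C g" "Cod C g' = Dom C g"
    "g' \<cdot> g = Idt C (Dom C g)" "g \<cdot> g' = Idt C (Cod C g)" using assms(2) by (rule isoE)
  show ?thesis
    by (rule isoI[of _ "f' \<cdot> g'"])
      (auto simp: f' g' assms reassoc[OF f'(5)] reassoc[OF g'(4)])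
qed

lemma iso_mono:
  assumes "is_iso C f"
  shows "is_mono C f"
proof -
  note [simp] = iso_Arr[OF assms]
  obtain f' where f': "f' \<in> Arr C" "Dom C f' = Cod C f" "Cod C f' = Dom C f"
    "f' \<cdot> f = Idt C (Dom C f)" using assms by (rule isoE)
  show ?thesis
    unfolding is_mono_def
  proof (intro conjI ballI impI)
    fix T g h assume "g \<in> Hom C T (Dom C f)" "h \<in> Hom C T (Dom C f)" and e: "f \<cdot> g = f \<cdot> h"
    then have gh: "g \<in> Arr C" "Cod C g = Dom C f" "h \<in> Arr C" "Cod C h = Dom C f"
      by (auto simp: Hom_iff)
    have "f' \<cdot> (f \<cdot> g) = f' \<cdot> (f \<cdot> h)" using e by simp
    then show "g = h" using gh f' by (simp add: reassoc[OF f'(4)])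
  qed simp
qed

lemma mono_Arr: "is_mono C f \<Longrightarrow> f \<in> Arr C"
  by (simp add: is_mono_def)

lemma mono_cancel:
  assumes "is_mono C f" "f \<cdot> g = f \<cdot> h" "g \<in> Arr C" "h \<in> Arr C" "Cod C g = Dom C f"
    "Cod C h = Dom C f"
  shows "g = h"
proof -
  have "Dom C g = Dom C h"
    using assms mono_Arr[OF assms(1)] Comp_Arr(2)[of g f] Comp_Arr(2)[of h f] by simp
  then have "g \<in> Hom C (Dom C h) (Dom C f)" "h \<in> Hom C (Dom C h) (Dom C f)" "Dom C h \<in> Obj C"
    using assms by (auto simp: Hom_iff)
  then show ?thesis using assms(1,2) unfolding is_mono_def by blast
qed

lemma mono_Zero:
  assumes "is_mono C f" "f \<cdot> g = ZeroArr C T B" "T = Dom C g" "B = Cod C f" "g \<in> Arr C"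
    "Cod C g = Dom C f"
  shows "g = ZeroArr C T (Dom C f)"
  by (rule mono_cancel[OF assms(1)]) (use assms mono_Arr[OF assms(1)] in auto)

lemma monoI:
  assumes "f \<in> Arr C"
    and "\<And>g. g \<in> Arr C \<Longrightarrow> Cod C g = Dom C f \<Longrightarrow> f \<cdot> g = ZeroArr C (Dom C g) (Cod C f) \<Longrightarrow>
      g = ZeroArr C (Dom C g) (Dom C f)"
  shows "is_mono C f"
  unfolding is_mono_def
proof (intro conjI ballI impI)
  fix T g h assume "g \<in> Hom C T (Dom C f)" "h \<in> Hom C T (Dom C f)" and e: "f \<cdot> g = f \<cdot> h"
  then have gh: "g \<in> Arr C" "Cod C g = Dom C f" "h \<in> Arr C" "Cod C h = Dom C f" "Dom C g = Dom C h"
    by (auto simp: Hom_iff)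
  have "Minus g h = ZeroArr C (Dom C h) (Cod C h)"
    using assms(2)[of "Minus g h"] gh assms(1) e by (auto simp: Minus_self)
  then show "g = h" using Minus_eq_Zero_iff[of g h] gh by simp
qed fact

lemma mono_Comp:
  assumes "is_mono C f" "is_mono C g" "Dom C g = Cod C f"
  shows "is_mono C (g \<cdot> f)"
proof (rule monoI)
  note [simp] = mono_Arr[OF assms(1)] mono_Arr[OF assms(2)]
  show "g \<cdot> f \<in> Arr C" using assms by simp
  fix h assume h: "h \<in> Arr C" "Cod C h = Dom C (g \<cdot> f)"
    "g \<cdot> f \<cdot> h = ZeroArr C (Dom C h) (Cod C (g \<cdot> f))"
  have "f \<cdot> h = ZeroArr C (Dom C h) (Dom C g)"
    by (rule mono_Zero[OF assms(2)]) (use h assms in auto)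
  then have "h = ZeroArr C (Dom C h) (Dom C f)"
    by (rule mono_Zero[OF assms(1)]) (use h assms in auto)
  then show "h = ZeroArr C (Dom C h) (Dom C (g \<cdot> f))" using assms by simp
qed

lemma mono_of_Comp:
  assumes "is_mono C (g \<cdot> f)" "f \<in> Arr C" "g \<in> Arr C" "Dom C g = Cod C f"
  shows "is_mono C f"
proof (rule monoI)
  fix h assume h: "h \<in> Arr C" "Cod C h = Dom C f" "f \<cdot> h = ZeroArr C (Dom C h) (Cod C f)"
  show "h = ZeroArr C (Dom C h) (Dom C f)"
    by (rule mono_Zero[OF assms(1), unfolded Comp_Arr(2)[OF assms(2-4)]]) (use h assms in auto)
qed fact

lemma kernelD:
  assumes "is_kernel C k f"
  shows "k \<in> Arr C" "f \<in> Arr C" "Cod C k = Dom C f" "f \<cdot> k = ZeroArr C (Dom C k) (Cod C f)"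
proof -
  have "k \<in> Hom C (Dom C k) (Dom C f)" using assms unfolding is_kernel_def by (elim conjE)
  then show "k \<in> Arr C" "Cod C k = Dom C f" by (simp_all add: Hom_iff)
  show "f \<in> Arr C" using assms unfolding is_kernel_def by (elim conjE)
  show "f \<cdot> k = ZeroArr C (Dom C k) (Cod C f)" using assms unfolding is_kernel_def by (elim conjE)
qed

lemma kernel_lift:
  assumes "is_kernel C k f" "g \<in> Arr C" "Cod C g = Dom C f" "f \<cdot> g = ZeroArr C T B"
    "T = Dom C g" "B = Cod C f"
  obtains u where "u \<in> Arr C" "Dom C u = Dom C g" "Cod C u = Dom C k" "k \<cdot> u = g"
proof -
  have "Dom C g \<in> Obj C" using assms by simp
  moreover have "g \<in> Hom C (Dom C g) (Dom C f)" using assms by (simp add: Hom_iff)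
  ultimately have "\<exists>u. u \<in> Hom C (Dom C g) (Dom C k) \<and> k \<cdot> u = g"
    using assms(1,4,5,6) unfolding is_kernel_def by blast
  then show ?thesis using that by (auto simp: Hom_iff)
qed

lemma kernel_mono:
  assumes "is_kernel C k f"
  shows "is_mono C k"
  unfolding is_mono_def
proof (intro conjI ballI impI)
  note k = kernelD[OF assms]
  fix T g h assume T: "T \<in> Obj C" and gh: "g \<in> Hom C T (Dom C k)" "h \<in> Hom C T (Dom C k)"
    and e: "k \<cdot> g = k \<cdot> h"
  from gh have *: "g \<in> Arr C" "Cod C g = Dom C k" "Dom C g = T" by (auto simp: Hom_iff)
  have "f \<cdot> (k \<cdot> g) = ZeroArr C T (Cod C f)" using k * by (simp add: reassoc[OF k(4)])
  moreover have "k \<cdot> g \<in> Hom C T (Dom C f)" using k * by (simp add: Hom_iff)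
  ultimately have "\<exists>!u. u \<in> Hom C T (Dom C k) \<and> k \<cdot> u = k \<cdot> g"
    using assms T unfolding is_kernel_def by blast
  then show "g = h" using gh e by metis
qed (use kernelD[OF assms] in auto)

lemma kernelI:
  assumes "is_mono C k" "f \<in> Arr C" "Cod C k = Dom C f" "f \<cdot> k = ZeroArr C (Dom C k) (Cod C f)"
    and "\<And>g. g \<in> Arr C \<Longrightarrow> Cod C g = Dom C f \<Longrightarrow> f \<cdot> g = ZeroArr C (Dom C g) (Cod C f) \<Longrightarrow>
      \<exists>u \<in> Arr C. Dom C u = Dom C g \<and> Cod C u = Dom C k \<and> k \<cdot> u = g"
  shows "is_kernel C k f"
  unfolding is_kernel_def
proof (intro conjI ballI impI)
  fix T g assume "g \<in> Hom C T (Dom C f)" "f \<cdot> g = ZeroArr C T (Cod C f)"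
  with assms(5)[of g] obtain u where "u \<in> Hom C T (Dom C k)" "k \<cdot> u = g" by (auto simp: Hom_iff)
  then show "\<exists>!u. u \<in> Hom C T (Dom C k) \<and> k \<cdot> u = g"
    using mono_cancel[OF assms(1)] by (intro ex1I[of _ u]) (auto simp: Hom_iff)
qed (use assms mono_Arr[OF assms(1)] in \<open>auto simp: Hom_iff\<close>)

text \<open>The axioms come in dual pairs; only a biproduct needs its injections and projections
  exchanged.\<close>

lemma abelian_category_op: "abelian_category K (op_cat C)"
proof -
  interpret op: linear_category K "op_cat C" by (rule linear_category_op)
  show ?thesis
  proof unfold_locales
    show "\<exists>Z. is_zero_object (op_cat C) Z" using zero_object_exists by simp
    fix A B assume "A \<in> Obj (op_cat C)" "B \<in> Obj (op_cat C)"
    then obtain i1 i2 p1 p2 where "is_biproduct C A B (i1, i2, p1, p2)"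
      using biproduct_exists[of A B] by auto
    then show "\<exists>b. is_biproduct (op_cat C) A B b" by (blast dest: is_biproduct_op)
  qed (auto simp: kernel_exists cokernel_exists mono_is_kernel epi_is_cokernel)
qed

lemmas iso_epi = abelian_category.iso_mono[OF abelian_category_op, simplified]
  and epi_Arr = abelian_category.mono_Arr[OF abelian_category_op, simplified]
  and epi_cancel = abelian_category.mono_cancel[OF abelian_category_op, simplified]
  and epi_Zero = abelian_category.mono_Zero[OF abelian_category_op, simplified]
  and epiI = abelian_category.monoI[OF abelian_category_op, simplified]
  and epi_Comp = abelian_category.mono_Comp[OF abelian_category_op, simplified]
  and epi_of_Comp = abelian_category.mono_of_Comp[OF abelian_category_op, simplified]
  and cokernelD = abelian_category.kernelD[OF abelian_category_op, simplified]
  and cokernel_desc = abelian_category.kernel_lift[OF abelian_category_op, simplified]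
  and cokernel_epi = abelian_category.kernel_mono[OF abelian_category_op, simplified]
  and cokernelI = abelian_category.kernelI[OF abelian_category_op, simplified]

text \<open>As a monomorphism, \<open>f\<close> is a kernel of some \<open>g\<close>. Since
  \<open>g\<close> kills \<open>f\<close>, it factors through \<open>c\<close>; so whatever
  \<open>c\<close> kills is also killed by \<open>g\<close> and lifts through
  \<open>f\<close>.\<close>

lemma mono_kernel_of_cokernel:
  assumes "is_mono C f" "is_cokernel C c f"
  shows "is_kernel C f c"
proof -
  obtain g where g: "is_kernel C f g" using mono_is_kernel[OF assms(1)] by blast
  note gD = kernelD[OF g] and cD = cokernelD[OF assms(2)]
  obtain v where v: "v \<in> Arr C" "Cod C v = Cod C g" "Dom C v = Cod C c" "v \<cdot> c = g"
    by (rule cokernel_desc[OF assms(2), of g]) (use gD cD in auto)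
  show ?thesis
  proof (rule kernelI[OF assms(1)])
    fix h assume h: "h \<in> Arr C" "Cod C h = Dom C c" "c \<cdot> h = ZeroArr C (Dom C h) (Cod C c)"
    have "g \<cdot> h = (v \<cdot> c) \<cdot> h" by (simp only: v(4))
    also have "\<dots> = v \<cdot> (c \<cdot> h)" using h(1,2) v(1,3) cD(1) by simp
    also have "\<dots> = ZeroArr C (Dom C h) (Cod C g)" using h v cD by simp
    finally have "g \<cdot> h = ZeroArr C (Dom C h) (Cod C g)" .
    moreover have "Cod C h = Dom C g" using h(2) cD(3) gD(3) by simp
    ultimately obtain u where "u \<in> Arr C" "Dom C u = Dom C h" "Cod C u = Dom C f" "f \<cdot> u = h"
      using kernel_lift[OF g h(1) _ _ refl refl] by blast
    then show "\<exists>u\<in>Arr C. Dom C u = Dom C h \<and> Cod C u = Dom C f \<and> f \<cdot> u = h" by blast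
  qed (use cD in auto)
qed

lemmas epi_cokernel_of_kernel =
  abelian_category.mono_kernel_of_cokernel[OF abelian_category_op, simplified]

text \<open>The cokernel of an epimorphism is zero and \<open>f\<close> is a kernel of its cokernel,
  so the identity of the codomain lifts through \<open>f\<close>. The lift is a two-sided inverse
  because \<open>f\<close> is mono.\<close>

lemma mono_epi_iso:
  assumes "is_mono C f" "is_epi C f"
  shows "is_iso C f"
proof -
  note [simp] = mono_Arr[OF assms(1)]
  obtain c where c: "is_cokernel C c f" using cokernel_exists[of f] by auto
  note k = mono_kernel_of_cokernel[OF assms(1) c] and cD = cokernelD[OF c]
  have "c = ZeroArr C (Cod C f) (Cod C c)"
    by (rule epi_Zero[OF assms(2) cD(4) refl refl cD(1,3)])
  then have cz: "c \<cdot> Idt C (Cod C f) = ZeroArr C (Cod C f) (Cod C c)"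
    by (subst Comp_Idt_right[OF cD(1,3)])
  obtain u where u: "u \<in> Arr C" "Dom C u = Cod C f" "Cod C u = Dom C f" "f \<cdot> u = Idt C (Cod C f)"
    by (rule kernel_lift[OF k _ _ cz]) (simp_all add: cD(3))
  have "u \<cdot> f = Idt C (Dom C f)"
    by (rule mono_cancel[OF assms(1)]) (simp_all add: u reassoc[OF u(4)])
  then show ?thesis using u by (intro isoI[of f u]) auto
qed

text \<open>The image \<open>m\<close> is the kernel of the cokernel \<open>c\<close>. To see that
  \<open>e\<close> is epi, let \<open>g\<close> kill \<open>e\<close> and let \<open>k\<close> be
  the kernel of \<open>g\<close>. The mono \<open>m \<cdot> k\<close> is a kernel of some
  \<open>h\<close>. As \<open>f\<close> factors through \<open>m \<cdot> k\<close>, \<open>h\<close>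
  kills \<open>f\<close>, so \<open>h\<close> factors through \<open>c\<close> and kills
  \<open>m\<close>. Thus \<open>m\<close> factors through \<open>m \<cdot> k\<close>, which makes
  \<open>k\<close> a split epimorphism and \<open>g\<close> zero.\<close>

lemma image_factorization:
  assumes "f \<in> Arr C"
  obtains m e where "is_mono C m" "is_epi C e" "Dom C m = Cod C e" "Cod C m = Cod C f"
    "Dom C e = Dom C f" "m \<cdot> e = f"
proof -
  obtain c where c: "is_cokernel C c f" using cokernel_exists[OF assms] by auto
  note cD = cokernelD[OF c]
  obtain m where m: "is_kernel C m c" using kernel_exists cD by auto
  note mD = kernelD[OF m]
  obtain e where e: "e \<in> Arr C" "Dom C e = Dom C f" "Cod C e = Dom C m" "m \<cdot> e = f"
    by (rule kernel_lift[OF m, of f]) (use cD mD in auto)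
  have "is_epi C e"
  proof (rule epiI[OF e(1)])
    fix g assume g: "g \<in> Arr C" "Dom C g = Cod C e" "g \<cdot> e = ZeroArr C (Dom C e) (Cod C g)"
    obtain k where k: "is_kernel C k g" using kernel_exists g by auto
    note kD = kernelD[OF k] and km = kernel_mono[OF k]
    obtain e' where e': "e' \<in> Arr C" "Dom C e' = Dom C e" "Cod C e' = Dom C k" "k \<cdot> e' = e"
      by (rule kernel_lift[OF k, of e]) (use g e in auto)
    have mk: "is_mono C (m \<cdot> k)" by (rule mono_Comp) (use km kernel_mono[OF m] kD g e in auto)
    obtain h where h: "is_kernel C (m \<cdot> k) h" using mono_is_kernel[OF mk] by blast
    note hD = kernelD[OF h]
    note kz = hD(4)
    have kmArr: "m \<in> Arr C" "k \<in> Arr C" "Dom C m = Cod C k" "Cod C m = Dom C h"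
      using mD kD hD(3) g e by (auto)
    have "h \<cdot> f = h \<cdot> ((m \<cdot> k) \<cdot> e')" using kmArr e e' by simp
    also have "\<dots> = (h \<cdot> (m \<cdot> k)) \<cdot> e'" using kmArr e' hD by (subst assoc) auto
    also have "\<dots> = ZeroArr C (Dom C f) (Cod C h)" using kz kmArr e' e hD by simp
    finally have hf: "h \<cdot> f = ZeroArr C (Dom C f) (Cod C h)" .
    obtain h' where h': "h' \<in> Arr C" "Cod C h' = Cod C h" "Dom C h' = Cod C c" "h' \<cdot> c = h"
      by (rule cokernel_desc[OF c, of h]) (use hf hD(1,2) kmArr mD(3) cD in auto)
    have "h \<cdot> m = (h' \<cdot> c) \<cdot> m" by (simp only: h'(4))
    also have "\<dots> = h' \<cdot> (c \<cdot> m)" using h'(1,3) cD mD by simp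
    also have "\<dots> = ZeroArr C (Dom C m) (Cod C h)" using mD h' cD by simp
    finally have hm: "h \<cdot> m = ZeroArr C (Dom C m) (Cod C h)" .
    obtain t where t: "t \<in> Arr C" "Dom C t = Dom C m" "Cod C t = Dom C (m \<cdot> k)" "(m \<cdot> k) \<cdot> t = m"
      by (rule kernel_lift[OF h, of m]) (use hm kmArr in auto)
    have kt: "k \<cdot> t = Idt C (Dom C m)"
      by (rule mono_cancel[OF kernel_mono[OF m]]) (use kmArr t in auto)
    have "g = g \<cdot> (k \<cdot> t)" using kt g e by simp
    also have "\<dots> = (g \<cdot> k) \<cdot> t" using g kD(1-3) t kmArr by simp
    also have "\<dots> = ZeroArr C (Dom C k) (Cod C g) \<cdot> t" by (simp only: kD(4))
    also have "\<dots> = ZeroArr C (Cod C e) (Cod C g)" using t g kmArr e(3) by simp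
    finally show "g = ZeroArr C (Cod C e) (Cod C g)" .
  qed
  from that[OF kernel_mono[OF m] this e(3)[symmetric] trans[OF mD(3) cD(3)] e(2,4)]
  show ?thesis .
qed

end

section \<open>Short exact sequences\<close>

declare Hom_iff [simp]

text \<open>Unlike \<open>ses\<close>, this keeps all three objects visible. With this order of
  arguments, passing to the opposite category just reverses the list of objects and the list of
  arrows.\<close>

definition sx :: "('o, 'm, 'k) lincat \<Rightarrow> 'o \<Rightarrow> 'o \<Rightarrow> 'o \<Rightarrow> 'm \<Rightarrow> 'm \<Rightarrow> bool" where
  "sx C N E M i p \<longleftrightarrow> (i, p) \<in> ses C M N \<and> Dom C p = E"

lemma sx_op [simp]: "sx (op_cat C) M E N p i \<longleftrightarrow> sx C N E M i p"
  by (auto simp: sx_def ses_def is_kernel_def is_cokernel_def)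

context abelian_category
begin

lemma sxD:
  assumes "sx C N E M i p"
  shows "i \<in> Arr C" "Dom C i = N" "Cod C i = E" "p \<in> Arr C" "Dom C p = E" "Cod C p = M"
    "N \<in> Obj C" "E \<in> Obj C" "M \<in> Obj C" "p \<cdot> i = ZeroArr C N M" "is_mono C i" "is_epi C p"
    "is_kernel C i p" "is_cokernel C p i"
proof -
  have k: "is_kernel C i p" "is_cokernel C p i" and e: "Dom C i = N" "Cod C p = M" "Dom C p = E"
    using assms by (auto simp: sx_def ses_def)
  note kD = kernelD[OF k(1)]
  show "i \<in> Arr C" "Cod C i = E" "p \<in> Arr C" "p \<cdot> i = ZeroArr C N M"
    using kD e by simp_all
  show "N \<in> Obj C" "E \<in> Obj C" "M \<in> Obj C"
    using DomCod_Obj(1)[OF kD(1)] DomCod_Obj(1)[OF kD(2)] DomCod_Obj(2)[OF kD(2)] e by simp_all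
  show "is_mono C i" by (rule kernel_mono[OF k(1)])
  show "is_epi C p" by (rule cokernel_epi[OF k(2)])
  show "Dom C i = N" "Dom C p = E" "Cod C p = M" "is_kernel C i p" "is_cokernel C p i"
    by (fact e k)+
qed

lemma sx_lift:
  assumes "sx C N E M i p" "g \<in> Hom C T E" "p \<cdot> g = ZeroArr C T M"
  obtains u where "u \<in> Hom C T N" "i \<cdot> u = g"
proof -
  note D = sxD[OF assms(1)]
  obtain u where "u \<in> Arr C" "Dom C u = Dom C g" "Cod C u = Dom C i" "i \<cdot> u = g"
    by (rule kernel_lift[OF D(13) _ _ assms(3)]) (use assms(2) D in auto)
  then show ?thesis using that[of u] assms(2) D by simp
qed

lemma sx_desc:
  assumes "sx C N E M i p" "g \<in> Hom C E T" "g \<cdot> i = ZeroArr C N T"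
  obtains u where "u \<in> Hom C M T" "u \<cdot> p = g"
proof -
  note D = sxD[OF assms(1)]
  obtain u where "u \<in> Arr C" "Cod C u = Cod C g" "Dom C u = Cod C p" "u \<cdot> p = g"
    by (rule cokernel_desc[OF D(14) _ _ assms(3)]) (use assms(2) D in auto)
  then show ?thesis using that[of u] assms(2) D by simp
qed

lemma kernel_sx:
  assumes "is_kernel C i p" "is_epi C p"
  shows "sx C (Dom C i) (Dom C p) (Cod C p) i p"
  using assms epi_cokernel_of_kernel[OF assms(2,1)] by (simp add: sx_def ses_def)

lemma sxI:
  assumes "is_mono C i" "is_epi C p" "i \<in> Hom C N E" "p \<in> Hom C E M" "p \<cdot> i = ZeroArr C N M"
    and "\<And>T g. g \<in> Hom C T E \<Longrightarrow> p \<cdot> g = ZeroArr C T M \<Longrightarrow> \<exists>u \<in> Hom C T N. i \<cdot> u = g"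
  shows "sx C N E M i p"
proof -
  have "is_kernel C i p"
  proof (rule kernelI[OF assms(1)])
    fix g assume g: "g \<in> Arr C" "Cod C g = Dom C p" "p \<cdot> g = ZeroArr C (Dom C g) (Cod C p)"
    then have "g \<in> Hom C (Dom C g) E" "p \<cdot> g = ZeroArr C (Dom C g) M" using assms(3,4) by simp_all
    from assms(6)[OF this] obtain u where "u \<in> Hom C (Dom C g) N" "i \<cdot> u = g" ..
    then show "\<exists>u\<in>Arr C. Dom C u = Dom C g \<and> Cod C u = Dom C i \<and> i \<cdot> u = g"
      using assms(3) by (intro bexI[of _ u]) simp_all
  qed (use assms(3-5) in simp_all)
  from kernel_sx[OF this assms(2)] assms(3,4) show ?thesis by simp
qed

lemma biprodE:
  assumes "A \<in> Obj C" "B \<in> Obj C"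
  obtains S i1 i2 p1 p2 where "S \<in> Obj C" "i1 \<in> Hom C A S" "i2 \<in> Hom C B S" "p1 \<in> Hom C S A"
    "p2 \<in> Hom C S B" "p1 \<cdot> i1 = Idt C A" "p2 \<cdot> i2 = Idt C B" "p1 \<cdot> i2 = ZeroArr C B A"
    "p2 \<cdot> i1 = ZeroArr C A B" "Plus C (i1 \<cdot> p1) (i2 \<cdot> p2) = Idt C S"
  using biproduct_exists[OF assms] unfolding is_biproduct_def by blast

lemma biprod_ext:
  assumes "i1 \<in> Hom C A S" "i2 \<in> Hom C B S" "p1 \<in> Hom C S A" "p2 \<in> Hom C S B"
    and e: "Plus C (i1 \<cdot> p1) (i2 \<cdot> p2) = Idt C S"
    and x: "x \<in> Hom C T S" "p1 \<cdot> x = y1" "p2 \<cdot> x = y2"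
  shows "x = Plus C (i1 \<cdot> y1) (i2 \<cdot> y2)"
proof -
  have "x = Plus C (i1 \<cdot> p1) (i2 \<cdot> p2) \<cdot> x" using x by (simp add: e)
  also have "\<dots> = Plus C (i1 \<cdot> y1) (i2 \<cdot> y2)" using assms(1-4) x by simp
  finally show ?thesis .
qed

lemma biprod_sx:
  assumes "i1 \<in> Hom C A S" "i2 \<in> Hom C B S" "p1 \<in> Hom C S A" "p2 \<in> Hom C S B"
    and e: "p1 \<cdot> i1 = Idt C A" "p2 \<cdot> i2 = Idt C B" "p2 \<cdot> i1 = ZeroArr C A B"
    "Plus C (i1 \<cdot> p1) (i2 \<cdot> p2) = Idt C S"
  shows "sx C A S B i1 p2"
proof (rule sxI)
  have [simp]: "A \<in> Obj C" "B \<in> Obj C" "S \<in> Obj C" using assms(1,2) by auto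
  show "is_mono C i1"
    by (rule mono_of_Comp[of p1]) (use assms(1-4) e(1) in \<open>simp_all add: iso_mono\<close>)
  show "is_epi C p2"
    by (rule epi_of_Comp[where g = i2]) (use assms(1-4) e(2) in \<open>simp_all add: iso_epi\<close>)
  fix T g assume g: "g \<in> Hom C T S" "p2 \<cdot> g = ZeroArr C T B"
  have "T \<in> Obj C" using g by auto
  then have "g = i1 \<cdot> (p1 \<cdot> g)"
    using biprod_ext[OF assms(1-4) e(4) g(1) refl g(2)] assms(1-4) g(1) by simp
  then show "\<exists>u\<in>Hom C T A. i1 \<cdot> u = g" using g assms(1-4)
    by (intro bexI[of _ "p1 \<cdot> g"]) auto
qed (use assms(1-4) e(3) in simp_all)

text \<open>The pullback is the kernel \<open>k\<close> of the difference \<open>d\<close> of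
  \<open>f \<cdot> p1\<close> and \<open>g \<cdot> p2\<close> on a biproduct. If \<open>g\<close> is
  epi, then so is \<open>d\<close>, hence \<open>d\<close> is a cokernel of \<open>k\<close>. An
  arrow \<open>h\<close> that kills \<open>p1 \<cdot> k\<close> gives
  \<open>h \<cdot> p1 = t \<cdot> d\<close>; restricting to the summand \<open>B\<close> shows that
  \<open>t\<close> kills \<open>g\<close>, so \<open>t\<close> and then \<open>h\<close>
  vanish.\<close>

lemma pullback:
  assumes f: "f \<in> Hom C A D" and g: "g \<in> Hom C B D"
  obtains P p q where "p \<in> Hom C P A" "q \<in> Hom C P B" "f \<cdot> p = g \<cdot> q"
    "\<forall>T. \<forall>x \<in> Hom C T A. \<forall>y \<in> Hom C T B. f \<cdot> x = g \<cdot> y \<longrightarrow>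
       (\<exists>w \<in> Hom C T P. p \<cdot> w = x \<and> q \<cdot> w = y)"
    "\<forall>T. \<forall>w \<in> Hom C T P. \<forall>w' \<in> Hom C T P. p \<cdot> w = p \<cdot> w' \<longrightarrow> q \<cdot> w = q \<cdot> w' \<longrightarrow> w = w'"
    "is_epi C g \<longrightarrow> is_epi C p"
proof -
  have O [simp]: "A \<in> Obj C" "B \<in> Obj C" "D \<in> Obj C" using f g by auto
  obtain S i1 i2 p1 p2 where S: "S \<in> Obj C" "i1 \<in> Hom C A S" "i2 \<in> Hom C B S" "p1 \<in> Hom C S A"
    "p2 \<in> Hom C S B" and e: "p1 \<cdot> i1 = Idt C A" "p2 \<cdot> i2 = Idt C B" "p1 \<cdot> i2 = ZeroArr C B A"
    "p2 \<cdot> i1 = ZeroArr C A B" "Plus C (i1 \<cdot> p1) (i2 \<cdot> p2) = Idt C S"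
    by (rule biprodE[OF O(1,2)])
  define d where "d = Minus (f \<cdot> p1) (g \<cdot> p2)"
  have d: "d \<in> Hom C S D" unfolding d_def using f g S by simp
  obtain k where k: "is_kernel C k d" using kernel_exists d by auto
  define P where "P = Dom C k"
  have kH: "k \<in> Hom C P S" and dk: "d \<cdot> k = ZeroArr C P D"
    using kernelD[OF k] d by (auto simp: P_def)
  have P: "P \<in> Obj C" using kH by auto
  have km: "is_mono C k" by (rule kernel_mono[OF k])
  have dk': "f \<cdot> (p1 \<cdot> k) = g \<cdot> (p2 \<cdot> k)"
    using dk f g S kH P Minus_eq_Zero_iff[of "f \<cdot> (p1 \<cdot> k)" "g \<cdot> (p2 \<cdot> k)"] by (simp add: d_def)
  show ?thesis
  proof (rule that[of "p1 \<cdot> k" P "p2 \<cdot> k"]; (intro allI ballI impI)?)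
    show "p1 \<cdot> k \<in> Hom C P A" "p2 \<cdot> k \<in> Hom C P B" using kH S by auto
    show "f \<cdot> (p1 \<cdot> k) = g \<cdot> (p2 \<cdot> k)" by (rule dk')
  next
    fix T x y assume x: "x \<in> Hom C T A" and y: "y \<in> Hom C T B" and xy: "f \<cdot> x = g \<cdot> y"
    define z where "z = Plus C (i1 \<cdot> x) (i2 \<cdot> y)"
    have T: "T \<in> Obj C" using x by auto
    have z: "z \<in> Hom C T S" "p1 \<cdot> z = x" "p2 \<cdot> z = y" unfolding z_def using x y S T
      by (auto simp: reassoc[OF e(1)] reassoc[OF e(2)] reassoc[OF e(3)] reassoc[OF e(4)])
    have dz: "d \<cdot> z = ZeroArr C T D" using z f g S x y
      by (simp add: d_def xy Minus_self)
    obtain w where w: "w \<in> Arr C" "Dom C w = Dom C z" "Cod C w = Dom C k" "k \<cdot> w = z"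
      by (rule kernel_lift[OF k _ _ dz]) (use z d in auto)
    show "\<exists>w\<in>Hom C T P. p1 \<cdot> k \<cdot> w = x \<and> p2 \<cdot> k \<cdot> w = y"
      by (rule bexI[of _ w]) (use w z kH S P_def in auto)
  next
    fix T w w' assume w: "w \<in> Hom C T P" "w' \<in> Hom C T P" "(p1 \<cdot> k) \<cdot> w = (p1 \<cdot> k) \<cdot> w'"
      "(p2 \<cdot> k) \<cdot> w = (p2 \<cdot> k) \<cdot> w'"
    have "k \<cdot> w = Plus C (i1 \<cdot> (p1 \<cdot> (k \<cdot> w'))) (i2 \<cdot> (p2 \<cdot> (k \<cdot> w')))"
      by (rule biprod_ext[OF S(2-5) e(5), of _ T]) (use w kH S(4,5) in simp_all)
    moreover have "k \<cdot> w' = Plus C (i1 \<cdot> (p1 \<cdot> (k \<cdot> w'))) (i2 \<cdot> (p2 \<cdot> (k \<cdot> w')))"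
      by (rule biprod_ext[OF S(2-5) e(5), of _ T]) (use w kH S(4,5) in simp_all)
    ultimately have kw: "k \<cdot> w = k \<cdot> w'" by simp
    show "w = w'" by (rule mono_cancel[OF km kw]) (use w(1,2) kH in simp_all)
  next
    assume ge: "is_epi C g"
    have di2: "d \<cdot> i2 = Minus (ZeroArr C B D) g" using f g S by (simp add: d_def e)
    have tg0: "t = ZeroArr C D (Cod C t)"
      if t: "t \<in> Arr C" "Dom C t = D" and td: "t \<cdot> (d \<cdot> i2) = ZeroArr C B (Cod C t)" for t
    proof -
      have "Minus (ZeroArr C B (Cod C t)) (t \<cdot> g) = ZeroArr C B (Cod C t)"
        using td t g by (simp add: di2)
      then have "ZeroArr C B (Cod C t) = t \<cdot> g"
        using Minus_eq_Zero_iff[of "ZeroArr C B (Cod C t)" "t \<cdot> g"] t g by simp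
      then have "t = ZeroArr C (Cod C g) (Cod C t)"
        by (intro epi_Zero[OF ge, of t B]) (use t g in simp_all)
      then show ?thesis using g by simp
    qed
    \<comment> \<open>The component of \<open>d\<close> on the summand \<open>B\<close> is the
      negative of \<open>g\<close>, which is already epi.\<close>
    have de: "is_epi C d"
    proof (rule epiI)
      fix t assume t: "t \<in> Arr C" "Dom C t = Cod C d" "t \<cdot> d = ZeroArr C (Dom C d) (Cod C t)"
      have "t \<cdot> (d \<cdot> i2) = ZeroArr C B (Cod C t)" using t(1,2) d S reassoc[OF t(3), of i2] by simp
      then show "t = ZeroArr C (Cod C d) (Cod C t)" using tg0[of t] t(1,2) d by simp
    qed (use d in simp)
    have sxk: "sx C P S D k d" using kernel_sx[OF k de] d by (simp add: P_def)
    show "is_epi C (p1 \<cdot> k)"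
    proof (rule epiI)
      fix h assume h: "h \<in> Arr C" "Dom C h = Cod C (p1 \<cdot> k)"
        "h \<cdot> (p1 \<cdot> k) = ZeroArr C (Dom C (p1 \<cdot> k)) (Cod C h)"
      have hA: "Dom C h = A" using h kH S by simp
      obtain t where t: "t \<in> Hom C D (Cod C h)" "t \<cdot> d = h \<cdot> p1"
        by (rule sx_desc[OF sxk, of "h \<cdot> p1" "Cod C h"]) (use h kH S in auto)
      have "t \<cdot> (d \<cdot> i2) = ZeroArr C B (Cod C h)"
        using t(1) h(1) d hA S reassoc[OF t(2), of i2] by (simp add: e)
      then have tz: "t = ZeroArr C D (Cod C h)" using tg0[of t] t(1) by simp
      have "h \<cdot> p1 = ZeroArr C S (Cod C h)" using d h(1) by (simp add: tz flip: t(2))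
      then have "h \<cdot> (p1 \<cdot> i1) = ZeroArr C A (Cod C h)" using S h(1) hA
        reassoc[of h p1 "ZeroArr C S (Cod C h)" i1] by simp
      then show "h = ZeroArr C (Cod C (p1 \<cdot> k)) (Cod C h)" using S h(1) hA kH by (simp add: e)
    qed (use kH S in auto)
  qed
qed

text \<open>The pullback of \<open>p\<close> along \<open>c\<close> has the same kernel: the new
  inclusion \<open>i'\<close> is the arrow with components zero and \<open>i\<close>.\<close>

lemma pull_sx:
  assumes s: "sx C N E M i p" and c: "c \<in> Hom C M' M"
  obtains E' i' p' b where "sx C N E' M' i' p'" "b \<in> Hom C E' E" "b \<cdot> i' = i" "p \<cdot> b = c \<cdot> p'"
proof -
  note D = sxD[OF s]
  have pH: "p \<in> Hom C E M" using D by simp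
  obtain E' p' b where p': "p' \<in> Hom C E' M'" and b: "b \<in> Hom C E' E" and cb: "c \<cdot> p' = p \<cdot> b"
    and U: "\<forall>T. \<forall>x \<in> Hom C T M'. \<forall>y \<in> Hom C T E. c \<cdot> x = p \<cdot> y \<longrightarrow>
       (\<exists>w \<in> Hom C T E'. p' \<cdot> w = x \<and> b \<cdot> w = y)"
    and V: "\<forall>T. \<forall>w \<in> Hom C T E'. \<forall>w' \<in> Hom C T E'. p' \<cdot> w = p' \<cdot> w' \<longrightarrow> b \<cdot> w = b \<cdot> w' \<longrightarrow> w = w'"
    and pe: "is_epi C p \<longrightarrow> is_epi C p'"
    by (rule pullback[OF c pH])
  have O: "M' \<in> Obj C" "M \<in> Obj C" "E' \<in> Obj C" using c b by auto
  have "\<exists>w\<in>Hom C N E'. p' \<cdot> w = ZeroArr C N M' \<and> b \<cdot> w = i"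
    by (rule U[rule_format]) (use D(1-10) c O in simp_all)
  then obtain i' where i': "i' \<in> Hom C N E'" "p' \<cdot> i' = ZeroArr C N M'" "b \<cdot> i' = i" by blast
  have "sx C N E' M' i' p'"
  proof (rule sxI)
    show "is_mono C i'" by (rule mono_of_Comp[of b]) (use i' b D(11) in simp_all)
    show "is_epi C p'" by (rule pe[rule_format, OF D(12)])
    fix T g assume g: "g \<in> Hom C T E'" "p' \<cdot> g = ZeroArr C T M'"
    have T: "T \<in> Obj C" using g by auto
    have pbg: "p \<cdot> (b \<cdot> g) = ZeroArr C T M"
      using g b D(4-6) p' c reassoc[OF cb[symmetric], of g] T by simp
    have bg: "b \<cdot> g \<in> Hom C T E" using b g by simp
    obtain u where u: "u \<in> Hom C T N" "i \<cdot> u = b \<cdot> g"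
      by (rule sx_lift[OF s bg pbg])
    have a: "p' \<cdot> (i' \<cdot> u) = ZeroArr C T M'" "b \<cdot> (i' \<cdot> u) = b \<cdot> g"
      using u i'(1) b p' O by (simp_all add: reassoc[OF i'(2)] reassoc[OF i'(3)])
    have "i' \<cdot> u = g"
      by (rule V[rule_format, of _ T]) (use a u(1) g i'(1) in simp_all)
    then show "\<exists>u\<in>Hom C T N. i' \<cdot> u = g" using u by blast
  qed (use i' p' in simp_all)
  from that[OF this b i'(3) cb[symmetric]] show ?thesis .
qed

lemmas push_sx = abelian_category.pull_sx[OF abelian_category_op, unfolded sx_op op_cat_sel Hom_op]

text \<open>The difference of \<open>w\<close> and \<open>w'\<close> kills \<open>j\<close>, so it
  is \<open>u \<cdot> r\<close> for some \<open>u\<close>. Restricted along \<open>b\<close> it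
  becomes \<open>u \<cdot> c \<cdot> p\<close>, and both \<open>c\<close> and \<open>p\<close> can
  be cancelled.\<close>

lemma push_joint_epi:
  assumes s: "sx C N E M i p" and s': "sx C N' D M' j r"
    and b: "b \<in> Hom C E D" "r \<cdot> b = c \<cdot> p" and c: "is_epi C c" "c \<in> Hom C M M'"
    and w: "w \<in> Hom C D T" "w' \<in> Hom C D T" "w \<cdot> b = w' \<cdot> b" "w \<cdot> j = w' \<cdot> j"
  shows "w = w'"
proof -
  note D = sxD[OF s] and D' = sxD[OF s']
  have T: "T \<in> Obj C" using w by auto
  define t where "t = Minus w w'"
  have t: "t \<in> Hom C D T" "t \<cdot> b = ZeroArr C E T" "t \<cdot> j = ZeroArr C N' T"
    using w b D D' by (auto simp: t_def Minus_self)
  obtain u where u: "u \<in> Hom C M' T" "u \<cdot> r = t" by (rule sx_desc[OF s' t(1,3)])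
  have "(u \<cdot> c) \<cdot> p = u \<cdot> (r \<cdot> b)" using u(1) b(2) D(4-6) c(2) by simp
  also have "\<dots> = (u \<cdot> r) \<cdot> b" using u(1) b(1) D'(4-6) by simp
  also have "\<dots> = ZeroArr C E T" by (simp only: u(2) t(2))
  finally have "u \<cdot> c = ZeroArr C M T"
    by (rule epi_Zero[OF D(12), unfolded D(6)]) (use D(5,6) u(1) c(2) in simp_all)
  then have "u = ZeroArr C (Cod C c) T" by (rule epi_Zero[OF c(1)]) (use u(1) c(2) in simp_all)
  then have u0: "u = ZeroArr C M' T" using c(2) by simp
  have "t = ZeroArr C D T" using u(2) D'(4-6,9) T by (simp add: u0)
  then have "Minus w w' = ZeroArr C (Dom C w') (Cod C w')" using w(1,2) by (simp add: t_def)
  then show ?thesis using w(1,2) by (subst (asm) Minus_eq_Zero_iff) simp_all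
qed

text \<open>A map of extensions with the identity on \<open>M\<close> is automatically a pushout:
  the arrows with components \<open>(i, -a)\<close> and \<open>(b, j)\<close> form a short exact
  sequence from \<open>N\<close> over the biproduct of \<open>E\<close> and \<open>N'\<close> to
  \<open>D\<close>, and the arrow given by \<open>u\<close> and \<open>v\<close> kills the first of
  them.\<close>

lemma push_prop:
  assumes s: "sx C N E M i p" and s': "sx C N' D M j r"
    and b: "b \<in> Hom C E D" "b \<cdot> i = j \<cdot> a" "r \<cdot> b = p" and a: "a \<in> Hom C N N'"
    and u: "u \<in> Hom C E T" and v: "v \<in> Hom C N' T" and uv: "u \<cdot> i = v \<cdot> a"
  obtains w where "w \<in> Hom C D T" "w \<cdot> b = u" "w \<cdot> j = v"
proof -
  note D = sxD[OF s] and D' = sxD[OF s']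
  have T: "T \<in> Obj C" using u by auto
  obtain S i1 i2 p1 p2 where S: "S \<in> Obj C" "i1 \<in> Hom C E S" "i2 \<in> Hom C N' S" "p1 \<in> Hom C S E"
    "p2 \<in> Hom C S N'" and e: "p1 \<cdot> i1 = Idt C E" "p2 \<cdot> i2 = Idt C N'" "p1 \<cdot> i2 = ZeroArr C N' E"
    "p2 \<cdot> i1 = ZeroArr C E N'" "Plus C (i1 \<cdot> p1) (i2 \<cdot> p2) = Idt C S"
    by (rule biprodE[OF D(8) D'(7)])
  note re = reassoc[OF e(1)] reassoc[OF e(2)] reassoc[OF e(3)] reassoc[OF e(4)]
  define q where "q = Plus C (b \<cdot> p1) (j \<cdot> p2)"
  \<comment> \<open>The minus sign is what makes \<open>q\<close> kill \<open>k\<close>, as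
    \<open>b \<cdot> i = j \<cdot> a\<close>.\<close>
  define k where "k = Minus (i1 \<cdot> i) (i2 \<cdot> a)"
  have q: "q \<in> Hom C S D" "q \<cdot> i1 = b" "q \<cdot> i2 = j" unfolding q_def using S b D D' by (auto simp: e)
  have k: "k \<in> Hom C N S" unfolding k_def using S a D D' by auto
  have p1k: "p1 \<cdot> k = i" unfolding k_def using S a D D'
    Minus_Plus_cancel(1)[of i "ZeroArr C N E"] by (simp add: re)
  have p2k: "p2 \<cdot> k = Minus (ZeroArr C N N') a" unfolding k_def using S a D D' by (simp add: re)
  have "sx C N S D k q"
  proof (rule sxI)
    show "is_mono C k" by (rule mono_of_Comp[of p1]) (use p1k k S(4) D(11) in simp_all)
    show "is_epi C q"
    proof (rule epiI)
      fix t assume t: "t \<in> Arr C" "Dom C t = Cod C q" "t \<cdot> q = ZeroArr C (Dom C q) (Cod C t)"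
      have "t \<cdot> b = ZeroArr C E (Cod C t)" "t \<cdot> j = ZeroArr C N' (Cod C t)"
        using reassoc[OF t(3), of i1] reassoc[OF t(3), of i2] t(1,2) q S by simp_all
      then show "t = ZeroArr C (Cod C q) (Cod C t)"
        by - (rule push_joint_epi[OF s s' b(1), of "Idt C M" _ "Cod C t"];
          use t(1,2) q(1) b D(1-9) D'(1-9) in \<open>simp add: iso_epi\<close>)
    qed (use q in auto)
    show "q \<cdot> k = ZeroArr C N D" unfolding k_def using S a D D' q b
      by (simp add: reassoc[OF q(2)] reassoc[OF q(3)] Minus_self)
    fix U x assume x: "x \<in> Hom C U S" "q \<cdot> x = ZeroArr C U D"
    have U: "U \<in> Obj C" using x by auto
    have qx: "Plus C (b \<cdot> (p1 \<cdot> x)) (j \<cdot> (p2 \<cdot> x)) = ZeroArr C U D"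
      using x S b D' by (simp add: q_def)
    then have "r \<cdot> Plus C (b \<cdot> (p1 \<cdot> x)) (j \<cdot> (p2 \<cdot> x)) = ZeroArr C U M" using D' U by simp
    then have "p \<cdot> (p1 \<cdot> x) = ZeroArr C U M" using x S b(1) D D' U
      by (simp add: reassoc[OF b(3)] reassoc[OF D'(10)])
    moreover have "p1 \<cdot> x \<in> Hom C U E" using x(1) S(4) by simp
    ultimately obtain z where z: "z \<in> Hom C U N" "i \<cdot> z = p1 \<cdot> x"
      using sx_lift[OF s] by metis
    have "Plus C (j \<cdot> (a \<cdot> z)) (j \<cdot> (p2 \<cdot> x)) = ZeroArr C U D"
      using qx z(1) a b(1) D D' by (simp add: reassoc[OF b(2)] flip: z(2))
    then have "j \<cdot> Plus C (a \<cdot> z) (p2 \<cdot> x) = ZeroArr C U D" using z a x S D' by simp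
    then have "Plus C (a \<cdot> z) (p2 \<cdot> x) = ZeroArr C U (Dom C j)"
      by (rule mono_Zero[OF D'(11)]) (use z(1) a x(1) S D'(1-9) in simp_all)
    then have "Plus C (a \<cdot> z) (p2 \<cdot> x) = ZeroArr C U N'" using D'(2) by simp
    then have "p2 \<cdot> x = Minus (ZeroArr C U N') (a \<cdot> z)"
      using Minus_Plus_cancel(4)[of "p2 \<cdot> x" "a \<cdot> z"] z a x S by simp
    also have "\<dots> = p2 \<cdot> (k \<cdot> z)" using p2k k z(1) a S D D' by (simp add: reassoc[OF p2k])
    finally have 2: "p2 \<cdot> x = p2 \<cdot> (k \<cdot> z)" .
    have 1: "p1 \<cdot> (k \<cdot> z) = p1 \<cdot> x" using k z S D by (simp add: reassoc[OF p1k])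
    have "x = Plus C (i1 \<cdot> (p1 \<cdot> x)) (i2 \<cdot> (p2 \<cdot> x))"
      by (rule biprod_ext[OF S(2-5) e(5) x(1) refl refl])
    moreover have "k \<cdot> z = Plus C (i1 \<cdot> (p1 \<cdot> x)) (i2 \<cdot> (p2 \<cdot> x))"
      by (rule biprod_ext[OF S(2-5) e(5), of _ U]) (use k z(1) 1 2 in simp_all)
    ultimately show "\<exists>y\<in>Hom C U N. k \<cdot> y = x" using z by metis
  qed (use k q in auto)
  moreover define h where "h = Plus C (u \<cdot> p1) (v \<cdot> p2)"
  have hH: "h \<in> Hom C S T" unfolding h_def using u v S by auto
  moreover have "h \<cdot> k = ZeroArr C N T"
  proof -
    have hi: "h \<cdot> i1 = u" "h \<cdot> i2 = v" unfolding h_def using u v S T D D' by (auto simp: e)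
    show ?thesis unfolding k_def using hH S a D D' u v uv T
      by (simp add: reassoc[OF hi(1)] reassoc[OF hi(2)] Minus_self)
  qed
  ultimately obtain w where w: "w \<in> Hom C D T" "w \<cdot> q = h" by (rule sx_desc)
  have "w \<cdot> b = h \<cdot> i1" "w \<cdot> j = h \<cdot> i2" using w q S D' hH
    by (simp_all add: reassoc[OF w(2)] flip: q(2,3))
  moreover have "h \<cdot> i1 = u" "h \<cdot> i2 = v" unfolding h_def using u v S T D D' by (auto simp: e)
  ultimately show ?thesis using that w by simp
qed

text \<open>One half of the five lemma for short exact sequences, by chasing a generalized element
  \<open>t\<close>; the epi half is its dual.\<close>

lemma sx_map_mono:
  assumes s: "sx C N E M i p" and s': "sx C N' E' M' i' p'"
    and b: "b \<in> Hom C E E'" "b \<cdot> i = i' \<cdot> a" "p' \<cdot> b = c \<cdot> p"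
    and a: "a \<in> Hom C N N'" "is_mono C a" and c: "c \<in> Hom C M M'" "is_mono C c"
  shows "is_mono C b"
proof (rule monoI)
  note D = sxD[OF s] and D' = sxD[OF s']
  fix t assume "t \<in> Arr C" "Cod C t = Dom C b" and bt: "b \<cdot> t = ZeroArr C (Dom C t) (Cod C b)"
  then have t: "t \<in> Hom C (Dom C t) E" using b by simp
  have T: "Dom C t \<in> Obj C" using t by auto
  have "c \<cdot> (p \<cdot> t) = p' \<cdot> (b \<cdot> t)" using t b(1) c D D' by (simp add: reassoc[OF b(3)])
  also have "\<dots> = ZeroArr C (Dom C t) M'" using T bt b(1) D' by simp
  finally have "p \<cdot> t = ZeroArr C (Dom C t) (Dom C c)"
    by (rule mono_Zero[OF c(2)]) (use t c(1) D(1-9) in simp_all)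
  then have "p \<cdot> t = ZeroArr C (Dom C t) M" using c(1) by simp
  then obtain z where z: "z \<in> Hom C (Dom C t) N" "i \<cdot> z = t" by (rule sx_lift[OF s t])
  have "(i' \<cdot> a) \<cdot> z = b \<cdot> (i \<cdot> z)" using z(1) a b(1) D D' by (simp add: reassoc[OF b(2)])
  also have "\<dots> = ZeroArr C (Dom C t) E'" using z(2) bt b(1) by simp
  finally have "z = ZeroArr C (Dom C t) (Dom C (i' \<cdot> a))"
    by (intro mono_Zero[OF mono_Comp[OF a(2) D'(11)]]) (use a(1) z(1) D'(1-9) in simp_all)
  then have z0: "z = ZeroArr C (Dom C t) N" using a(1) D'(1-3) by simp
  have "i \<cdot> z = ZeroArr C (Dom C t) E" unfolding z0 using D(1-9) T by simp
  then show "t = ZeroArr C (Dom C t) (Dom C b)" using z(2) b(1) by simp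
qed (use b in auto)

lemmas sx_map_epi = abelian_category.sx_map_mono[OF abelian_category_op, unfolded sx_op op_cat_sel
    Hom_op is_mono_op]

text \<open>Replaces exactness, encoded by epi-mono factorizations, with kernels and cokernels. In
  one direction the epi part of the mono \<open>a\<close> is an isomorphism. In the other, the image
  of \<open>b\<close> is a kernel of its own cokernel \<open>d\<close>, and \<open>d\<close> factors
  through \<open>c\<close>, so it is also a kernel of \<open>c\<close>.\<close>

lemma two_ext_iff:
  assumes "N \<in> Obj C" "M \<in> Obj C"
  shows "(a, b, c) \<in> two_ext C M N \<longleftrightarrow>
    is_kernel C a b \<and> is_cokernel C c b \<and> Dom C a = N \<and> Cod C c = M"
proof
  assume "(a, b, c) \<in> two_ext C M N"
  then have a: "is_mono C a" "Dom C a = N" and c: "is_epi C c" "Cod C c = M"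
    and ab: "exact_pair C a b" and bc: "exact_pair C b c"
    by (simp_all add: two_ext_def)
  obtain k e where k: "is_kernel C k b" and e: "is_epi C e" "Cod C e = Dom C k" and ak: "a = k \<cdot> e"
    using ab unfolding exact_pair_def by blast
  note kD = kernelD[OF k] and eA = epi_Arr[OF e(1)]
  have "is_mono C e" by (rule mono_of_Comp[of k]) (use a(1) ak kD(1) e eA in simp_all)
  then have "is_iso C e" using e(1) by (rule mono_epi_iso)
  then obtain e' where e': "e' \<in> Arr C" "Dom C e' = Cod C e" "Cod C e' = Dom C e"
    "e' \<cdot> e = Idt C (Dom C e)" "e \<cdot> e' = Idt C (Cod C e)" by (rule isoE)
  have "is_kernel C a b"
  proof (rule kernelI[OF a(1)])
    show "b \<in> Arr C" by (rule kD(2))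
    show "Cod C a = Dom C b" using ak kD(1,3) eA e(2) by simp
    show "b \<cdot> a = ZeroArr C (Dom C a) (Cod C b)"
      using ak kD(1-3) eA e(2) by (simp add: reassoc[OF kD(4)])
    fix g assume g: "g \<in> Arr C" "Cod C g = Dom C b" "b \<cdot> g = ZeroArr C (Dom C g) (Cod C b)"
    obtain u where u: "u \<in> Arr C" "Dom C u = Dom C g" "Cod C u = Dom C k" "k \<cdot> u = g"
      by (rule kernel_lift[OF k g refl refl])
    show "\<exists>u\<in>Arr C. Dom C u = Dom C g \<and> Cod C u = Dom C a \<and> a \<cdot> u = g"
      by (rule bexI[of _ "e' \<cdot> u"])
        (use u e'(1-3) e(2) eA kD(1,3) in \<open>simp_all add: ak reassoc[OF e'(5)]\<close>)
  qed
  moreover obtain m d where m: "is_kernel C m c" and d: "is_epi C d" "Cod C d = Dom C m"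
    and bm: "b = m \<cdot> d"
    using bc unfolding exact_pair_def by blast
  note mD = kernelD[OF m] and dA = epi_Arr[OF d(1)]
  have "is_cokernel C c b"
  proof (rule cokernelI[OF c(1)])
    show "b \<in> Arr C" by (rule kD(2))
    show "Dom C c = Cod C b" using bm mD(1,3) dA d(2) by simp
    show "c \<cdot> b = ZeroArr C (Dom C b) (Cod C c)"
      using bm mD(1-3) dA d(2) by (simp add: reassoc[OF mD(4)])
    fix g assume g: "g \<in> Arr C" "Dom C g = Cod C b" "g \<cdot> b = ZeroArr C (Dom C b) (Cod C g)"
    have "(g \<cdot> m) \<cdot> d = ZeroArr C (Dom C d) (Cod C g)" using g bm mD(1,3) dA d(2) by simp
    then have "g \<cdot> m = ZeroArr C (Cod C d) (Cod C g)"
      by (rule epi_Zero[OF d(1)]) (use g(1,2) bm mD(1,3) dA d(2) in simp_all)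
    then have gm: "g \<cdot> m = ZeroArr C (Dom C m) (Cod C g)" using d(2) by simp
    have "is_cokernel C c m" by (rule epi_cokernel_of_kernel[OF c(1) m])
    then obtain u where "u \<in> Arr C" "Cod C u = Cod C g" "Dom C u = Cod C c" "u \<cdot> c = g"
      by (rule cokernel_desc[OF _ _ _ gm]) (use g(1,2) bm mD(1,3) dA d(2) in simp_all)
    then show "\<exists>u\<in>Arr C. Cod C u = Cod C g \<and> Dom C u = Cod C c \<and> u \<cdot> c = g" by blast
  qed
  ultimately show "is_kernel C a b \<and> is_cokernel C c b \<and> Dom C a = N \<and> Cod C c = M"
    using a(2) c(2) by simp
next
  assume *: "is_kernel C a b \<and> is_cokernel C c b \<and> Dom C a = N \<and> Cod C c = M"
  then have k: "is_kernel C a b" and c: "is_cokernel C c b" by simp_all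
  note kD = kernelD[OF k] and cD = cokernelD[OF c]
  have ab: "exact_pair C a b"
    unfolding exact_pair_def
    by (rule exI[of _ a], rule exI[of _ "Idt C (Dom C a)"]) (use k kD(1) in \<open>simp add: iso_epi\<close>)
  obtain m e where m: "is_mono C m" and e: "is_epi C e" "Dom C m = Cod C e"
    "Cod C m = Cod C b" "Dom C e = Dom C b" "m \<cdot> e = b"
    by (rule image_factorization[OF kD(2)])
  note mA = mono_Arr[OF m] and eA = epi_Arr[OF e(1)]
  obtain d where d: "is_cokernel C d m" using cokernel_exists[OF mA] by blast
  note dD = cokernelD[OF d]
  have "d \<cdot> b = d \<cdot> (m \<cdot> e)" by (simp only: e(5))
  also have "\<dots> = ZeroArr C (Dom C b) (Cod C d)"
    using dD(1-3) mA eA e(2,4) by (simp add: reassoc[OF dD(4)])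
  finally have db: "d \<cdot> b = ZeroArr C (Dom C b) (Cod C d)" .
  obtain v where v: "v \<in> Arr C" "Cod C v = Cod C d" "Dom C v = Cod C c" "v \<cdot> c = d"
    by (rule cokernel_desc[OF c _ _ db]) (use dD(1,3) e(3) in simp_all)
  have "is_kernel C m c"
  proof (rule kernelI[OF m])
    show "c \<in> Arr C" by (rule cD(1))
    show "Cod C m = Dom C c" using e(3) cD(3) by simp
    have "(c \<cdot> m) \<cdot> e = ZeroArr C (Dom C e) (Cod C c)"
      using mA eA cD e by simp
    then have "c \<cdot> m = ZeroArr C (Cod C e) (Cod C c)"
      by (rule epi_Zero[OF e(1)]) (use mA eA cD(1,3) e(2,3) in simp_all)
    then show "c \<cdot> m = ZeroArr C (Dom C m) (Cod C c)" using e(2) by simp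
    fix g assume g: "g \<in> Arr C" "Cod C g = Dom C c" "c \<cdot> g = ZeroArr C (Dom C g) (Cod C c)"
    have "d \<cdot> g = (v \<cdot> c) \<cdot> g" by (simp only: v(4))
    also have "\<dots> = v \<cdot> (c \<cdot> g)" using v(1,3) cD(1) g(1,2) by simp
    also have "\<dots> = ZeroArr C (Dom C g) (Cod C d)" using v(1-3) g by simp
    finally have dg: "d \<cdot> g = ZeroArr C (Dom C g) (Cod C d)" .
    obtain u where "u \<in> Arr C" "Dom C u = Dom C g" "Cod C u = Dom C m" "m \<cdot> u = g"
      by (rule kernel_lift[OF mono_kernel_of_cokernel[OF m d] _ _ dg])
        (use g(1,2) dD(3) e(3) cD(3) in simp_all)
    then show "\<exists>u\<in>Arr C. Dom C u = Dom C g \<and> Cod C u = Dom C m \<and> m \<cdot> u = g" by blast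
  qed
  with e have "exact_pair C b c" unfolding exact_pair_def by metis
  with ab show "(a, b, c) \<in> two_ext C M N"
    using * kernel_mono[OF k] cokernel_epi[OF c] by (simp add: two_ext_def)
qed

text \<open>An exact sequence \<open>N \<rightarrow> E \<rightarrow> F \<rightarrow> M\<close> (with maps \<open>a, b, c\<close>) splits as a Yoneda product iff there is
  an object \<open>H\<close> that is at the same time an extension of \<open>M\<close> by \<open>E\<close> and of \<open>F\<close> by \<open>N\<close>.\<close>

lemma lift_form:
  assumes k: "is_kernel C a b" and c: "is_cokernel C c b"
    and H: "a \<in> Hom C N E" "b \<in> Hom C E F" "c \<in> Hom C F M"
    and s: "sx C E H M u (c \<cdot> w)" and w: "w \<in> Hom C H F" "w \<cdot> u = b"
  shows "sx C N H F (u \<cdot> a) w"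
proof (rule sxI)
  note D = sxD[OF s]
  have O: "N \<in> Obj C" "F \<in> Obj C" "H \<in> Obj C" "M \<in> Obj C" using H D(8) by auto
  show "is_mono C (u \<cdot> a)" by (rule mono_Comp[OF kernel_mono[OF k] D(11)]) (use H(1) D(2) in simp)
  show "is_epi C w"
  proof (rule epiI)
    show "w \<in> Arr C" using w(1) by simp
    fix f assume f: "f \<in> Arr C" "Dom C f = Cod C w" "f \<cdot> w = ZeroArr C (Dom C w) (Cod C f)"
    have "f \<cdot> b = f \<cdot> (w \<cdot> u)" by (simp only: w(2))
    also have "\<dots> = ZeroArr C (Dom C b) (Cod C f)"
      using f w(1) D(1-3) H(2) by (simp add: reassoc[OF f(3)])
    finally have fb: "f \<cdot> b = ZeroArr C (Dom C b) (Cod C f)" .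
    obtain f' where f': "f' \<in> Arr C" "Cod C f' = Cod C f" "Dom C f' = Cod C c" "f' \<cdot> c = f"
      by (rule cokernel_desc[OF c _ _ fb]) (use f(1,2) w(1) H(2) in simp_all)
    have "f' \<cdot> (c \<cdot> w) = ZeroArr C H (Cod C f)"
      using f f'(1,3) w(1) H(3) by (simp add: reassoc[OF f'(4)])
    then have "f' = ZeroArr C (Cod C (c \<cdot> w)) (Cod C f)"
      by (rule epi_Zero[OF D(12)]) (use f'(1-3) D(5,6) H(3) in simp_all)
    then have z: "f' = ZeroArr C M (Cod C f)" using D(6) by simp
    have "f' \<cdot> c = ZeroArr C F (Cod C f)" unfolding z using f(1) H(3) by simp
    then show "f = ZeroArr C (Cod C w) (Cod C f)" using w(1) f'(4) by simp
  qed
  show "w \<cdot> (u \<cdot> a) = ZeroArr C N F"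
    using w(1) D(1-3) H(1,2) kernelD(4)[OF k] by (simp add: reassoc[OF w(2)])
  fix T g assume g: "g \<in> Hom C T H" "w \<cdot> g = ZeroArr C T F"
  have "T \<in> Obj C" using g by auto
  then have "(c \<cdot> w) \<cdot> g = ZeroArr C T M" using g w(1) H(3) by simp
  then obtain r where r: "r \<in> Hom C T E" "u \<cdot> r = g" by (rule sx_lift[OF s g(1)])
  have "b \<cdot> r = w \<cdot> (u \<cdot> r)" using r(1) D(1-3) w(1) by (simp add: reassoc[OF w(2)])
  then have br: "b \<cdot> r = ZeroArr C T F" by (simp only: r(2) g(2))
  obtain q where q: "q \<in> Arr C" "Dom C q = Dom C r" "Cod C q = Dom C a" "a \<cdot> q = r"
    by (rule kernel_lift[OF k _ _ br]) (use r(1) H(2) in simp_all)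
  show "\<exists>q \<in> Hom C T N. (u \<cdot> a) \<cdot> q = g"
    by (rule bexI[of _ q]) (use q r D(1-3) H(1) in simp_all)
qed (use H w sxD(1-9)[OF s] in simp_all)

text \<open>The pushout of the extension \<open>H\<close> along \<open>f\<close> carries the
  required structure: its universal property yields \<open>w'\<close>, and agreement on both legs of
  the pushout identifies \<open>c' \<cdot> w'\<close> with the new projection.\<close>

lemma lift_step:
  assumes s: "sx C E H M u (c \<cdot> w)" and w: "w \<in> Hom C H F" "w \<cdot> u = b"
    and H: "c \<in> Hom C F M" "f \<in> Hom C E E'" "g \<in> Hom C F F'" "b' \<in> Hom C E' F'" "c' \<in> Hom C F' M"
    and e: "g \<cdot> b = b' \<cdot> f" "c' \<cdot> g = c" "c' \<cdot> b' = ZeroArr C E' M"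
  shows "\<exists>H' u' w'. sx C E' H' M u' (c' \<cdot> w') \<and> w' \<in> Hom C H' F' \<and> w' \<cdot> u' = b'"
proof -
  note D = sxD[OF s]
  obtain H' j r h where s': "sx C E' H' M j r" and h: "h \<in> Hom C H H'" "r \<cdot> h = c \<cdot> w" "h \<cdot> u = j \<cdot> f"
    by (rule push_sx[OF s H(2)])
  note D' = sxD[OF s']
  have gw: "g \<cdot> w \<in> Hom C H F'" using H(3) w(1) by simp
  have "(g \<cdot> w) \<cdot> u = b' \<cdot> f" using H(3) w D(1-3) e(1) by simp
  then obtain w' where w': "w' \<in> Hom C H' F'" "w' \<cdot> h = g \<cdot> w" "w' \<cdot> j = b'"
    by (rule push_prop[OF s s' h(1,3,2) H(2) gw H(4)])
  have "c' \<cdot> w' = r"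
  proof (rule push_joint_epi[OF s s' h(1)])
    show "r \<cdot> h = Idt C M \<cdot> (c \<cdot> w)" using h(2) w(1) H(1) D(9) by simp
    show "is_epi C (Idt C M)" "Idt C M \<in> Hom C M M" using D(9) by (simp_all add: iso_epi)
    show "c' \<cdot> w' \<in> Hom C H' M" "r \<in> Hom C H' M" using w'(1) H(5) D'(4-6) by simp_all
    show "(c' \<cdot> w') \<cdot> h = r \<cdot> h"
      using w'(1,2) h(1,2) H(3,5) w(1) by (simp add: reassoc[OF e(2)])
    show "(c' \<cdot> w') \<cdot> j = r \<cdot> j" using w'(1,3) H(5) D'(1-3,10) e(3) by simp
  qed
  with s' w' show ?thesis by blast
qed

end

section \<open>The lifting property from the vanishing of second extensions\<close>

context hereditary_category
begin

text \<open>Having a lift \<open>H\<close> is preserved by elementary equivalences of two-extensions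
  in both directions, and the trivial two-extension has one. By heredity a zigzag of elementary
  steps joins the trivial two-extension to the given one.\<close>

lemma hereditary_lift:
  assumes k: "is_kernel C a b" and c: "is_cokernel C c b"
  shows "\<exists>H u w. sx C (Dom C b) H (Cod C c) u (c \<cdot> w) \<and> w \<in> Hom C H (Cod C b) \<and> w \<cdot> u = b"
proof -
  define N where "N = Dom C a"
  define M where "M = Cod C c"
  have O: "N \<in> Obj C" "M \<in> Obj C"
    using kernelD[OF k] cokernelD[OF c] by (simp_all add: N_def M_def)
  define T where "T = (\<lambda>(a :: 'm, b, c). \<exists>H u w. sx C (Dom C b) H (Cod C c) u (c \<cdot> w) \<and>
    w \<in> Hom C H (Cod C b) \<and> w \<cdot> u = b)"
  have step1: "T (a', b', c')" if st: "((a, b, c), (a', b', c')) \<in> two_ext_step C M N"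
    and t: "T (a, b, c)" for a b c a' b' c'
  proof -
    from st obtain f g where t1: "(a, b, c) \<in> two_ext C M N" and t2: "(a', b', c') \<in> two_ext C M N"
      and f: "f \<in> Hom C (Dom C b) (Dom C b')" and g: "g \<in> Hom C (Dom C c) (Dom C c')"
      and e: "f \<cdot> a = a'" "g \<cdot> b = b' \<cdot> f" "c' \<cdot> g = c"
      unfolding two_ext_step_def by blast
    have x: "is_kernel C a b" "is_cokernel C c b" "Dom C a = N" "Cod C c = M"
      "is_kernel C a' b'" "is_cokernel C c' b'" "Dom C a' = N" "Cod C c' = M"
      using t1 t2 two_ext_iff[OF O] by simp_all
    note xD = kernelD[OF x(1)] cokernelD[OF x(2)] kernelD[OF x(5)] cokernelD[OF x(6)]
    obtain H u w where s: "sx C (Dom C b) H M u (c \<cdot> w)" and w: "w \<in> Hom C H (Cod C b)" "w \<cdot> u = b"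
      using t x(4) unfolding T_def by auto
    have H: "c \<in> Hom C (Cod C b) M" "g \<in> Hom C (Cod C b) (Cod C b')" "b' \<in> Hom C (Dom C b') (Cod C b')"
      "c' \<in> Hom C (Cod C b') M" "c' \<cdot> b' = ZeroArr C (Dom C b') M"
      using x(4,8) xD(5,7,10,13,15,16) g by simp_all
    show ?thesis
      using lift_step[OF s w H(1) f H(2,3,4) e(2,3) H(5)] x(8) unfolding T_def by simp
  qed
  \<comment> \<open>Against the direction of the step, \<open>H\<close> must be pulled back along
    \<open>g\<close> instead. \<open>lift_form\<close> rereads it as an extension of the codomain of
    \<open>b'\<close> by \<open>N\<close>, the dual of \<open>lift_step\<close> performs the
    pullback, and the dual of \<open>lift_form\<close> returns to an extension of
    \<open>M\<close>.\<close>
  have step2: "T (a, b, c)" if st: "((a, b, c), (a', b', c')) \<in> two_ext_step C M N"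
    and t: "T (a', b', c')" for a b c a' b' c'
  proof -
    from st obtain f g where t1: "(a, b, c) \<in> two_ext C M N" and t2: "(a', b', c') \<in> two_ext C M N"
      and f: "f \<in> Hom C (Dom C b) (Dom C b')" and g: "g \<in> Hom C (Dom C c) (Dom C c')"
      and e: "f \<cdot> a = a'" "g \<cdot> b = b' \<cdot> f" "c' \<cdot> g = c"
      unfolding two_ext_step_def by blast
    have x: "is_kernel C a b" "is_cokernel C c b" "Dom C a = N" "Cod C c = M"
      "is_kernel C a' b'" "is_cokernel C c' b'" "Dom C a' = N" "Cod C c' = M"
      using t1 t2 two_ext_iff[OF O] by simp_all
    note xD = kernelD[OF x(1)] cokernelD[OF x(2)] kernelD[OF x(5)] cokernelD[OF x(6)]
    obtain H u w where s: "sx C (Dom C b') H M u (c' \<cdot> w)" and w: "w \<in> Hom C H (Cod C b')" "w \<cdot> u = b'"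
      using t x(8) unfolding T_def by auto
    have H: "a \<in> Hom C N (Dom C b)" "b \<in> Hom C (Dom C b) (Cod C b)" "c \<in> Hom C (Cod C b) M"
      "a' \<in> Hom C N (Dom C b')" "b' \<in> Hom C (Dom C b') (Cod C b')" "c' \<in> Hom C (Cod C b') M"
      "g \<in> Hom C (Cod C b) (Cod C b')"
      using x(3,4,7,8) xD(1-3,5,7,9-11,13,15) g by simp_all
    have ba: "b \<cdot> a = ZeroArr C N (Cod C b)" using xD(4) x(3) by simp
    have s2: "sx C N H (Cod C b') (u \<cdot> a') w"
      by (rule lift_form[OF x(5,6) H(4-6) s w])
    have uH: "u \<in> Hom C (Dom C b') H" using sxD(1-3)[OF s] by simp
    have "\<exists>H u' w'. sx C N H (Cod C b) (w' \<cdot> a) u' \<and> w' \<in> Hom C (Dom C b) H \<and> u' \<cdot> w' = b"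
      by (rule abelian_category.lift_step[OF abelian_category_op, of "Cod C b'" H N w a' u "Dom C b'" b' g "Cod C b"
            f "Dom C b" b a, unfolded sx_op op_cat_sel Hom_op])
        (fact s2 uH w(2) H e(2)[symmetric] f e(1) ba)+
    then obtain H' u' w' where s3: "sx C N H' (Cod C b) (w' \<cdot> a) u'" and w': "w' \<in> Hom C (Dom C b) H'"
      "u' \<cdot> w' = b" by blast
    have "sx C (Dom C b) H' M w' (c \<cdot> u')"
      by (rule abelian_category.lift_form[OF abelian_category_op, of c b a M "Cod C b" "Dom C b" N H' u' w',
            unfolded sx_op op_cat_sel Hom_op is_kernel_op is_cokernel_op])
        (fact x(1,2) H s3 w')+
    moreover have "u' \<in> Hom C H' (Cod C b)" using sxD(4-6)[OF s3] by simp
    ultimately show ?thesis using w'(2) x(4) unfolding T_def by auto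
  qed
  \<comment> \<open>The biproduct of \<open>N\<close> and \<open>M\<close> is a lift of the trivial
    two-extension.\<close>
  have T0: "T (Idt C N, ZeroArr C N M, Idt C M)"
  proof -
    obtain S i1 i2 p1 p2 where S: "S \<in> Obj C" "i1 \<in> Hom C N S" "i2 \<in> Hom C M S" "p1 \<in> Hom C S N"
      "p2 \<in> Hom C S M" and e: "p1 \<cdot> i1 = Idt C N" "p2 \<cdot> i2 = Idt C M" "p1 \<cdot> i2 = ZeroArr C M N"
      "p2 \<cdot> i1 = ZeroArr C N M" "Plus C (i1 \<cdot> p1) (i2 \<cdot> p2) = Idt C S"
      by (rule biprodE[OF O])
    have "sx C N S M i1 p2" by (rule biprod_sx[OF S(2-5) e(1,2,4,5)])
    then have "sx C N S M i1 (Idt C M \<cdot> p2) \<and> p2 \<in> Hom C S M \<and> p2 \<cdot> i1 = ZeroArr C N M"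
      using S(5) e(4) by simp
    then show ?thesis unfolding T_def using O by (auto simp del: Hom_iff)
  qed
  have all: "T t" if "((Idt C N, ZeroArr C N M, Idt C M), t) \<in> two_ext_equiv C M N" for t
    using that unfolding two_ext_equiv_def
  proof (induction rule: rtrancl_induct)
    case base
    show ?case by (rule T0)
  next
    case (step y z)
    obtain a b c a' b' c' where "y = (a, b, c)" "z = (a', b', c')" by (metis prod_cases3)
    with step show ?case using step1 step2 by (auto simp del: Hom_iff)
  qed
  have abc: "(a, b, c) \<in> two_ext C M N" using k c two_ext_iff[OF O] by (simp add: N_def M_def)
  then have "two_ext_equiv C M N `` {(a, b, c)} \<in> Ext2 C M N"
    unfolding Ext2_def by (rule quotientI)
  then have "two_ext_equiv C M N `` {(a, b, c)} = Ext2_zero C M N" using hereditary O(1,2) by blast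
  moreover have "(a, b, c) \<in> two_ext_equiv C M N `` {(a, b, c)}" by (simp add: two_ext_equiv_def)
  ultimately have "T (a, b, c)" using all by (simp add: Ext2_zero_def)
  then show ?thesis by (simp add: T_def del: Hom_iff)
qed

end

section \<open>Pushouts and pullbacks of extensions\<close>

lemma ses_map_op: "ses_map (op_cat C) (p', i') c a (p, i) \<longleftrightarrow> ses_map C (i, p) a c (i', p')"
  if "is_kernel C i p" "is_kernel C i' p'"
proof -
  have "Cod C i = Dom C p" "Cod C i' = Dom C p'" using that by (auto simp: is_kernel_def)
  then show ?thesis by (auto simp: ses_map_def)
qed

context abelian_category
begin

lemma ses_obtain:
  assumes "e \<in> ses C M N"
  obtains i p E where "e = (i, p)" "sx C N E M i p"
  using that assms by (cases e) (auto simp: sx_def)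

lemma sx_ses: "sx C N E M i p \<Longrightarrow> (i, p) \<in> ses C M N"
  by (simp add: sx_def)

lemma ses_map_sx:
  assumes "sx C N E M i p" "sx C N' E' M' i' p'"
  shows "ses_map C (i, p) a c (i', p') \<longleftrightarrow> (\<exists>b \<in> Hom C E E'. b \<cdot> i = i' \<cdot> a \<and> p' \<cdot> b = c \<cdot> p)"
  using sxD(5)[OF assms(1)] sxD(5)[OF assms(2)] by (simp add: ses_map_def del: Hom_iff)

lemma ses_map_trans:
  assumes "e \<in> ses C M N" "e' \<in> ses C M' N'" "e'' \<in> ses C M'' N''"
    and ac: "a \<in> Hom C N N'" "a' \<in> Hom C N' N''" "c \<in> Hom C M M'" "c' \<in> Hom C M' M''"
    and m: "ses_map C e a c e'" "ses_map C e' a' c' e''"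
  shows "ses_map C e (a' \<cdot> a) (c' \<cdot> c) e''"
proof -
  obtain i p E where e: "e = (i, p)" and s: "sx C N E M i p" by (rule ses_obtain[OF assms(1)])
  obtain i' p' E' where e': "e' = (i', p')" and s': "sx C N' E' M' i' p'" by (rule ses_obtain[OF assms(2)])
  obtain i'' p'' E'' where e'': "e'' = (i'', p'')" and s'': "sx C N'' E'' M'' i'' p''"
    by (rule ses_obtain[OF assms(3)])
  obtain b where b: "b \<in> Hom C E E'" "b \<cdot> i = i' \<cdot> a" "p' \<cdot> b = c \<cdot> p"
    using m(1) unfolding e e' ses_map_sx[OF s s'] by blast
  obtain b' where b': "b' \<in> Hom C E' E''" "b' \<cdot> i' = i'' \<cdot> a'" "p'' \<cdot> b' = c' \<cdot> p'"
    using m(2) unfolding e' e'' ses_map_sx[OF s' s''] by blast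
  note D = sxD[OF s] sxD[OF s'] sxD[OF s'']
  have "(b' \<cdot> b) \<cdot> i = i'' \<cdot> (a' \<cdot> a)"
    using b(1,2) b'(1) ac(1,2) sxD(1-6)[OF s] sxD(1-6)[OF s'] sxD(1-6)[OF s'']
    by (simp add: reassoc[OF b'(2)])
  moreover have "p'' \<cdot> (b' \<cdot> b) = (c' \<cdot> c) \<cdot> p"
    using b(1,3) b'(1) ac(3,4) sxD(1-6)[OF s] sxD(1-6)[OF s'] sxD(1-6)[OF s'']
    by (simp add: reassoc[OF b'(3)])
  moreover have "b' \<cdot> b \<in> Hom C E E''" using b(1) b'(1) by simp
  ultimately show ?thesis unfolding e e'' ses_map_sx[OF s s''] by blast
qed

lemma ses_push:
  assumes "e \<in> ses C M N" "a \<in> Hom C N N'"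
  obtains e' where "e' \<in> ses C M N'" "ses_map C e a (Idt C M) e'"
proof -
  obtain i p E where e: "e = (i, p)" and s: "sx C N E M i p" by (rule ses_obtain[OF assms(1)])
  obtain E' j r h where s': "sx C N' E' M j r" and h: "h \<in> Hom C E E'" "r \<cdot> h = p" "h \<cdot> i = j \<cdot> a"
    by (rule push_sx[OF s assms(2)])
  have "h \<cdot> i = j \<cdot> a \<and> r \<cdot> h = Idt C M \<cdot> p" using h sxD(4-6)[OF s] by simp
  with h(1) have "ses_map C e a (Idt C M) (j, r)" unfolding e ses_map_sx[OF s s'] by blast
  then show ?thesis using that sx_ses[OF s'] by blast
qed

text \<open>By the universal property of the pushout \<open>d\<close>. This factors an arbitrary map
  of extensions into a pushout along \<open>a\<close> followed by a pullback along
  \<open>c\<close>.\<close>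

lemma ses_push_factor:
  assumes "e \<in> ses C M N" "e' \<in> ses C M' N'" "d \<in> ses C M N'"
    and ac: "a \<in> Hom C N N'" "c \<in> Hom C M M'"
    and m: "ses_map C e a c e'" "ses_map C e a (Idt C M) d"
  shows "ses_map C d (Idt C N') c e'"
proof -
  obtain i p E where e: "e = (i, p)" and s: "sx C N E M i p" by (rule ses_obtain[OF assms(1)])
  obtain i' p' E' where e': "e' = (i', p')" and s': "sx C N' E' M' i' p'" by (rule ses_obtain[OF assms(2)])
  obtain j r D where d: "d = (j, r)" and sd: "sx C N' D M j r" by (rule ses_obtain[OF assms(3)])
  note D = sxD[OF s] and D' = sxD[OF s'] and Dd = sxD[OF sd]
  obtain b where b: "b \<in> Hom C E E'" "b \<cdot> i = i' \<cdot> a" "p' \<cdot> b = c \<cdot> p"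
    using m(1) unfolding e e' ses_map_sx[OF s s'] by blast
  obtain h where h: "h \<in> Hom C E D" "h \<cdot> i = j \<cdot> a" "r \<cdot> h = Idt C M \<cdot> p"
    using m(2) unfolding e d ses_map_sx[OF s sd] by blast
  have rh: "r \<cdot> h = p" using h(3) D(4,6) by simp
  have i': "i' \<in> Hom C N' E'" using D'(1-3) by simp
  obtain w where w: "w \<in> Hom C D E'" "w \<cdot> h = b" "w \<cdot> j = i'"
    by (rule push_prop[OF s sd h(1,2) rh ac(1) b(1) i' b(2)])
  have "p' \<cdot> w = c \<cdot> r"
  proof (rule push_joint_epi[OF s sd h(1,3)])
    show "is_epi C (Idt C M)" "Idt C M \<in> Hom C M M" using D(9) by (simp_all add: iso_epi)
    show "p' \<cdot> w \<in> Hom C D M'" "c \<cdot> r \<in> Hom C D M'" using w(1) D'(4-6) Dd(4-6) ac(2) by simp_all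
    show "(p' \<cdot> w) \<cdot> h = (c \<cdot> r) \<cdot> h"
      using w(1,2) h(1) b(3) rh D'(4-6) Dd(4-6) ac(2) by simp
    show "(p' \<cdot> w) \<cdot> j = (c \<cdot> r) \<cdot> j"
      using w(1,3) D'(4-6,10) Dd(1-10) ac(2) D'(9) by simp
  qed
  moreover have "w \<cdot> j = i' \<cdot> Idt C N'" using w(3) D'(1-3) by simp
  ultimately show ?thesis unfolding d e' ses_map_sx[OF sd s'] using w(1) by blast
qed

lemma ses_swap:
  assumes "e \<in> ses C M N" "e' \<in> ses C M' N'"
  shows "ses_map (op_cat C) (prod.swap e') c a (prod.swap e) \<longleftrightarrow> ses_map C e a c e'"
    and "prod.swap e \<in> ses (op_cat C) N M"
proof -
  have "is_kernel C (fst e) (snd e)" "is_kernel C (fst e') (snd e')"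
    using assms by (auto simp: ses_def)
  then show "ses_map (op_cat C) (prod.swap e') c a (prod.swap e) \<longleftrightarrow> ses_map C e a c e'"
    using ses_map_op[of C "fst e" "snd e" "fst e'" "snd e'" c a] by (simp add: prod.swap_def)
  show "prod.swap e \<in> ses (op_cat C) N M" using assms by (cases e) simp
qed

text \<open>The dual of \<open>ses_push_factor\<close>: here \<open>d\<close> is the pullback of
  \<open>e'\<close> along \<open>c\<close>.\<close>

lemma ses_pull_factor:
  assumes e: "e \<in> ses C M N" "e' \<in> ses C M' N'" "d \<in> ses C M N'"
    and ac: "a \<in> Hom C N N'" "c \<in> Hom C M M'"
    and m: "ses_map C e a c e'" "ses_map C d (Idt C N') c e'"
  shows "ses_map C e a (Idt C M) d"
proof -
  have "ses_map (op_cat C) (prod.swap d) (Idt C M) a (prod.swap e)"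
    by (rule abelian_category.ses_push_factor[OF abelian_category_op, of "prod.swap e'" N' M' "prod.swap e" N M
          "prod.swap d" c a, unfolded op_cat_sel Hom_op])
      (use ses_swap[OF e(1,2)] ses_swap[OF e(3,2)] ses_swap(2)[OF e(2,2)] ac m in \<open>simp_all del: Hom_iff\<close>)
  then show ?thesis using ses_swap(1)[OF e(1,3)] by simp
qed

text \<open>By the five lemma the middle component of a map with identities at both ends is an
  isomorphism, so equivalence of extensions becomes a special case of
  \<open>ses_map\<close>.\<close>

lemma ses_equiv_iff:
  "(e, e') \<in> ses_equiv C M N \<longleftrightarrow>
    e \<in> ses C M N \<and> e' \<in> ses C M N \<and> ses_map C e (Idt C N) (Idt C M) e'"
proof (cases "e \<in> ses C M N \<and> e' \<in> ses C M N")
  case True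
  obtain i p E where e: "e = (i, p)" and s: "sx C N E M i p" using True by (blast elim: ses_obtain)
  obtain i' p' E' where e': "e' = (i', p')" and s': "sx C N E' M i' p'"
    using True by (blast elim: ses_obtain)
  note D = sxD[OF s] and D' = sxD[OF s']
  have 1: "i' \<cdot> Idt C N = i'" "Idt C M \<cdot> p = p" using D(4,6) D'(1,2) by simp_all
  have "is_iso C b" if b: "b \<in> Hom C E E'" "b \<cdot> i = i'" "p' \<cdot> b = p" for b
  proof (rule mono_epi_iso)
    have I: "Idt C N \<in> Hom C N N" "Idt C M \<in> Hom C M M" "is_iso C (Idt C N)" "is_iso C (Idt C M)"
      using D(7,9) by simp_all
    show "is_mono C b"
      by (rule sx_map_mono[OF s s' b(1) _ _ I(1) iso_mono[OF I(3)] I(2) iso_mono[OF I(4)]])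
        (use b(2,3) 1 in simp_all)
    show "is_epi C b"
      by (rule sx_map_epi[OF s' s b(1) _ _ I(2) iso_epi[OF I(4)] I(1) iso_epi[OF I(3)]])
        (use b(2,3) 1 in simp_all)
  qed
  then show ?thesis using True D(5) D'(5) 1
    unfolding ses_equiv_def e e' ses_map_sx[OF s s'] by (auto simp del: Hom_iff)
qed (auto simp: ses_equiv_def)

lemma ses_equiv_refl: "e \<in> ses C M N \<Longrightarrow> (e, e) \<in> ses_equiv C M N"
proof -
  assume e: "e \<in> ses C M N"
  then obtain i p E where ep: "e = (i, p)" and s: "sx C N E M i p" by (rule ses_obtain)
  have "Idt C E \<cdot> i = i \<cdot> Idt C N \<and> p \<cdot> Idt C E = Idt C M \<cdot> p" "Idt C E \<in> Hom C E E"
    using sxD(1-9)[OF s] by simp_all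
  then show ?thesis unfolding ses_equiv_iff using e unfolding ep ses_map_sx[OF s s] by blast
qed

lemma ses_equiv_sym: "(e, e') \<in> ses_equiv C M N \<Longrightarrow> (e', e) \<in> ses_equiv C M N"
proof -
  assume *: "(e, e') \<in> ses_equiv C M N"
  then have e: "e \<in> ses C M N" "e' \<in> ses C M N" by (auto simp: ses_equiv_def)
  obtain i p E where ep: "e = (i, p)" and s: "sx C N E M i p" by (rule ses_obtain[OF e(1)])
  obtain i' p' E' where ep': "e' = (i', p')" and s': "sx C N E' M i' p'" by (rule ses_obtain[OF e(2)])
  note D = sxD[OF s] and D' = sxD[OF s']
  obtain h where h: "h \<in> Hom C E E'" "is_iso C h" "h \<cdot> i = i'" "p' \<cdot> h = p"
    using * D(5) D'(5) unfolding ses_equiv_def ep ep' by auto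
  obtain g where g: "g \<in> Arr C" "Dom C g = Cod C h" "Cod C g = Dom C h"
    "g \<cdot> h = Idt C (Dom C h)" "h \<cdot> g = Idt C (Cod C h)" using h(2) by (rule isoE)
  have gH: "g \<in> Hom C E' E" using g(1-3) h(1) by simp
  have "g \<cdot> i' = g \<cdot> (h \<cdot> i)" by (simp only: h(3))
  also have "\<dots> = i \<cdot> Idt C N" using g(1-3) h(1) D(1-3) by (simp add: reassoc[OF g(4)])
  finally have 1: "g \<cdot> i' = i \<cdot> Idt C N" .
  have "p \<cdot> g = (p' \<cdot> h) \<cdot> g" by (simp only: h(4))
  also have "\<dots> = Idt C M \<cdot> p'" using g(1-3) h(1) D'(4-6) g(5) by simp
  finally have "p \<cdot> g = Idt C M \<cdot> p'" .
  with 1 gH show ?thesis unfolding ses_equiv_iff using e unfolding ep ep' ses_map_sx[OF s' s] by blast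
qed

lemma ses_equiv_trans:
  "(e, e') \<in> ses_equiv C M N \<Longrightarrow> (e', e'') \<in> ses_equiv C M N \<Longrightarrow> (e, e'') \<in> ses_equiv C M N"
proof -
  assume a: "(e, e') \<in> ses_equiv C M N" "(e', e'') \<in> ses_equiv C M N"
  then have e: "e \<in> ses C M N" "e' \<in> ses C M N" "e'' \<in> ses C M N" by (auto simp: ses_equiv_def)
  obtain i p E where s: "sx C N E M i p" by (rule ses_obtain[OF e(1)])
  have I: "Idt C N \<in> Hom C N N" "Idt C M \<in> Hom C M M" using sxD(7,9)[OF s] by simp_all
  have "ses_map C e (Idt C N \<cdot> Idt C N) (Idt C M \<cdot> Idt C M) e''"
    by (rule ses_map_trans[OF e I(1) I(1) I(2) I(2)]) (use a ses_equiv_iff in blast)+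
  then show ?thesis using e I unfolding ses_equiv_iff by simp
qed

lemma equiv_ses: "equiv (ses C M N) (ses_equiv C M N)"
proof (rule equivI)
  show "ses_equiv C M N \<subseteq> ses C M N \<times> ses C M N" by (auto simp: ses_equiv_def)
qed (auto simp: refl_on_def sym_def trans_def intro: ses_equiv_refl ses_equiv_sym ses_equiv_trans)

text \<open>The connecting map from \<open>Hom C R N\<close> to \<open>Ext1 C M N\<close> of the
  extension \<open>\<eta>\<close>. Its value is the set of all pushouts rather than a chosen one, so
  that it can be an extension class.\<close>

definition pushc :: "'o \<Rightarrow> 'o \<Rightarrow> 'm \<times> 'm \<Rightarrow> 'm \<Rightarrow> ('m \<times> 'm) set" where
  "pushc M N \<eta> f = {e \<in> ses C M N. ses_map C \<eta> f (Idt C M) e}"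

text \<open>Pushouts along the same arrow are equivalent by their universal property, and a pushout
  followed by an equivalence is again one. Hence \<open>pushc\<close> is a full equivalence
  class.\<close>

lemma pushc_equiv:
  assumes h: "\<eta> \<in> ses C M R" and f: "f \<in> Hom C R N" and e: "e \<in> pushc M N \<eta> f"
  shows "(e, e') \<in> ses_equiv C M N \<longleftrightarrow> e' \<in> pushc M N \<eta> f"
proof
  have eM: "e \<in> ses C M N" "ses_map C \<eta> f (Idt C M) e" using e by (auto simp: pushc_def)
  obtain i p E where s: "sx C N E M i p" by (rule ses_obtain[OF eM(1)])
  have I: "Idt C N \<in> Hom C N N" "Idt C M \<in> Hom C M M" using sxD(7,9)[OF s] by simp_all
  {
    assume "(e, e') \<in> ses_equiv C M N"
    then have a: "e' \<in> ses C M N" "ses_map C e (Idt C N) (Idt C M) e'" using ses_equiv_iff by blast+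
    have "ses_map C \<eta> (Idt C N \<cdot> f) (Idt C M \<cdot> Idt C M) e'"
      by (rule ses_map_trans[OF h eM(1) a(1) f I(1) I(2) I(2) eM(2) a(2)])
    then show "e' \<in> pushc M N \<eta> f" using a(1) f I by (simp add: pushc_def)
  next
    assume "e' \<in> pushc M N \<eta> f"
    then have a: "e' \<in> ses C M N" "ses_map C \<eta> f (Idt C M) e'" by (auto simp: pushc_def)
    have "ses_map C e (Idt C N) (Idt C M) e'"
      by (rule ses_push_factor[OF h a(1) eM(1) f I(2) a(2) eM(2)])
    then show "(e, e') \<in> ses_equiv C M N" unfolding ses_equiv_iff using eM(1) a(1) by blast
  }
qed

lemma pushc_nonempty:
  assumes "\<eta> \<in> ses C M R" "f \<in> Hom C R N"
  obtains e where "e \<in> pushc M N \<eta> f"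
proof -
  obtain e' where "e' \<in> ses C M N" "ses_map C \<eta> f (Idt C M) e'" by (rule ses_push[OF assms])
  then show ?thesis using that by (simp add: pushc_def)
qed

lemma pushc_class:
  assumes "\<eta> \<in> ses C M R" "f \<in> Hom C R N" "e \<in> pushc M N \<eta> f"
  shows "pushc M N \<eta> f = ses_equiv C M N `` {e}"
  using pushc_equiv[OF assms] by blast

lemma pushc_Ext1:
  assumes "\<eta> \<in> ses C M R" "f \<in> Hom C R N"
  shows "pushc M N \<eta> f \<in> Ext1 C M N"
proof -
  obtain e where e: "e \<in> pushc M N \<eta> f" by (rule pushc_nonempty[OF assms])
  then have "e \<in> ses C M N" by (simp add: pushc_def)
  then show ?thesis unfolding Ext1_def pushc_class[OF assms e] by (rule quotientI)
qed

text \<open>Exactness at \<open>Hom C R N\<close> of the long exact sequence. Two maps of extensions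
  into the same \<open>e\<close> differ by an arrow that \<open>p\<close> kills, hence by
  \<open>i \<cdot> h\<close>; conversely, subtracting \<open>i \<cdot> h\<close> turns a map over
  \<open>f\<close> into one over \<open>g\<close>.\<close>

lemma pushc_mem_iff:
  assumes s: "sx C R P M \<iota> \<pi>" and f: "f \<in> Hom C R N" and g: "g \<in> Hom C R N"
    and e: "e \<in> pushc M N (\<iota>, \<pi>) f"
  shows "e \<in> pushc M N (\<iota>, \<pi>) g \<longleftrightarrow> (\<exists>h \<in> Hom C P N. Minus f g = h \<cdot> \<iota>)"
proof -
  have eM: "e \<in> ses C M N" "ses_map C (\<iota>, \<pi>) f (Idt C M) e" using e by (auto simp: pushc_def)
  obtain i p E where ep: "e = (i, p)" and s': "sx C N E M i p" by (rule ses_obtain[OF eM(1)])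
  note D = sxD[OF s] and D' = sxD[OF s']
  obtain b where b: "b \<in> Hom C P E" "b \<cdot> \<iota> = i \<cdot> f" "p \<cdot> b = Idt C M \<cdot> \<pi>"
    using eM(2) unfolding ep ses_map_sx[OF s s'] by blast
  show ?thesis
  proof
    assume "e \<in> pushc M N (\<iota>, \<pi>) g"
    then have "ses_map C (\<iota>, \<pi>) g (Idt C M) e" by (simp add: pushc_def)
    then obtain b' where b': "b' \<in> Hom C P E" "b' \<cdot> \<iota> = i \<cdot> g" "p \<cdot> b' = Idt C M \<cdot> \<pi>"
      unfolding ep ses_map_sx[OF s s'] by blast
    have m: "Minus b b' \<in> Hom C P E" using b(1) b'(1) by simp
    have "p \<cdot> Minus b b' = ZeroArr C P M" using b(1,3) b'(1,3) D'(4-6) D(4-6,9) by (simp add: Minus_self)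
    then obtain h where h: "h \<in> Hom C P N" "i \<cdot> h = Minus b b'" by (rule sx_lift[OF s' m])
    have "i \<cdot> (h \<cdot> \<iota>) = Minus b b' \<cdot> \<iota>" using h(1) D(1-3) D'(1-3) by (simp flip: h(2))
    also have "\<dots> = i \<cdot> Minus f g" using b(1,2) b'(1,2) D(1-3) D'(1-3) f g by simp
    finally have ih: "i \<cdot> (h \<cdot> \<iota>) = i \<cdot> Minus f g" .
    have "h \<cdot> \<iota> = Minus f g"
      by (rule mono_cancel[OF D'(11) ih]) (use h(1) D(1-3) D'(1-3) f g in simp_all)
    then show "\<exists>h \<in> Hom C P N. Minus f g = h \<cdot> \<iota>" using h(1) by metis
  next
    assume "\<exists>h \<in> Hom C P N. Minus f g = h \<cdot> \<iota>"
    then obtain h where h: "h \<in> Hom C P N" "Minus f g = h \<cdot> \<iota>" by blast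
    define b' where "b' = Minus b (i \<cdot> h)"
    have b': "b' \<in> Hom C P E" unfolding b'_def using b(1) h(1) D'(1-3) by simp
    have "f = Plus C g (Minus f g)" using f g Minus_Plus_cancel(3)[of f g] by simp
    then have fe: "f = Plus C g (h \<cdot> \<iota>)" by (simp only: h(2))
    have "b' \<cdot> \<iota> = Minus (i \<cdot> f) (i \<cdot> (h \<cdot> \<iota>))" unfolding b'_def using b(1,2) h(1) D'(1-3) D(1-3) by simp
    also have "\<dots> = i \<cdot> g" unfolding fe using g h(1) D'(1-3) D(1-3)
      Minus_Plus_cancel(1)[of "i \<cdot> g" "i \<cdot> (h \<cdot> \<iota>)"] by simp
    finally have 1: "b' \<cdot> \<iota> = i \<cdot> g" .
    have "p \<cdot> b' = Minus \<pi> (ZeroArr C P M)" unfolding b'_def using b(1,3) h(1) D'(1-6) D(4-6)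
      by (simp add: reassoc[OF D'(10)] D'(9))
    also have "\<dots> = Idt C M \<cdot> \<pi>" using D(4-6,8,9) Minus_Plus_cancel(1)[of \<pi> "ZeroArr C P M"] by simp
    finally have "p \<cdot> b' = Idt C M \<cdot> \<pi>" .
    with 1 b' have "ses_map C (\<iota>, \<pi>) g (Idt C M) e" unfolding ep ses_map_sx[OF s s'] by blast
    then show "e \<in> pushc M N (\<iota>, \<pi>) g" using eM(1) by (simp add: pushc_def)
  qed
qed

lemma pushc_eq_iff:
  assumes s: "sx C R P M \<iota> \<pi>" and f: "f \<in> Hom C R N" and g: "g \<in> Hom C R N"
  shows "pushc M N (\<iota>, \<pi>) f = pushc M N (\<iota>, \<pi>) g \<longleftrightarrow> (\<exists>h \<in> Hom C P N. Minus f g = h \<cdot> \<iota>)"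
proof -
  obtain e where e: "e \<in> pushc M N (\<iota>, \<pi>) f" by (rule pushc_nonempty[OF sx_ses[OF s] f])
  show ?thesis
  proof
    assume "pushc M N (\<iota>, \<pi>) f = pushc M N (\<iota>, \<pi>) g"
    then show "\<exists>h \<in> Hom C P N. Minus f g = h \<cdot> \<iota>" using pushc_mem_iff[OF s f g e] e by blast
  next
    assume "\<exists>h \<in> Hom C P N. Minus f g = h \<cdot> \<iota>"
    then have "e \<in> pushc M N (\<iota>, \<pi>) g" using pushc_mem_iff[OF s f g e] by blast
    then show "pushc M N (\<iota>, \<pi>) f = pushc M N (\<iota>, \<pi>) g"
      using pushc_class[OF sx_ses[OF s] f e] pushc_class[OF sx_ses[OF s] g] by blast
  qed
qed

text \<open>Effaceability: an epimorphism onto \<open>M\<close> that kills finitely many given extension classes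
  replaces the projective covers that are missing in \<^term>\<open>C\<close>.\<close>

definition effaces :: "'m \<times> 'm \<Rightarrow> 'o \<Rightarrow> 'o \<Rightarrow> 'o \<Rightarrow> bool" where
  "effaces \<eta> M R N \<longleftrightarrow> (\<forall>e \<in> ses C M N. \<exists>f \<in> Hom C R N. e \<in> pushc M N \<eta> f)"

text \<open>Pullbacks of epimorphisms are epimorphisms, so two epimorphisms onto \<open>M\<close>
  are dominated by the composite from their pullback; induction handles finitely many.\<close>

lemma common_refinement:
  assumes "finite F" "\<And>p. p \<in> F \<Longrightarrow> is_epi C p \<and> Cod C p = M" "M \<in> Obj C"
  shows "\<exists>\<pi>. is_epi C \<pi> \<and> Cod C \<pi> = M \<and> (\<forall>p \<in> F. \<exists>t \<in> Hom C (Dom C \<pi>) (Dom C p). p \<cdot> t = \<pi>)"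
  using assms(1,2)
proof (induction rule: finite_induct)
  case empty
  show ?case by (rule exI[of _ "Idt C M"]) (simp add: iso_epi assms(3))
next
  case (insert p F)
  obtain \<pi> where \<pi>: "is_epi C \<pi>" "Cod C \<pi> = M" "\<forall>p \<in> F. \<exists>t \<in> Hom C (Dom C \<pi>) (Dom C p). p \<cdot> t = \<pi>"
    using insert.IH insert.prems by blast
  have p: "is_epi C p" "Cod C p = M" using insert.prems by blast+
  have H: "\<pi> \<in> Hom C (Dom C \<pi>) M" "p \<in> Hom C (Dom C p) M"
    using \<pi>(1,2) p epi_Arr by simp_all
  obtain P x y where x: "x \<in> Hom C P (Dom C \<pi>)" and y: "y \<in> Hom C P (Dom C p)"
    and xy: "\<pi> \<cdot> x = p \<cdot> y" and xe: "is_epi C p \<longrightarrow> is_epi C x"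
    by (rule pullback[OF H])
  show ?case
  proof (intro exI conjI ballI)
    show "is_epi C (\<pi> \<cdot> x)" using xe p(1) \<pi>(1) x H(1) by (intro epi_Comp) auto
    show "Cod C (\<pi> \<cdot> x) = M" using x H(1) by simp
    fix q assume "q \<in> insert p F"
    then consider "q = p" | "q \<in> F" by blast
    then show "\<exists>t \<in> Hom C (Dom C (\<pi> \<cdot> x)) (Dom C q). q \<cdot> t = \<pi> \<cdot> x"
    proof cases
      case 1
      then show ?thesis using xy x y H by (intro bexI[of _ y]) auto
    next
      case 2
      then obtain t where t: "t \<in> Hom C (Dom C \<pi>) (Dom C q)" "q \<cdot> t = \<pi>" using \<pi>(3) by blast
      have "q \<in> Arr C" using insert.prems 2 epi_Arr by blast
      then have "q \<cdot> (t \<cdot> x) = \<pi> \<cdot> x" using t(1) x by (simp add: reassoc[OF t(2)])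
      then show ?thesis using t(1) x H(1) by (intro bexI[of _ "t \<cdot> x"]) auto
    qed
  qed
qed

text \<open>A lift \<open>t\<close> of \<open>\<pi>\<close> through \<open>p\<close> maps the kernel
  \<open>R\<close> into \<open>N\<close>; the restriction is the arrow along which the given
  extension is a pushout.\<close>

lemma effacesI:
  assumes s: "sx C R P M \<iota> \<pi>"
    and t: "\<And>i p. (i, p) \<in> ses C M N \<Longrightarrow> \<exists>t \<in> Hom C P (Dom C p). p \<cdot> t = \<pi>"
  shows "effaces (\<iota>, \<pi>) M R N"
  unfolding effaces_def
proof
  fix e assume e: "e \<in> ses C M N"
  then obtain i p E where ep: "e = (i, p)" and s': "sx C N E M i p" by (rule ses_obtain)
  note D = sxD[OF s] and D' = sxD[OF s']
  obtain t where t: "t \<in> Hom C P E" "p \<cdot> t = \<pi>" using t[of i p] e ep D'(5) by auto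
  have "p \<cdot> (t \<cdot> \<iota>) = ZeroArr C R M" using t(1) D(1-3,10) D'(4-6) by (simp add: reassoc[OF t(2)])
  moreover have "t \<cdot> \<iota> \<in> Hom C R E" using t(1) D(1-3) by simp
  ultimately obtain f where f: "f \<in> Hom C R N" "i \<cdot> f = t \<cdot> \<iota>" using sx_lift[OF s'] by metis
  have "t \<cdot> \<iota> = i \<cdot> f \<and> p \<cdot> t = Idt C M \<cdot> \<pi>" using f t(2) D(4,6) by simp
  then have "ses_map C (\<iota>, \<pi>) f (Idt C M) e" unfolding ep ses_map_sx[OF s s'] using t(1) by blast
  then show "\<exists>f \<in> Hom C R N. e \<in> pushc M N (\<iota>, \<pi>) f" using f(1) e by (auto simp: pushc_def simp del: Hom_iff)
qed

text \<open>Whether \<open>\<pi>\<close> lifts through an extension depends only on its equivalence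
  class, so one representative for each of the finitely many classes is enough.\<close>

lemma effacing_exists:
  assumes "M \<in> Obj C" "finite \<N>" "\<And>N. N \<in> \<N> \<Longrightarrow> finite (Ext1 C M N)"
  obtains R P \<iota> \<pi> where "sx C R P M \<iota> \<pi>" "\<And>N. N \<in> \<N> \<Longrightarrow> effaces (\<iota>, \<pi>) M R N"
proof -
  define F where "F = (\<Union>N \<in> \<N>. (\<lambda>x. snd (SOME e. e \<in> x)) ` Ext1 C M N)"
  have rep: "(SOME e. e \<in> x) \<in> x" "x \<subseteq> ses C M N" if "x \<in> Ext1 C M N" for x N
  proof -
    have "x \<noteq> {}" using in_quotient_imp_non_empty[OF equiv_ses that[unfolded Ext1_def]] .
    then show "(SOME e. e \<in> x) \<in> x" by (simp add: some_in_eq)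
    show "x \<subseteq> ses C M N" using in_quotient_imp_subset[OF equiv_ses that[unfolded Ext1_def]] .
  qed
  have "\<exists>\<pi>. is_epi C \<pi> \<and> Cod C \<pi> = M \<and> (\<forall>p \<in> F. \<exists>t \<in> Hom C (Dom C \<pi>) (Dom C p). p \<cdot> t = \<pi>)"
  proof (rule common_refinement)
    show "finite F" unfolding F_def using assms by blast
    fix p assume "p \<in> F"
    then obtain N x where x: "x \<in> Ext1 C M N" "p = snd (SOME e. e \<in> x)" unfolding F_def by blast
    then have e: "(SOME e. e \<in> x) \<in> ses C M N" using rep[OF x(1)] by blast
    obtain i q E where "(SOME e. e \<in> x) = (i, q)" and s: "sx C N E M i q" by (rule ses_obtain[OF e])
    then have "p = q" using x(2) by simp
    then show "is_epi C p \<and> Cod C p = M" using sxD(6,12)[OF s] by simp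
  qed fact
  then obtain \<pi> where \<pi>: "is_epi C \<pi>" "Cod C \<pi> = M"
    and lift: "\<forall>p \<in> F. \<exists>t \<in> Hom C (Dom C \<pi>) (Dom C p). p \<cdot> t = \<pi>" by blast
  obtain \<iota> where \<iota>: "is_kernel C \<iota> \<pi>" using kernel_exists epi_Arr[OF \<pi>(1)] by blast
  have s: "sx C (Dom C \<iota>) (Dom C \<pi>) M \<iota> \<pi>" using kernel_sx[OF \<iota> \<pi>(1)] \<pi>(2) by simp
  moreover have "effaces (\<iota>, \<pi>) M (Dom C \<iota>) N" if N: "N \<in> \<N>" for N
  proof (rule effacesI[OF s])
    fix i p assume ip: "(i, p) \<in> ses C M N"
    define x where "x = ses_equiv C M N `` {(i, p)}"
    have x: "x \<in> Ext1 C M N" unfolding x_def Ext1_def using ip by (rule quotientI)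
    define e where "e = (SOME e. e \<in> x)"
    have "e \<in> x" unfolding e_def by (rule rep(1)[OF x])
    then have "(e, (i, p)) \<in> ses_equiv C M N" unfolding x_def using ses_equiv_sym by blast
    then obtain h where h: "h \<in> Hom C (Dom C (snd e)) (Dom C p)" "p \<cdot> h = snd e"
      unfolding ses_equiv_def by (auto simp del: Hom_iff)
    have "snd e \<in> F" unfolding F_def e_def using N x by blast
    then obtain t where t: "t \<in> Hom C (Dom C \<pi>) (Dom C (snd e))" "snd e \<cdot> t = \<pi>" using lift by blast
    have "p \<in> Arr C" using sxD(4) ip unfolding sx_def by blast
    then have "p \<cdot> (h \<cdot> t) = \<pi>" using h(1) t by (simp add: reassoc[OF h(2)])
    then show "\<exists>t \<in> Hom C (Dom C \<pi>) (Dom C p). p \<cdot> t = \<pi>"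
      using h(1) t(1) by (intro bexI[of _ "h \<cdot> t"]) auto
  qed
  ultimately show ?thesis using that by blast
qed

end

section \<open>Counting homomorphisms and extensions\<close>

lemma card_eq_card_image_mult:
  assumes "finite A" "\<And>x. x \<in> A \<Longrightarrow> card {y \<in> A. f y = f x} = k"
  shows "card A = card (f ` A) * k"
proof -
  have "card A = (\<Sum>z \<in> f ` A. card {y \<in> A. f y = z})"
    using sum.image_gen[OF assms(1), of "\<lambda>_. 1 :: nat" f] by simp
  also have "\<dots> = (\<Sum>z \<in> f ` A. k)" using assms(2) by (intro sum.cong) auto
  finally show ?thesis by simp
qed

context linear_category
begin

lemma Plus_assoc:
  assumes "f \<in> Hom C A B" "g \<in> Hom C A B" "h \<in> Hom C A B"
  shows "Plus C (Plus C f g) h = Plus C f (Plus C g h)"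
proof -
  interpret V: vectorspace K "HomSpace C A B" using assms by (intro Hom_vectorspace) auto
  show ?thesis using V.a_assoc[of f g h] assms by (simp del: Hom_iff)
qed

lemma Plus_right_cancel:
  assumes "f \<in> Hom C A B" "g \<in> Hom C A B" "h \<in> Hom C A B"
  shows "Plus C f h = Plus C g h \<longleftrightarrow> f = g"
proof
  assume e: "Plus C f h = Plus C g h"
  have "f = Minus (Plus C f h) h" using Minus_Plus_cancel(1)[of f h] assms by simp
  also have "\<dots> = g" unfolding e using Minus_Plus_cancel(1)[of g h] assms by simp
  finally show "f = g" .
qed simp

lemma Plus_eq_Plus_iff:
  assumes "a \<in> Hom C A B" "b \<in> Hom C A B" "c \<in> Hom C A B" "d \<in> Hom C A B"
  shows "Plus C a b = Plus C c d \<longleftrightarrow> Minus a c = Minus d b"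
proof -
  have 1: "Plus C (Minus a c) (Plus C c b) = Plus C a b"
    using assms Plus_assoc[of "Minus a c" A B c b] Minus_Plus_cancel(2)[of a c] by simp
  have "Plus C c b = Plus C b c" by (rule Plus_comm) (use assms in auto)
  then have "Plus C (Minus d b) (Plus C c b) = Plus C (Minus d b) (Plus C b c)" by simp
  also have "\<dots> = Plus C d c"
    using assms Plus_assoc[of "Minus d b" A B b c] Minus_Plus_cancel(2)[of d b] by simp
  also have "\<dots> = Plus C c d" by (rule Plus_comm) (use assms in auto)
  finally have 2: "Plus C (Minus d b) (Plus C c b) = Plus C c d" .
  show ?thesis using Plus_right_cancel[of "Minus a c" A B "Minus d b" "Plus C c b"] assms 1 2 by simp
qed

lemma Minus_Minus_cancel:
  assumes "f \<in> Hom C A B" "g \<in> Hom C A B"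
  shows "Minus f (Minus f g) = g"
proof -
  have "f = Plus C g (Minus f g)" using Minus_Plus_cancel(3)[of f g] assms by simp
  then have "Minus f (Minus f g) = Minus (Plus C g (Minus f g)) (Minus f g)" by simp
  also have "\<dots> = g" using Minus_Plus_cancel(1)[of g "Minus f g"] assms by simp
  finally show ?thesis .
qed

lemma Plus_Plus_Minus:
  assumes "a \<in> Hom C A B" "b \<in> Hom C A B" "c \<in> Hom C A B"
  shows "Plus C (Plus C a c) (Minus b c) = Plus C a b"
  using assms Plus_assoc[of a A B c "Minus b c"] Minus_Plus_cancel(3)[of b c] by simp

end

context abelian_category
begin

text \<open>Two arrows on \<open>P\<close> with equal restriction to \<open>R\<close> differ by an
  arrow that factors uniquely through \<open>M\<close>, so every fibre of the restriction is a coset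
  of \<open>Hom C M N\<close>.\<close>

lemma card_restrict:
  assumes s: "sx C R P M \<iota> \<pi>" and N: "N \<in> Obj C" and fin: "finite (Hom C P N)"
  shows "card (Hom C P N) = card ((\<lambda>h. h \<cdot> \<iota>) ` Hom C P N) * card (Hom C M N)"
proof (rule card_eq_card_image_mult[OF fin])
  note D = sxD[OF s]
  fix h assume h: "h \<in> Hom C P N"
  have "bij_betw (\<lambda>g. Plus C h (g \<cdot> \<pi>)) (Hom C M N) {h' \<in> Hom C P N. h' \<cdot> \<iota> = h \<cdot> \<iota>}"
    unfolding bij_betw_def
  proof
    show "inj_on (\<lambda>g. Plus C h (g \<cdot> \<pi>)) (Hom C M N)"
    proof (rule inj_onI)
      fix g g' assume g: "g \<in> Hom C M N" "g' \<in> Hom C M N" "Plus C h (g \<cdot> \<pi>) = Plus C h (g' \<cdot> \<pi>)"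
      then have e: "g \<cdot> \<pi> = g' \<cdot> \<pi>" using Plus_left_cancel[of "g \<cdot> \<pi>" "g' \<cdot> \<pi>" h] h D(4-6) by simp
      show "g = g'" by (rule epi_cancel[OF D(12) e]) (use g D(6) in auto)
    qed
    show "(\<lambda>g. Plus C h (g \<cdot> \<pi>)) ` Hom C M N = {h' \<in> Hom C P N. h' \<cdot> \<iota> = h \<cdot> \<iota>}"
    proof (intro equalityI subsetI)
      fix x assume "x \<in> (\<lambda>g. Plus C h (g \<cdot> \<pi>)) ` Hom C M N"
      then obtain g where g: "g \<in> Hom C M N" "x = Plus C h (g \<cdot> \<pi>)" by blast
      then have "x \<cdot> \<iota> = Plus C (h \<cdot> \<iota>) (ZeroArr C R N)" using h D(1-10) N by simp
      then show "x \<in> {h' \<in> Hom C P N. h' \<cdot> \<iota> = h \<cdot> \<iota>}" using g h D(1-6) by simp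
    next
      fix x assume "x \<in> {h' \<in> Hom C P N. h' \<cdot> \<iota> = h \<cdot> \<iota>}"
      then have x: "x \<in> Hom C P N" "x \<cdot> \<iota> = h \<cdot> \<iota>" by blast+
      have m: "Minus x h \<in> Hom C P N" using x h by simp
      have "Minus x h \<cdot> \<iota> = ZeroArr C R N" using x h D(1-3) by (simp add: Minus_self)
      then obtain g where g: "g \<in> Hom C M N" "g \<cdot> \<pi> = Minus x h" by (rule sx_desc[OF s m])
      have "x = Plus C h (g \<cdot> \<pi>)" using g(2) x(1) h Minus_Plus_cancel(3)[of x h] by simp
      then show "x \<in> (\<lambda>g. Plus C h (g \<cdot> \<pi>)) ` Hom C M N" using g(1) by blast
    qed
  qed
  from bij_betw_same_card[OF this, symmetric]
  show "card {h' \<in> Hom C P N. h' \<cdot> \<iota> = h \<cdot> \<iota>} = card (Hom C M N)" .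
qed

text \<open>By \<open>pushc_eq_iff\<close> the fibres of the connecting map are cosets of the arrows
  that extend to \<open>P\<close>.\<close>

lemma card_pushc_fibre:
  assumes s: "sx C R P M \<iota> \<pi>" and f: "f \<in> Hom C R N"
  shows "card {g \<in> Hom C R N. pushc M N (\<iota>, \<pi>) g = pushc M N (\<iota>, \<pi>) f} = card ((\<lambda>h. h \<cdot> \<iota>) ` Hom C P N)"
proof -
  note D = sxD[OF s]
  let ?I = "(\<lambda>h. h \<cdot> \<iota>) ` Hom C P N"
  have I: "?I \<subseteq> Hom C R N" using D(1-3) by auto
  have "bij_betw (\<lambda>k. Minus f k) ?I {g \<in> Hom C R N. pushc M N (\<iota>, \<pi>) g = pushc M N (\<iota>, \<pi>) f}"
    unfolding bij_betw_def
  proof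
    show "inj_on (\<lambda>k. Minus f k) ?I"
      by (rule inj_on_inverseI[of _ "Minus f"]) (use I f Minus_Minus_cancel in blast)
    show "(\<lambda>k. Minus f k) ` ?I = {g \<in> Hom C R N. pushc M N (\<iota>, \<pi>) g = pushc M N (\<iota>, \<pi>) f}"
    proof (intro equalityI subsetI)
      fix g assume "g \<in> (\<lambda>k. Minus f k) ` ?I"
      then obtain h where h: "h \<in> Hom C P N" "g = Minus f (h \<cdot> \<iota>)" by blast
      then have g: "g \<in> Hom C R N" using f D(1-3) by simp
      have "Minus f g = h \<cdot> \<iota>" unfolding h(2) by (rule Minus_Minus_cancel[OF f]) (use h(1) D(1-3) in auto)
      then have "pushc M N (\<iota>, \<pi>) f = pushc M N (\<iota>, \<pi>) g" using pushc_eq_iff[OF s f g] h(1) by blast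
      then show "g \<in> {g \<in> Hom C R N. pushc M N (\<iota>, \<pi>) g = pushc M N (\<iota>, \<pi>) f}" using g by simp
    next
      fix g assume "g \<in> {g \<in> Hom C R N. pushc M N (\<iota>, \<pi>) g = pushc M N (\<iota>, \<pi>) f}"
      then have g: "g \<in> Hom C R N" "pushc M N (\<iota>, \<pi>) f = pushc M N (\<iota>, \<pi>) g" by blast+
      then obtain h where h: "h \<in> Hom C P N" "Minus f g = h \<cdot> \<iota>" using pushc_eq_iff[OF s f g(1)] by blast
      have "g = Minus f (h \<cdot> \<iota>)" unfolding h(2)[symmetric] by (rule Minus_Minus_cancel[OF f g(1), symmetric])
      then show "g \<in> (\<lambda>k. Minus f k) ` ?I" using h(1) by blast
    qed
  qed
  from bij_betw_same_card[OF this, symmetric] show ?thesis .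
qed

lemma pushc_surj:
  assumes s: "sx C R P M \<iota> \<pi>" and e: "effaces (\<iota>, \<pi>) M R N"
  shows "pushc M N (\<iota>, \<pi>) ` Hom C R N = Ext1 C M N"
proof (intro equalityI subsetI)
  fix x assume "x \<in> pushc M N (\<iota>, \<pi>) ` Hom C R N"
  then show "x \<in> Ext1 C M N" using pushc_Ext1[OF sx_ses[OF s]] by blast
next
  fix x assume "x \<in> Ext1 C M N"
  then obtain e where e': "e \<in> ses C M N" "x = ses_equiv C M N `` {e}"
    unfolding Ext1_def by (rule quotientE)
  then obtain f where f: "f \<in> Hom C R N" "e \<in> pushc M N (\<iota>, \<pi>) f" using e unfolding effaces_def by blast
  then have "x = pushc M N (\<iota>, \<pi>) f" using pushc_class[OF sx_ses[OF s] f] e'(2) by simp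
  then show "x \<in> pushc M N (\<iota>, \<pi>) ` Hom C R N" using f(1) by blast
qed

text \<open>The alternating count in the exact sequence of \<open>Hom C M N\<close>,
  \<open>Hom C P N\<close>, \<open>Hom C R N\<close>, \<open>Ext1 C M N\<close>. Effacement provides
  the surjectivity of the connecting map that projectivity of \<open>P\<close> would give.\<close>

lemma card_Hom_Ext1:
  assumes s: "sx C R P M \<iota> \<pi>" and e: "effaces (\<iota>, \<pi>) M R N" and N: "N \<in> Obj C"
    and fin: "finite (Hom C P N)" "finite (Hom C R N)"
  shows "card (Hom C R N) * card (Hom C M N) = card (Ext1 C M N) * card (Hom C P N)"
proof -
  have "card (Hom C R N) = card (pushc M N (\<iota>, \<pi>) ` Hom C R N) * card ((\<lambda>h. h \<cdot> \<iota>) ` Hom C P N)"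
    by (rule card_eq_card_image_mult[OF fin(2) card_pushc_fibre[OF s]])
  then show ?thesis using card_restrict[OF s N fin(1)] pushc_surj[OF s e] by simp
qed

end

text \<open>Unlike the vanishing of second Yoneda extensions, the condition \<open>lifting\<close> is visibly self-dual, so
  that every result of this locale can be dualised.\<close>

locale finitary_lifting_category = abelian_category K C
  for K :: "'k ring" and C :: "('o, 'm, 'k) lincat" (structure) +
  assumes fin_Hom: "M \<in> Obj C \<Longrightarrow> N \<in> Obj C \<Longrightarrow> finite (Hom C M N)"
    and fin_Ext1: "M \<in> Obj C \<Longrightarrow> N \<in> Obj C \<Longrightarrow> finite (Ext1 C M N)"
    and lifting: "is_kernel C a b \<Longrightarrow> is_cokernel C c b \<Longrightarrow>
      \<exists>H u w. sx C (Dom C b) H (Cod C c) u (c \<cdot> w) \<and> w \<in> Hom C H (Cod C b) \<and> w \<cdot> u = b"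

sublocale finitary_hereditary_category \<subseteq> finitary_lifting_category
proof
  fix M N assume "M \<in> Obj C" "N \<in> Obj C"
  then show "finite (Hom C M N)" "finite (Ext1 C M N)" by (rule finite_Hom, rule finite_Ext1)
next
  fix a b c assume "is_kernel C a b" "is_cokernel C c b"
  then show "\<exists>H u w. sx C (Dom C b) H (Cod C c) u (c \<cdot> w) \<and> w \<in> Hom C H (Cod C b) \<and> w \<cdot> u = b"
    by (rule hereditary_lift)
qed

section \<open>Multiplicativity of the Euler form\<close>

context finitary_lifting_category
begin

text \<open>Right exactness of the first extension functor. The composite
  \<open>i \<cdot> \<beta>\<close> has kernel \<open>\<alpha>\<close> and cokernel \<open>p\<close>,
  so \<open>lifting\<close> applies to it and the resulting \<open>H\<close> is the middle term of
  the lifted extension.\<close>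

lemma lift_ses:
  assumes s: "sx C N' N N'' \<alpha> \<beta>" and e'': "e'' \<in> ses C M N''"
  obtains e where "e \<in> ses C M N" "ses_map C e \<beta> (Idt C M) e''"
proof -
  obtain i p E where e: "e'' = (i, p)" and se: "sx C N'' E M i p" by (rule ses_obtain[OF e''])
  note D = sxD[OF s] and D' = sxD[OF se]
  have b: "i \<cdot> \<beta> \<in> Hom C N E" using D(4-6) D'(1-3) by simp
  have k: "is_kernel C \<alpha> (i \<cdot> \<beta>)"
  proof (rule kernelI[OF D(11)])
    show "(i \<cdot> \<beta>) \<cdot> \<alpha> = ZeroArr C (Dom C \<alpha>) (Cod C (i \<cdot> \<beta>))"
      using D(1-10) D'(1-3,8) by simp
    fix g assume g: "g \<in> Arr C" "Cod C g = Dom C (i \<cdot> \<beta>)"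
      "(i \<cdot> \<beta>) \<cdot> g = ZeroArr C (Dom C g) (Cod C (i \<cdot> \<beta>))"
    have gH: "g \<in> Hom C (Dom C g) N" using g(1,2) b by simp
    have "i \<cdot> (\<beta> \<cdot> g) = ZeroArr C (Dom C g) E" using g D(4-6) D'(1-3) by simp
    then have "\<beta> \<cdot> g = ZeroArr C (Dom C g) (Dom C i)"
      by (rule mono_Zero[OF D'(11)]) (use gH D(4-6) D'(1-3) in simp_all)
    then have "\<beta> \<cdot> g = ZeroArr C (Dom C g) N''" using D'(2) by simp
    then obtain u where "u \<in> Hom C (Dom C g) N'" "\<alpha> \<cdot> u = g" by (rule sx_lift[OF s gH])
    then show "\<exists>u\<in>Arr C. Dom C u = Dom C g \<and> Cod C u = Dom C \<alpha> \<and> \<alpha> \<cdot> u = g" using D(2) by auto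
  qed (use b D(1-3) in simp_all)
  have c: "is_cokernel C p (i \<cdot> \<beta>)"
  proof (rule cokernelI[OF D'(12)])
    show "p \<cdot> (i \<cdot> \<beta>) = ZeroArr C (Dom C (i \<cdot> \<beta>)) (Cod C p)"
      using D(4-6) D'(1-10) by (simp add: reassoc[OF D'(10)])
    fix g assume g: "g \<in> Arr C" "Dom C g = Cod C (i \<cdot> \<beta>)"
      "g \<cdot> (i \<cdot> \<beta>) = ZeroArr C (Dom C (i \<cdot> \<beta>)) (Cod C g)"
    have gH: "g \<in> Hom C E (Cod C g)" using g(1,2) b by simp
    have "(g \<cdot> i) \<cdot> \<beta> = ZeroArr C N (Cod C g)" using g D(4-6) D'(1-3) by simp
    then have "g \<cdot> i = ZeroArr C (Cod C \<beta>) (Cod C g)"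
      by (rule epi_Zero[OF D(12)]) (use gH D(4-6) D'(1-3) in simp_all)
    then have "g \<cdot> i = ZeroArr C N'' (Cod C g)" using D(6) by simp
    then obtain u where "u \<in> Hom C M (Cod C g)" "u \<cdot> p = g" by (rule sx_desc[OF se gH])
    then show "\<exists>u\<in>Arr C. Cod C u = Cod C g \<and> Dom C u = Cod C p \<and> u \<cdot> p = g" using D'(6) by auto
  qed (use b D'(4-6) in simp_all)
  obtain H u w where h: "sx C N H M u (p \<cdot> w)" "w \<in> Hom C H E" "w \<cdot> u = i \<cdot> \<beta>"
    using lifting[OF k c] b D'(6) by auto
  have "p \<cdot> w = Idt C M \<cdot> (p \<cdot> w)" using h(2) D'(4-6,9) by simp
  then have "ses_map C (u, p \<cdot> w) \<beta> (Idt C M) e''"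
    unfolding e ses_map_sx[OF h(1) se] using h(2,3) by blast
  then show ?thesis using that sx_ses[OF h(1)] by blast
qed

text \<open>Push the presentation out along \<open>f\<close> to an extension \<open>E\<close> of
  \<open>M\<close> by \<open>N\<close>. The hypothesis on \<open>f\<close> and \<open>h\<close>
  gives an arrow \<open>w\<close> from \<open>E\<close> to \<open>N''\<close>, and its kernel
  \<open>E'\<close> is an extension of \<open>M\<close> by \<open>N'\<close>. This extension is
  effaced, so \<open>\<pi>\<close> lifts to \<open>E'\<close>; the canonical arrow \<open>b\<close>
  minus this lift lands in \<open>N\<close> and is the desired \<open>h'\<close>.\<close>

lemma effaced_lift:
  assumes s: "sx C N' N N'' \<alpha> \<beta>" and sR: "sx C R P M \<iota> \<pi>" and eff: "effaces (\<iota>, \<pi>) M R N'"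
    and f: "f \<in> Hom C R N" and h: "h \<in> Hom C P N''" and fh: "\<beta> \<cdot> f = h \<cdot> \<iota>"
  obtains h' where "h' \<in> Hom C P N" "\<beta> \<cdot> h' = h"
proof -
  note D = sxD[OF s] and DR = sxD[OF sR]
  obtain E j p b where sE: "sx C N E M j p" and b: "b \<in> Hom C P E" "p \<cdot> b = \<pi>" "b \<cdot> \<iota> = j \<cdot> f"
    by (rule push_sx[OF sR f])
  note DE = sxD[OF sE]
  have \<beta>: "\<beta> \<in> Hom C N N''" using D(4-6) by simp
  obtain w where w: "w \<in> Hom C E N''" "w \<cdot> b = h" "w \<cdot> j = \<beta>"
    by (rule push_prop[OF sR sE b(1,3,2) f h \<beta> fh[symmetric]])
  obtain k where k: "is_kernel C k w" using kernel_exists w(1) by auto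
  have we: "is_epi C w" by (rule epi_of_Comp[where g = j]) (use w(1,3) D(12) DE(1-3) in simp_all)
  define E' where "E' = Dom C k"
  have sk: "sx C E' E N'' k w" using kernel_sx[OF k we] w(1) by (simp add: E'_def)
  note Dk = sxD[OF sk]
  have wja: "w \<cdot> (j \<cdot> \<alpha>) = ZeroArr C N' N''" using w(1) DE(1-3) D(1-3,10) by (simp add: reassoc[OF w(3)])
  have jaH: "j \<cdot> \<alpha> \<in> Hom C N' E" using DE(1-3) D(1-3) by simp
  obtain i' where i': "i' \<in> Hom C N' E'" "k \<cdot> i' = j \<cdot> \<alpha>" by (rule sx_lift[OF sk jaH wja])
  have s': "sx C N' E' M i' (p \<cdot> k)"
  proof (rule sxI)
    show "is_mono C i'"
    proof (rule mono_of_Comp[of k])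
      show "is_mono C (k \<cdot> i')" unfolding i'(2)
        by (rule mono_Comp[OF D(11) DE(11)]) (use DE(2) D(3) in simp)
    qed (use i'(1) Dk(1-3) in simp_all)
    show "is_epi C (p \<cdot> k)"
    proof (rule epiI)
      fix t assume t: "t \<in> Arr C" "Dom C t = Cod C (p \<cdot> k)"
        "t \<cdot> (p \<cdot> k) = ZeroArr C (Dom C (p \<cdot> k)) (Cod C t)"
      have tH: "t \<in> Hom C M (Cod C t)" using t(1,2) DE(4-6) Dk(1-3) by simp
      have tp: "t \<cdot> p \<in> Hom C E (Cod C t)" using tH DE(4-6) by simp
      have "(t \<cdot> p) \<cdot> k = ZeroArr C E' (Cod C t)" using t DE(4-6) Dk(1-3) by simp
      then obtain v where v: "v \<in> Hom C N'' (Cod C t)" "v \<cdot> w = t \<cdot> p" by (rule sx_desc[OF sk tp])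
      have "v \<cdot> \<beta> = (v \<cdot> w) \<cdot> j" using v(1) w(1,3) DE(1-3) by simp
      also have "\<dots> = (t \<cdot> p) \<cdot> j" by (simp only: v(2))
      also have "\<dots> = ZeroArr C N (Cod C t)" using tH DE(1-10) by simp
      finally have "v = ZeroArr C (Cod C \<beta>) (Cod C t)"
        by (rule epi_Zero[OF D(12)]) (use v(1) D(4-6) in simp_all)
      then have v0: "v = ZeroArr C N'' (Cod C t)" using D(6) by simp
      have "t \<cdot> p = ZeroArr C E (Cod C t)" unfolding v(2)[symmetric] v0 using w(1) tH t(1) by simp
      then have "t = ZeroArr C (Cod C p) (Cod C t)"
        by (rule epi_Zero[OF DE(12)]) (use tH DE(4-6) in simp_all)
      then show "t = ZeroArr C (Cod C (p \<cdot> k)) (Cod C t)" using DE(4-6) Dk(1-3) by simp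
    qed (use DE(4-6) Dk(1-3) in simp)
    show "(p \<cdot> k) \<cdot> i' = ZeroArr C N' M" using i' DE(1-10) Dk(1-3) D(1-3,7) by (simp add: reassoc[OF DE(10)])
    fix T g assume g: "g \<in> Hom C T E'" "(p \<cdot> k) \<cdot> g = ZeroArr C T M"
    have kg: "k \<cdot> g \<in> Hom C T E" using g(1) Dk(1-3) by simp
    have "p \<cdot> (k \<cdot> g) = ZeroArr C T M" using g DE(4-6) Dk(1-3) by simp
    then obtain y where y: "y \<in> Hom C T N" "j \<cdot> y = k \<cdot> g" by (rule sx_lift[OF sE kg])
    have "\<beta> \<cdot> y = w \<cdot> (j \<cdot> y)" using y(1) w(1) DE(1-3) by (simp add: reassoc[OF w(3)])
    also have "\<dots> = (w \<cdot> k) \<cdot> g" unfolding y(2) using g(1) w(1) Dk(1-3) by simp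
    also have "\<dots> = ZeroArr C T N''" using g(1) Dk(9,10) by simp
    finally obtain x where x: "x \<in> Hom C T N'" "\<alpha> \<cdot> x = y" by (rule sx_lift[OF s y(1)])
    have e: "k \<cdot> (i' \<cdot> x) = k \<cdot> g"
      using i'(1) x(1) Dk(1-3) DE(1-3) D(1-3) y(2) by (simp add: reassoc[OF i'(2)] x(2))
    have "i' \<cdot> x = g" by (rule mono_cancel[OF Dk(11) e]) (use i'(1) x(1) g(1) Dk(2) in simp_all)
    then show "\<exists>u\<in>Hom C T N'. i' \<cdot> u = g" using x(1) by blast
  qed (use i'(1) DE(4-6) Dk(1-3) in simp_all)
  obtain f' where f': "f' \<in> Hom C R N'" "(i', p \<cdot> k) \<in> pushc M N' (\<iota>, \<pi>) f'"
    using eff sx_ses[OF s'] unfolding effaces_def by blast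
  then have "ses_map C (\<iota>, \<pi>) f' (Idt C M) (i', p \<cdot> k)" by (simp add: pushc_def)
  then obtain t where t: "t \<in> Hom C P E'" "(p \<cdot> k) \<cdot> t = Idt C M \<cdot> \<pi>"
    unfolding ses_map_sx[OF sR s'] by blast
  have kt: "k \<cdot> t \<in> Hom C P E" using t(1) Dk(1-3) by simp
  have pkt: "p \<cdot> (k \<cdot> t) = \<pi>" using t DE(4-6) Dk(1-3) DR(4-6) by simp
  have m: "Minus b (k \<cdot> t) \<in> Hom C P E" using b(1) kt by simp
  have "p \<cdot> Minus b (k \<cdot> t) = ZeroArr C P M"
    using b(1,2) kt pkt DE(4-6) DR(4-6) by (simp add: Minus_self)
  then obtain h' where h': "h' \<in> Hom C P N" "j \<cdot> h' = Minus b (k \<cdot> t)" by (rule sx_lift[OF sE m])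
  have "\<beta> \<cdot> h' = w \<cdot> (j \<cdot> h')" using h'(1) w(1) DE(1-3) by (simp add: reassoc[OF w(3)])
  also have "\<dots> = Minus h (ZeroArr C P N'')"
    unfolding h'(2) using w(1,2) b(1) kt t(1) Dk(1-3,9) by (simp add: reassoc[OF Dk(10)])
  also have "\<dots> = h" using Minus_Plus_cancel(1)[of h "ZeroArr C P N''"] h DR(8) D(9) by simp
  finally show ?thesis using that h'(1) by blast
qed

text \<open>The total complex of the square of Hom-sets is exact: it runs from
  \<open>Hom C P N'\<close> through the products of \<open>Hom C P N\<close> with
  \<open>Hom C R N'\<close> and of \<open>Hom C R N\<close> with \<open>Hom C P N''\<close> to
  \<open>Hom C R N''\<close>. The identity is its alternating count.\<close>

lemma card_Hom_exact:
  assumes s: "sx C N' N N'' \<alpha> \<beta>" and sR: "sx C R P M \<iota> \<pi>"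
    and eff: "effaces (\<iota>, \<pi>) M R N'" "effaces (\<iota>, \<pi>) M R N"
  shows "card (Hom C R N) * card (Hom C P N'') * card (Hom C P N') =
    card (Hom C P N) * card (Hom C R N') * card (Hom C R N'')"
proof -
  note D = sxD[OF s] and DR = sxD[OF sR]
  \<comment> \<open>Up to the sign of \<open>h\<close>, the set \<open>Z\<close> is the kernel of
    \<open>m1\<close>. It turns out to be the image of \<open>m2\<close>.\<close>
  define Z where "Z = {(f, h). f \<in> Hom C R N \<and> h \<in> Hom C P N'' \<and> \<beta> \<cdot> f = h \<cdot> \<iota>}"
  define m1 where "m1 = (\<lambda>(f, h). Plus C (\<beta> \<cdot> f) (h \<cdot> \<iota>))"
  define m2 where "m2 = (\<lambda>(h, f). (Plus C (h \<cdot> \<iota>) (\<alpha> \<cdot> f), \<beta> \<cdot> h))"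
  have H: "f \<in> Hom C R N \<Longrightarrow> \<beta> \<cdot> f \<in> Hom C R N''" "h \<in> Hom C P N'' \<Longrightarrow> h \<cdot> \<iota> \<in> Hom C R N''"
    "h' \<in> Hom C P N \<Longrightarrow> h' \<cdot> \<iota> \<in> Hom C R N" "f' \<in> Hom C R N' \<Longrightarrow> \<alpha> \<cdot> f' \<in> Hom C R N"
    "h' \<in> Hom C P N \<Longrightarrow> \<beta> \<cdot> h' \<in> Hom C P N''" "h'' \<in> Hom C P N' \<Longrightarrow> \<alpha> \<cdot> h'' \<in> Hom C P N"
    "h'' \<in> Hom C P N' \<Longrightarrow> h'' \<cdot> \<iota> \<in> Hom C R N'" for f h h' f' h''
    using D(1-6) DR(1-3) by auto
  have PM: "a \<in> Hom C A B \<Longrightarrow> b \<in> Hom C A B \<Longrightarrow> Plus C a b \<in> Hom C A B"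
    "a \<in> Hom C A B \<Longrightarrow> b \<in> Hom C A B \<Longrightarrow> Minus a b \<in> Hom C A B" for a b A B
    by auto
  have "card (Hom C R N \<times> Hom C P N'') = card (m1 ` (Hom C R N \<times> Hom C P N'')) * card Z"
  proof (rule card_eq_card_image_mult)
    fix x assume "x \<in> Hom C R N \<times> Hom C P N''"
    then obtain f h where x: "x = (f, h)" and f: "f \<in> Hom C R N" and h: "h \<in> Hom C P N''" by blast
    have key: "m1 (f', h') = m1 (f, h) \<longleftrightarrow> \<beta> \<cdot> Minus f' f = Minus h h' \<cdot> \<iota>"
      if "f' \<in> Hom C R N" "h' \<in> Hom C P N''" for f' h'
    proof -
      have "m1 (f', h') = m1 (f, h) \<longleftrightarrow> Minus (\<beta> \<cdot> f') (\<beta> \<cdot> f) = Minus (h \<cdot> \<iota>) (h' \<cdot> \<iota>)"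
        unfolding m1_def prod.case by (rule Plus_eq_Plus_iff) (use H f h that in blast)+
      also have "\<dots> \<longleftrightarrow> \<beta> \<cdot> Minus f' f = Minus h h' \<cdot> \<iota>" using that f h D(4-6) DR(1-3) by simp
      finally show ?thesis .
    qed
    have "bij_betw (\<lambda>(f', h'). (Minus f' f, Minus h h')) {y \<in> Hom C R N \<times> Hom C P N''. m1 y = m1 x} Z"
    proof (rule bij_betwI[where g = "\<lambda>(f', h'). (Plus C f' f, Minus h h')"])
      show "(\<lambda>(f', h'). (Minus f' f, Minus h h')) \<in> {y \<in> Hom C R N \<times> Hom C P N''. m1 y = m1 x} \<rightarrow> Z"
        unfolding Z_def x using key f h PM by (auto simp del: Hom_iff)
      show "(\<lambda>(f', h'). (Plus C f' f, Minus h h')) \<in> Z \<rightarrow> {y \<in> Hom C R N \<times> Hom C P N''. m1 y = m1 x}"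
      proof
        fix z assume "z \<in> Z"
        then obtain f' h' where z: "z = (f', h')" "f' \<in> Hom C R N" "h' \<in> Hom C P N''" "\<beta> \<cdot> f' = h' \<cdot> \<iota>"
          unfolding Z_def by blast
        have "Minus (Plus C f' f) f = f'" using Minus_Plus_cancel(1)[of f' f] z(2) f by simp
        moreover have "Minus h (Minus h h') = h'" by (rule Minus_Minus_cancel[OF h z(3)])
        ultimately have "m1 (Plus C f' f, Minus h h') = m1 (f, h)"
          using key[OF PM(1)[OF z(2) f] PM(2)[OF h z(3)]] z(4) by simp
        then show "(case z of (f', h') \<Rightarrow> (Plus C f' f, Minus h h')) \<in> {y \<in> Hom C R N \<times> Hom C P N''. m1 y = m1 x}"
          using PM(1)[OF z(2) f] PM(2)[OF h z(3)] unfolding z(1) x by simp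
      qed
      fix y assume "y \<in> {y \<in> Hom C R N \<times> Hom C P N''. m1 y = m1 x}"
      then obtain f' h' where y: "y = (f', h')" "f' \<in> Hom C R N" "h' \<in> Hom C P N''" by blast
      show "(\<lambda>(f', h'). (Plus C f' f, Minus h h')) ((\<lambda>(f', h'). (Minus f' f, Minus h h')) y) = y"
        using Minus_Plus_cancel(2)[of f' f] Minus_Minus_cancel[OF h y(3)] y f by simp
    next
      fix z assume "z \<in> Z"
      then obtain f' h' where z: "z = (f', h')" "f' \<in> Hom C R N" "h' \<in> Hom C P N''"
        unfolding Z_def by blast
      show "(\<lambda>(f', h'). (Minus f' f, Minus h h')) ((\<lambda>(f', h'). (Plus C f' f, Minus h h')) z) = z"
        using Minus_Plus_cancel(1)[of f' f] Minus_Minus_cancel[OF h z(3)] z f by simp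
    qed
    then show "card {y \<in> Hom C R N \<times> Hom C P N''. m1 y = m1 x} = card Z" by (rule bij_betw_same_card)
  qed (use fin_Hom D(8,9) DR(7,8) in auto)
  \<comment> \<open>Surjectivity rests on \<open>lift_ses\<close>: the class defined by
    \<open>g\<close> lifts to an extension of \<open>M\<close> by \<open>N\<close>, and the latter
    is effaced.\<close>
  moreover have "m1 ` (Hom C R N \<times> Hom C P N'') = Hom C R N''"
  proof (intro equalityI subsetI)
    fix g assume g: "g \<in> Hom C R N''"
    obtain e'' where e'': "e'' \<in> pushc M N'' (\<iota>, \<pi>) g" by (rule pushc_nonempty[OF sx_ses[OF sR] g])
    have \<beta>: "\<beta> \<in> Hom C N N''" and I: "Idt C M \<in> Hom C M M" using D(4-6) DR(9) by simp_all
    obtain e where e: "e \<in> ses C M N" "ses_map C e \<beta> (Idt C M) e''"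
      using lift_ses[OF s, of e'' M] e'' by (auto simp: pushc_def)
    obtain f where f: "f \<in> Hom C R N" "e \<in> pushc M N (\<iota>, \<pi>) f"
      using eff(2) e(1) unfolding effaces_def by blast
    have "ses_map C (\<iota>, \<pi>) (\<beta> \<cdot> f) (Idt C M \<cdot> Idt C M) e''"
      by (rule ses_map_trans[OF sx_ses[OF sR] e(1) _ f(1) \<beta> I I _ e(2)]) (use f(2) e'' in \<open>auto simp: pushc_def\<close>)
    then have "e'' \<in> pushc M N'' (\<iota>, \<pi>) (\<beta> \<cdot> f)" using e'' DR(9) by (simp add: pushc_def)
    then obtain h where h: "h \<in> Hom C P N''" "Minus g (\<beta> \<cdot> f) = h \<cdot> \<iota>"
      using pushc_mem_iff[OF sR g H(1)[OF f(1)] e''] by blast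
    have "m1 (f, h) = g"
      using Minus_Plus_cancel(3)[of g "\<beta> \<cdot> f"] g H(1)[OF f(1)] h(2) by (simp add: m1_def)
    then show "g \<in> m1 ` (Hom C R N \<times> Hom C P N'')" using f(1) h(1) by blast
  qed (use H PM in \<open>auto simp: m1_def simp del: Hom_iff\<close>)
  moreover have "card (Hom C P N \<times> Hom C R N') = card (m2 ` (Hom C P N \<times> Hom C R N')) * card (Hom C P N')"
  proof (rule card_eq_card_image_mult)
    fix x assume "x \<in> Hom C P N \<times> Hom C R N'"
    then obtain h f where x: "x = (h, f)" and h: "h \<in> Hom C P N" and f: "f \<in> Hom C R N'" by blast
    define b where "b = (\<lambda>k. (Plus C h (\<alpha> \<cdot> k), Minus f (k \<cdot> \<iota>)))"
    have "bij_betw b (Hom C P N') {y \<in> Hom C P N \<times> Hom C R N'. m2 y = m2 x}"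
      unfolding bij_betw_def
    proof
      show "inj_on b (Hom C P N')"
      proof (rule inj_onI)
        fix k k' assume k: "k \<in> Hom C P N'" "k' \<in> Hom C P N'" "b k = b k'"
        then have e: "\<alpha> \<cdot> k = \<alpha> \<cdot> k'"
          using Plus_left_cancel[of "\<alpha> \<cdot> k" "\<alpha> \<cdot> k'" h] h D(1-3) by (simp add: b_def)
        show "k = k'" by (rule mono_cancel[OF D(11) e]) (use k D(2) in auto)
      qed
      show "b ` Hom C P N' = {y \<in> Hom C P N \<times> Hom C R N'. m2 y = m2 x}"
      proof (intro equalityI subsetI)
        fix y assume "y \<in> b ` Hom C P N'"
        then obtain k where k: "k \<in> Hom C P N'" "y = b k" by blast
        have "\<beta> \<cdot> Plus C h (\<alpha> \<cdot> k) = \<beta> \<cdot> h"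
          using k(1) h D(1-6,9) by (simp add: reassoc[OF D(10)])
        moreover have "Plus C (Plus C h (\<alpha> \<cdot> k) \<cdot> \<iota>) (\<alpha> \<cdot> Minus f (k \<cdot> \<iota>)) = Plus C (h \<cdot> \<iota>) (\<alpha> \<cdot> f)"
          using Plus_Plus_Minus[of "h \<cdot> \<iota>" R N "\<alpha> \<cdot> f" "\<alpha> \<cdot> (k \<cdot> \<iota>)"] k(1) h f D(1-3) DR(1-3) by simp
        ultimately have "m2 y = m2 x" unfolding k(2) x b_def m2_def by simp
        moreover have "y \<in> Hom C P N \<times> Hom C R N'"
          unfolding k(2) b_def using PM(1)[OF h H(6)[OF k(1)]] PM(2)[OF f H(7)[OF k(1)]] by blast
        ultimately show "y \<in> {y \<in> Hom C P N \<times> Hom C R N'. m2 y = m2 x}" by blast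
      next
        fix y assume "y \<in> {y \<in> Hom C P N \<times> Hom C R N'. m2 y = m2 x}"
        then obtain h1 f1 where y: "y = (h1, f1)" "h1 \<in> Hom C P N" "f1 \<in> Hom C R N'"
          and e: "Plus C (h1 \<cdot> \<iota>) (\<alpha> \<cdot> f1) = Plus C (h \<cdot> \<iota>) (\<alpha> \<cdot> f)" "\<beta> \<cdot> h1 = \<beta> \<cdot> h"
          unfolding x m2_def by auto
        have "\<beta> \<cdot> Minus h1 h = ZeroArr C P N''" using e(2) y(2) h D(4-6) by (simp add: Minus_self)
        then obtain k where k: "k \<in> Hom C P N'" "\<alpha> \<cdot> k = Minus h1 h"
          by (rule sx_lift[OF s PM(2)[OF y(2) h]])
        have 1: "Plus C h (\<alpha> \<cdot> k) = h1" using k(2) Minus_Plus_cancel(3)[of h1 h] y(2) h by simp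
        have "Plus C (Plus C (h \<cdot> \<iota>) (\<alpha> \<cdot> (k \<cdot> \<iota>))) (\<alpha> \<cdot> f1) = Plus C (h1 \<cdot> \<iota>) (\<alpha> \<cdot> f1)"
          unfolding 1[symmetric] using h k(1) D(1-3) DR(1-3) by simp
        also have "\<dots> = Plus C (h \<cdot> \<iota>) (\<alpha> \<cdot> f)" by (rule e(1))
        finally have "Plus C (h \<cdot> \<iota>) (Plus C (\<alpha> \<cdot> (k \<cdot> \<iota>)) (\<alpha> \<cdot> f1)) = Plus C (h \<cdot> \<iota>) (\<alpha> \<cdot> f)"
          using Plus_assoc[of "h \<cdot> \<iota>" R N "\<alpha> \<cdot> (k \<cdot> \<iota>)" "\<alpha> \<cdot> f1"] h k(1) y(3) D(1-3) DR(1-3) by simp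
        then have "Plus C (\<alpha> \<cdot> (k \<cdot> \<iota>)) (\<alpha> \<cdot> f1) = \<alpha> \<cdot> f"
          using Plus_left_cancel[of "Plus C (\<alpha> \<cdot> (k \<cdot> \<iota>)) (\<alpha> \<cdot> f1)" "\<alpha> \<cdot> f" "h \<cdot> \<iota>"]
            h k(1) y(3) f D(1-3) DR(1-3) by simp
        then have a: "\<alpha> \<cdot> Plus C (k \<cdot> \<iota>) f1 = \<alpha> \<cdot> f" using k(1) y(3) D(1-3) DR(1-3) by simp
        have "Plus C (k \<cdot> \<iota>) f1 = f"
          by (rule mono_cancel[OF D(11) a]) (use k(1) y(3) f D(2) DR(1-3) in auto)
        then have "Minus f (k \<cdot> \<iota>) = f1"
          using Minus_Plus_cancel(4)[of f1 "k \<cdot> \<iota>"] k(1) y(3) DR(1-3) by auto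
        then have "y = b k" unfolding y(1) b_def using 1 by simp
        then show "y \<in> b ` Hom C P N'" using k(1) by blast
      qed
    qed
    from bij_betw_same_card[OF this, symmetric]
    show "card {y \<in> Hom C P N \<times> Hom C R N'. m2 y = m2 x} = card (Hom C P N')" .
  qed (use fin_Hom D(7,8) DR(7,8) in auto)
  \<comment> \<open>Exactness at \<open>Z\<close> is the lifting statement
    \<open>effaced_lift\<close>, which needs the extensions of \<open>M\<close> by \<open>N'\<close>
    to be effaced.\<close>
  moreover have "m2 ` (Hom C P N \<times> Hom C R N') = Z"
  proof (intro equalityI subsetI)
    fix z assume "z \<in> m2 ` (Hom C P N \<times> Hom C R N')"
    then obtain h f where z: "z = m2 (h, f)" "h \<in> Hom C P N" "f \<in> Hom C R N'" by blast
    have "\<beta> \<cdot> Plus C (h \<cdot> \<iota>) (\<alpha> \<cdot> f) = (\<beta> \<cdot> h) \<cdot> \<iota>"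
      using z(2,3) D(1-6,9) DR(1-3) by (simp add: reassoc[OF D(10)])
    moreover have "Plus C (h \<cdot> \<iota>) (\<alpha> \<cdot> f) \<in> Hom C R N"
      by (rule PM(1)[OF H(3)[OF z(2)] H(4)[OF z(3)]])
    ultimately show "z \<in> Z" unfolding z(1) using H(5)[OF z(2)] by (simp add: m2_def Z_def del: Hom_iff)
  next
    fix z assume "z \<in> Z"
    then obtain f h where z: "z = (f, h)" "f \<in> Hom C R N" "h \<in> Hom C P N''" "\<beta> \<cdot> f = h \<cdot> \<iota>"
      unfolding Z_def by blast
    obtain h' where h': "h' \<in> Hom C P N" "\<beta> \<cdot> h' = h" by (rule effaced_lift[OF s sR eff(1) z(2-4)])
    have "\<beta> \<cdot> Minus f (h' \<cdot> \<iota>) = ZeroArr C R N''"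
      using z(2,4) h'(1) D(4-6) DR(1-3) z(3) by (simp add: reassoc[OF h'(2)] Minus_self)
    then obtain f' where f': "f' \<in> Hom C R N'" "\<alpha> \<cdot> f' = Minus f (h' \<cdot> \<iota>)"
      by (rule sx_lift[OF s PM(2)[OF z(2) H(3)[OF h'(1)]]])
    have "m2 (h', f') = z" unfolding z(1) m2_def using h'(2) f'(2) z(2) H(3)[OF h'(1)]
      Minus_Plus_cancel(3)[of f "h' \<cdot> \<iota>"] by simp
    then show "z \<in> m2 ` (Hom C P N \<times> Hom C R N')" using h'(1) f'(1) by blast
  qed
  ultimately have 1: "card (Hom C R N) * card (Hom C P N'') = card (Hom C R N'') * card Z"
    and 2: "card (Hom C P N) * card (Hom C R N') = card Z * card (Hom C P N')"
    by (simp_all add: card_cartesian_product del: Hom_iff)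
  have "card (Hom C R N) * card (Hom C P N'') * card (Hom C P N') =
    card (Hom C R N'') * (card Z * card (Hom C P N'))" using 1 by (simp add: mult.assoc)
  also have "\<dots> = card (Hom C P N) * card (Hom C R N') * card (Hom C R N'')"
    unfolding 2[symmetric] by simp
  finally show ?thesis .
qed

definition euler :: "'o \<Rightarrow> 'o \<Rightarrow> real" where
  "euler M N = real (card (Hom C M N)) / real (card (Ext1 C M N))"

lemma card_Hom_pos: "M \<in> Obj C \<Longrightarrow> N \<in> Obj C \<Longrightarrow> card (Hom C M N) > 0"
proof -
  assume a: "M \<in> Obj C" "N \<in> Obj C"
  then have "ZeroArr C M N \<in> Hom C M N" by simp
  then show ?thesis using fin_Hom[OF a] by (auto simp: card_gt_0_iff simp del: Hom_iff)
qed

lemma card_Ext1_pos: "M \<in> Obj C \<Longrightarrow> N \<in> Obj C \<Longrightarrow> card (Ext1 C M N) > 0"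
proof -
  assume a: "M \<in> Obj C" "N \<in> Obj C"
  obtain S i1 i2 p1 p2 where S: "S \<in> Obj C" "i1 \<in> Hom C N S" "i2 \<in> Hom C M S" "p1 \<in> Hom C S N"
    "p2 \<in> Hom C S M" and e: "p1 \<cdot> i1 = Idt C N" "p2 \<cdot> i2 = Idt C M" "p1 \<cdot> i2 = ZeroArr C M N"
    "p2 \<cdot> i1 = ZeroArr C N M" "Plus C (i1 \<cdot> p1) (i2 \<cdot> p2) = Idt C S"
    by (rule biprodE[OF a(2,1)])
  have "(i1, p2) \<in> ses C M N" by (rule sx_ses[OF biprod_sx[OF S(2-5) e(1,2,4,5)]])
  then have "ses_equiv C M N `` {(i1, p2)} \<in> Ext1 C M N" unfolding Ext1_def by (rule quotientI)
  then show ?thesis using fin_Ext1[OF a] by (auto simp: card_gt_0_iff)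
qed

lemma euler_pos: "M \<in> Obj C \<Longrightarrow> N \<in> Obj C \<Longrightarrow> euler M N > 0"
  by (simp add: euler_def card_Hom_pos card_Ext1_pos del: Hom_iff)

text \<open>With one presentation that effaces all three coefficient objects,
  \<open>euler M B\<close> is the ratio of \<open>card (Hom C P B)\<close> to
  \<open>card (Hom C R B)\<close>, as for a projective resolution; \<open>card_Hom_exact\<close>
  compares these ratios.\<close>

lemma euler_mult_right:
  assumes s: "sx C N' N N'' \<alpha> \<beta>" and M: "M \<in> Obj C"
  shows "euler M N = euler M N' * euler M N''"
proof -
  note D = sxD[OF s]
  obtain R P \<iota> \<pi> where sR: "sx C R P M \<iota> \<pi>" and eff: "\<And>B. B \<in> {N', N, N''} \<Longrightarrow> effaces (\<iota>, \<pi>) M R B"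
    by (rule effacing_exists[OF M, of "{N', N, N''}"]) (use fin_Ext1 M D(7-9) in auto)
  note DR = sxD[OF sR]
  have e: "euler M B = real (card (Hom C P B)) / real (card (Hom C R B))" if B: "B \<in> {N', N, N''}" for B
  proof -
    have O: "B \<in> Obj C" using B D(7-9) by auto
    have "card (Hom C R B) * card (Hom C M B) = card (Ext1 C M B) * card (Hom C P B)"
      by (rule card_Hom_Ext1[OF sR eff[OF B] O fin_Hom[OF DR(8) O] fin_Hom[OF DR(7) O]])
    then have "real (card (Hom C R B)) * real (card (Hom C M B)) =
      real (card (Ext1 C M B)) * real (card (Hom C P B))" by (metis of_nat_mult)
    then show ?thesis unfolding euler_def
      using card_Hom_pos[OF DR(7) O] card_Ext1_pos[OF M O] by (simp add: field_simps del: Hom_iff)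
  qed
  have "card (Hom C R N) * card (Hom C P N'') * card (Hom C P N') =
    card (Hom C P N) * card (Hom C R N') * card (Hom C R N'')"
    by (rule card_Hom_exact[OF s sR]) (use eff in auto)
  then have "real (card (Hom C R N)) * real (card (Hom C P N'')) * real (card (Hom C P N')) =
    real (card (Hom C P N)) * real (card (Hom C R N')) * real (card (Hom C R N''))"
    by (metis of_nat_mult)
  then show ?thesis using e card_Hom_pos[OF DR(7) D(7)] card_Hom_pos[OF DR(7) D(8)] card_Hom_pos[OF DR(7) D(9)]
    by (simp add: field_simps del: Hom_iff)
qed

lemma Ext1_op: "Ext1 (op_cat C) N M = (`) prod.swap ` Ext1 C M N"
proof -
  have sw: "ses (op_cat C) N M = prod.swap ` ses C M N" by (auto simp: image_iff) (metis swap_simp ses_op)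
  interpret op: abelian_category K "op_cat C" by (rule abelian_category_op)
  have eq: "ses_equiv (op_cat C) N M `` {prod.swap e} = prod.swap ` (ses_equiv C M N `` {e})"
    if e: "e \<in> ses C M N" for e
  proof -
    have "(prod.swap e, prod.swap e') \<in> ses_equiv (op_cat C) N M \<longleftrightarrow> (e', e) \<in> ses_equiv C M N"
      if e': "e' \<in> ses C M N" for e'
      unfolding op.ses_equiv_iff ses_equiv_iff using ses_swap[OF e' e] ses_swap(2)[OF e e] e e' by simp
    then have *: "(prod.swap e, prod.swap e') \<in> ses_equiv (op_cat C) N M \<longleftrightarrow> (e, e') \<in> ses_equiv C M N"
      if e': "e' \<in> ses C M N" for e'
      using e' ses_equiv_sym by blast
    show ?thesis
    proof (intro equalityI subsetI)
      fix y assume "y \<in> ses_equiv (op_cat C) N M `` {prod.swap e}"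
      then have y: "(prod.swap e, y) \<in> ses_equiv (op_cat C) N M" by blast
      then have "y \<in> ses (op_cat C) N M" using op.ses_equiv_iff by blast
      then obtain e' where "e' \<in> ses C M N" "y = prod.swap e'" using sw by blast
      then show "y \<in> prod.swap ` (ses_equiv C M N `` {e})" using * y by blast
    next
      fix y assume "y \<in> prod.swap ` (ses_equiv C M N `` {e})"
      then obtain e' where e': "(e, e') \<in> ses_equiv C M N" "y = prod.swap e'" by blast
      then have "e' \<in> ses C M N" using ses_equiv_iff by blast
      then show "y \<in> ses_equiv (op_cat C) N M `` {prod.swap e}" using * e' by blast
    qed
  qed
  have q: "S // r = (\<lambda>x. r `` {x}) ` S" for S and r :: "(('m \<times> 'm) \<times> ('m \<times> 'm)) set"
    by (auto simp: quotient_def)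
  show ?thesis unfolding Ext1_def q sw image_image by (intro image_cong refl eq)
qed

text \<open>\<open>lift_form\<close> reads the same object \<open>H\<close> as an extension of the
  codomain of \<open>b\<close> by its kernel, which is the lifting property in the opposite
  category.\<close>

lemma finitary_lifting_category_op: "finitary_lifting_category K (op_cat C)"
proof -
  interpret op: abelian_category K "op_cat C" by (rule abelian_category_op)
  show ?thesis
  proof
    fix M N assume "M \<in> Obj (op_cat C)" "N \<in> Obj (op_cat C)"
    then show "finite (Hom (op_cat C) M N)" "finite (Ext1 (op_cat C) M N)"
      using fin_Hom fin_Ext1 by (simp_all add: Ext1_op del: Hom_iff)
  next
    fix a b c assume "is_kernel (op_cat C) a b" "is_cokernel (op_cat C) c b"
    then have k: "is_kernel C c b" and c: "is_cokernel C a b" by simp_all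
    note kD = kernelD[OF k] and cD = cokernelD[OF c]
    obtain H u w where h: "sx C (Dom C b) H (Cod C a) u (a \<cdot> w)" "w \<in> Hom C H (Cod C b)" "w \<cdot> u = b"
      using lifting[OF k c] by blast
    have "sx C (Dom C c) H (Cod C b) (u \<cdot> c) w"
      by (rule lift_form[OF k c _ _ _ h]) (use kD(1-3) cD(1,3) in auto)
    moreover have "u \<in> Hom C (Dom C b) H" using sxD(1-3)[OF h(1)] by simp
    ultimately show "\<exists>H u w. sx (op_cat C) (Dom (op_cat C) b) H (Cod (op_cat C) c) u (c \<cdot>\<^bsub>op_cat C\<^esub> w) \<and>
        w \<in> Hom (op_cat C) H (Cod (op_cat C) b) \<and> w \<cdot>\<^bsub>op_cat C\<^esub> u = b"
      using h(3) by (auto simp del: Hom_iff)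
  qed
qed

text \<open>In the opposite category \<open>euler\<close> has its arguments exchanged, so this is
  the dual of \<open>euler_mult_right\<close>.\<close>

lemma euler_mult_left:
  assumes s: "sx C M' M M'' \<alpha> \<beta>" and N: "N \<in> Obj C"
  shows "euler M N = euler M' N * euler M'' N"
proof -
  interpret op: finitary_lifting_category K "op_cat C" by (rule finitary_lifting_category_op)
  have inj: "inj_on ((`) prod.swap) S" for S :: "('m \<times> 'm) set set"
    by (rule inj_onI) (simp add: inj_image_eq_iff[OF inj_swap])
  have e: "op.euler B A = euler A B" for A B
    unfolding op.euler_def euler_def Hom_op Ext1_op card_image[OF inj] ..
  have "op.euler N M = op.euler N M'' * op.euler N M'"
    by (rule op.euler_mult_right[of M'' M M' \<beta> \<alpha> N]) (simp_all only: sx_op op_cat_sel s N)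
  then show ?thesis unfolding e by simp
qed

end

section \<open>The extension space as a vector space\<close>

text \<open>Each axiom of \<open>W\<close> is the image of the same axiom in \<open>V\<close>. This
  allows the Baer sum to inherit its laws from addition of arrows instead of verifying them on
  extensions.\<close>

lemma vectorspace_image:
  assumes V: "vectorspace K V" and \<phi>: "\<phi> ` carrier V = carrier W"
    and add: "\<And>x y. x \<in> carrier V \<Longrightarrow> y \<in> carrier V \<Longrightarrow> \<phi> (x \<oplus>\<^bsub>V\<^esub> y) = \<phi> x \<oplus>\<^bsub>W\<^esub> \<phi> y"
    and zero: "\<phi> \<zero>\<^bsub>V\<^esub> = \<zero>\<^bsub>W\<^esub>"
    and smult: "\<And>c x. c \<in> carrier K \<Longrightarrow> x \<in> carrier V \<Longrightarrow> \<phi> (c \<odot>\<^bsub>V\<^esub> x) = c \<odot>\<^bsub>W\<^esub> \<phi> x"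
  shows "vectorspace K W"
proof -
  interpret V: vectorspace K V by (rule V)
  have cl: "\<phi> x \<in> carrier W" if "x \<in> carrier V" for x using that \<phi> by blast
  have ob: "\<exists>x \<in> carrier V. w = \<phi> x" if "w \<in> carrier W" for w using that \<phi> by blast
  have "abelian_group W"
  proof (rule abelian_groupI)
    fix x y assume "x \<in> carrier W" "y \<in> carrier W"
    then obtain a b where [simp]: "a \<in> carrier V" "b \<in> carrier V" "x = \<phi> a" "y = \<phi> b"
      using ob by blast
    show "x \<oplus>\<^bsub>W\<^esub> y \<in> carrier W" by (simp add: cl flip: add)
    show "x \<oplus>\<^bsub>W\<^esub> y = y \<oplus>\<^bsub>W\<^esub> x" by (simp add: V.a_comm flip: add)
    fix z assume "z \<in> carrier W"
    then obtain c where [simp]: "c \<in> carrier V" "z = \<phi> c" using ob by blast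
    show "x \<oplus>\<^bsub>W\<^esub> y \<oplus>\<^bsub>W\<^esub> z = x \<oplus>\<^bsub>W\<^esub> (y \<oplus>\<^bsub>W\<^esub> z)" by (simp add: V.a_assoc flip: add)
  next
    show "\<zero>\<^bsub>W\<^esub> \<in> carrier W" unfolding zero[symmetric] by (rule cl) simp
  next
    fix x assume "x \<in> carrier W"
    then obtain a where [simp]: "a \<in> carrier V" "x = \<phi> a" using ob by blast
    show "\<zero>\<^bsub>W\<^esub> \<oplus>\<^bsub>W\<^esub> x = x" by (simp flip: add zero)
    have "\<phi> (\<ominus>\<^bsub>V\<^esub> a) \<oplus>\<^bsub>W\<^esub> x = \<zero>\<^bsub>W\<^esub>" by (simp add: V.l_neg flip: add zero)
    then show "\<exists>y\<in>carrier W. y \<oplus>\<^bsub>W\<^esub> x = \<zero>\<^bsub>W\<^esub>" using cl[of "\<ominus>\<^bsub>V\<^esub> a"] by auto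
  qed
  moreover have "module_axioms K W"
  proof
    fix a x assume a: "a \<in> carrier K" and "x \<in> carrier W"
    then obtain x' where [simp]: "x' \<in> carrier V" "x = \<phi> x'" using ob by blast
    show "a \<odot>\<^bsub>W\<^esub> x \<in> carrier W" using a by (simp add: cl flip: smult)
    fix b assume b: "b \<in> carrier K"
    show "(a \<oplus>\<^bsub>K\<^esub> b) \<odot>\<^bsub>W\<^esub> x = a \<odot>\<^bsub>W\<^esub> x \<oplus>\<^bsub>W\<^esub> b \<odot>\<^bsub>W\<^esub> x"
      using a b by (simp add: V.smult_l_distr flip: smult add)
    show "(a \<otimes>\<^bsub>K\<^esub> b) \<odot>\<^bsub>W\<^esub> x = a \<odot>\<^bsub>W\<^esub> (b \<odot>\<^bsub>W\<^esub> x)"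
      using a b by (simp add: V.smult_assoc1 flip: smult)
  next
    fix a x y assume a: "a \<in> carrier K" and "x \<in> carrier W" "y \<in> carrier W"
    then obtain x' y' where [simp]: "x' \<in> carrier V" "x = \<phi> x'" "y' \<in> carrier V" "y = \<phi> y'"
      using ob by blast
    show "a \<odot>\<^bsub>W\<^esub> (x \<oplus>\<^bsub>W\<^esub> y) = a \<odot>\<^bsub>W\<^esub> x \<oplus>\<^bsub>W\<^esub> a \<odot>\<^bsub>W\<^esub> y"
      using a by (simp add: V.smult_r_distr flip: smult add)
  next
    fix x assume "x \<in> carrier W"
    then obtain x' where [simp]: "x' \<in> carrier V" "x = \<phi> x'" using ob by blast
    show "\<one>\<^bsub>K\<^esub> \<odot>\<^bsub>W\<^esub> x = x" by (simp flip: smult)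
  qed
  ultimately have "module K W"
    unfolding module_def using module.axioms(1)[OF V.module_axioms] by simp
  then show ?thesis unfolding vectorspace_def using V.field_axioms by simp
qed

text \<open>Coordinates with respect to a finite basis identify the space with the functions from
  the basis to the field.\<close>

lemma (in vectorspace) card_carrier_eq_power_dim:
  assumes "finite (carrier K)" "finite (carrier V)"
  shows "card (carrier V) = card (carrier K) ^ dim"
proof -
  have "span (carrier V) = carrier V"
    using span_is_subset2[of "carrier V"] in_own_span[of "carrier V"] by blast
  then have "fin_dim" unfolding fin_dim_def using assms(2) by blast
  then obtain \<beta> where \<beta>: "finite \<beta>" "basis \<beta>" using finite_basis_exists by blast
  have \<beta>V: "\<beta> \<subseteq> carrier V" using \<beta>(2) by (simp add: basis_def)
  have u: "\<exists>!a. a \<in> \<beta> \<rightarrow>\<^sub>E carrier K \<and> lincomb a \<beta> = v" if "v \<in> carrier V" for v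
    using basis_criterion[OF \<beta>(1) \<beta>V] \<beta>(2) that by blast
  have cl: "lincomb a \<beta> \<in> carrier V" if "a \<in> \<beta> \<rightarrow>\<^sub>E carrier K" for a
    using that \<beta>V by (intro lincomb_closed) (auto simp: PiE_def)
  have "bij_betw (\<lambda>a. lincomb a \<beta>) (\<beta> \<rightarrow>\<^sub>E carrier K) (carrier V)"
    unfolding bij_betw_def
  proof
    show "inj_on (\<lambda>a. lincomb a \<beta>) (\<beta> \<rightarrow>\<^sub>E carrier K)"
      by (rule inj_onI) (use u cl in blast)
    show "(\<lambda>a. lincomb a \<beta>) ` (\<beta> \<rightarrow>\<^sub>E carrier K) = carrier V"
      using u cl by blast
  qed
  from bij_betw_same_card[OF this, symmetric] show ?thesis
    unfolding card_funcsetE[OF \<beta>(1)] dim_basis[OF \<beta>] .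
qed

section \<open>Baer sums and scalars through the connecting map\<close>

context abelian_category
begin

definition bip :: "'o \<Rightarrow> 'o \<Rightarrow> 'o" where
  "bip A B = Cod C (inj1 C A B)"

lemma bipD:
  assumes "A \<in> Obj C" "B \<in> Obj C"
  shows "bip A B \<in> Obj C" "inj1 C A B \<in> Hom C A (bip A B)" "inj2 C A B \<in> Hom C B (bip A B)"
    "proj1 C A B \<in> Hom C (bip A B) A" "proj2 C A B \<in> Hom C (bip A B) B"
    "proj1 C A B \<cdot> inj1 C A B = Idt C A" "proj2 C A B \<cdot> inj2 C A B = Idt C B"
    "proj1 C A B \<cdot> inj2 C A B = ZeroArr C B A" "proj2 C A B \<cdot> inj1 C A B = ZeroArr C A B"
    "Plus C (inj1 C A B \<cdot> proj1 C A B) (inj2 C A B \<cdot> proj2 C A B) = Idt C (bip A B)"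
proof -
  have "is_biproduct C A B (biproduct C A B)"
    unfolding biproduct_def by (rule someI_ex[OF biproduct_exists[OF assms]])
  then obtain S where S: "S \<in> Obj C" "inj1 C A B \<in> Hom C A S" "inj2 C A B \<in> Hom C B S"
    "proj1 C A B \<in> Hom C S A" "proj2 C A B \<in> Hom C S B" and
    e: "proj1 C A B \<cdot> inj1 C A B = Idt C A" "proj2 C A B \<cdot> inj2 C A B = Idt C B"
    "proj1 C A B \<cdot> inj2 C A B = ZeroArr C B A" "proj2 C A B \<cdot> inj1 C A B = ZeroArr C A B"
    "Plus C (inj1 C A B \<cdot> proj1 C A B) (inj2 C A B \<cdot> proj2 C A B) = Idt C S"
    unfolding is_biproduct_def inj1_def inj2_def proj1_def proj2_def
    by (cases "biproduct C A B") (auto simp del: Hom_iff)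
  have b: "bip A B = S" using S(2) by (simp add: bip_def)
  show "bip A B \<in> Obj C" "inj1 C A B \<in> Hom C A (bip A B)" "inj2 C A B \<in> Hom C B (bip A B)"
    "proj1 C A B \<in> Hom C (bip A B) A" "proj2 C A B \<in> Hom C (bip A B) B"
    "proj1 C A B \<cdot> inj1 C A B = Idt C A" "proj2 C A B \<cdot> inj2 C A B = Idt C B"
    "proj1 C A B \<cdot> inj2 C A B = ZeroArr C B A" "proj2 C A B \<cdot> inj1 C A B = ZeroArr C A B"
    "Plus C (inj1 C A B \<cdot> proj1 C A B) (inj2 C A B \<cdot> proj2 C A B) = Idt C (bip A B)"
    unfolding b by (fact S e)+
qed

lemma bip_eqI:
  assumes O: "A \<in> Obj C" "B \<in> Obj C" and x: "x \<in> Hom C T (bip A B)" "y \<in> Hom C T (bip A B)"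
    and e: "proj1 C A B \<cdot> x = proj1 C A B \<cdot> y" "proj2 C A B \<cdot> x = proj2 C A B \<cdot> y"
  shows "x = y"
  using biprod_ext[OF bipD(2-5,10)[OF O] x(1) e] biprod_ext[OF bipD(2-5,10)[OF O] x(2) refl refl] by simp

lemma direct_sum_arr:
  assumes f: "f \<in> Hom C A A'" and g: "g \<in> Hom C B B'"
  shows "direct_sum_arr C f g \<in> Hom C (bip A B) (bip A' B')"
    "proj1 C A' B' \<cdot> direct_sum_arr C f g = f \<cdot> proj1 C A B"
    "proj2 C A' B' \<cdot> direct_sum_arr C f g = g \<cdot> proj2 C A B"
    "direct_sum_arr C f g \<cdot> inj1 C A B = inj1 C A' B' \<cdot> f"
    "direct_sum_arr C f g \<cdot> inj2 C A B = inj2 C A' B' \<cdot> g"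
proof -
  have O: "A \<in> Obj C" "B \<in> Obj C" "A' \<in> Obj C" "B' \<in> Obj C" using f g by auto
  note b = bipD[OF O(1,2)] and b' = bipD[OF O(3,4)]
  have d: "direct_sum_arr C f g = Plus C (inj1 C A' B' \<cdot> (f \<cdot> proj1 C A B)) (inj2 C A' B' \<cdot> (g \<cdot> proj2 C A B))"
    using f g b(4,5) b'(2,3) by (simp add: direct_sum_arr_def)
  note re = reassoc[OF b'(6)] reassoc[OF b'(7)] reassoc[OF b'(8)] reassoc[OF b'(9)]
  show "direct_sum_arr C f g \<in> Hom C (bip A B) (bip A' B')"
    unfolding d using f g b(4,5) b'(2,3) by simp
  show "proj1 C A' B' \<cdot> direct_sum_arr C f g = f \<cdot> proj1 C A B"
    "proj2 C A' B' \<cdot> direct_sum_arr C f g = g \<cdot> proj2 C A B"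
    unfolding d using f g b(1,4,5) b'(1-5) O by (simp_all add: re)
  show "direct_sum_arr C f g \<cdot> inj1 C A B = inj1 C A' B' \<cdot> f"
    "direct_sum_arr C f g \<cdot> inj2 C A B = inj2 C A' B' \<cdot> g"
    unfolding d using f g b(1-9) b'(1-5) O by simp_all
qed

lemma direct_sum_sx:
  assumes s: "sx C N E M i p" and s': "sx C N' E' M' i' p'"
  shows "sx C (bip N N') (bip E E') (bip M M') (direct_sum_arr C i i') (direct_sum_arr C p p')"
proof (rule sxI)
  note D = sxD[OF s] and D' = sxD[OF s']
  have H: "i \<in> Hom C N E" "i' \<in> Hom C N' E'" "p \<in> Hom C E M" "p' \<in> Hom C E' M'"
    using D(1-6) D'(1-6) by simp_all
  note bN = bipD[OF D(7) D'(7)] and bE = bipD[OF D(8) D'(8)] and bM = bipD[OF D(9) D'(9)]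
  note I = direct_sum_arr[OF H(1,2)] and P = direct_sum_arr[OF H(3,4)]
  show "direct_sum_arr C i i' \<in> Hom C (bip N N') (bip E E')" by (rule I(1))
  show "direct_sum_arr C p p' \<in> Hom C (bip E E') (bip M M')" by (rule P(1))
  show "is_mono C (direct_sum_arr C i i')"
  proof (rule monoI)
    fix g assume g: "g \<in> Arr C" "Cod C g = Dom C (direct_sum_arr C i i')"
      and z: "direct_sum_arr C i i' \<cdot> g = ZeroArr C (Dom C g) (Cod C (direct_sum_arr C i i'))"
    have gH: "g \<in> Hom C (Dom C g) (bip N N')" and T: "Dom C g \<in> Obj C" using g I(1) by simp_all
    have z': "direct_sum_arr C i i' \<cdot> g = ZeroArr C (Dom C g) (bip E E')" using z I(1) by simp
    have "i \<cdot> (proj1 C N N' \<cdot> g) = proj1 C E E' \<cdot> (direct_sum_arr C i i' \<cdot> g)"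
      using gH I(1) H bE(4) bN(4) by (simp add: reassoc[OF I(2)])
    also have "\<dots> = ZeroArr C (Dom C g) E" unfolding z' using T bE(4) by simp
    finally have "proj1 C N N' \<cdot> g = ZeroArr C (Dom C g) (Dom C i)"
      by (rule mono_Zero[OF D(11)]) (use gH bN(4) H(1) in simp_all)
    then have 1: "proj1 C N N' \<cdot> g = proj1 C N N' \<cdot> ZeroArr C (Dom C g) (bip N N')"
      using T bN(1,4) H(1) by simp
    have "i' \<cdot> (proj2 C N N' \<cdot> g) = proj2 C E E' \<cdot> (direct_sum_arr C i i' \<cdot> g)"
      using gH I(1) H bE(5) bN(5) by (simp add: reassoc[OF I(3)])
    also have "\<dots> = ZeroArr C (Dom C g) E'" unfolding z' using T bE(5) by simp
    finally have "proj2 C N N' \<cdot> g = ZeroArr C (Dom C g) (Dom C i')"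
      by (rule mono_Zero[OF D'(11)]) (use gH bN(5) H(2) in simp_all)
    then have 2: "proj2 C N N' \<cdot> g = proj2 C N N' \<cdot> ZeroArr C (Dom C g) (bip N N')"
      using T bN(1,5) H(2) by simp
    have "g = ZeroArr C (Dom C g) (bip N N')"
      by (rule bip_eqI[OF D(7) D'(7) gH _ 1 2]) (use T bN(1) in simp)
    then show "g = ZeroArr C (Dom C g) (Dom C (direct_sum_arr C i i'))" using I(1) by simp
  qed (use I(1) in simp)
  show "is_epi C (direct_sum_arr C p p')"
  proof (rule epiI)
    fix h assume h: "h \<in> Arr C" "Dom C h = Cod C (direct_sum_arr C p p')"
      and z: "h \<cdot> direct_sum_arr C p p' = ZeroArr C (Dom C (direct_sum_arr C p p')) (Cod C h)"
    have hH: "h \<in> Hom C (bip M M') (Cod C h)" and T: "Cod C h \<in> Obj C" using h P(1) by simp_all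
    have z': "h \<cdot> direct_sum_arr C p p' = ZeroArr C (bip E E') (Cod C h)" using z P(1) by simp
    have "(h \<cdot> inj1 C M M') \<cdot> p = (h \<cdot> direct_sum_arr C p p') \<cdot> inj1 C E E'"
      using hH P(1) H bM(2) bE(2) by (simp add: P(4))
    also have "\<dots> = ZeroArr C E (Cod C h)" unfolding z' using T bE(2) by simp
    finally have "h \<cdot> inj1 C M M' = ZeroArr C (Cod C p) (Cod C h)"
      by (rule epi_Zero[OF D(12)]) (use hH bM(2) H(3) in simp_all)
    then have 1: "h \<cdot> inj1 C M M' = ZeroArr C M (Cod C h)" using H(3) by simp
    have "(h \<cdot> inj2 C M M') \<cdot> p' = (h \<cdot> direct_sum_arr C p p') \<cdot> inj2 C E E'"
      using hH P(1) H bM(3) bE(3) by (simp add: P(5))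
    also have "\<dots> = ZeroArr C E' (Cod C h)" unfolding z' using T bE(3) by simp
    finally have "h \<cdot> inj2 C M M' = ZeroArr C (Cod C p') (Cod C h)"
      by (rule epi_Zero[OF D'(12)]) (use hH bM(3) H(4) in simp_all)
    then have 2: "h \<cdot> inj2 C M M' = ZeroArr C M' (Cod C h)" using H(4) by simp
    have "h = h \<cdot> Plus C (inj1 C M M' \<cdot> proj1 C M M') (inj2 C M M' \<cdot> proj2 C M M')"
      using hH by (simp add: bM(10))
    also have "\<dots> = ZeroArr C (bip M M') (Cod C h)"
      using hH bM(1-5) T by (simp add: reassoc[OF 1] reassoc[OF 2])
    finally show "h = ZeroArr C (Cod C (direct_sum_arr C p p')) (Cod C h)" using P(1) by simp
  qed (use P(1) in simp)
  show "direct_sum_arr C p p' \<cdot> direct_sum_arr C i i' = ZeroArr C (bip N N') (bip M M')"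
  proof (rule bip_eqI[OF D(9) D'(9), of _ "bip N N'"])
    show "proj1 C M M' \<cdot> (direct_sum_arr C p p' \<cdot> direct_sum_arr C i i') = proj1 C M M' \<cdot> ZeroArr C (bip N N') (bip M M')"
      using P(1) I(1) H bM(1,4) bN(1,4) bE(4) D(9) by (simp add: reassoc[OF P(2)] I(2) reassoc[OF D(10)])
    show "proj2 C M M' \<cdot> (direct_sum_arr C p p' \<cdot> direct_sum_arr C i i') = proj2 C M M' \<cdot> ZeroArr C (bip N N') (bip M M')"
      using P(1) I(1) H bM(1,5) bN(1,5) bE(5) D'(9) by (simp add: reassoc[OF P(3)] I(3) reassoc[OF D'(10)])
  qed (use P(1) I(1) bM(1) bN(1) in simp_all)
  fix T s assume t: "s \<in> Hom C T (bip E E')" and z: "direct_sum_arr C p p' \<cdot> s = ZeroArr C T (bip M M')"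
  have T: "T \<in> Obj C" using t by auto
  have "p \<cdot> (proj1 C E E' \<cdot> s) = proj1 C M M' \<cdot> (direct_sum_arr C p p' \<cdot> s)"
    using t P(1) H bM(4) bE(4) by (simp add: reassoc[OF P(2)])
  then have "p \<cdot> (proj1 C E E' \<cdot> s) = ZeroArr C T M" unfolding z using T bM(4) by simp
  moreover have "proj1 C E E' \<cdot> s \<in> Hom C T E" using t bE(4) by simp
  ultimately obtain u where u: "u \<in> Hom C T N" "i \<cdot> u = proj1 C E E' \<cdot> s"
    using sx_lift[OF assms(1)] by metis
  have "p' \<cdot> (proj2 C E E' \<cdot> s) = proj2 C M M' \<cdot> (direct_sum_arr C p p' \<cdot> s)"
    using t P(1) H bM(5) bE(5) by (simp add: reassoc[OF P(3)])
  then have "p' \<cdot> (proj2 C E E' \<cdot> s) = ZeroArr C T M'" unfolding z using T bM(5) by simp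
  moreover have "proj2 C E E' \<cdot> s \<in> Hom C T E'" using t bE(5) by simp
  ultimately obtain v where v: "v \<in> Hom C T N'" "i' \<cdot> v = proj2 C E E' \<cdot> s"
    using sx_lift[OF assms(2)] by metis
  define w where "w = Plus C (inj1 C N N' \<cdot> u) (inj2 C N N' \<cdot> v)"
  have w: "w \<in> Hom C T (bip N N')" unfolding w_def using u v bN(2,3) by simp
  have pw: "proj1 C N N' \<cdot> w = u" "proj2 C N N' \<cdot> w = v" unfolding w_def using u(1) v(1) bN(2-5) T D(7) D'(7)
    by (simp_all add: reassoc[OF bN(6)] reassoc[OF bN(7)] reassoc[OF bN(8)] reassoc[OF bN(9)])
  have "direct_sum_arr C i i' \<cdot> w = s"
  proof (rule bip_eqI[OF D(8) D'(8) _ t])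
    show "proj1 C E E' \<cdot> (direct_sum_arr C i i' \<cdot> w) = proj1 C E E' \<cdot> s"
      using I(1) w bE(4) bN(4) H by (simp add: reassoc[OF I(2)] pw u(2))
    show "proj2 C E E' \<cdot> (direct_sum_arr C i i' \<cdot> w) = proj2 C E E' \<cdot> s"
      using I(1) w bE(5) bN(5) H by (simp add: reassoc[OF I(3)] pw v(2))
  qed (use I(1) w in simp)
  then show "\<exists>u\<in>Hom C T (bip N N'). direct_sum_arr C i i' \<cdot> u = s" using w by blast
qed

lemma diagonal:
  assumes "M \<in> Obj C"
  shows "diagonal C M \<in> Hom C M (bip M M)" "proj1 C M M \<cdot> diagonal C M = Idt C M"
    "proj2 C M M \<cdot> diagonal C M = Idt C M"
  using bipD[OF assms assms] assms unfolding diagonal_def by simp_all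

text \<open>The two maps from \<open>P\<close> to the middle terms are combined componentwise. On
  kernels this gives the arrow with components \<open>f\<close> and \<open>g\<close>, on quotients
  the diagonal.\<close>

lemma pushc_direct_sum:
  assumes s: "sx C R P M \<iota> \<pi>" and f: "f \<in> Hom C R N" and g: "g \<in> Hom C R N"
    and e1: "e1 \<in> pushc M N (\<iota>, \<pi>) f" and e2: "e2 \<in> pushc M N (\<iota>, \<pi>) g"
  defines "k \<equiv> Plus C (inj1 C N N \<cdot> f) (inj2 C N N \<cdot> g)"
  shows "direct_sum_ses C e1 e2 \<in> ses C (bip M M) (bip N N)"
    "ses_map C (\<iota>, \<pi>) k (diagonal C M) (direct_sum_ses C e1 e2)"
proof -
  have eM: "e1 \<in> ses C M N" "ses_map C (\<iota>, \<pi>) f (Idt C M) e1"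
    "e2 \<in> ses C M N" "ses_map C (\<iota>, \<pi>) g (Idt C M) e2" using e1 e2 by (auto simp: pushc_def)
  obtain i p E where ep: "e1 = (i, p)" and s1: "sx C N E M i p" by (rule ses_obtain[OF eM(1)])
  obtain i' p' E' where ep': "e2 = (i', p')" and s2: "sx C N E' M i' p'" by (rule ses_obtain[OF eM(3)])
  note D = sxD[OF s] and D1 = sxD[OF s1] and D2 = sxD[OF s2]
  obtain b where b: "b \<in> Hom C P E" "b \<cdot> \<iota> = i \<cdot> f" "p \<cdot> b = Idt C M \<cdot> \<pi>"
    using eM(2) unfolding ep ses_map_sx[OF s s1] by blast
  obtain b' where b': "b' \<in> Hom C P E'" "b' \<cdot> \<iota> = i' \<cdot> g" "p' \<cdot> b' = Idt C M \<cdot> \<pi>"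
    using eM(4) unfolding ep' ses_map_sx[OF s s2] by blast
  have H: "i \<in> Hom C N E" "i' \<in> Hom C N E'" "p \<in> Hom C E M" "p' \<in> Hom C E' M"
    using D1(1-6) D2(1-6) by simp_all
  have ds: "direct_sum_ses C e1 e2 = (direct_sum_arr C i i', direct_sum_arr C p p')"
    by (simp add: direct_sum_ses_def ep ep')
  note sd = direct_sum_sx[OF s1 s2]
  show "direct_sum_ses C e1 e2 \<in> ses C (bip M M) (bip N N)" unfolding ds by (rule sx_ses[OF sd])
  note bN = bipD[OF D1(7) D1(7)] and bE = bipD[OF D1(8) D2(8)] and bM = bipD[OF D(9) D(9)]
  note I = direct_sum_arr[OF H(1,2)] and P = direct_sum_arr[OF H(3,4)]
  have k: "k \<in> Hom C R (bip N N)" "proj1 C N N \<cdot> k = f" "proj2 C N N \<cdot> k = g"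
    unfolding k_def using f g bN(1-5) D(7) D1(7)
    by (simp_all add: reassoc[OF bN(6)] reassoc[OF bN(7)] reassoc[OF bN(8)] reassoc[OF bN(9)])
  define B where "B = Plus C (inj1 C E E' \<cdot> b) (inj2 C E E' \<cdot> b')"
  have B: "B \<in> Hom C P (bip E E')" "proj1 C E E' \<cdot> B = b" "proj2 C E E' \<cdot> B = b'"
    unfolding B_def using b(1) b'(1) bE(1-5) D(8) D1(8) D2(8)
    by (simp_all add: reassoc[OF bE(6)] reassoc[OF bE(7)] reassoc[OF bE(8)] reassoc[OF bE(9)])
  have \<pi>: "Idt C M \<cdot> \<pi> = \<pi>" using D(4,6) by simp
  note dg = diagonal[OF D(9)]
  have "B \<cdot> \<iota> = direct_sum_arr C i i' \<cdot> k"
  proof (rule bip_eqI[OF D1(8) D2(8), of _ R])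
    show "proj1 C E E' \<cdot> (B \<cdot> \<iota>) = proj1 C E E' \<cdot> (direct_sum_arr C i i' \<cdot> k)"
      using B(1) k(1) I(1) D(1-3) bE(4) bN(4) H by (simp add: reassoc[OF B(2)] reassoc[OF I(2)] b(2) k(2))
    show "proj2 C E E' \<cdot> (B \<cdot> \<iota>) = proj2 C E E' \<cdot> (direct_sum_arr C i i' \<cdot> k)"
      using B(1) k(1) I(1) D(1-3) bE(5) bN(5) H by (simp add: reassoc[OF B(3)] reassoc[OF I(3)] b'(2) k(3))
  qed (use B(1) D(1-3) I(1) k(1) in simp_all)
  moreover have "direct_sum_arr C p p' \<cdot> B = diagonal C M \<cdot> \<pi>"
  proof (rule bip_eqI[OF D(9) D(9), of _ P])
    show "proj1 C M M \<cdot> (direct_sum_arr C p p' \<cdot> B) = proj1 C M M \<cdot> (diagonal C M \<cdot> \<pi>)"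
      using B(1) P(1) D(4-6) dg(1) bM(4) bE(4) H by (simp add: reassoc[OF P(2)] B(2) b(3) reassoc[OF dg(2)])
    show "proj2 C M M \<cdot> (direct_sum_arr C p p' \<cdot> B) = proj2 C M M \<cdot> (diagonal C M \<cdot> \<pi>)"
      using B(1) P(1) D(4-6) dg(1) bM(5) bE(5) H by (simp add: reassoc[OF P(3)] B(3) b'(3) reassoc[OF dg(3)])
  qed (use B(1) D(4-6) P(1) dg(1) in simp_all)
  ultimately show "ses_map C (\<iota>, \<pi>) k (diagonal C M) (direct_sum_ses C e1 e2)"
    unfolding ds ses_map_sx[OF s sd] using B(1) by blast
qed

text \<open>The pullback \<open>d\<close> in the definition of the Baer sum is the pushout of the
  given presentation along the arrow \<open>k\<close> with components \<open>f\<close> and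
  \<open>g\<close>. Pushing on along the codiagonal replaces \<open>k\<close> by its composite with
  it, which is the sum of \<open>f\<close> and \<open>g\<close>.\<close>

lemma Baer_pushc:
  assumes s: "sx C R P M \<iota> \<pi>" and f: "f \<in> Hom C R N" and g: "g \<in> Hom C R N"
  shows "Baer_sum C M N (pushc M N (\<iota>, \<pi>) f) (pushc M N (\<iota>, \<pi>) g) = pushc M N (\<iota>, \<pi>) (Plus C f g)"
proof -
  define k where "k = Plus C (inj1 C N N \<cdot> f) (inj2 C N N \<cdot> g)"
  note D = sxD[OF s] and \<eta> = sx_ses[OF s]
  have O: "N \<in> Obj C" using f by auto
  note bN = bipD[OF O O] and bM = bipD[OF D(9) D(9)] and dg = diagonal[OF D(9)]
  have k: "k \<in> Hom C R (bip N N)" "proj1 C N N \<cdot> k = f" "proj2 C N N \<cdot> k = g"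
    unfolding k_def using f g bN(1-5) D(7) O
    by (simp_all add: reassoc[OF bN(6)] reassoc[OF bN(7)] reassoc[OF bN(8)] reassoc[OF bN(9)])
  have cd: "codiagonal C N \<in> Hom C (bip N N) N" unfolding codiagonal_def using bN(4,5) by simp
  have ck: "codiagonal C N \<cdot> k = Plus C f g" unfolding codiagonal_def using bN(4,5) k by simp
  have I: "Idt C M \<in> Hom C M M" "Idt C (bip N N) \<in> Hom C (bip N N) (bip N N)" "Idt C N \<in> Hom C N N"
    using D(9) bN(1) O by simp_all
  have II: "Idt C M \<cdot> Idt C M = Idt C M" using D(9) by simp
  show ?thesis
  proof (intro equalityI subsetI)
    fix e assume "e \<in> Baer_sum C M N (pushc M N (\<iota>, \<pi>) f) (pushc M N (\<iota>, \<pi>) g)"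
    then obtain e1 e2 d where e: "e \<in> ses C M N" "e1 \<in> pushc M N (\<iota>, \<pi>) f" "e2 \<in> pushc M N (\<iota>, \<pi>) g"
      and d: "d \<in> ses C M (bip N N)"
      and m1: "ses_map C d (Idt C (bip N N)) (diagonal C M) (direct_sum_ses C e1 e2)"
      and m2: "ses_map C d (codiagonal C N) (Idt C M) e"
      unfolding Baer_sum_def bip_def by blast
    note ds = pushc_direct_sum[OF s f g e(2,3), folded k_def]
    have "ses_map C (\<iota>, \<pi>) k (Idt C M) d"
      by (rule ses_pull_factor[OF \<eta> ds(1) d k(1) dg(1) ds(2) m1])
    then have "ses_map C (\<iota>, \<pi>) (codiagonal C N \<cdot> k) (Idt C M \<cdot> Idt C M) e"
      by (rule ses_map_trans[OF \<eta> d e(1) k(1) cd I(1) I(1) _ m2])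
    then show "e \<in> pushc M N (\<iota>, \<pi>) (Plus C f g)" unfolding ck II pushc_def using e(1) by simp
  next
    fix e assume e: "e \<in> pushc M N (\<iota>, \<pi>) (Plus C f g)"
    then have eM: "e \<in> ses C M N" by (simp add: pushc_def)
    have fg: "Plus C f g \<in> Hom C R N" using f g by simp
    obtain e1 where e1: "e1 \<in> pushc M N (\<iota>, \<pi>) f" by (rule pushc_nonempty[OF \<eta> f])
    obtain e2 where e2: "e2 \<in> pushc M N (\<iota>, \<pi>) g" by (rule pushc_nonempty[OF \<eta> g])
    note ds = pushc_direct_sum[OF s f g e1 e2, folded k_def]
    obtain d where d: "d \<in> ses C M (bip N N)" "ses_map C (\<iota>, \<pi>) k (Idt C M) d"
      by (rule ses_push[OF \<eta> k(1)])
    have m1: "ses_map C d (Idt C (bip N N)) (diagonal C M) (direct_sum_ses C e1 e2)"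
      by (rule ses_push_factor[OF \<eta> ds(1) d(1) k(1) dg(1) ds(2) d(2)])
    obtain e0 where e0: "e0 \<in> ses C M N" "ses_map C d (codiagonal C N) (Idt C M) e0"
      by (rule ses_push[OF d(1) cd])
    have "ses_map C (\<iota>, \<pi>) (codiagonal C N \<cdot> k) (Idt C M \<cdot> Idt C M) e0"
      by (rule ses_map_trans[OF \<eta> d(1) e0(1) k(1) cd I(1) I(1) d(2) e0(2)])
    then have "e0 \<in> pushc M N (\<iota>, \<pi>) (Plus C f g)" unfolding ck II pushc_def using e0(1) by simp
    then have "(e0, e) \<in> ses_equiv C M N" using pushc_equiv[OF \<eta> fg] e by blast
    then have "ses_map C e0 (Idt C N) (Idt C M) e" using ses_equiv_iff by blast
    then have "ses_map C d (Idt C N \<cdot> codiagonal C N) (Idt C M \<cdot> Idt C M) e"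
      by (rule ses_map_trans[OF d(1) e0(1) eM cd I(3) I(1) I(1) e0(2)])
    then have "ses_map C d (codiagonal C N) (Idt C M) e" using cd II by simp
    then show "e \<in> Baer_sum C M N (pushc M N (\<iota>, \<pi>) f) (pushc M N (\<iota>, \<pi>) g)"
      unfolding Baer_sum_def bip_def[symmetric] using eM e1 e2 d(1) m1 by blast
  qed
qed

lemma Ext_scale_pushc:
  assumes s: "sx C R P M \<iota> \<pi>" and f: "f \<in> Hom C R N" and c: "c \<in> carrier K"
  shows "Ext_scale C M N c (pushc M N (\<iota>, \<pi>) f) = pushc M N (\<iota>, \<pi>) (Scale C c f)"
proof -
  note D = sxD[OF s] and \<eta> = sx_ses[OF s]
  have O: "N \<in> Obj C" using f by auto
  have I: "Idt C M \<in> Hom C M M" "Idt C N \<in> Hom C N N" "Scale C c (Idt C N) \<in> Hom C N N"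
    using D(9) O c by simp_all
  have II: "Idt C M \<cdot> Idt C M = Idt C M" using D(9) by simp
  have ci: "Scale C c (Idt C N) \<cdot> f = Scale C c f" using f O c by simp
  have cf: "Scale C c f \<in> Hom C R N" using f c by simp
  have 1: "e \<in> pushc M N (\<iota>, \<pi>) (Scale C c f)"
    if "e \<in> ses C M N" "e0 \<in> pushc M N (\<iota>, \<pi>) f" "ses_map C e0 (Scale C c (Idt C N)) (Idt C M) e" for e e0
  proof -
    have "e0 \<in> ses C M N" "ses_map C (\<iota>, \<pi>) f (Idt C M) e0" using that(2) by (auto simp: pushc_def)
    then have "ses_map C (\<iota>, \<pi>) (Scale C c (Idt C N) \<cdot> f) (Idt C M \<cdot> Idt C M) e"
      by (intro ses_map_trans[OF \<eta> _ that(1) f I(3) I(1) I(1) _ that(3)])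
    then show ?thesis unfolding ci II pushc_def using that(1) by simp
  qed
  show ?thesis
  proof (intro equalityI subsetI)
    fix e assume "e \<in> Ext_scale C M N c (pushc M N (\<iota>, \<pi>) f)"
    then show "e \<in> pushc M N (\<iota>, \<pi>) (Scale C c f)" unfolding Ext_scale_def using 1 by blast
  next
    fix e assume e: "e \<in> pushc M N (\<iota>, \<pi>) (Scale C c f)"
    then have eM: "e \<in> ses C M N" by (simp add: pushc_def)
    obtain e0 where e0: "e0 \<in> pushc M N (\<iota>, \<pi>) f" by (rule pushc_nonempty[OF \<eta> f])
    then have e0M: "e0 \<in> ses C M N" by (simp add: pushc_def)
    obtain e1 where e1: "e1 \<in> ses C M N" "ses_map C e0 (Scale C c (Idt C N)) (Idt C M) e1"
      by (rule ses_push[OF e0M I(3)])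
    have "e1 \<in> pushc M N (\<iota>, \<pi>) (Scale C c f)" by (rule 1[OF e1(1) e0 e1(2)])
    then have "(e1, e) \<in> ses_equiv C M N" using pushc_equiv[OF \<eta> cf] e by blast
    then have "ses_map C e1 (Idt C N) (Idt C M) e" using ses_equiv_iff by blast
    then have "ses_map C e0 (Idt C N \<cdot> Scale C c (Idt C N)) (Idt C M \<cdot> Idt C M) e"
      by (rule ses_map_trans[OF e0M e1(1) eM I(3) I(2) I(1) I(1) e1(2)])
    then have "ses_map C e0 (Scale C c (Idt C N)) (Idt C M) e" using I(3) II by simp
    then show "e \<in> Ext_scale C M N c (pushc M N (\<iota>, \<pi>) f)" unfolding Ext_scale_def using eM e0 by blast
  qed
qed

text \<open>A map of extensions that is zero on \<open>R\<close> factors through \<open>M\<close>,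
  and the factor is a section; conversely a section composed with \<open>\<pi>\<close> is such a
  map.\<close>

lemma split_pushc:
  assumes s: "sx C R P M \<iota> \<pi>" and N: "N \<in> Obj C"
  shows "pushc M N (\<iota>, \<pi>) (ZeroArr C R N) = split_ses C M N"
proof -
  note D = sxD[OF s]
  have "ses_map C (\<iota>, \<pi>) (ZeroArr C R N) (Idt C M) e \<longleftrightarrow> (\<exists>t \<in> Hom C M (Dom C (snd e)). snd e \<cdot> t = Idt C M)"
    if e: "e \<in> ses C M N" for e
  proof -
    obtain i p E where ep: "e = (i, p)" and s1: "sx C N E M i p" by (rule ses_obtain[OF e])
    note D1 = sxD[OF s1]
    have z: "i \<cdot> ZeroArr C R N = ZeroArr C R E" "Idt C M \<cdot> \<pi> = \<pi>" using D1(1-3) D(4,6,7) by simp_all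
    show ?thesis unfolding ep ses_map_sx[OF s s1] z snd_conv D1(5)
    proof
      assume "\<exists>b\<in>Hom C P E. b \<cdot> \<iota> = ZeroArr C R E \<and> p \<cdot> b = \<pi>"
      then obtain b where b: "b \<in> Hom C P E" "b \<cdot> \<iota> = ZeroArr C R E" "p \<cdot> b = \<pi>" by blast
      obtain t where t: "t \<in> Hom C M E" "t \<cdot> \<pi> = b" by (rule sx_desc[OF s b(1,2)])
      have "(p \<cdot> t) \<cdot> \<pi> = Idt C M \<cdot> \<pi>" using t b(3) D1(4-6) D(4-6) by simp
      then have "p \<cdot> t = Idt C M"
        by (rule epi_cancel[OF D(12)]) (use t(1) D1(4-6) D(6,9) in simp_all)
      then show "\<exists>t\<in>Hom C M E. p \<cdot> t = Idt C M" using t(1) by blast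
    next
      assume "\<exists>t\<in>Hom C M E. p \<cdot> t = Idt C M"
      then obtain t where t: "t \<in> Hom C M E" "p \<cdot> t = Idt C M" by blast
      have "(t \<cdot> \<pi>) \<cdot> \<iota> = ZeroArr C R E" using t(1) D(1-10) by simp
      moreover have "p \<cdot> (t \<cdot> \<pi>) = \<pi>" using t(1) D1(4-6) D(4-6) by (simp add: reassoc[OF t(2)])
      moreover have "t \<cdot> \<pi> \<in> Hom C P E" using t(1) D(4-6) by simp
      ultimately show "\<exists>b\<in>Hom C P E. b \<cdot> \<iota> = ZeroArr C R E \<and> p \<cdot> b = \<pi>" by blast
    qed
  qed
  then show ?thesis unfolding pushc_def split_ses_def by (auto simp del: Hom_iff)
qed

text \<open>For an effacing presentation the connecting map is a surjection from
  \<open>Hom C R N\<close> that respects sums, scalars and zero.\<close>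

lemma ExtSpace_vectorspace:
  assumes M: "M \<in> Obj C" and N: "N \<in> Obj C" and fin: "finite (Ext1 C M N)"
  shows "vectorspace K (ExtSpace C M N)"
proof -
  obtain R P \<iota> \<pi> where s: "sx C R P M \<iota> \<pi>" and eff: "\<And>B. B \<in> {N} \<Longrightarrow> effaces (\<iota>, \<pi>) M R B"
    by (rule effacing_exists[OF M, of "{N}"]) (use fin in auto)
  have E: "carrier (ExtSpace C M N) = Ext1 C M N" "\<zero>\<^bsub>ExtSpace C M N\<^esub> = split_ses C M N"
    "x \<oplus>\<^bsub>ExtSpace C M N\<^esub> y = Baer_sum C M N x y" "c \<odot>\<^bsub>ExtSpace C M N\<^esub> x = Ext_scale C M N c x" for x y c
    by (simp_all add: ExtSpace_def)
  show ?thesis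
    by (rule vectorspace_image[OF Hom_vectorspace[OF sxD(7)[OF s] N], of "pushc M N (\<iota>, \<pi>)"],
        unfold E HomSpace_sel)
      (use pushc_surj[OF s] eff Baer_pushc[OF s] split_pushc[OF s N] Ext_scale_pushc[OF s] in
        \<open>simp_all del: Hom_iff\<close>)
qed

end

section \<open>From dimensions to cardinalities\<close>

context finitary_hereditary_category
begin

lemma card_Hom_dim:
  assumes "M \<in> Obj C" "N \<in> Obj C"
  shows "card (Hom C M N) = card (carrier K) ^ vectorspace.dim K (HomSpace C M N)"
  using vectorspace.card_carrier_eq_power_dim[OF Hom_vectorspace[OF assms] finite_field]
    finite_Hom[OF assms] by (simp del: Hom_iff)

lemma card_Ext1_dim:
  assumes "M \<in> Obj C" "N \<in> Obj C"
  shows "card (Ext1 C M N) = card (carrier K) ^ vectorspace.dim K (ExtSpace C M N)"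
  using vectorspace.card_carrier_eq_power_dim[OF ExtSpace_vectorspace[OF assms] finite_field]
    finite_Ext1[OF assms] by (simp add: ExtSpace_def)

lemma card_K_gt: "card (carrier K) > 1"
proof -
  have "card {\<zero>\<^bsub>K\<^esub>, \<one>\<^bsub>K\<^esub>} \<le> card (carrier K)" by (rule card_mono[OF finite_field]) auto
  then show ?thesis using one_not_zero by simp
qed

text \<open>Both spaces have as many elements as q to the power of their dimension, so
  \<open>euler\<close> is q to the Euler form; the claim follows by comparing squares of positive
  numbers.\<close>

lemma sqrt_q_powi_Euler_form:
  assumes "M \<in> Obj C" "N \<in> Obj C"
  shows "sqrt_q K powi Euler_form K C M N = sqrt (euler M N)"
proof -
  have v: "sqrt_q K > 0" "(sqrt_q K)\<^sup>2 = real (card (carrier K))"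
    using card_K_gt by (simp_all add: sqrt_q_def)
  have "(sqrt_q K powi Euler_form K C M N)\<^sup>2 = (sqrt_q K)\<^sup>2 powi Euler_form K C M N"
    by (simp add: power_int_power' mult.commute power_int_power)
  also have "\<dots> = euler M N"
    unfolding v(2) Euler_form_def euler_def card_Hom_dim[OF assms] card_Ext1_dim[OF assms]
    using card_K_gt by (simp add: power_int_diff)
  finally show ?thesis using v(1) by (intro real_sqrt_unique[symmetric]) auto
qed

end

section \<open>Isomorphism classes and Hall numbers\<close>

lemma nn_integral_count_space_nested:
  fixes f :: "'a \<Rightarrow> 'b \<Rightarrow> ennreal"
  shows "(\<integral>\<^sup>+x. \<integral>\<^sup>+y. f x y \<partial>count_space B \<partial>count_space A) =
    (\<integral>\<^sup>+x. \<integral>\<^sup>+y. f x y * indicator B y * indicator A x \<partial>count_space UNIV \<partial>count_space UNIV)"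
  by (simp add: nn_integral_count_space_indicator nn_integral_multc)

text \<open>Tonelli for counting measures on arbitrary, possibly uncountable sets. Indicators move
  both sums to the whole types.\<close>

lemma nn_integral_count_space_swap:
  fixes f :: "'a \<Rightarrow> 'b \<Rightarrow> ennreal"
  shows "(\<integral>\<^sup>+x. \<integral>\<^sup>+y. f x y \<partial>count_space B \<partial>count_space A) =
    (\<integral>\<^sup>+y. \<integral>\<^sup>+x. f x y \<partial>count_space A \<partial>count_space B)"
  unfolding nn_integral_count_space_nested[where f = f]
    nn_integral_count_space_nested[where f = "\<lambda>y x. f x y"]
  using trans[OF nn_integral_fst_count_space[of "\<lambda>(x, y). f x y * indicator B y * indicator A x"]
      nn_integral_snd_count_space[of "\<lambda>(x, y). f x y * indicator B y * indicator A x", symmetric]]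
  by (simp add: mult.assoc mult.commute[of "indicator A _"])

context abelian_category
begin

lemma iso_inv:
  assumes "is_iso C f" "f \<in> Hom C A B"
  obtains g where "is_iso C g" "g \<in> Hom C B A" "g \<cdot> f = Idt C A" "f \<cdot> g = Idt C B"
proof -
  obtain g where "g \<in> Arr C" "Dom C g = Cod C f" "Cod C g = Dom C f"
    "g \<cdot> f = Idt C (Dom C f)" "f \<cdot> g = Idt C (Cod C f)" "is_iso C g" using assms(1) by (rule isoE)
  then show ?thesis using that[of g] assms(2) by simp
qed

lemma isomorphic_refl: "A \<in> Obj C \<Longrightarrow> isomorphic C A A"
  unfolding isomorphic_def by (rule bexI[of _ "Idt C A"]) auto

lemma isomorphic_sym: "isomorphic C A B \<Longrightarrow> isomorphic C B A"
  unfolding isomorphic_def by (meson iso_inv)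

lemma isomorphic_trans:
  assumes "isomorphic C A B" "isomorphic C B D"
  shows "isomorphic C A D"
proof -
  obtain f g where f: "f \<in> Hom C A B" "is_iso C f" "g \<in> Hom C B D" "is_iso C g"
    using assms unfolding isomorphic_def by blast
  then have "is_iso C (g \<cdot> f)" by (intro iso_Comp) auto
  then show ?thesis unfolding isomorphic_def using f by (intro bexI[of _ "g \<cdot> f"]) auto
qed

lemma iso_class_eq_iff:
  assumes "A \<in> Obj C" "B \<in> Obj C"
  shows "iso_class C A = iso_class C B \<longleftrightarrow> isomorphic C A B"
proof
  assume "iso_class C A = iso_class C B"
  moreover have "B \<in> iso_class C B" using assms isomorphic_refl by (simp add: iso_class_def)
  ultimately show "isomorphic C A B" by (auto simp: iso_class_def)
next
  assume "isomorphic C A B"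
  then show "iso_class C A = iso_class C B"
    unfolding iso_class_def using isomorphic_trans isomorphic_sym by blast
qed

lemma rep_Iso:
  assumes "m \<in> Iso C"
  shows "rep m \<in> Obj C" "iso_class C (rep m) = m"
proof -
  obtain A where A: "A \<in> Obj C" "m = iso_class C A" using assms by (auto simp: Iso_def)
  then have "A \<in> m" using isomorphic_refl by (simp add: iso_class_def)
  then have "rep m \<in> m" unfolding rep_def by (rule someI)
  then have "rep m \<in> Obj C" "isomorphic C A (rep m)" using A by (auto simp: iso_class_def)
  then show "rep m \<in> Obj C" "iso_class C (rep m) = m"
    using iso_class_eq_iff[OF A(1), of "rep m"] A(2) by simp_all
qed

lemma iso_class_Iso: "A \<in> Obj C \<Longrightarrow> iso_class C A \<in> Iso C"
  by (auto simp: Iso_def)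

lemma isomorphic_rep: "A \<in> Obj C \<Longrightarrow> isomorphic C A (rep (iso_class C A))"
  using rep_Iso[OF iso_class_Iso[of A]] iso_class_eq_iff[of A "rep (iso_class C A)"] by simp

definition isos :: "'o \<Rightarrow> 'o \<Rightarrow> 'm set" where
  "isos A B = {f \<in> Hom C A B. is_iso C f}"

lemma Aut_isos: "Aut C A = isos A A"
  by (simp add: Aut_def isos_def)

text \<open>Composition with one isomorphism identifies the isomorphisms from \<open>A\<close> to
  \<open>B\<close> with the automorphisms of the target.\<close>

lemma card_isos:
  assumes "A \<in> Obj C" "B \<in> Obj C"
  shows "card (isos A B) = (if isomorphic C A B then card (Aut C B) else 0)"
proof (cases "isomorphic C A B")
  case False
  then have "isos A B = {}" unfolding isos_def isomorphic_def by blast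
  then show ?thesis using False by simp
next
  case True
  then obtain f where f: "f \<in> Hom C A B" "is_iso C f" unfolding isomorphic_def by blast
  obtain f' where f': "is_iso C f'" "f' \<in> Hom C B A" "f' \<cdot> f = Idt C A" "f \<cdot> f' = Idt C B"
    by (rule iso_inv[OF f(2,1)])
  have "bij_betw (\<lambda>g. g \<cdot> f) (isos B B) (isos A B)"
  proof (rule bij_betwI[where g = "\<lambda>g. g \<cdot> f'"])
    show "(\<lambda>g. g \<cdot> f) \<in> isos B B \<rightarrow> isos A B" using f iso_Comp[OF f(2)] by (auto simp: isos_def)
    show "(\<lambda>g. g \<cdot> f') \<in> isos A B \<rightarrow> isos B B" using f' iso_Comp[OF f'(1)] by (auto simp: isos_def)
  qed (use f(1) f'(2-4) in \<open>auto simp: isos_def\<close>)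
  from bij_betw_same_card[OF this] True show ?thesis by (simp add: Aut_isos)
qed

lemma sx_iso:
  assumes s: "sx C N E M i p" and h: "h \<in> isos N' N" and g: "g \<in> isos M M'"
  shows "sx C N' E M' (i \<cdot> h) (g \<cdot> p)"
proof (rule sxI)
  note D = sxD[OF s]
  have H: "h \<in> Hom C N' N" "is_iso C h" "g \<in> Hom C M M'" "is_iso C g" using h g by (auto simp: isos_def)
  obtain h' where h': "is_iso C h'" "h' \<in> Hom C N N'" "h' \<cdot> h = Idt C N'" "h \<cdot> h' = Idt C N"
    by (rule iso_inv[OF H(2,1)])
  show "is_mono C (i \<cdot> h)" by (rule mono_Comp[OF iso_mono[OF H(2)] D(11)]) (use D(2) H(1) in simp)
  show "is_epi C (g \<cdot> p)" by (rule epi_Comp[OF iso_epi[OF H(4)] D(12)]) (use D(6) H(3) in simp)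
  have O: "N' \<in> Obj C" "M' \<in> Obj C" using H(1,3) by auto
  show "(g \<cdot> p) \<cdot> (i \<cdot> h) = ZeroArr C N' M'" using D(1-9) H O by (simp add: reassoc[OF D(10)])
  fix T t assume t: "t \<in> Hom C T E" "(g \<cdot> p) \<cdot> t = ZeroArr C T M'"
  have "g \<cdot> (p \<cdot> t) = ZeroArr C T M'" using t D(4-6) H(3) by simp
  then have "p \<cdot> t = ZeroArr C T (Dom C g)"
    by (rule mono_Zero[OF iso_mono[OF H(4)]]) (use t(1) D(4-6) H(3) in simp_all)
  then have "p \<cdot> t = ZeroArr C T M" using H(3) by simp
  then obtain u where u: "u \<in> Hom C T N" "i \<cdot> u = t" by (rule sx_lift[OF s t(1)])
  have "(i \<cdot> h) \<cdot> (h' \<cdot> u) = t" using u H(1) h'(2) D(1-3) by (simp add: reassoc[OF h'(4)])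
  then show "\<exists>u\<in>Hom C T N'. (i \<cdot> h) \<cdot> u = t" using u(1) h'(2) by (intro bexI[of _ "h' \<cdot> u"]) auto
qed (use sxD(1-6)[OF assms(1)] h g in \<open>simp_all add: isos_def\<close>)

lemma sx_iso_mid:
  assumes s: "sx C N E M i p" and k: "k \<in> isos E E'" and k': "k' \<in> Hom C E' E" "k' \<cdot> k = Idt C E" "k \<cdot> k' = Idt C E'"
  shows "sx C N E' M (k \<cdot> i) (p \<cdot> k')"
proof (rule sxI)
  note D = sxD[OF s]
  have H: "k \<in> Hom C E E'" "is_iso C k" using k by (auto simp: isos_def)
  have ik': "is_iso C k'" by (rule isoI[of k' k]) (use k' H in simp_all)
  show "is_mono C (k \<cdot> i)" by (rule mono_Comp[OF D(11) iso_mono[OF H(2)]]) (use D(3) H(1) in simp)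
  show "is_epi C (p \<cdot> k')" by (rule epi_Comp[OF D(12) iso_epi[OF ik']]) (use D(5) k'(1) in simp)
  show "(p \<cdot> k') \<cdot> (k \<cdot> i) = ZeroArr C N M" using D(1-10) H(1) k'(1) by (simp add: reassoc[OF k'(2)])
  fix T t assume t: "t \<in> Hom C T E'" "(p \<cdot> k') \<cdot> t = ZeroArr C T M"
  have "p \<cdot> (k' \<cdot> t) = ZeroArr C T M" using t D(4-6) k'(1) by simp
  moreover have "k' \<cdot> t \<in> Hom C T E" using t(1) k'(1) by simp
  ultimately obtain u where u: "u \<in> Hom C T N" "i \<cdot> u = k' \<cdot> t" using sx_lift[OF s] by metis
  have "(k \<cdot> i) \<cdot> u = t" using u(1) t(1) H(1) k'(1) D(1-3) by (simp add: u(2) reassoc[OF k'(3)])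
  then show "\<exists>u\<in>Hom C T N. (k \<cdot> i) \<cdot> u = t" using u(1) by blast
qed (use sxD(1-6)[OF s] k k'(1) in \<open>simp_all add: isos_def\<close>)

lemma sx_coker_unique:
  assumes s: "sx C N E M i p" and s': "sx C N E M' i p'"
  obtains g where "g \<in> isos M M'" "p' = g \<cdot> p"
proof -
  note D = sxD[OF s] and D' = sxD[OF s']
  have H: "p \<in> Hom C E M" "p' \<in> Hom C E M'" using D(4-6) D'(4-6) by simp_all
  obtain g where g: "g \<in> Hom C M M'" "g \<cdot> p = p'" by (rule sx_desc[OF s H(2) D'(10)])
  obtain g' where g': "g' \<in> Hom C M' M" "g' \<cdot> p' = p" by (rule sx_desc[OF s' H(1) D(10)])
  have e1: "(g' \<cdot> g) \<cdot> p = Idt C M \<cdot> p" using g(1) g'(1) H D(9) by (simp add: g(2) g'(2))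
  have 1: "g' \<cdot> g = Idt C M" by (rule epi_cancel[OF D(12) e1]) (use g(1) g'(1) D(6,9) in simp_all)
  have e2: "(g \<cdot> g') \<cdot> p' = Idt C M' \<cdot> p'" using g(1) g'(1) H D'(9) by (simp add: g(2) g'(2))
  have 2: "g \<cdot> g' = Idt C M'" by (rule epi_cancel[OF D'(12) e2]) (use g(1) g'(1) D'(6,9) in simp_all)
  have "is_iso C g" by (rule isoI[of g g']) (use g(1) g'(1) 1 2 in simp_all)
  then show ?thesis using that[of g] g by (simp add: isos_def)
qed

text \<open>Cokernels of a fixed arrow differ by a unique isomorphism, so those with target
  \<open>M'\<close> form a torsor-like copy of \<open>isos M M'\<close>. This is the pattern that
  \<open>gsum_torsor\<close> turns into total weight 1.\<close>

lemma card_cokernels: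
  assumes s: "sx C N E M i p" and M': "M' \<in> Obj C"
  shows "card {p'. sx C N E M' i p'} = card (isos M M')"
proof -
  note D = sxD[OF s]
  have I: "Idt C N \<in> isos N N" using D(7) by (simp add: isos_def)
  have "bij_betw (\<lambda>g. g \<cdot> p) (isos M M') {p'. sx C N E M' i p'}"
    unfolding bij_betw_def
  proof
    show "inj_on (\<lambda>g. g \<cdot> p) (isos M M')"
    proof (rule inj_onI)
      fix g g' assume g: "g \<in> isos M M'" "g' \<in> isos M M'" "g \<cdot> p = g' \<cdot> p"
      show "g = g'" by (rule epi_cancel[OF D(12) g(3)]) (use g(1,2) D(6) in \<open>auto simp: isos_def\<close>)
    qed
    show "(\<lambda>g. g \<cdot> p) ` isos M M' = {p'. sx C N E M' i p'}"
    proof (intro equalityI subsetI)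
      fix x assume "x \<in> (\<lambda>g. g \<cdot> p) ` isos M M'"
      then obtain g where g: "g \<in> isos M M'" "x = g \<cdot> p" by blast
      have "i \<cdot> Idt C N = i" using D(1,2) by simp
      then show "x \<in> {p'. sx C N E M' i p'}" using sx_iso[OF s I g(1)] g(2) by simp
    next
      fix x assume "x \<in> {p'. sx C N E M' i p'}"
      then have "sx C N E M' i x" by simp
      then obtain g where "g \<in> isos M M'" "x = g \<cdot> p" by (rule sx_coker_unique[OF s])
      then show "x \<in> (\<lambda>g. g \<cdot> p) ` isos M M'" by blast
    qed
  qed
  from bij_betw_same_card[OF this] show ?thesis by simp
qed

text \<open>The order of arguments follows \<open>Hall_number\<close>: quotient, subobject, middle
  term.\<close>

definition sesm :: "'o \<Rightarrow> 'o \<Rightarrow> 'o \<Rightarrow> ('m \<times> 'm) set" where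
  "sesm A B M = {(i, p). sx C B M A i p}"

lemma sx_of_mono:
  assumes "is_mono C i" "is_cokernel C p i"
  shows "sx C (Dom C i) (Cod C i) (Cod C p) i p"
proof -
  have k: "is_kernel C i p" by (rule mono_kernel_of_cokernel[OF assms])
  have "Dom C p = Cod C i" using kernelD[OF k] by simp
  then show ?thesis using kernel_sx[OF k cokernel_epi[OF assms(2)]] by simp
qed

lemma mono_equiv_class:
  assumes "is_mono C i" "Cod C i = M"
  shows "mono_equiv C M `` {i} = {i \<cdot> h |h. \<exists>N. h \<in> isos N (Dom C i)}"
proof (intro equalityI subsetI)
  have iH: "i \<in> Hom C (Dom C i) M" using assms mono_Arr by simp
  fix j
  {
    assume "j \<in> mono_equiv C M `` {i}"
    then obtain h where j: "is_mono C j" "Cod C j = M" and h: "h \<in> Hom C (Dom C i) (Dom C j)" "is_iso C h" "j \<cdot> h = i"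
      unfolding mono_equiv_def by blast
    obtain h' where h': "is_iso C h'" "h' \<in> Hom C (Dom C j) (Dom C i)" "h' \<cdot> h = Idt C (Dom C i)" "h \<cdot> h' = Idt C (Dom C j)"
      by (rule iso_inv[OF h(2,1)])
    have "i \<cdot> h' = (j \<cdot> h) \<cdot> h'" by (simp only: h(3))
    also have "\<dots> = j" using mono_Arr[OF j(1)] h(1) h'(2,4) by simp
    finally show "j \<in> {i \<cdot> h |h. \<exists>N. h \<in> isos N (Dom C i)}" using h'(1,2) unfolding isos_def by blast
  next
    assume "j \<in> {i \<cdot> h |h. \<exists>N. h \<in> isos N (Dom C i)}"
    then obtain h N where h: "h \<in> Hom C N (Dom C i)" "is_iso C h" and j: "j = i \<cdot> h" unfolding isos_def by blast
    obtain h' where h': "is_iso C h'" "h' \<in> Hom C (Dom C i) N" "h' \<cdot> h = Idt C N" "h \<cdot> h' = Idt C (Dom C i)"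
      by (rule iso_inv[OF h(2,1)])
    have "is_mono C j" unfolding j by (rule mono_Comp[OF iso_mono[OF h(2)] assms(1)]) (use h(1) in simp)
    moreover have "Cod C j = M" "Dom C j = N" "j \<cdot> h' = i" unfolding j using iH h(1) h'(2,4) by simp_all
    ultimately show "j \<in> mono_equiv C M `` {i}" using assms h' unfolding mono_equiv_def by blast
  }
qed

lemma mono_equiv_equiv: "equiv {i. is_mono C i \<and> Cod C i = M} (mono_equiv C M)"
proof (rule equivI)
  show "mono_equiv C M \<subseteq> {i. is_mono C i \<and> Cod C i = M} \<times> {i. is_mono C i \<and> Cod C i = M}"
    by (auto simp: mono_equiv_def)
  show "refl_on {i. is_mono C i \<and> Cod C i = M} (mono_equiv C M)"
  proof (rule refl_onI)
    fix i assume i: "i \<in> {i. is_mono C i \<and> Cod C i = M}"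
    then have A: "i \<in> Arr C" using mono_Arr by blast
    then have "i \<cdot> Idt C (Dom C i) = i" "Idt C (Dom C i) \<in> Hom C (Dom C i) (Dom C i)" "is_iso C (Idt C (Dom C i))"
      by simp_all
    then show "(i, i) \<in> mono_equiv C M" using i unfolding mono_equiv_def by blast
  qed
  show "sym (mono_equiv C M)"
  proof (rule symI)
    fix i j assume "(i, j) \<in> mono_equiv C M"
    then obtain h where i: "is_mono C i" "Cod C i = M" and j: "is_mono C j" "Cod C j = M"
      and h: "h \<in> Hom C (Dom C i) (Dom C j)" "is_iso C h" "j \<cdot> h = i"
      unfolding mono_equiv_def by blast
    then have "i \<in> {j \<cdot> h |h. \<exists>N. h \<in> isos N (Dom C j)}" unfolding isos_def by blast
    then show "(j, i) \<in> mono_equiv C M" using mono_equiv_class[OF j] by blast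
  qed
  show "trans (mono_equiv C M)"
  proof (rule transI)
    fix i j k assume "(i, j) \<in> mono_equiv C M" "(j, k) \<in> mono_equiv C M"
    then obtain h g where i: "is_mono C i" "Cod C i = M" and k: "is_mono C k" "Cod C k = M" and j: "is_mono C j"
      and h: "h \<in> Hom C (Dom C i) (Dom C j)" "is_iso C h" "j \<cdot> h = i"
      and g: "g \<in> Hom C (Dom C j) (Dom C k)" "is_iso C g" "k \<cdot> g = j"
      unfolding mono_equiv_def by blast
    have "is_iso C (g \<cdot> h)" by (rule iso_Comp[OF h(2) g(2)]) (use h(1) g(1) in simp)
    moreover have "k \<cdot> (g \<cdot> h) = i" using h g mono_Arr[OF k(1)] by (simp add: reassoc[OF g(3)])
    moreover have "g \<cdot> h \<in> Hom C (Dom C i) (Dom C k)" using h(1) g(1) by simp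
    ultimately show "(i, k) \<in> mono_equiv C M" using i k unfolding mono_equiv_def by blast
  qed
qed

end

section \<open>Hall numbers and weighted sums over isomorphism classes\<close>

context finitary_lifting_category
begin

lemma finite_isos [simp]: "A \<in> Obj C \<Longrightarrow> B \<in> Obj C \<Longrightarrow> finite (isos A B)"
  by (rule finite_subset[of _ "Hom C A B"]) (auto simp: isos_def fin_Hom simp del: Hom_iff)

lemma card_Aut_pos: "A \<in> Obj C \<Longrightarrow> card (Aut C A) > 0"
proof -
  assume A: "A \<in> Obj C"
  then have "Idt C A \<in> Aut C A" by (simp add: Aut_isos isos_def)
  then show ?thesis using finite_isos[OF A A] by (auto simp: card_gt_0_iff Aut_isos)
qed

lemma finite_sesm [simp]:
  assumes "A \<in> Obj C" "B \<in> Obj C" "M \<in> Obj C"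
  shows "finite (sesm A B M)"
proof (rule finite_subset)
  show "sesm A B M \<subseteq> Hom C B M \<times> Hom C M A"
    using sxD(1-6) by (fastforce simp: sesm_def)
qed (use assms fin_Hom in \<open>simp del: Hom_iff\<close>)

text \<open>The product of the two automorphism groups acts freely on the short exact sequences, and
  its orbits correspond to the subobjects counted by the Hall number.\<close>

lemma card_sesm:
  assumes A: "A \<in> Obj C" and B: "B \<in> Obj C" and M: "M \<in> Obj C"
  shows "card (sesm A B M) = Hall_number C A B M * (card (Aut C B) * card (Aut C A))"
proof -
  \<comment> \<open>Sends a sequence to the subobject it defines; the fibres of
    \<open>\<Phi>\<close> are the orbits of the two automorphism groups.\<close>
  define \<Phi> where "\<Phi> = (\<lambda>(i :: 'm, p :: 'm). mono_equiv C M `` {i})"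
  have "\<Phi> ` sesm A B M = {T \<in> subobjects C M. \<exists>i \<in> T. isomorphic C (Dom C i) B \<and>
       (\<exists>p. is_cokernel C p i \<and> isomorphic C (Cod C p) A)}" (is "?L = ?R")
  proof (intro equalityI subsetI)
    fix T assume "T \<in> ?L"
    then obtain i p where s: "sx C B M A i p" and T: "T = mono_equiv C M `` {i}"
      unfolding sesm_def \<Phi>_def by auto
    note D = sxD[OF s]
    have im: "i \<in> {i. is_mono C i \<and> Cod C i = M}" using D(3,11) by simp
    have "T \<in> subobjects C M" unfolding T subobjects_def using im by (rule quotientI)
    moreover have "i \<in> T" unfolding T by (rule equiv_class_self[OF mono_equiv_equiv im])
    ultimately show "T \<in> ?R" using D(2,6,14) isomorphic_refl[OF A] isomorphic_refl[OF B] by blast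
  next
    fix T assume "T \<in> ?R"
    then obtain i p where T: "T \<in> subobjects C M" "i \<in> T" and iB: "isomorphic C (Dom C i) B"
      and p: "is_cokernel C p i" "isomorphic C (Cod C p) A" by blast
    obtain i0 where "is_mono C i0" "Cod C i0 = M" "T = mono_equiv C M `` {i0}"
      using T(1) unfolding subobjects_def by (auto elim: quotientE)
    then have i: "is_mono C i" "Cod C i = M" "T = mono_equiv C M `` {i}"
      using T(2) equiv_class_eq[OF mono_equiv_equiv, of i0 i M] by (auto simp: mono_equiv_def)
    have s: "sx C (Dom C i) M (Cod C p) i p" using sx_of_mono[OF i(1) p(1)] i(2) by simp
    obtain h g where hg: "h \<in> isos B (Dom C i)" "g \<in> isos (Cod C p) A"
      using isomorphic_sym[OF iB] p(2) unfolding isomorphic_def isos_def by blast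
    have s': "sx C B M A (i \<cdot> h) (g \<cdot> p)" by (rule sx_iso[OF s hg])
    have "i \<cdot> h \<in> mono_equiv C M `` {i}" unfolding mono_equiv_class[OF i(1,2)] using hg(1) by blast
    then have "T = mono_equiv C M `` {i \<cdot> h}" unfolding i(3) using equiv_class_eq[OF mono_equiv_equiv] by blast
    then have "T = \<Phi> (i \<cdot> h, g \<cdot> p)" by (simp add: \<Phi>_def)
    moreover have "(i \<cdot> h, g \<cdot> p) \<in> sesm A B M" using s' by (simp add: sesm_def)
    ultimately show "T \<in> ?L" by blast
  qed
  then have H: "card (\<Phi> ` sesm A B M) = Hall_number C A B M" unfolding Hall_number_def by simp
  show ?thesis unfolding H[symmetric]
  proof (rule card_eq_card_image_mult)
    fix x assume "x \<in> sesm A B M"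
    then obtain i p where x: "x = (i, p)" and s: "sx C B M A i p" unfolding sesm_def by auto
    note D = sxD[OF s]
    have "bij_betw (\<lambda>(h, g). (i \<cdot> h, g \<cdot> p)) (isos B B \<times> isos A A) {y \<in> sesm A B M. \<Phi> y = \<Phi> x}"
      unfolding bij_betw_def
    proof
      show "inj_on (\<lambda>(h, g). (i \<cdot> h, g \<cdot> p)) (isos B B \<times> isos A A)"
      proof (rule inj_onI)
        fix y z assume yz: "y \<in> isos B B \<times> isos A A" "z \<in> isos B B \<times> isos A A"
          "(\<lambda>(h, g). (i \<cdot> h, g \<cdot> p)) y = (\<lambda>(h, g). (i \<cdot> h, g \<cdot> p)) z"
        obtain h g h' g' where y: "y = (h, g)" "h \<in> isos B B" "g \<in> isos A A"
          and z: "z = (h', g')" "h' \<in> isos B B" "g' \<in> isos A A" using yz(1,2) by blast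
        have e: "i \<cdot> h = i \<cdot> h'" "g \<cdot> p = g' \<cdot> p" using yz(3) y(1) z(1) by simp_all
        have "h = h'" by (rule mono_cancel[OF D(11) e(1)]) (use y z D(2) in \<open>auto simp: isos_def\<close>)
        moreover have "g = g'" by (rule epi_cancel[OF D(12) e(2)]) (use y z D(6) in \<open>auto simp: isos_def\<close>)
        ultimately show "y = z" using y(1) z(1) by simp
      qed
      show "(\<lambda>(h, g). (i \<cdot> h, g \<cdot> p)) ` (isos B B \<times> isos A A) = {y \<in> sesm A B M. \<Phi> y = \<Phi> x}"
      proof (intro equalityI subsetI)
        fix y assume "y \<in> (\<lambda>(h, g). (i \<cdot> h, g \<cdot> p)) ` (isos B B \<times> isos A A)"
        then obtain h g where y: "y = (i \<cdot> h, g \<cdot> p)" "h \<in> isos B B" "g \<in> isos A A" by auto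
        have "i \<cdot> h \<in> mono_equiv C M `` {i}" unfolding mono_equiv_class[OF D(11,3)] D(2) using y(2) by blast
        then have "\<Phi> y = \<Phi> x" unfolding y(1) x \<Phi>_def using equiv_class_eq[OF mono_equiv_equiv, of i "i \<cdot> h" M] by simp
        then show "y \<in> {y \<in> sesm A B M. \<Phi> y = \<Phi> x}" using sx_iso[OF s y(2,3)] y(1) by (simp add: sesm_def)
      next
        fix y assume "y \<in> {y \<in> sesm A B M. \<Phi> y = \<Phi> x}"
        then obtain i' p' where y: "y = (i', p')" and s': "sx C B M A i' p'" and e: "\<Phi> (i', p') = \<Phi> (i, p)"
          unfolding x sesm_def by auto
        note D' = sxD[OF s']
        have "i' \<in> mono_equiv C M `` {i'}"
          by (rule equiv_class_self[OF mono_equiv_equiv]) (use D'(3,11) in simp)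
        then have "i' \<in> mono_equiv C M `` {i}" using e unfolding \<Phi>_def prod.case by blast
        then obtain h N where h: "h \<in> isos N B" "i' = i \<cdot> h"
          unfolding mono_equiv_class[OF D(11,3)] D(2) by blast
        have "N = B" using h D'(1,2) D(1,2) by (simp add: isos_def)
        then have h': "h \<in> isos B B" using h(1) by simp
        have "sx C B M A (i \<cdot> h) (Idt C A \<cdot> p)"
          by (rule sx_iso[OF s h']) (use A in \<open>simp add: isos_def\<close>)
        then have s2: "sx C B M A i' p" using D(4,6) h(2) by simp
        obtain g where g: "g \<in> isos A A" "p' = g \<cdot> p" by (rule sx_coker_unique[OF s2 s'])
        show "y \<in> (\<lambda>(h, g). (i \<cdot> h, g \<cdot> p)) ` (isos B B \<times> isos A A)" unfolding y h(2) g(2)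
          by (rule image_eqI[of _ _ "(h, g)"]) (use h' g(1) in simp_all)
      qed
    qed
    from bij_betw_same_card[OF this, symmetric]
    show "card {y \<in> sesm A B M. \<Phi> y = \<Phi> x} = card (Aut C B) * card (Aut C A)"
      by (simp add: card_cartesian_product Aut_isos)
  qed (use assms in simp)
qed

text \<open>Sums over isomorphism classes weighted by the inverse orders of the automorphism groups,
  i.e.\ integrals over the groupoid of objects.\<close>

definition gsum :: "('o \<Rightarrow> ennreal) \<Rightarrow> ennreal"  (binder "\<Sum>\<^sub>g" 10) where
  "gsum f = (\<integral>\<^sup>+m. ennreal (1 / real (card (Aut C (rep m)))) * f (rep m) \<partial>count_space (Iso C))"

lemma gsum_cong: "(\<And>M. M \<in> Obj C \<Longrightarrow> f M = g M) \<Longrightarrow> gsum f = gsum g"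
  unfolding gsum_def by (rule nn_integral_cong) (simp add: rep_Iso)

lemma gsum_swap: "(\<Sum>\<^sub>g M. \<Sum>\<^sub>g N. f M N) = (\<Sum>\<^sub>g N. \<Sum>\<^sub>g M. f M N)"
proof -
  have "(\<Sum>\<^sub>g M. \<Sum>\<^sub>g N. f M N) = (\<integral>\<^sup>+m. \<integral>\<^sup>+n. ennreal (1 / real (card (Aut C (rep m)))) *
      (ennreal (1 / real (card (Aut C (rep n)))) * f (rep m) (rep n)) \<partial>count_space (Iso C) \<partial>count_space (Iso C))"
    unfolding gsum_def by (simp add: nn_integral_cmult)
  also have "\<dots> = (\<integral>\<^sup>+n. \<integral>\<^sup>+m. ennreal (1 / real (card (Aut C (rep m)))) *
      (ennreal (1 / real (card (Aut C (rep n)))) * f (rep m) (rep n)) \<partial>count_space (Iso C) \<partial>count_space (Iso C))"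
    by (rule nn_integral_count_space_swap)
  also have "\<dots> = (\<Sum>\<^sub>g N. \<Sum>\<^sub>g M. f M N)"
    unfolding gsum_def by (simp add: mult.left_commute nn_integral_cmult flip: nn_integral_cmult)
  finally show ?thesis .
qed

lemma gsum_cmult: "(\<Sum>\<^sub>g M. c * f M) = c * gsum f"
  unfolding gsum_def by (simp add: mult.left_commute nn_integral_cmult)

lemma gsum_multc: "(\<Sum>\<^sub>g M. f M * c) = gsum f * c"
  using gsum_cmult[of c f] by (simp add: mult.commute)

lemma gsum_sum: "finite S \<Longrightarrow> (\<Sum>\<^sub>g M. \<Sum>x\<in>S. f x M) = (\<Sum>x\<in>S. \<Sum>\<^sub>g M. f x M)"
  unfolding gsum_def by (simp add: sum_distrib_left nn_integral_sum)

text \<open>Only the class of \<open>A\<close> contributes, and there the number of isomorphisms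
  cancels the weight.\<close>

lemma gsum_isos:
  assumes "A \<in> Obj C"
  shows "(\<Sum>\<^sub>g M. of_nat (card (isos A M)) * f M) = f (rep (iso_class C A))"
proof -
  let ?a = "iso_class C A"
  have "ennreal (1 / real (card (Aut C (rep m)))) * (of_nat (card (isos A (rep m))) * f (rep m)) =
      f (rep ?a) * indicator {?a} m" if m: "m \<in> Iso C" for m
  proof (cases "m = ?a")
    case True
    have "card (isos A (rep m)) = card (Aut C (rep m))"
      using card_isos[OF assms rep_Iso(1)[OF m]] isomorphic_rep[OF assms] True by simp
    moreover have "ennreal (1 / real (card (Aut C (rep m)))) * of_nat (card (Aut C (rep m))) = 1"
      using card_Aut_pos[OF rep_Iso(1)[OF m]]
      by (simp add: ennreal_of_nat_eq_real_of_nat flip: ennreal_mult')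
    ultimately show ?thesis using True by (simp flip: mult.assoc)
  next
    case False
    then have "\<not> isomorphic C A (rep m)"
      using iso_class_eq_iff[OF assms rep_Iso(1)[OF m]] rep_Iso(2)[OF m] by auto
    then show ?thesis using False card_isos[OF assms rep_Iso(1)[OF m]] by simp
  qed
  then have "(\<Sum>\<^sub>g M. of_nat (card (isos A M)) * f M) =
      (\<integral>\<^sup>+m. f (rep ?a) * indicator {?a} m \<partial>count_space (Iso C))"
    unfolding gsum_def by (intro nn_integral_cong) simp
  also have "\<dots> = f (rep ?a)" using iso_class_Iso[OF assms] by (subst nn_integral_cmult_indicator) auto
  finally show ?thesis .
qed

text \<open>A structure that exists exactly once up to unique isomorphism has total weight 1.
  Kernels, cokernels and image factorizations are counted in this way.\<close>

lemma gsum_torsor: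
  assumes "A \<in> Obj C" "\<And>M. M \<in> Obj C \<Longrightarrow> card (\<Omega> M) = card (isos A M)"
  shows "(\<Sum>\<^sub>g M. of_nat (card (\<Omega> M))) = 1"
proof -
  have "(\<Sum>\<^sub>g M. of_nat (card (\<Omega> M))) = (\<Sum>\<^sub>g M. of_nat (card (isos A M)) * 1)"
    by (rule gsum_cong) (simp add: assms(2))
  then show ?thesis using gsum_isos[OF assms(1), of "\<lambda>_. 1"] by simp
qed

end

section \<open>Counting flags\<close>

context abelian_category
begin

text \<open>The diagonal filler of a square with an epimorphism on one side and a monomorphism on
  the other: \<open>t\<close> composed with the cokernel of \<open>l\<close> vanishes because this
  holds after composing with the epimorphism \<open>r\<close>.\<close>

lemma mono_epi_lift:
  assumes l: "is_mono C l" "l \<in> Hom C b I" and r: "is_epi C r" "r \<in> Hom C A T"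
    and t: "t \<in> Hom C T I" and y: "y \<in> Hom C A b" and e: "t \<cdot> r = l \<cdot> y"
  obtains u where "u \<in> Hom C T b" "l \<cdot> u = t"
proof -
  have "l \<in> Arr C" using l(2) by simp
  then obtain d where d: "is_cokernel C d l" using cokernel_exists by blast
  note dD = cokernelD[OF d]
  have "(d \<cdot> t) \<cdot> r = (d \<cdot> l) \<cdot> y" using dD(1,3) t r(2) l(2) y e by simp
  also have "\<dots> = ZeroArr C A (Cod C d)" using dD l(2) y by simp
  finally have "d \<cdot> t = ZeroArr C (Cod C r) (Cod C d)"
    by (rule epi_Zero[OF r(1)]) (use dD(1,3) l(2) t r(2) in simp_all)
  then have dt: "d \<cdot> t = ZeroArr C T (Cod C d)" using r(2) by simp
  obtain u where "u \<in> Arr C" "Dom C u = Dom C t" "Cod C u = Dom C l" "l \<cdot> u = t"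
    by (rule kernel_lift[OF mono_kernel_of_cokernel[OF l(1) d] _ _ dt]) (use t dD(3) l(2) in simp_all)
  then show ?thesis using that t l(2) by simp
qed

text \<open>The third isomorphism theorem: modulo \<open>c\<close>, the subobject \<open>N\<close>
  of \<open>A\<close> becomes \<open>b\<close>, and the quotient \<open>a\<close> stays the same.
  Generalized elements of a quotient are lifted by pulling back an extension by
  \<open>c\<close>.\<close>

lemma subquotient_sx:
  assumes s: "sx C N A a i p" and j: "sx C c N b j q" and r: "sx C c A I (i \<cdot> j) r"
    and s': "s \<in> Hom C I a" "s \<cdot> r = p" and l: "l \<in> Hom C b I" "l \<cdot> q = r \<cdot> i"
  shows "sx C b I a l s"
proof (rule sxI)
  note D = sxD[OF s] and Dj = sxD[OF j] and Dr = sxD[OF r]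
  show lm: "is_mono C l"
  proof (rule monoI)
    fix t assume t: "t \<in> Arr C" "Cod C t = Dom C l" "l \<cdot> t = ZeroArr C (Dom C t) (Cod C l)"
    have tH: "t \<in> Hom C (Dom C t) b" and T: "Dom C t \<in> Obj C" using t(1,2) l(1) by simp_all
    obtain N' j' q' h where s1: "sx C c N' (Dom C t) j' q'" and h: "h \<in> Hom C N' N" "h \<cdot> j' = j" "q \<cdot> h = t \<cdot> q'"
      by (rule pull_sx[OF j tH])
    note D1 = sxD[OF s1]
    have "r \<cdot> (i \<cdot> h) = l \<cdot> (q \<cdot> h)" using D(1-3) Dj(4-6) Dr(4-6) h(1) l(1) by (simp add: reassoc[OF l(2)])
    also have "\<dots> = (l \<cdot> t) \<cdot> q'" using h(3) tH D1(4-6) l(1) by simp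
    also have "\<dots> = ZeroArr C N' I" using t(3) D1(4-6) l(1) T Dr(9) by simp
    finally have z: "r \<cdot> (i \<cdot> h) = ZeroArr C N' I" .
    have ih: "i \<cdot> h \<in> Hom C N' A" using D(1-3) h(1) by simp
    obtain y where y: "y \<in> Hom C N' c" "(i \<cdot> j) \<cdot> y = i \<cdot> h" by (rule sx_lift[OF r ih z])
    have e: "i \<cdot> (j \<cdot> y) = i \<cdot> h" using y D(1-3) Dj(1-3) by simp
    have "j \<cdot> y = h" by (rule mono_cancel[OF D(11) e]) (use y(1) h(1) D(2) Dj(1-3) in simp_all)
    then have "t \<cdot> q' = q \<cdot> (j \<cdot> y)" using h(3) by simp
    also have "\<dots> = ZeroArr C N' b" using y(1) Dj(1-10) by (simp add: reassoc[OF Dj(10)])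
    finally have "t = ZeroArr C (Cod C q') b" by (rule epi_Zero[OF D1(12)]) (use tH D1(4-6) in simp_all)
    then show "t = ZeroArr C (Dom C t) (Dom C l)" using D1(6) l(1) by simp
  qed (use l(1) in simp)
  show "is_epi C s" by (rule epi_of_Comp[where g = r]) (use s' D(12) Dr(4-6) in simp_all)
  show "l \<in> Hom C b I" "s \<in> Hom C I a" by fact+
  have "(s \<cdot> l) \<cdot> q = (s \<cdot> r) \<cdot> i" using s'(1) l Dr(4-6) Dj(4-6) D(1-3) by simp
  also have "\<dots> = ZeroArr C N a" unfolding s'(2) by (rule D(10))
  finally have "s \<cdot> l = ZeroArr C (Cod C q) a" by (rule epi_Zero[OF Dj(12)]) (use s'(1) l(1) Dj(4-6) in simp_all)
  then show "s \<cdot> l = ZeroArr C b a" using Dj(6) by simp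
  fix T t assume t: "t \<in> Hom C T I" "s \<cdot> t = ZeroArr C T a"
  have T: "T \<in> Obj C" using t(1) by auto
  obtain A' k' r' h where s1: "sx C c A' T k' r'" and h: "h \<in> Hom C A' A" "h \<cdot> k' = i \<cdot> j" "r \<cdot> h = t \<cdot> r'"
    by (rule pull_sx[OF r t(1)])
  note D1 = sxD[OF s1]
  have "p \<cdot> h = s \<cdot> (r \<cdot> h)" using h(1) s'(1) Dr(4-6) by (simp add: reassoc[OF s'(2)])
  also have "\<dots> = ZeroArr C A' a"
    unfolding h(3) using t s'(1) D1(4-6) D(9) by (simp add: reassoc[OF t(2)])
  finally have "p \<cdot> h = ZeroArr C A' a" .
  then obtain z where z: "z \<in> Hom C A' N" "i \<cdot> z = h" by (rule sx_lift[OF s h(1)])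
  have "t \<cdot> r' = r \<cdot> (i \<cdot> z)" using h(3) z(2) by simp
  also have "\<dots> = l \<cdot> (q \<cdot> z)" using z(1) D(1-3) Dr(4-6) Dj(4-6) l(1) by (simp add: reassoc[OF l(2)])
  finally have e: "t \<cdot> r' = l \<cdot> (q \<cdot> z)" .
  have rH: "r' \<in> Hom C A' T" and qz: "q \<cdot> z \<in> Hom C A' b" using D1(4-6) z(1) Dj(4-6) by simp_all
  obtain u where "u \<in> Hom C T b" "l \<cdot> u = t" by (rule mono_epi_lift[OF lm l(1) D1(12) rH t(1) qz e])
  then show "\<exists>u\<in>Hom C T b. l \<cdot> u = t" by blast
qed

text \<open>Compatibility of the two ways to record a filtration of \<open>A\<close> with subquotients \<open>a, b, c\<close>.\<close>

definition flag_compat :: "('m \<times> 'm) \<times> 'm \<times> 'm \<Rightarrow> ('m \<times> 'm) \<times> 'm \<times> 'm \<Rightarrow> bool" where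
  "flag_compat = (\<lambda>((i, p), (j, q)) ((k, r), (l, s)). k = i \<cdot> j \<and> p = s \<cdot> r \<and> r \<cdot> i = l \<cdot> q)"

text \<open>Compatibility fixes the inclusion as \<open>i \<cdot> j\<close>. A choice of its
  cokernel \<open>r\<close> then determines \<open>l\<close> and \<open>s\<close>, because
  \<open>q\<close> and \<open>r\<close> are epi, and \<open>subquotient_sx\<close> shows that they
  exist.\<close>

lemma card_flags_right:
  assumes s: "sx C N A a i p" and j: "sx C c N b j q"
  shows "card {y \<in> sesm I c A \<times> sesm a b I. flag_compat ((i, p), (j, q)) y} = card {r. sx C c A I (i \<cdot> j) r}"
proof -
  note D = sxD[OF s] and Dj = sxD[OF j]
  have "bij_betw (\<lambda>y. snd (fst y)) {y \<in> sesm I c A \<times> sesm a b I. flag_compat ((i, p), (j, q)) y}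
      {r. sx C c A I (i \<cdot> j) r}"
    unfolding bij_betw_def
  proof
    show "inj_on (\<lambda>y. snd (fst y)) {y \<in> sesm I c A \<times> sesm a b I. flag_compat ((i, p), (j, q)) y}"
    proof (rule inj_onI)
      fix y y' assume y: "y \<in> {y \<in> sesm I c A \<times> sesm a b I. flag_compat ((i, p), (j, q)) y}"
        "y' \<in> {y \<in> sesm I c A \<times> sesm a b I. flag_compat ((i, p), (j, q)) y}"
        and e: "snd (fst y) = snd (fst y')"
      obtain k r l s where y1: "y = ((k, r), (l, s))" by (metis surj_pair)
      obtain k' r' l' s' where y2: "y' = ((k', r'), (l', s'))" by (metis surj_pair)
      have a1: "sx C c A I (i \<cdot> j) r" "sx C b I a l s" "k = i \<cdot> j" "p = s \<cdot> r" "r \<cdot> i = l \<cdot> q"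
        using y(1) unfolding y1 sesm_def flag_compat_def by auto
      have a2: "sx C c A I (i \<cdot> j) r'" "sx C b I a l' s'" "k' = i \<cdot> j" "p = s' \<cdot> r'" "r' \<cdot> i = l' \<cdot> q"
        using y(2) unfolding y2 sesm_def flag_compat_def by auto
      have rr: "r' = r" using e unfolding y1 y2 by simp
      have e1: "s \<cdot> r = s' \<cdot> r" "l \<cdot> q = l' \<cdot> q" using a1(4,5) a2(4,5) rr by simp_all
      have "s = s'" by (rule epi_cancel[OF sxD(12)[OF a1(1)] e1(1)])
        (use sxD(4-6)[OF a1(1)] sxD(4-6)[OF a1(2)] sxD(4-6)[OF a2(2)] in simp_all)
      moreover have "l = l'" by (rule epi_cancel[OF Dj(12) e1(2)])
        (use Dj(4-6) sxD(1-3)[OF a1(2)] sxD(1-3)[OF a2(2)] in simp_all)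
      ultimately show "y = y'" unfolding y1 y2 using a1(3) a2(3) rr by simp
    qed
    show "(\<lambda>y. snd (fst y)) ` {y \<in> sesm I c A \<times> sesm a b I. flag_compat ((i, p), (j, q)) y} =
      {r. sx C c A I (i \<cdot> j) r}"
    proof (intro equalityI subsetI)
      fix r assume "r \<in> (\<lambda>y. snd (fst y)) ` {y \<in> sesm I c A \<times> sesm a b I. flag_compat ((i, p), (j, q)) y}"
      then show "r \<in> {r. sx C c A I (i \<cdot> j) r}" unfolding sesm_def flag_compat_def by auto
    next
      fix r assume "r \<in> {r. sx C c A I (i \<cdot> j) r}"
      then have r: "sx C c A I (i \<cdot> j) r" by simp
      note Dr = sxD[OF r]
      have pH: "p \<in> Hom C A a" and riH: "r \<cdot> i \<in> Hom C N I" using D(1-6) Dr(4-6) by simp_all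
      have "p \<cdot> (i \<cdot> j) = ZeroArr C c a" using D(1-10) Dj(1-3,7) by (simp add: reassoc[OF D(10)])
      then obtain s' where s': "s' \<in> Hom C I a" "s' \<cdot> r = p" by (rule sx_desc[OF r pH])
      have "(r \<cdot> i) \<cdot> j = ZeroArr C c I" using Dr(1-10) D(1-3) Dj(1-3) by simp
      then obtain l where l: "l \<in> Hom C b I" "l \<cdot> q = r \<cdot> i" by (rule sx_desc[OF j riH])
      have "sx C b I a l s'" by (rule subquotient_sx[OF s j r s' l])
      then have "((i \<cdot> j, r), (l, s')) \<in> {y \<in> sesm I c A \<times> sesm a b I. flag_compat ((i, p), (j, q)) y}"
        using r s'(2) l(2) unfolding sesm_def flag_compat_def by simp
      then show "r \<in> (\<lambda>y. snd (fst y)) ` {y \<in> sesm I c A \<times> sesm a b I. flag_compat ((i, p), (j, q)) y}"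
        by force
    qed
  qed
  then show ?thesis by (rule bij_betw_same_card)
qed

lemma sesm_op: "(p, i) \<in> abelian_category.sesm (op_cat C) B A M \<longleftrightarrow> (i, p) \<in> sesm A B M"
  unfolding abelian_category.sesm_def[OF abelian_category_op] sesm_def by simp

text \<open>The opposite category interchanges the two descriptions of a filtration, so this is the
  dual count.\<close>

lemma card_flags_left:
  assumes r: "sx C c A I k r" and s: "sx C b I a l s"
  shows "card {x \<in> sesm a N A \<times> sesm b c N. flag_compat x ((k, r), (l, s))} = card {i. sx C N A a i (s \<cdot> r)}"
proof -
  interpret op: abelian_category K "op_cat C" by (rule abelian_category_op)
  have "card {x \<in> sesm a N A \<times> sesm b c N. flag_compat x ((k, r), (l, s))} =
    card {y \<in> op.sesm N a A \<times> op.sesm c b N. op.flag_compat ((r, k), (s, l)) y}"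
  proof (rule bij_betw_same_card[of "\<lambda>((i, p), (j, q)). ((p, i), (q, j))"],
      rule bij_betwI[where g = "\<lambda>((i, p), (j, q)). ((p, i), (q, j))"])
  qed (auto simp: sesm_op flag_compat_def op.flag_compat_def)
  also have "\<dots> = card {i. sx (op_cat C) a A N (r \<cdot>\<^bsub>op_cat C\<^esub> s) i}"
    by (rule op.card_flags_right) (use r s in simp_all)
  finally show ?thesis by simp
qed

text \<open>A factorization is determined by its epi part, and the possible epi parts are precisely
  the cokernels of the fixed kernel \<open>k\<close>.\<close>

lemma image_factorizations:
  assumes s: "sx C N B Q k e" and m: "is_mono C m" "m \<in> Hom C Q A" "m \<cdot> e = f" and Q': "Q' \<in> Obj C"
  shows "card {(e', m'). is_epi C e' \<and> e' \<in> Hom C B Q' \<and> is_mono C m' \<and> m' \<in> Hom C Q' A \<and> m' \<cdot> e' = f} =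
    card (isos Q Q')" (is "card ?S = _")
proof -
  note D = sxD[OF s]
  have A: "A \<in> Obj C" using m(2) by auto
  have fk: "f \<cdot> k = ZeroArr C N A" unfolding m(3)[symmetric] using m(2) D(1-10) by simp
  have "bij_betw fst ?S {e'. sx C N B Q' k e'}"
    unfolding bij_betw_def
  proof
    show "inj_on fst ?S"
    proof (rule inj_onI)
      fix x y assume "x \<in> ?S" "y \<in> ?S" and xy: "fst x = fst y"
      then obtain e1 m1 m2 where x: "x = (e1, m1)" "y = (e1, m2)" and e1: "is_epi C e1" "e1 \<in> Hom C B Q'"
        and m1: "m1 \<in> Hom C Q' A" "m1 \<cdot> e1 = f" "m2 \<in> Hom C Q' A" "m2 \<cdot> e1 = f" by (auto simp del: Hom_iff)
      have "m1 \<cdot> e1 = m2 \<cdot> e1" using m1 by simp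
      then have "m1 = m2" by (rule epi_cancel[OF e1(1)]) (use e1(2) m1 in simp_all)
      then show "x = y" using x by simp
    qed
    show "fst ` ?S = {e'. sx C N B Q' k e'}"
    proof (intro equalityI subsetI)
      fix e' assume "e' \<in> fst ` ?S"
      then obtain m' where e': "is_epi C e'" "e' \<in> Hom C B Q'" and m': "is_mono C m'" "m' \<in> Hom C Q' A" "m' \<cdot> e' = f"
        by (auto simp del: Hom_iff)
      have "m' \<cdot> (e' \<cdot> k) = ZeroArr C N A" using m'(2) e'(2) D(1-3) fk by (simp add: reassoc[OF m'(3)])
      then have "e' \<cdot> k = ZeroArr C N (Dom C m')" by (rule mono_Zero[OF m'(1)]) (use m'(2) e'(2) D(1-3) in simp_all)
      then have ek: "e' \<cdot> k = ZeroArr C N Q'" using m'(2) by simp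
      have "sx C N B Q' k e'"
      proof (rule sxI[OF D(11) e'(1) _ e'(2) ek])
        show "k \<in> Hom C N B" using D(1-3) by simp
        fix T t assume t: "t \<in> Hom C T B" "e' \<cdot> t = ZeroArr C T Q'"
        have T: "T \<in> Obj C" using t(1) by auto
        have "m \<cdot> (e \<cdot> t) = m' \<cdot> (e' \<cdot> t)"
          using t(1) m(2) m'(2) e'(2) D(4-6) by (simp add: reassoc[OF m(3)] reassoc[OF m'(3)])
        also have "\<dots> = ZeroArr C T A" unfolding t(2) using T m'(2) by simp
        finally have "e \<cdot> t = ZeroArr C T (Dom C m)" by (rule mono_Zero[OF m(1)]) (use m(2) t(1) D(4-6) in simp_all)
        then have "e \<cdot> t = ZeroArr C T Q" using m(2) by simp
        then obtain u where "u \<in> Hom C T N" "k \<cdot> u = t" by (rule sx_lift[OF s t(1)])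
        then show "\<exists>u\<in>Hom C T N. k \<cdot> u = t" by blast
      qed
      then show "e' \<in> {e'. sx C N B Q' k e'}" by simp
    next
      fix e' assume "e' \<in> {e'. sx C N B Q' k e'}"
      then have s': "sx C N B Q' k e'" by simp
      note D' = sxD[OF s']
      obtain g where g: "g \<in> isos Q' Q" "e = g \<cdot> e'" by (rule sx_coker_unique[OF s' s])
      have gH: "g \<in> Hom C Q' Q" "is_iso C g" using g(1) by (simp_all add: isos_def)
      have "is_mono C (m \<cdot> g)" by (rule mono_Comp[OF iso_mono[OF gH(2)] m(1)]) (use gH(1) m(2) in simp)
      moreover have "(m \<cdot> g) \<cdot> e' = f" unfolding m(3)[symmetric] g(2) using gH(1) m(2) D'(4-6) by simp
      ultimately have "(e', m \<cdot> g) \<in> ?S" using D'(4-6,12) gH(1) m(2) by simp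
      then show "e' \<in> fst ` ?S" by force
    qed
  qed
  from bij_betw_same_card[OF this] show ?thesis using card_cokernels[OF s Q'] by simp
qed

text \<open>Two arrows with the same restriction to \<open>N0\<close> and the same projection to
  \<open>M'\<close> differ by an arrow that factors through \<open>M\<close> at the source and
  through \<open>N\<close> at the target.\<close>

lemma ses_map_torsor:
  assumes s0: "sx C N0 E0 M i0 p0" and s: "sx C N E M' i p" and k: "k \<in> Hom C E0 E"
  shows "card {k' \<in> Hom C E0 E. k' \<cdot> i0 = k \<cdot> i0 \<and> p \<cdot> k' = p \<cdot> k} = card (Hom C M N)"
proof -
  note D0 = sxD[OF s0] and D = sxD[OF s]
  have "bij_betw (\<lambda>g. Plus C k (i \<cdot> (g \<cdot> p0))) (Hom C M N) {k' \<in> Hom C E0 E. k' \<cdot> i0 = k \<cdot> i0 \<and> p \<cdot> k' = p \<cdot> k}"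
    unfolding bij_betw_def
  proof
    show "inj_on (\<lambda>g. Plus C k (i \<cdot> (g \<cdot> p0))) (Hom C M N)"
    proof (rule inj_onI)
      fix g g' assume g: "g \<in> Hom C M N" "g' \<in> Hom C M N" "Plus C k (i \<cdot> (g \<cdot> p0)) = Plus C k (i \<cdot> (g' \<cdot> p0))"
      then have "i \<cdot> (g \<cdot> p0) = i \<cdot> (g' \<cdot> p0)"
        using Plus_left_cancel[of "i \<cdot> (g \<cdot> p0)" "i \<cdot> (g' \<cdot> p0)" k] k D0(4-6) D(1-3) by simp
      then have "g \<cdot> p0 = g' \<cdot> p0" by (rule mono_cancel[OF D(11)]) (use g D0(4-6) D(2) in simp_all)
      then show "g = g'" by (rule epi_cancel[OF D0(12)]) (use g D0(6) in simp_all)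
    qed
    show "(\<lambda>g. Plus C k (i \<cdot> (g \<cdot> p0))) ` Hom C M N = {k' \<in> Hom C E0 E. k' \<cdot> i0 = k \<cdot> i0 \<and> p \<cdot> k' = p \<cdot> k}"
    proof (intro equalityI subsetI)
      fix x assume "x \<in> (\<lambda>g. Plus C k (i \<cdot> (g \<cdot> p0))) ` Hom C M N"
      then obtain g where g: "g \<in> Hom C M N" "x = Plus C k (i \<cdot> (g \<cdot> p0))" by blast
      have "x \<in> Hom C E0 E" unfolding g(2) using g(1) k D0(4-6) D(1-3) by simp
      moreover have "x \<cdot> i0 = k \<cdot> i0" unfolding g(2) using g(1) k D0(1-10) D(1-3,7,8) by simp
      moreover have "p \<cdot> x = p \<cdot> k" unfolding g(2) using g(1) k D0(4-9) D(1-9) by (simp add: reassoc[OF D(10)])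
      ultimately show "x \<in> {k' \<in> Hom C E0 E. k' \<cdot> i0 = k \<cdot> i0 \<and> p \<cdot> k' = p \<cdot> k}" by blast
    next
      fix x assume "x \<in> {k' \<in> Hom C E0 E. k' \<cdot> i0 = k \<cdot> i0 \<and> p \<cdot> k' = p \<cdot> k}"
      then have x: "x \<in> Hom C E0 E" "x \<cdot> i0 = k \<cdot> i0" "p \<cdot> x = p \<cdot> k" by blast+
      have mH: "Minus x k \<in> Hom C E0 E" using x(1) k by simp
      have "p \<cdot> Minus x k = ZeroArr C E0 M'" using x k D(4-6) D0(4-6) by (simp add: Minus_self)
      then obtain h where h: "h \<in> Hom C E0 N" "i \<cdot> h = Minus x k" by (rule sx_lift[OF s mH])
      have "i \<cdot> (h \<cdot> i0) = Minus x k \<cdot> i0" using h(1) D(1-3) D0(1-3) by (simp flip: h(2))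
      also have "\<dots> = ZeroArr C N0 E" using x k D0(1-3) D(1-3) by (simp add: Minus_self)
      finally have "h \<cdot> i0 = ZeroArr C N0 (Dom C i)" by (rule mono_Zero[OF D(11)]) (use h(1) D(1-3) D0(1-3) in simp_all)
      then have "h \<cdot> i0 = ZeroArr C N0 N" using D(2) by simp
      then obtain g where g: "g \<in> Hom C M N" "g \<cdot> p0 = h" by (rule sx_desc[OF s0 h(1)])
      have "x = Plus C k (i \<cdot> (g \<cdot> p0))" using g(2) h(2) Minus_Plus_cancel(3)[of x k] x(1) k by simp
      then show "x \<in> (\<lambda>g. Plus C k (i \<cdot> (g \<cdot> p0))) ` Hom C M N" using g(1) by blast
    qed
  qed
  from bij_betw_same_card[OF this, symmetric] show ?thesis .
qed

lemma sx_map_iso: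
  assumes s: "sx C N E M i p" and s': "sx C N E' M i' p'" and b: "b \<in> Hom C E E'" "b \<cdot> i = i'" "p' \<cdot> b = p"
  shows "b \<in> isos E E'"
proof -
  note D = sxD[OF s] and D' = sxD[OF s']
  have I: "Idt C N \<in> Hom C N N" "Idt C M \<in> Hom C M M" "is_iso C (Idt C N)" "is_iso C (Idt C M)"
    using D(7,9) by simp_all
  have 1: "i' \<cdot> Idt C N = i'" "Idt C M \<cdot> p = p" using D(4,6) D'(1,2) by simp_all
  have "is_mono C b"
    by (rule sx_map_mono[OF s s' b(1) _ _ I(1) iso_mono[OF I(3)] I(2) iso_mono[OF I(4)]])
      (use b(2,3) 1 in simp_all)
  moreover have "is_epi C b"
    by (rule sx_map_epi[OF s' s b(1) _ _ I(2) iso_epi[OF I(4)] I(1) iso_epi[OF I(3)]])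
      (use b(2,3) 1 in simp_all)
  ultimately show ?thesis using mono_epi_iso b(1) by (simp add: isos_def)
qed

end

section \<open>Weighted counts of cokernels, images, filtrations and extensions\<close>

context finitary_lifting_category
begin

lemma Iso_op: "Iso (op_cat C) = Iso C"
proof -
  have "isomorphic (op_cat C) A B \<longleftrightarrow> isomorphic C B A" for A B
    unfolding isomorphic_def by (simp del: Hom_iff)
  then have "iso_class (op_cat C) A = iso_class C A" for A
    unfolding iso_class_def using isomorphic_sym by auto
  then show ?thesis unfolding Iso_def by simp
qed

lemma gsum_op: "finitary_lifting_category.gsum (op_cat C) f = gsum f"
proof -
  interpret op: finitary_lifting_category K "op_cat C" by (rule finitary_lifting_category_op)
  have "Aut (op_cat C) A = Aut C A" for A unfolding Aut_def by (simp del: Hom_iff)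
  then show ?thesis unfolding op.gsum_def gsum_def Iso_op by simp
qed

lemma gsum_cokernels:
  assumes "is_mono C i" "i \<in> Hom C N E"
  shows "(\<Sum>\<^sub>g M. of_nat (card {p. sx C N E M i p})) = 1"
proof -
  obtain p where p: "is_cokernel C p i" using cokernel_exists assms(2) by auto
  have s: "sx C N E (Cod C p) i p" using sx_of_mono[OF assms(1) p] assms(2) by simp
  show ?thesis by (rule gsum_torsor[OF sxD(9)[OF s] card_cokernels[OF s]])
qed

lemma gsum_kernels:
  assumes "is_epi C p" "p \<in> Hom C E M"
  shows "(\<Sum>\<^sub>g N. of_nat (card {i. sx C N E M i p})) = 1"
proof -
  interpret op: finitary_lifting_category K "op_cat C" by (rule finitary_lifting_category_op)
  have "{i. sx (op_cat C) M E N p i} = {i. sx C N E M i p}" for N by auto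
  moreover have "(\<Sum>\<^sub>g N. of_nat (card {i. sx (op_cat C) M E N p i})) = 1"
    unfolding gsum_op[symmetric] by (rule op.gsum_cokernels) (use assms in simp_all)
  ultimately show ?thesis by simp
qed

lemma gsum_images:
  assumes f: "f \<in> Hom C B A"
  shows "(\<Sum>\<^sub>g Q. of_nat (card {(e, m). is_epi C e \<and> e \<in> Hom C B Q \<and> is_mono C m \<and> m \<in> Hom C Q A \<and> m \<cdot> e = f})) = 1"
proof -
  have "f \<in> Arr C" using f by simp
  then obtain m e where m: "is_mono C m" and e: "is_epi C e" "Dom C m = Cod C e" "Cod C m = Cod C f"
    "Dom C e = Dom C f" "m \<cdot> e = f" by (rule image_factorization)
  note A = mono_Arr[OF m] epi_Arr[OF e(1)]
  obtain k where k: "is_kernel C k e" using kernel_exists A(2) by blast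
  have s: "sx C (Dom C k) B (Cod C e) k e" using kernel_sx[OF k e(1)] e(4) f by simp
  have mH: "m \<in> Hom C (Cod C e) A" using A(1) e(2,3) f by simp
  show ?thesis by (rule gsum_torsor[OF sxD(9)[OF s] image_factorizations[OF s m mH e(5)]])
qed

text \<open>Double counting of compatible descriptions of a filtration of \<open>A\<close>: over
  each description on one side, the compatible ones on the other have total weight 1. This is the
  associativity of the ordinary Hall algebra.\<close>

lemma gsum_sesm_assoc:
  assumes O: "a \<in> Obj C" "b \<in> Obj C" "c \<in> Obj C" "A \<in> Obj C"
  shows "(\<Sum>\<^sub>g N. of_nat (card (sesm a N A)) * of_nat (card (sesm b c N))) =
    (\<Sum>\<^sub>g I. of_nat (card (sesm I c A)) * of_nat (card (sesm a b I)))"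
proof -
  define L where "L = (\<lambda>N. sesm a N A \<times> sesm b c N)"
  define R where "R = (\<lambda>I. sesm I c A \<times> sesm a b I)"
  have fL: "finite (L N)" and fR: "finite (R N)" if "N \<in> Obj C" for N
    using that O by (simp_all add: L_def R_def)
  have 1: "(\<Sum>\<^sub>g I. of_nat (card {y \<in> R I. flag_compat x y})) = 1" if x: "x \<in> L N" for x N
  proof -
    obtain i p j q where xe: "x = ((i, p), (j, q))" and s: "sx C N A a i p" and j: "sx C c N b j q"
      using x unfolding L_def sesm_def by auto
    have m: "is_mono C (i \<cdot> j)"
      by (rule mono_Comp[OF sxD(11)[OF j] sxD(11)[OF s]]) (use sxD(2)[OF s] sxD(3)[OF j] in simp)
    have H: "i \<cdot> j \<in> Hom C c A" using sxD(1-3)[OF s] sxD(1-3)[OF j] by simp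
    show ?thesis unfolding xe R_def card_flags_right[OF s j] by (rule gsum_cokernels[OF m H])
  qed
  have 2: "(\<Sum>\<^sub>g N. of_nat (card {x \<in> L N. flag_compat x y})) = 1" if y: "y \<in> R I" for y I
  proof -
    obtain k r l s where ye: "y = ((k, r), (l, s))" and r: "sx C c A I k r" and s: "sx C b I a l s"
      using y unfolding R_def sesm_def by auto
    have e: "is_epi C (s \<cdot> r)"
      by (rule epi_Comp[OF sxD(12)[OF s] sxD(12)[OF r]]) (use sxD(5)[OF s] sxD(6)[OF r] in simp)
    have H: "s \<cdot> r \<in> Hom C A a" using sxD(4-6)[OF s] sxD(4-6)[OF r] by simp
    show ?thesis unfolding ye L_def card_flags_left[OF r s] by (rule gsum_kernels[OF e H])
  qed
  have dc: "(\<Sum>x\<in>L N. of_nat (card {y \<in> R I. flag_compat x y})) =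
      (\<Sum>y\<in>R I. (of_nat (card {x \<in> L N. flag_compat x y}) :: ennreal))"
    if "N \<in> Obj C" "I \<in> Obj C" for N I
    using sum.swap_restrict[OF fL[OF that(1)] fR[OF that(2)], of "\<lambda>_ _. 1 :: ennreal" flag_compat]
    by simp
  have "(\<Sum>\<^sub>g N. of_nat (card (sesm a N A)) * of_nat (card (sesm b c N))) = (\<Sum>\<^sub>g N. of_nat (card (L N)))"
    by (simp add: L_def card_cartesian_product)
  also have "\<dots> = (\<Sum>\<^sub>g N. \<Sum>x\<in>L N. \<Sum>\<^sub>g I. of_nat (card {y \<in> R I. flag_compat x y}))"
    by (rule gsum_cong) (simp add: 1)
  also have "\<dots> = (\<Sum>\<^sub>g N. \<Sum>\<^sub>g I. \<Sum>x\<in>L N. of_nat (card {y \<in> R I. flag_compat x y}))"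
    by (rule gsum_cong) (simp add: gsum_sum fL)
  also have "\<dots> = (\<Sum>\<^sub>g N. \<Sum>\<^sub>g I. \<Sum>y\<in>R I. of_nat (card {x \<in> L N. flag_compat x y}))"
    by (intro gsum_cong dc)
  also have "\<dots> = (\<Sum>\<^sub>g I. \<Sum>\<^sub>g N. \<Sum>y\<in>R I. of_nat (card {x \<in> L N. flag_compat x y}))"
    by (rule gsum_swap)
  also have "\<dots> = (\<Sum>\<^sub>g I. \<Sum>y\<in>R I. \<Sum>\<^sub>g N. of_nat (card {x \<in> L N. flag_compat x y}))"
    by (rule gsum_cong) (simp add: gsum_sum fR)
  also have "\<dots> = (\<Sum>\<^sub>g I. of_nat (card (R I)))"
    by (rule gsum_cong) (simp add: 2)
  also have "\<dots> = (\<Sum>\<^sub>g I. of_nat (card (sesm I c A)) * of_nat (card (sesm a b I)))"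
    by (simp add: R_def card_cartesian_product)
  finally show ?thesis .
qed

text \<open>Riedtmann's formula for a single class. An isomorphism from \<open>E0\<close> to
  \<open>E\<close> transports the sequence to a representative of the class with middle term
  \<open>E\<close>; each representative arises from as many isomorphisms as there are arrows from
  \<open>M\<close> to \<open>N\<close>.\<close>

lemma gsum_Ext1_class:
  assumes s0: "sx C N E0 M i0 p0"
  shows "(\<Sum>\<^sub>g E. of_nat (card {e \<in> sesm M N E. ((i0, p0), e) \<in> ses_equiv C M N})) = ennreal (1 / real (card (Hom C M N)))"
proof -
  note D0 = sxD[OF s0]
  have c: "card (isos E0 E) = card {e \<in> sesm M N E. ((i0, p0), e) \<in> ses_equiv C M N} * card (Hom C M N)"
    if E: "E \<in> Obj C" for E
  proof -
    \<comment> \<open>Projecting to \<open>k\<close> gives the isomorphisms, projecting to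
      \<open>(i, p)\<close> the representatives of the class.\<close>
    define Z where "Z = {(k, (i, p)). sx C N E M i p \<and> k \<in> Hom C E0 E \<and> k \<cdot> i0 = i \<and> p \<cdot> k = p0}"
    have inj: "inj_on fst Z"
    proof (rule inj_onI)
      fix x y assume "x \<in> Z" "y \<in> Z" "fst x = fst y"
      then obtain k i p p' where x: "x = (k, (i, p))" "y = (k, (i, p'))" and s: "sx C N E M i p" "sx C N E M i p'"
        and k: "k \<in> Hom C E0 E" "k \<cdot> i0 = i" "p \<cdot> k = p0" "p' \<cdot> k = p0" unfolding Z_def by (auto simp del: Hom_iff)
      have "is_iso C k" using sx_map_iso[OF s0 s(1) k(1-3)] by (simp add: isos_def)
      moreover have "p \<cdot> k = p' \<cdot> k" using k by simp
      ultimately have "p = p'" by (intro epi_cancel[of k p p'] iso_epi) (use k(1) sxD(4-6)[OF s(1)] sxD(4-6)[OF s(2)] in simp_all)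
      then show "x = y" using x by simp
    qed
    have im: "fst ` Z = isos E0 E"
    proof (intro equalityI subsetI)
      fix k assume "k \<in> fst ` Z"
      then obtain i p where "sx C N E M i p" "k \<in> Hom C E0 E" "k \<cdot> i0 = i" "p \<cdot> k = p0"
        unfolding Z_def by (auto simp del: Hom_iff)
      then show "k \<in> isos E0 E" using sx_map_iso[OF s0] by blast
    next
      fix k assume k: "k \<in> isos E0 E"
      then have kH: "k \<in> Hom C E0 E" "is_iso C k" by (simp_all add: isos_def)
      obtain k' where k': "is_iso C k'" "k' \<in> Hom C E E0" "k' \<cdot> k = Idt C E0" "k \<cdot> k' = Idt C E"
        by (rule iso_inv[OF kH(2,1)])
      have "sx C N E M (k \<cdot> i0) (p0 \<cdot> k')" by (rule sx_iso_mid[OF s0 k k'(2-4)])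
      moreover have "(p0 \<cdot> k') \<cdot> k = p0" using D0(4-6) kH(1) k'(2,3) by simp
      ultimately have "(k, (k \<cdot> i0, p0 \<cdot> k')) \<in> Z" unfolding Z_def using kH(1) by (simp del: Hom_iff)
      then show "k \<in> fst ` Z" by force
    qed
    have fZ: "finite Z" using finite_imageD[OF _ inj] im finite_isos[OF D0(8) E] by simp
    have "card Z = card (snd ` Z) * card (Hom C M N)"
    proof (rule card_eq_card_image_mult[OF fZ])
      fix x assume "x \<in> Z"
      then obtain k i p where x: "x = (k, (i, p))" and s: "sx C N E M i p"
        and k: "k \<in> Hom C E0 E" "k \<cdot> i0 = i" "p \<cdot> k = p0" unfolding Z_def by (auto simp del: Hom_iff)
      have "{y \<in> Z. snd y = snd x} = (\<lambda>k. (k, (i, p))) ` {k \<in> Hom C E0 E. k \<cdot> i0 = i \<and> p \<cdot> k = p0}"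
        unfolding x Z_def using s by (auto simp del: Hom_iff)
      then show "card {y \<in> Z. snd y = snd x} = card (Hom C M N)"
        using ses_map_torsor[OF s0 s k(1)] k(2,3) by (simp add: card_image inj_on_def del: Hom_iff)
    qed
    moreover have "snd ` Z = {e \<in> sesm M N E. ((i0, p0), e) \<in> ses_equiv C M N}"
    proof (intro equalityI subsetI)
      fix e assume "e \<in> snd ` Z"
      then obtain k i p where e: "e = (i, p)" and s: "sx C N E M i p"
        and k: "k \<in> Hom C E0 E" "k \<cdot> i0 = i" "p \<cdot> k = p0" unfolding Z_def by (auto simp del: Hom_iff)
      have "k \<cdot> i0 = i \<cdot> Idt C N \<and> p \<cdot> k = Idt C M \<cdot> p0" using k sxD(1-3)[OF s] D0(4-6) by simp
      then have "ses_map C (i0, p0) (Idt C N) (Idt C M) (i, p)" unfolding ses_map_sx[OF s0 s] using k(1) by blast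
      then show "e \<in> {e \<in> sesm M N E. ((i0, p0), e) \<in> ses_equiv C M N}"
        unfolding e ses_equiv_iff using s sx_ses[OF s0] sx_ses[OF s] by (simp add: sesm_def)
    next
      fix e assume "e \<in> {e \<in> sesm M N E. ((i0, p0), e) \<in> ses_equiv C M N}"
      then obtain i p where e: "e = (i, p)" and s: "sx C N E M i p" and m: "ses_map C (i0, p0) (Idt C N) (Idt C M) (i, p)"
        unfolding sesm_def ses_equiv_iff by auto
      obtain k where k: "k \<in> Hom C E0 E" "k \<cdot> i0 = i \<cdot> Idt C N" "p \<cdot> k = Idt C M \<cdot> p0"
        using m unfolding ses_map_sx[OF s0 s] by blast
      have "k \<cdot> i0 = i" "p \<cdot> k = p0" using k(2,3) sxD(1-3)[OF s] D0(4-6) by simp_all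
      then have "(k, e) \<in> Z" unfolding Z_def e using s k(1) by (simp del: Hom_iff)
      then show "e \<in> snd ` Z" by force
    qed
    moreover have "card Z = card (isos E0 E)" using card_image[OF inj] im by simp
    ultimately show ?thesis by simp
  qed
  let ?h = "card (Hom C M N)" and ?W = "\<lambda>E. {e \<in> sesm M N E. ((i0, p0), e) \<in> ses_equiv C M N}"
  have h: "?h > 0" by (rule card_Hom_pos[OF D0(9,7)])
  have "(\<Sum>\<^sub>g E. of_nat (card (isos E0 E)) * ennreal (1 / real ?h)) = ennreal (1 / real ?h)"
    by (rule gsum_isos[OF D0(8)])
  moreover have "of_nat (card (isos E0 E)) * ennreal (1 / real ?h) = of_nat (card (?W E))" if "E \<in> Obj C" for E
    unfolding c[OF that] ennreal_of_nat_eq_real_of_nat using h by (simp flip: ennreal_mult' add: field_simps)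
  ultimately show ?thesis using gsum_cong[of "\<lambda>E. of_nat (card (isos E0 E)) * ennreal (1 / real ?h)" "\<lambda>E. of_nat (card (?W E))"] by simp
qed

end

section \<open>Green's formula\<close>

context finitary_lifting_category
begin

text \<open>All fibres of the surjection from \<open>Ext1 C M N\<close> to
  \<open>Ext1 C M N''\<close> have the same size. The comparison takes place in
  \<open>Hom C R N\<close>, where fibres can be translated by subtraction: it maps onto both
  extension sets, with fibres of constant size.\<close>

lemma card_lifted_classes:
  assumes s: "sx C N' N N'' \<alpha> \<beta>" and e'': "e'' \<in> ses C M N''"
  shows "card (Ext1 C M N) = card (Ext1 C M N'') * card {c \<in> Ext1 C M N. \<exists>e \<in> c. ses_map C e \<beta> (Idt C M) e''}"
proof -
  note D = sxD[OF s]
  obtain i'' p'' E'' where s'': "sx C N'' E'' M i'' p''" by (rule ses_obtain[OF e''])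
  have M: "M \<in> Obj C" by (rule sxD(9)[OF s''])
  obtain R P \<iota> \<pi> where sR: "sx C R P M \<iota> \<pi>" and eff: "\<And>B. B \<in> {N, N''} \<Longrightarrow> effaces (\<iota>, \<pi>) M R B"
    by (rule effacing_exists[OF M, of "{N, N''}"]) (use fin_Ext1 M D(8,9) in auto)
  note DR = sxD[OF sR] and \<eta> = sx_ses[OF sR]
  have \<beta>: "\<beta> \<in> Hom C N N''" and I: "Idt C M \<in> Hom C M M" and II: "Idt C M \<cdot> Idt C M = Idt C M"
    using D(4-6) M by simp_all
  have IN: "Idt C N'' \<in> Hom C N'' N''" using D(9) by simp
  have bf: "\<beta> \<cdot> f \<in> Hom C R N''" if "f \<in> Hom C R N" for f using that \<beta> by simp
  define F where "F = (\<lambda>f. pushc M N'' (\<iota>, \<pi>) (\<beta> \<cdot> f))"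
  define Q where "Q = pushc M N (\<iota>, \<pi>)"
  \<comment> \<open>The common size of the fibres of \<open>F\<close>, as the number of arrows whose
    composite with \<open>\<beta>\<close> has a trivial pushout.\<close>
  define k0 where "k0 = card {f \<in> Hom C R N. \<exists>h \<in> Hom C P N''. \<beta> \<cdot> f = h \<cdot> \<iota>}"
  obtain g0 where g0: "g0 \<in> Hom C R N''" "e'' \<in> pushc M N'' (\<iota>, \<pi>) g0"
    using eff[of N''] e'' unfolding effaces_def by blast
  have comp: "e2 \<in> F f" if "f \<in> Hom C R N" "e \<in> Q f" "e2 \<in> ses C M N''" "ses_map C e \<beta> (Idt C M) e2" for e e2 f
  proof -
    have "e \<in> ses C M N" "ses_map C (\<iota>, \<pi>) f (Idt C M) e" using that(2) by (auto simp: Q_def pushc_def)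
    then have "ses_map C (\<iota>, \<pi>) (\<beta> \<cdot> f) (Idt C M \<cdot> Idt C M) e2"
      by (intro ses_map_trans[OF \<eta> _ that(3) that(1) \<beta> I I _ that(4)])
    then show ?thesis unfolding F_def pushc_def II using that(3) by simp
  qed
  have comp': "ses_map C e \<beta> (Idt C M) e2" if f: "f \<in> Hom C R N" and e: "e \<in> Q f" and e2: "e2 \<in> F f" for e e2 f
  proof -
    have eM: "e \<in> ses C M N" "e2 \<in> ses C M N''" using e e2 by (auto simp: Q_def F_def pushc_def)
    obtain e1 where e1: "e1 \<in> ses C M N''" "ses_map C e \<beta> (Idt C M) e1" by (rule ses_push[OF eM(1) \<beta>])
    have "e1 \<in> F f" by (rule comp[OF f e e1])
    then have "(e1, e2) \<in> ses_equiv C M N''" using pushc_equiv[OF \<eta> bf[OF f]] e2 unfolding F_def by blast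
    then have "ses_map C e1 (Idt C N'') (Idt C M) e2" using ses_equiv_iff by blast
    then have "ses_map C e (Idt C N'' \<cdot> \<beta>) (Idt C M \<cdot> Idt C M) e2"
      by (rule ses_map_trans[OF eM(1) e1(1) eM(2) \<beta> IN I I e1(2)])
    then show ?thesis using \<beta> II by simp
  qed
  have surj: "F ` Hom C R N = Ext1 C M N''"
  proof (intro equalityI subsetI)
    fix x assume "x \<in> F ` Hom C R N"
    then show "x \<in> Ext1 C M N''" unfolding F_def using pushc_Ext1[OF \<eta> bf] by blast
  next
    fix x assume "x \<in> Ext1 C M N''"
    then obtain e2 where e2: "e2 \<in> ses C M N''" "x = ses_equiv C M N'' `` {e2}"
      unfolding Ext1_def by (rule quotientE)
    obtain e where e: "e \<in> ses C M N" "ses_map C e \<beta> (Idt C M) e2" by (rule lift_ses[OF s e2(1)])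
    obtain f where f: "f \<in> Hom C R N" "e \<in> Q f" using eff[of N] e(1) unfolding effaces_def Q_def by blast
    have "e2 \<in> F f" by (rule comp[OF f e2(1) e(2)])
    then have "x = F f" using pushc_class[OF \<eta> bf[OF f(1)]] e2(2) unfolding F_def by simp
    then show "x \<in> F ` Hom C R N" using f(1) by blast
  qed
  have Feq: "F f = F f' \<longleftrightarrow> (\<exists>h \<in> Hom C P N''. \<beta> \<cdot> Minus f f' = h \<cdot> \<iota>)"
    if "f \<in> Hom C R N" "f' \<in> Hom C R N" for f f'
    using pushc_eq_iff[OF sR bf[OF that(1)] bf[OF that(2)]] that \<beta> unfolding F_def by simp
  have fib: "card {f' \<in> Hom C R N. F f' = F f} = k0" if f: "f \<in> Hom C R N" for f
  proof -
    have "bij_betw (\<lambda>f'. Minus f' f) {f' \<in> Hom C R N. F f' = F f} {f \<in> Hom C R N. \<exists>h \<in> Hom C P N''. \<beta> \<cdot> f = h \<cdot> \<iota>}"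
    proof (rule bij_betwI[where g = "\<lambda>d. Plus C d f"])
      show "(\<lambda>f'. Minus f' f) \<in> {f' \<in> Hom C R N. F f' = F f} \<rightarrow> {f \<in> Hom C R N. \<exists>h \<in> Hom C P N''. \<beta> \<cdot> f = h \<cdot> \<iota>}"
      proof
        fix f' assume "f' \<in> {f' \<in> Hom C R N. F f' = F f}"
        then have f': "f' \<in> Hom C R N" "F f' = F f" by blast+
        then show "Minus f' f \<in> {f \<in> Hom C R N. \<exists>h \<in> Hom C P N''. \<beta> \<cdot> f = h \<cdot> \<iota>}"
          using Feq[OF f'(1) f] f by auto
      qed
      show "(\<lambda>d. Plus C d f) \<in> {f \<in> Hom C R N. \<exists>h \<in> Hom C P N''. \<beta> \<cdot> f = h \<cdot> \<iota>} \<rightarrow> {f' \<in> Hom C R N. F f' = F f}"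
      proof
        fix d assume "d \<in> {f \<in> Hom C R N. \<exists>h \<in> Hom C P N''. \<beta> \<cdot> f = h \<cdot> \<iota>}"
        then have d: "d \<in> Hom C R N" "\<exists>h \<in> Hom C P N''. \<beta> \<cdot> d = h \<cdot> \<iota>" by blast+
        have df: "Plus C d f \<in> Hom C R N" using d f by simp
        have "Minus (Plus C d f) f = d" using Minus_Plus_cancel(1)[of d f] d f by simp
        then show "Plus C d f \<in> {f' \<in> Hom C R N. F f' = F f}" using Feq[OF df f] d(2) df by simp
      qed
    qed (use f Minus_Plus_cancel in auto)
    from bij_betw_same_card[OF this] show ?thesis unfolding k0_def .
  qed
  have finR: "finite (Hom C R N)" by (rule fin_Hom[OF DR(7) D(8)])
  have 1: "card (Hom C R N) = card (Ext1 C M N'') * k0"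
    using card_eq_card_image_mult[OF finR fib] surj by simp
  let ?I = "card ((\<lambda>h. h \<cdot> \<iota>) ` Hom C P N)"
  have Qfib: "card {f' \<in> Hom C R N. Q f' = Q f} = ?I" if "f \<in> Hom C R N" for f
    unfolding Q_def by (rule card_pushc_fibre[OF sR that])
  have 2: "card (Hom C R N) = card (Ext1 C M N) * ?I"
    using card_eq_card_image_mult[OF finR Qfib] pushc_surj[OF sR eff[of N]] unfolding Q_def by simp
  define T where "T = {f \<in> Hom C R N. F f = pushc M N'' (\<iota>, \<pi>) g0}"
  obtain f0 where f0: "f0 \<in> Hom C R N" "F f0 = pushc M N'' (\<iota>, \<pi>) g0"
    using surj pushc_Ext1[OF \<eta> g0(1)] by (metis imageE)
  have cT: "card T = k0" using fib[OF f0(1)] unfolding T_def f0(2) .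
  \<comment> \<open>Hence the fibre \<open>T\<close> of \<open>F\<close> is a union of fibres of
    \<open>Q\<close>, and the number of lifted classes is \<open>k0\<close> divided by the size of
    one fibre of \<open>Q\<close>.\<close>
  have sat: "F f' = F f" if f: "f \<in> Hom C R N" "f' \<in> Hom C R N" "Q f' = Q f" for f f'
  proof -
    obtain h where h: "h \<in> Hom C P N" "Minus f' f = h \<cdot> \<iota>" using pushc_eq_iff[OF sR f(2,1)] f(3) unfolding Q_def by blast
    have "\<beta> \<cdot> Minus f' f = (\<beta> \<cdot> h) \<cdot> \<iota>" unfolding h(2) using h(1) \<beta> DR(1-3) by simp
    moreover have "\<beta> \<cdot> h \<in> Hom C P N''" using h(1) \<beta> by simp
    ultimately show ?thesis using Feq[OF f(2,1)] by blast
  qed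
  have "card T = card (Q ` T) * ?I"
  proof (rule card_eq_card_image_mult)
    show "finite T" unfolding T_def using finR by (simp del: Hom_iff)
    fix f assume "f \<in> T"
    then have f: "f \<in> Hom C R N" "F f = pushc M N'' (\<iota>, \<pi>) g0" unfolding T_def by blast+
    have "{f' \<in> T. Q f' = Q f} = {f' \<in> Hom C R N. Q f' = Q f}" unfolding T_def using sat[OF f(1)] f(2) by auto
    then show "card {f' \<in> T. Q f' = Q f} = ?I" using Qfib[OF f(1)] by simp
  qed
  moreover have "Q ` T = {c \<in> Ext1 C M N. \<exists>e \<in> c. ses_map C e \<beta> (Idt C M) e''}"
  proof (intro equalityI subsetI)
    fix c assume "c \<in> Q ` T"
    then obtain f where f: "f \<in> Hom C R N" "F f = pushc M N'' (\<iota>, \<pi>) g0" "c = Q f" unfolding T_def by blast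
    obtain e where e: "e \<in> Q f" unfolding Q_def by (rule pushc_nonempty[OF \<eta> f(1)])
    have "ses_map C e \<beta> (Idt C M) e''" by (rule comp'[OF f(1) e]) (use g0(2) f(2) in simp)
    moreover have "c \<in> Ext1 C M N" unfolding f(3) Q_def by (rule pushc_Ext1[OF \<eta> f(1)])
    ultimately show "c \<in> {c \<in> Ext1 C M N. \<exists>e \<in> c. ses_map C e \<beta> (Idt C M) e''}" using e f(3) by blast
  next
    fix c assume "c \<in> {c \<in> Ext1 C M N. \<exists>e \<in> c. ses_map C e \<beta> (Idt C M) e''}"
    then obtain e where c: "c \<in> Ext1 C M N" "e \<in> c" "ses_map C e \<beta> (Idt C M) e''" by blast
    have "c \<in> Q ` Hom C R N" using c(1) pushc_surj[OF sR eff[of N]] unfolding Q_def by simp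
    then obtain f where f: "f \<in> Hom C R N" "c = Q f" by blast
    have "e'' \<in> F f" by (rule comp[OF f(1) _ e'' c(3)]) (use c(2) f(2) in simp)
    then have "F f = pushc M N'' (\<iota>, \<pi>) g0"
      using pushc_class[OF \<eta> bf[OF f(1)]] pushc_class[OF \<eta> g0] unfolding F_def by simp
    then show "c \<in> Q ` T" using f unfolding T_def by blast
  qed
  ultimately have 3: "k0 = card {c \<in> Ext1 C M N. \<exists>e \<in> c. ses_map C e \<beta> (Idt C M) e''} * ?I" using cT by simp
  have "?I > 0"
  proof -
    have "Hom C P N \<noteq> {}" using card_Hom_pos[OF DR(8) D(8)] by (metis card.empty less_irrefl)
    then show ?thesis using fin_Hom[OF DR(8) D(8)] by (simp add: card_gt_0_iff del: Hom_iff)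
  qed
  moreover have "card (Ext1 C M N) * ?I = card (Ext1 C M N'') *
      card {c \<in> Ext1 C M N. \<exists>e \<in> c. ses_map C e \<beta> (Idt C M) e''} * ?I"
    using 1 2 3 by (simp add: mult.assoc)
  ultimately show ?thesis by simp
qed

text \<open>For a fixed extension there are \<open>card (Hom C A1 G)\<close> choices of
  \<open>w\<close>. Each class that lifts the given one contributes 1 over
  \<open>card (Hom C A1 Y)\<close>, and there are as many such classes as the quotient of
  \<open>card (Ext1 C A1 Y)\<close> by \<open>card (Ext1 C A1 G)\<close>. Together this is the ratio
  of \<open>euler A1 G\<close> to \<open>euler A1 Y\<close>, which multiplicativity
  simplifies.\<close>

lemma gsum_lifts:
  assumes sY: "sx C B2 Y G \<kappa> \<pi>" and sX: "sx C G Xo A1 l \<xi>"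
  shows "(\<Sum>\<^sub>g M. of_nat (card {(u, w). u \<in> Hom C Y M \<and> w \<in> Hom C M Xo \<and> sx C Y M A1 u (\<xi> \<cdot> w) \<and> w \<cdot> u = l \<cdot> \<pi>})) =
    ennreal (1 / euler A1 B2)"
proof -
  note DY = sxD[OF sY] and DX = sxD[OF sX]
  define UW where "UW = (\<lambda>M. {(u, w). u \<in> Hom C Y M \<and> w \<in> Hom C M Xo \<and> sx C Y M A1 u (\<xi> \<cdot> w) \<and> w \<cdot> u = l \<cdot> \<pi>})"
  define V where "V = (\<lambda>M. {e \<in> sesm A1 Y M. ses_map C e \<pi> (Idt C A1) (l, \<xi>)})"
  define Z where "Z = {c \<in> Ext1 C A1 Y. \<exists>e \<in> c. ses_map C e \<pi> (Idt C A1) (l, \<xi>)}"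
  have \<pi>: "\<pi> \<in> Hom C Y G" and I: "Idt C A1 \<in> Hom C A1 A1" "Idt C Y \<in> Hom C Y Y"
    and II: "Idt C A1 \<cdot> Idt C A1 = Idt C A1" "\<pi> \<cdot> Idt C Y = \<pi>"
    using DY(4-6,8) DX(9) by simp_all
  have fZ: "finite Z" unfolding Z_def using fin_Ext1[OF DX(9) DY(8)] by simp
  have 1: "card (UW M) = card (V M) * card (Hom C A1 G)" if M: "M \<in> Obj C" for M
  proof -
    let ?f = "\<lambda>(u, w). (u, \<xi> \<cdot> w)"
    have "card (UW M) = card (?f ` UW M) * card (Hom C A1 G)"
    proof (rule card_eq_card_image_mult)
      show "finite (UW M)"
        by (rule finite_subset[of _ "Hom C Y M \<times> Hom C M Xo"])
          (use fin_Hom M DY(8) DX(8) in \<open>auto simp: UW_def simp del: Hom_iff\<close>)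
      fix x assume "x \<in> UW M"
      then obtain u w where x: "x = (u, w)" and u: "u \<in> Hom C Y M" and w: "w \<in> Hom C M Xo"
        and s: "sx C Y M A1 u (\<xi> \<cdot> w)" and wu: "w \<cdot> u = l \<cdot> \<pi>" unfolding UW_def by blast
      have "{y \<in> UW M. ?f y = ?f x} = Pair u ` {w' \<in> Hom C M Xo. w' \<cdot> u = w \<cdot> u \<and> \<xi> \<cdot> w' = \<xi> \<cdot> w}"
        unfolding x UW_def using u s wu by (auto simp del: Hom_iff)
      then show "card {y \<in> UW M. ?f y = ?f x} = card (Hom C A1 G)"
        using ses_map_torsor[OF s sX w] by (simp add: card_image inj_on_def del: Hom_iff)
    qed
    moreover have "?f ` UW M = V M"
    proof (intro equalityI subsetI)
      fix e assume "e \<in> ?f ` UW M"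
      then obtain u w where e: "e = (u, \<xi> \<cdot> w)" and w: "w \<in> Hom C M Xo"
        and s: "sx C Y M A1 u (\<xi> \<cdot> w)" and wu: "w \<cdot> u = l \<cdot> \<pi>" unfolding UW_def by auto
      have "\<xi> \<cdot> w = Idt C A1 \<cdot> (\<xi> \<cdot> w)" using w DX(4-6,9) by simp
      then have "ses_map C e \<pi> (Idt C A1) (l, \<xi>)" unfolding e ses_map_sx[OF s sX] using w wu by blast
      then show "e \<in> V M" unfolding V_def sesm_def using e s by simp
    next
      fix e assume "e \<in> V M"
      then obtain u q where e: "e = (u, q)" and s: "sx C Y M A1 u q" and m: "ses_map C e \<pi> (Idt C A1) (l, \<xi>)"
        unfolding V_def sesm_def by auto
      obtain w where w: "w \<in> Hom C M Xo" "w \<cdot> u = l \<cdot> \<pi>" "\<xi> \<cdot> w = Idt C A1 \<cdot> q"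
        using m unfolding e ses_map_sx[OF s sX] by blast
      have q: "\<xi> \<cdot> w = q" using w(3) sxD(4-6)[OF s] by simp
      have "(u, w) \<in> UW M" unfolding UW_def using w s sxD(1-3)[OF s] q by simp
      then show "e \<in> ?f ` UW M" unfolding e using q by force
    qed
    ultimately show ?thesis by simp
  qed
  \<comment> \<open>Mapping to the given extension along \<open>\<pi>\<close> is a property of the
    whole class, so \<open>V M\<close> splits by extension classes.\<close>
  have 2: "card (V M) = (\<Sum>c\<in>Z. card {e \<in> sesm A1 Y M. e \<in> c})" if M: "M \<in> Obj C" for M
  proof -
    have "V M = (\<Union>c\<in>Z. {e \<in> sesm A1 Y M. e \<in> c})"
    proof (intro equalityI subsetI)
      fix e assume e: "e \<in> V M"
      then have eM: "e \<in> ses C A1 Y" "ses_map C e \<pi> (Idt C A1) (l, \<xi>)" unfolding V_def sesm_def using sx_ses by auto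
      let ?c = "ses_equiv C A1 Y `` {e}"
      have "?c \<in> Ext1 C A1 Y" unfolding Ext1_def using eM(1) by (rule quotientI)
      moreover have "e \<in> ?c" using ses_equiv_refl[OF eM(1)] by blast
      ultimately show "e \<in> (\<Union>c\<in>Z. {e \<in> sesm A1 Y M. e \<in> c})" using eM(2) e unfolding Z_def V_def by blast
    next
      fix e assume "e \<in> (\<Union>c\<in>Z. {e \<in> sesm A1 Y M. e \<in> c})"
      then obtain c e1 where e: "e \<in> sesm A1 Y M" "e \<in> c" and c: "c \<in> Ext1 C A1 Y" "e1 \<in> c" "ses_map C e1 \<pi> (Idt C A1) (l, \<xi>)"
        unfolding Z_def by blast
      have "(e, e1) \<in> ses_equiv C A1 Y"
        by (rule in_quotient_imp_in_rel[OF equiv_ses]) (use e c in \<open>auto simp: Ext1_def\<close>)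
      then have ee: "e \<in> ses C A1 Y" "e1 \<in> ses C A1 Y" "ses_map C e (Idt C Y) (Idt C A1) e1" using ses_equiv_iff by blast+
      have "ses_map C e (\<pi> \<cdot> Idt C Y) (Idt C A1 \<cdot> Idt C A1) (l, \<xi>)"
        by (rule ses_map_trans[OF ee(1,2) sx_ses[OF sX] I(2) \<pi> I(1) I(1) ee(3) c(3)])
      then show "e \<in> V M" unfolding V_def II using e(1) by simp
    qed
    moreover have "card (\<Union>c\<in>Z. {e \<in> sesm A1 Y M. e \<in> c}) = (\<Sum>c\<in>Z. card {e \<in> sesm A1 Y M. e \<in> c})"
    proof (rule card_UN_disjoint[OF fZ])
      show "\<forall>c\<in>Z. finite {e \<in> sesm A1 Y M. e \<in> c}" using M DX(9) DY(8) by simp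
      show "\<forall>c\<in>Z. \<forall>c'\<in>Z. c \<noteq> c' \<longrightarrow> {e \<in> sesm A1 Y M. e \<in> c} \<inter> {e \<in> sesm A1 Y M. e \<in> c'} = {}"
        using quotient_disj[OF equiv_ses] unfolding Z_def Ext1_def by fastforce
    qed
    ultimately show ?thesis by simp
  qed
  have 3: "(\<Sum>\<^sub>g M. of_nat (card {e \<in> sesm A1 Y M. e \<in> c})) = ennreal (1 / real (card (Hom C A1 Y)))" if cZ: "c \<in> Z" for c
  proof -
    obtain e0 where e0: "e0 \<in> ses C A1 Y" "c = ses_equiv C A1 Y `` {e0}"
    proof -
      have "c \<in> ses C A1 Y // ses_equiv C A1 Y" using cZ unfolding Z_def Ext1_def by blast
      then show thesis by (rule quotientE) (rule that)
    qed
    obtain i0 p0 E0 where ep: "e0 = (i0, p0)" and s0: "sx C Y E0 A1 i0 p0" by (rule ses_obtain[OF e0(1)])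
    show ?thesis unfolding e0(2) ep using gsum_Ext1_class[OF s0] by simp
  qed
  let ?hG = "card (Hom C A1 G)" and ?hY = "card (Hom C A1 Y)" and ?eG = "card (Ext1 C A1 G)" and ?eY = "card (Ext1 C A1 Y)"
  have "(\<Sum>\<^sub>g M. of_nat (card (UW M))) = (\<Sum>\<^sub>g M. (\<Sum>c\<in>Z. of_nat (card {e \<in> sesm A1 Y M. e \<in> c})) * of_nat ?hG)"
    by (rule gsum_cong) (simp add: 1 2)
  also have "\<dots> = (\<Sum>c\<in>Z. \<Sum>\<^sub>g M. of_nat (card {e \<in> sesm A1 Y M. e \<in> c})) * of_nat ?hG"
    by (simp add: gsum_multc gsum_sum[OF fZ])
  also have "\<dots> = of_nat (card Z) * ennreal (1 / real ?hY) * of_nat ?hG" by (simp add: 3)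
  also have "\<dots> = ennreal (real (card Z) * (1 / real ?hY) * real ?hG)"
    by (simp only: ennreal_of_nat_eq_real_of_nat ennreal_mult' of_nat_0_le_iff zero_le_mult_iff divide_nonneg_nonneg zero_le_one simp_thms)
  also have "real (card Z) * (1 / real ?hY) * real ?hG = 1 / euler A1 B2"
  proof -
    have c: "?eY = ?eG * card Z" unfolding Z_def by (rule card_lifted_classes[OF sY sx_ses[OF sX]])
    have m: "euler A1 Y = euler A1 B2 * euler A1 G" by (rule euler_mult_right[OF sY DX(9)])
    have p: "?hY > 0" "?hG > 0" "?eG > 0" "?eY > 0"
      using card_Hom_pos[OF DX(9) DY(8)] card_Hom_pos[OF DX(9) DY(9)] card_Ext1_pos[OF DX(9) DY(9)] card_Ext1_pos[OF DX(9) DY(8)]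
      by simp_all
    have "card Z > 0" using c p(4) by (cases "card Z") simp_all
    moreover have "euler A1 B2 > 0" by (rule euler_pos[OF DX(9) DY(7)])
    moreover have "real ?hY / (real ?eG * real (card Z)) = euler A1 B2 * (real ?hG / real ?eG)"
      using m unfolding euler_def[of A1 Y] euler_def[of A1 G] c by simp
    ultimately show ?thesis using p by (simp add: field_simps)
  qed
  finally show ?thesis unfolding UW_def .
qed

end

section \<open>Corner pushout, corner pullback and the frame of a 3 x 3 diagram\<close>

context abelian_category
begin

text \<open>One of the two sequences through the pushout \<open>Y\<close> is built into its
  construction. For the other, \<open>j\<close> is mono by the four lemma, and the cokernel of
  \<open>j\<close> factors through \<open>\<theta>\<close>, which is checked on the two legs of the
  pushout.\<close>

lemma pushout_cross:
  assumes x: "sx C B2 B B1 x x'" and y: "sx C B2 B' A2 y y'"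
  shows "\<exists>Y j j' \<rho> \<theta>. sx C B' Y B1 j' \<rho> \<and> sx C B Y A2 j \<theta> \<and> \<rho> \<cdot> j = x' \<and> \<theta> \<cdot> j' = y' \<and> j \<cdot> x = j' \<cdot> y \<and>
    (\<forall>T. \<forall>u \<in> Hom C B T. \<forall>v \<in> Hom C B' T. u \<cdot> x = v \<cdot> y \<longrightarrow> (\<exists>w \<in> Hom C Y T. w \<cdot> j = u \<and> w \<cdot> j' = v)) \<and>
    (\<forall>T. \<forall>w \<in> Hom C Y T. \<forall>w' \<in> Hom C Y T. w \<cdot> j = w' \<cdot> j \<longrightarrow> w \<cdot> j' = w' \<cdot> j' \<longrightarrow> w = w')"
proof -
  note Dx = sxD[OF x] and Dy = sxD[OF y]
  have yH: "y \<in> Hom C B2 B'" and y'H: "y' \<in> Hom C B' A2" using Dy(1-6) by simp_all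
  obtain Y j' \<rho> j where sY: "sx C B' Y B1 j' \<rho>" and j: "j \<in> Hom C B Y" "\<rho> \<cdot> j = x'" "j \<cdot> x = j' \<cdot> y"
    by (rule push_sx[OF x yH])
  note DY = sxD[OF sY]
  have univ: "\<exists>w \<in> Hom C Y T. w \<cdot> j = u \<and> w \<cdot> j' = v"
    if u: "u \<in> Hom C B T" and v: "v \<in> Hom C B' T" and e: "u \<cdot> x = v \<cdot> y" for u v T
  proof -
    obtain w where "w \<in> Hom C Y T" "w \<cdot> j = u" "w \<cdot> j' = v" by (rule push_prop[OF x sY j(1,3,2) yH u v e])
    then show ?thesis by blast
  qed
  have uniq: "w = w'" if w: "w \<in> Hom C Y T" "w' \<in> Hom C Y T" "w \<cdot> j = w' \<cdot> j" "w \<cdot> j' = w' \<cdot> j'" for w w' T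
  proof (rule push_joint_epi[OF x sY j(1)])
    show "\<rho> \<cdot> j = Idt C B1 \<cdot> x'" using j(2) Dx(4,6) by simp
    show "is_epi C (Idt C B1)" "Idt C B1 \<in> Hom C B1 B1" using Dx(9) by (simp_all add: iso_epi)
  qed fact+
  have "ZeroArr C B A2 \<cdot> x = y' \<cdot> y" using Dx(1-3,7) Dy(9,10) by simp
  then obtain \<theta> where \<theta>: "\<theta> \<in> Hom C Y A2" "\<theta> \<cdot> j = ZeroArr C B A2" "\<theta> \<cdot> j' = y'"
    using univ[OF _ y'H, of "ZeroArr C B A2"] Dx(8) Dy(9) by auto
  have jm: "is_mono C j"
  proof (rule sx_map_mono[OF x sY j(1,3) _ yH Dy(11)])
    show "\<rho> \<cdot> j = Idt C B1 \<cdot> x'" using j(2) Dx(4,6) by simp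
    show "is_mono C (Idt C B1)" "Idt C B1 \<in> Hom C B1 B1" using Dx(9) by (simp_all add: iso_mono)
  qed
  have "sx C B Y A2 j \<theta>"
  proof (rule sxI[OF jm _ j(1) \<theta>(1,2)])
    show "is_epi C \<theta>" by (rule epi_of_Comp[where g = j']) (use \<theta>(1,3) Dy(12) DY(1-3) in simp_all)
    fix T g assume g: "g \<in> Hom C T Y" "\<theta> \<cdot> g = ZeroArr C T A2"
    have T: "T \<in> Obj C" using g(1) by auto
    have "j \<in> Arr C" using j(1) by simp
    then obtain d where d: "is_cokernel C d j" using cokernel_exists by blast
    note dD = cokernelD[OF d]
    have dH: "d \<in> Hom C Y (Cod C d)" and dO: "Cod C d \<in> Obj C" using dD(1,3) j(1) by simp_all
    have dj: "d \<cdot> j = ZeroArr C B (Cod C d)" using dD(4) j(1) by simp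
    have "(d \<cdot> j') \<cdot> y = (d \<cdot> j) \<cdot> x" using dH j DY(1-3) Dy(1-3) Dx(1-3) by simp
    also have "\<dots> = ZeroArr C B2 (Cod C d)" unfolding dj using dO Dx(1-3) by simp
    finally have z: "(d \<cdot> j') \<cdot> y = ZeroArr C B2 (Cod C d)" .
    have dj'H: "d \<cdot> j' \<in> Hom C B' (Cod C d)" using dH DY(1-3) by simp
    obtain k where k: "k \<in> Hom C A2 (Cod C d)" "k \<cdot> y' = d \<cdot> j'" by (rule sx_desc[OF y dj'H z])
    have "d = k \<cdot> \<theta>"
    proof (rule uniq[OF dH])
      show "k \<cdot> \<theta> \<in> Hom C Y (Cod C d)" using k(1) \<theta>(1) by simp
      show "d \<cdot> j = (k \<cdot> \<theta>) \<cdot> j" using dj k(1) \<theta>(1,2) j(1) Dx(8) by simp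
      show "d \<cdot> j' = (k \<cdot> \<theta>) \<cdot> j'" using k \<theta>(1,3) DY(1-3) by simp
    qed
    then have "d \<cdot> g = (k \<cdot> \<theta>) \<cdot> g" by simp
    also have "\<dots> = ZeroArr C T (Cod C d)" using k(1) \<theta>(1) g T by simp
    finally have dg: "d \<cdot> g = ZeroArr C T (Cod C d)" .
    obtain u where u: "u \<in> Arr C" "Dom C u = Dom C g" "Cod C u = Dom C j" "j \<cdot> u = g"
      by (rule kernel_lift[OF mono_kernel_of_cokernel[OF jm d] _ _ dg]) (use g(1) dH in simp_all)
    then show "\<exists>u\<in>Hom C T B. j \<cdot> u = g" using g(1) j(1) by (intro bexI[of _ u]) simp_all
  qed
  have U1: "\<forall>T. \<forall>u \<in> Hom C B T. \<forall>v \<in> Hom C B' T. u \<cdot> x = v \<cdot> y \<longrightarrow> (\<exists>w \<in> Hom C Y T. w \<cdot> j = u \<and> w \<cdot> j' = v)"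
    by (intro allI ballI impI) (rule univ)
  have U2: "\<forall>T. \<forall>w \<in> Hom C Y T. \<forall>w' \<in> Hom C Y T. w \<cdot> j = w' \<cdot> j \<longrightarrow> w \<cdot> j' = w' \<cdot> j' \<longrightarrow> w = w'"
    by (intro allI ballI impI) (rule uniq)
  show ?thesis
    by (rule exI[of _ Y], rule exI[of _ j], rule exI[of _ j'], rule exI[of _ \<rho>], rule exI[of _ \<theta>], intro conjI)
      (fact \<open>sx C B Y A2 j \<theta>\<close> sY j(2,3) \<theta>(3) U1 U2)+
qed

text \<open>Modulo the common subobject \<open>B2\<close>, the pushout \<open>Y\<close> is the
  direct sum of \<open>B1\<close> and \<open>A2\<close>. An element killed by both projections comes
  first from \<open>B'\<close> and then from \<open>B2\<close>.\<close>

lemma pushout_kernel: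
  assumes x: "sx C B2 B B1 x x'" and y: "sx C B2 B' A2 y y'"
    and Y: "sx C B' Y B1 j' \<rho>" "sx C B Y A2 j \<theta>" "\<rho> \<cdot> j = x'" "\<theta> \<cdot> j' = y'" "j \<cdot> x = j' \<cdot> y"
    and S: "i1 \<in> Hom C B1 S" "i2 \<in> Hom C A2 S" "p1 \<in> Hom C S B1" "p2 \<in> Hom C S A2"
    and e: "p1 \<cdot> i1 = Idt C B1" "p2 \<cdot> i2 = Idt C A2" "p1 \<cdot> i2 = ZeroArr C A2 B1" "p2 \<cdot> i1 = ZeroArr C B1 A2"
      "Plus C (i1 \<cdot> p1) (i2 \<cdot> p2) = Idt C S"
  shows "sx C B2 Y S (j \<cdot> x) (Plus C (i1 \<cdot> \<rho>) (i2 \<cdot> \<theta>))"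
proof (rule sxI)
  note Dx = sxD[OF x] and Dy = sxD[OF y] and D1 = sxD[OF Y(1)] and D2 = sxD[OF Y(2)]
  define \<pi> where "\<pi> = Plus C (i1 \<cdot> \<rho>) (i2 \<cdot> \<theta>)"
  have SO: "S \<in> Obj C" using S(1) by auto
  have \<pi>: "\<pi> \<in> Hom C Y S" unfolding \<pi>_def using S D1(4-6) D2(4-6) by simp
  have \<pi>j: "\<pi> \<cdot> j = i1 \<cdot> x'" unfolding \<pi>_def using S D1(4-6) D2(1-10) Dx(4-6) SO Y(3) by simp
  have \<pi>j': "\<pi> \<cdot> j' = i2 \<cdot> y'" unfolding \<pi>_def using S D1(1-10) D2(4-6) Dy(4-6) SO Y(4) by simp
  have p\<pi>: "p1 \<cdot> \<pi> = \<rho>" "p2 \<cdot> \<pi> = \<theta>" unfolding \<pi>_def using S D1(4-6,8) D2(4-6,8) D1(9) D2(9)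
    by (simp_all add: reassoc[OF e(1)] reassoc[OF e(2)] reassoc[OF e(3)] reassoc[OF e(4)])
  show "Plus C (i1 \<cdot> \<rho>) (i2 \<cdot> \<theta>) \<in> Hom C Y S" using \<pi> unfolding \<pi>_def .
  show "is_mono C (j \<cdot> x)" by (rule mono_Comp[OF Dx(11) D2(11)]) (use Dx(3) D2(2) in simp)
  show "j \<cdot> x \<in> Hom C B2 Y" using Dx(1-3) D2(1-3) by simp
  show "is_epi C (Plus C (i1 \<cdot> \<rho>) (i2 \<cdot> \<theta>))" unfolding \<pi>_def[symmetric]
  proof (rule epiI)
    show "\<pi> \<in> Arr C" using \<pi> by simp
    fix f assume f: "f \<in> Arr C" "Dom C f = Cod C \<pi>" "f \<cdot> \<pi> = ZeroArr C (Dom C \<pi>) (Cod C f)"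
    have fH: "f \<in> Hom C S (Cod C f)" and fO: "Cod C f \<in> Obj C" and fz: "f \<cdot> \<pi> = ZeroArr C Y (Cod C f)"
      using f \<pi> by simp_all
    have "(f \<cdot> i1) \<cdot> x' = (f \<cdot> \<pi>) \<cdot> j" using fH S Dx(4-6) \<pi> D2(1-3) by (simp add: \<pi>j)
    also have "\<dots> = ZeroArr C B (Cod C f)" unfolding fz using fO D2(1-3) by simp
    finally have "f \<cdot> i1 = ZeroArr C (Cod C x') (Cod C f)"
      by (rule epi_Zero[OF Dx(12)]) (use fH S(1) Dx(4-6) in simp_all)
    then have 1: "f \<cdot> i1 = ZeroArr C B1 (Cod C f)" using Dx(6) by simp
    have "(f \<cdot> i2) \<cdot> y' = (f \<cdot> \<pi>) \<cdot> j'" using fH S Dy(4-6) \<pi> D1(1-3) by (simp add: \<pi>j')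
    also have "\<dots> = ZeroArr C B' (Cod C f)" unfolding fz using fO D1(1-3) by simp
    finally have "f \<cdot> i2 = ZeroArr C (Cod C y') (Cod C f)"
      by (rule epi_Zero[OF Dy(12)]) (use fH S(2) Dy(4-6) in simp_all)
    then have 2: "f \<cdot> i2 = ZeroArr C A2 (Cod C f)" using Dy(6) by simp
    have "f = f \<cdot> Plus C (i1 \<cdot> p1) (i2 \<cdot> p2)" using fH by (simp add: e(5))
    also have "\<dots> = ZeroArr C S (Cod C f)" using fH S fO SO by (simp add: reassoc[OF 1] reassoc[OF 2])
    finally show "f = ZeroArr C (Cod C \<pi>) (Cod C f)" using \<pi> by simp
  qed
  show "Plus C (i1 \<cdot> \<rho>) (i2 \<cdot> \<theta>) \<cdot> (j \<cdot> x) = ZeroArr C B2 S"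
    unfolding \<pi>_def[symmetric] using \<pi> D2(1-3) Dx(1-10) S(1) by (simp add: reassoc[OF \<pi>j])
  fix T s assume s: "s \<in> Hom C T Y" "Plus C (i1 \<cdot> \<rho>) (i2 \<cdot> \<theta>) \<cdot> s = ZeroArr C T S"
  have T: "T \<in> Obj C" using s(1) by auto
  have ps: "\<pi> \<cdot> s = ZeroArr C T S" unfolding \<pi>_def by (rule s(2))
  have "\<rho> \<cdot> s = p1 \<cdot> (\<pi> \<cdot> s)" using s(1) \<pi> S(3) by (simp add: reassoc[OF p\<pi>(1)])
  also have "\<dots> = ZeroArr C T B1" unfolding ps using T S(3) by simp
  finally obtain r where r: "r \<in> Hom C T B'" "j' \<cdot> r = s" by (rule sx_lift[OF Y(1) s(1)])
  have "y' \<cdot> r = \<theta> \<cdot> (j' \<cdot> r)" using r(1) D1(1-3) D2(4-6) by (simp add: reassoc[OF Y(4)])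
  also have "\<dots> = p2 \<cdot> (\<pi> \<cdot> s)" unfolding r(2) using s(1) \<pi> S(4) by (simp add: reassoc[OF p\<pi>(2)])
  also have "\<dots> = ZeroArr C T A2" unfolding ps using T S(4) by simp
  finally obtain c where c: "c \<in> Hom C T B2" "y \<cdot> c = r" by (rule sx_lift[OF y r(1)])
  have "(j \<cdot> x) \<cdot> c = (j' \<cdot> y) \<cdot> c" by (simp only: Y(5))
  also have "\<dots> = s" using c D1(1-3) Dy(1-3) r(2) by simp
  finally show "\<exists>u\<in>Hom C T B2. (j \<cdot> x) \<cdot> u = s" using c(1) by blast
qed

text \<open>An element killed by \<open>q \<cdot> w\<close> is killed by
  \<open>\<xi> \<cdot> w\<close>, so it comes from \<open>Y\<close>; there the composite is
  \<open>\<theta>\<close> followed by the mono \<open>t\<close>, so it comes from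
  \<open>B\<close>.\<close>

lemma cross_forward:
  assumes s: "sx C Y M A1 u (\<xi> \<cdot> w)" and w: "w \<in> Hom C M Xo" "is_epi C w"
    and j: "sx C B Y A2 j \<theta>" and q: "sx C B1 Xo A l q"
    and t: "t \<in> Hom C A2 A" "is_mono C t" and t': "t' \<in> Hom C A A1" "\<xi> = t' \<cdot> q"
    and e: "q \<cdot> (w \<cdot> u) = t \<cdot> \<theta>"
  shows "sx C B M A (u \<cdot> j) (q \<cdot> w)"
proof (rule sxI)
  note D = sxD[OF s] and Dj = sxD[OF j] and Dq = sxD[OF q]
  show "is_mono C (u \<cdot> j)" by (rule mono_Comp[OF Dj(11) D(11)]) (use D(2) Dj(3) in simp)
  show "is_epi C (q \<cdot> w)" by (rule epi_Comp[OF Dq(12) w(2)]) (use w(1) Dq(5) in simp)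
  show "u \<cdot> j \<in> Hom C B M" "q \<cdot> w \<in> Hom C M A" using D(1-3) Dj(1-3) Dq(4-6) w(1) by simp_all
  have "(q \<cdot> w) \<cdot> (u \<cdot> j) = (q \<cdot> (w \<cdot> u)) \<cdot> j" using D(1-3) Dj(1-3) Dq(4-6) w(1) by simp
  also have "\<dots> = ZeroArr C B A" unfolding e using t(1) Dj(1-10) by simp
  finally show "(q \<cdot> w) \<cdot> (u \<cdot> j) = ZeroArr C B A" .
  fix T g assume g: "g \<in> Hom C T M" "(q \<cdot> w) \<cdot> g = ZeroArr C T A"
  have T: "T \<in> Obj C" using g(1) by auto
  have "(\<xi> \<cdot> w) \<cdot> g = t' \<cdot> ((q \<cdot> w) \<cdot> g)" unfolding t'(2) using t'(1) Dq(4-6) w(1) g(1) by simp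
  also have "\<dots> = ZeroArr C T A1" unfolding g(2) using T t'(1) by simp
  finally obtain r where r: "r \<in> Hom C T Y" "u \<cdot> r = g" by (rule sx_lift[OF s g(1)])
  have "t \<cdot> (\<theta> \<cdot> r) = (q \<cdot> (w \<cdot> u)) \<cdot> r" unfolding e using t(1) Dj(4-6) r(1) by simp
  also have "\<dots> = (q \<cdot> w) \<cdot> g" unfolding r(2)[symmetric] using Dq(4-6) w(1) D(1-3) r(1) by simp
  also have "\<dots> = ZeroArr C T A" by (rule g(2))
  finally have "\<theta> \<cdot> r = ZeroArr C T (Dom C t)" by (rule mono_Zero[OF t(2)]) (use t(1) Dj(4-6) r(1) in simp_all)
  then have "\<theta> \<cdot> r = ZeroArr C T A2" using t(1) by simp
  then obtain c where c: "c \<in> Hom C T B" "j \<cdot> c = r" by (rule sx_lift[OF j r(1)])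
  have "(u \<cdot> j) \<cdot> c = g" using c D(1-3) Dj(1-3) r(2) by simp
  then show "\<exists>u'\<in>Hom C T B. (u \<cdot> j) \<cdot> u' = g" using c(1) by blast
qed

text \<open>Modulo \<open>B'\<close>, the arrow \<open>u\<close> becomes the inclusion
  \<open>z\<close> of \<open>B1\<close> in \<open>A'\<close>; so it is mono and the quotient of
  \<open>M\<close> by \<open>Y\<close> is that of \<open>A'\<close> by \<open>B1\<close>.\<close>

lemma cross_backward:
  assumes s': "sx C B' M A' i' p'" and Y: "sx C B' Y B1 j' \<rho>" and z: "sx C B1 A' A1 z z'"
    and u: "u \<in> Hom C Y M" "u \<cdot> j' = i'" "p' \<cdot> u = z \<cdot> \<rho>"
  shows "sx C Y M A1 u (z' \<cdot> p')"
proof (rule sxI)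
  note D = sxD[OF s'] and DY = sxD[OF Y] and Dz = sxD[OF z]
  show um: "is_mono C u"
  proof (rule monoI)
    fix r assume r: "r \<in> Arr C" "Cod C r = Dom C u" "u \<cdot> r = ZeroArr C (Dom C r) (Cod C u)"
    have rH: "r \<in> Hom C (Dom C r) Y" and T: "Dom C r \<in> Obj C" and ur: "u \<cdot> r = ZeroArr C (Dom C r) M"
      using r u(1) by simp_all
    have "z \<cdot> (\<rho> \<cdot> r) = p' \<cdot> (u \<cdot> r)" using rH u(1) DY(4-6) Dz(1-3) D(4-6) by (simp add: reassoc[OF u(3)])
    also have "\<dots> = ZeroArr C (Dom C r) A'" unfolding ur using T D(4-6) by simp
    finally have "\<rho> \<cdot> r = ZeroArr C (Dom C r) (Dom C z)"
      by (rule mono_Zero[OF Dz(11)]) (use rH DY(4-6) Dz(1-3) in simp_all)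
    then have "\<rho> \<cdot> r = ZeroArr C (Dom C r) B1" using Dz(2) by simp
    then obtain c where c: "c \<in> Hom C (Dom C r) B'" "j' \<cdot> c = r" by (rule sx_lift[OF Y rH])
    have "i' \<cdot> c = u \<cdot> (j' \<cdot> c)" using c(1) u(1) DY(1-3) by (simp add: reassoc[OF u(2)])
    then have "i' \<cdot> c = ZeroArr C (Dom C r) M" unfolding c(2) ur .
    then have "c = ZeroArr C (Dom C r) (Dom C i')" by (rule mono_Zero[OF D(11)]) (use c(1) D(1-3) in simp_all)
    then have c0: "c = ZeroArr C (Dom C r) B'" using D(2) by simp
    have "j' \<cdot> c = ZeroArr C (Dom C r) Y" unfolding c0 using DY(1-3) T D(7) by simp
    then show "r = ZeroArr C (Dom C r) (Dom C u)" using c(2) u(1) by simp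
  qed (use u(1) in simp)
  show "is_epi C (z' \<cdot> p')" by (rule epi_Comp[OF Dz(12) D(12)]) (use D(6) Dz(5) in simp)
  show "u \<in> Hom C Y M" "z' \<cdot> p' \<in> Hom C M A1" using u(1) D(4-6) Dz(4-6) by simp_all
  show "(z' \<cdot> p') \<cdot> u = ZeroArr C Y A1"
    using u(1) D(4-6) Dz(1-10) DY(4-6) by (simp add: u(3) reassoc[OF Dz(10)])
  fix T s assume s: "s \<in> Hom C T M" "(z' \<cdot> p') \<cdot> s = ZeroArr C T A1"
  have T: "T \<in> Obj C" using s(1) by auto
  have "u \<in> Arr C" using u(1) by simp
  then obtain d where d: "is_cokernel C d u" using cokernel_exists by blast
  note dD = cokernelD[OF d]
  have dH: "d \<in> Hom C M (Cod C d)" and dO: "Cod C d \<in> Obj C" and du: "d \<cdot> u = ZeroArr C Y (Cod C d)"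
    using dD(1,3,4) u(1) by simp_all
  have "d \<cdot> i' = (d \<cdot> u) \<cdot> j'" using dH u(1,2) DY(1-3) by simp
  also have "\<dots> = ZeroArr C B' (Cod C d)" unfolding du using dO DY(1-3) by simp
  finally obtain c where c: "c \<in> Hom C A' (Cod C d)" "c \<cdot> p' = d" by (rule sx_desc[OF s' dH])
  have "(c \<cdot> z) \<cdot> \<rho> = (c \<cdot> p') \<cdot> u" using c(1) Dz(1-3) DY(4-6) u(1,3) D(4-6) by simp
  also have "\<dots> = ZeroArr C Y (Cod C d)" unfolding c(2) by (rule du)
  finally have "c \<cdot> z = ZeroArr C (Cod C \<rho>) (Cod C d)"
    by (rule epi_Zero[OF DY(12)]) (use c(1) Dz(1-3) DY(4-6) in simp_all)
  then have "c \<cdot> z = ZeroArr C B1 (Cod C d)" using DY(6) by simp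
  then obtain c' where c': "c' \<in> Hom C A1 (Cod C d)" "c' \<cdot> z' = c" by (rule sx_desc[OF z c(1)])
  have "d \<cdot> s = (c' \<cdot> z') \<cdot> p' \<cdot> s" by (simp only: c'(2) c(2))
  also have "\<dots> = c' \<cdot> ((z' \<cdot> p') \<cdot> s)" using c'(1) Dz(4-6) D(4-6) s(1) by simp
  also have "\<dots> = ZeroArr C T (Cod C d)" unfolding s(2) using c'(1) T by simp
  finally have ds: "d \<cdot> s = ZeroArr C T (Cod C d)" .
  obtain v where v: "v \<in> Arr C" "Dom C v = Dom C s" "Cod C v = Dom C u" "u \<cdot> v = s"
    by (rule kernel_lift[OF mono_kernel_of_cokernel[OF um d] _ _ ds]) (use s(1) dH in simp_all)
  then show "\<exists>v\<in>Hom C T Y. u \<cdot> v = s" using s(1) u(1) by (intro bexI[of _ v]) simp_all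
qed

lemma pullback_cross:
  assumes "sx C B1 A' A1 z z'" "sx C A2 A A1 t t'"
  shows "\<exists>Xo q' q l m. sx C B1 Xo A l q \<and> sx C A2 Xo A' m q' \<and> q' \<cdot> l = z \<and> q \<cdot> m = t \<and> z' \<cdot> q' = t' \<cdot> q \<and>
    (\<forall>T. \<forall>u \<in> Hom C T A'. \<forall>v \<in> Hom C T A. z' \<cdot> u = t' \<cdot> v \<longrightarrow> (\<exists>w \<in> Hom C T Xo. q' \<cdot> w = u \<and> q \<cdot> w = v)) \<and>
    (\<forall>T. \<forall>w \<in> Hom C T Xo. \<forall>w' \<in> Hom C T Xo. q' \<cdot> w = q' \<cdot> w' \<longrightarrow> q \<cdot> w = q \<cdot> w' \<longrightarrow> w = w')"
  by (rule abelian_category.pushout_cross[OF abelian_category_op, of A1 A' B1 z' z A A2 t' t,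
        unfolded sx_op op_cat_sel Hom_op]) (fact assms)+

lemma pullback_cokernel:
  assumes "sx C B1 A' A1 z z'" "sx C A2 A A1 t t'"
    "sx C B1 Xo A l q" "sx C A2 Xo A' m q'" "q' \<cdot> l = z" "q \<cdot> m = t" "z' \<cdot> q' = t' \<cdot> q"
    "p1 \<in> Hom C S B1" "p2 \<in> Hom C S A2" "i1 \<in> Hom C B1 S" "i2 \<in> Hom C A2 S"
    "p1 \<cdot> i1 = Idt C B1" "p2 \<cdot> i2 = Idt C A2" "p2 \<cdot> i1 = ZeroArr C B1 A2" "p1 \<cdot> i2 = ZeroArr C A2 B1"
    "Plus C (i1 \<cdot> p1) (i2 \<cdot> p2) = Idt C S"
  shows "sx C S Xo A1 (Plus C (l \<cdot> p1) (m \<cdot> p2)) (z' \<cdot> q')"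
  by (rule abelian_category.pushout_kernel[OF abelian_category_op, of A1 A' B1 z' z A A2 t' t Xo q l q' m
        p1 S p2 i1 i2, unfolded sx_op op_cat_sel Hom_op]) (fact assms)+

text \<open>\<open>cross\<close> relates two short exact sequences with the same middle term to the four outer sequences
  of their \<open>3 \<times> 3\<close> diagram. Both sides of Green's formula count related pairs: over a given pair on
  the left hand side there is exactly one outer frame up to isomorphism, while the pairs over a given
  frame are the lifts of one extension along \<open>Y \<rightarrow> B1 \<oplus> A2\<close>, where \<open>Y\<close> is the pushout at the corner
  \<open>B2\<close>.\<close>

definition cross :: "('m \<times> 'm) \<times> 'm \<times> 'm \<Rightarrow> ('m \<times> 'm) \<times> ('m \<times> 'm) \<times> ('m \<times> 'm) \<times> 'm \<times> 'm \<Rightarrow> bool" where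
  "cross = (\<lambda>((i, p), (i', p')) ((x, x'), (y, y'), (z, z'), (t, t')).
    i \<cdot> x = i' \<cdot> y \<and> p' \<cdot> i = z \<cdot> x' \<and> p \<cdot> i' = t \<cdot> y' \<and> z' \<cdot> p' = t' \<cdot> p)"

text \<open>Both kernels, that of \<open>p' \<cdot> i\<close> in \<open>B\<close> and that of
  \<open>p \<cdot> i'\<close> in \<open>B'\<close>, are the intersection of \<open>B\<close> and
  \<open>B'\<close> inside \<open>M\<close>. Hence the inclusion \<open>x\<close> into
  \<open>B\<close> determines the inclusion \<open>y\<close> into \<open>B'\<close>.\<close>

lemma cross_complete:
  assumes s: "sx C B M A i p" and s': "sx C B' M A' i' p'" and x: "sx C B2 B B1 x x'"
    and z: "is_mono C z" "z \<in> Hom C B1 A'" "z \<cdot> x' = p' \<cdot> i"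
    and y': "is_epi C y'" "y' \<in> Hom C B' A2" and t: "is_mono C t" "t \<in> Hom C A2 A" "t \<cdot> y' = p \<cdot> i'"
  shows "\<exists>y. sx C B2 B' A2 y y' \<and> i \<cdot> x = i' \<cdot> y"
proof -
  note D = sxD[OF s] and D' = sxD[OF s'] and Dx = sxD[OF x]
  have ixH: "i \<cdot> x \<in> Hom C B2 M" using D(1-3) Dx(1-3) by simp
  have "p' \<cdot> (i \<cdot> x) = z \<cdot> (x' \<cdot> x)"
    using D(1-3) D'(4-6) Dx(1-6) z(2) by (simp add: reassoc[OF z(3)[symmetric]])
  also have "\<dots> = ZeroArr C B2 A'" using z(2) Dx(7,10) by simp
  finally obtain y where y: "y \<in> Hom C B2 B'" "i' \<cdot> y = i \<cdot> x" by (rule sx_lift[OF s' ixH])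
  have "sx C B2 B' A2 y y'"
  proof (rule sxI[OF _ y'(1) y(1) y'(2)])
    show "is_mono C y"
    proof (rule mono_of_Comp[of i'])
      show "is_mono C (i' \<cdot> y)" unfolding y(2) by (rule mono_Comp[OF Dx(11) D(11)]) (use D(2) Dx(3) in simp)
    qed (use y(1) D'(1-3) in simp_all)
    have "t \<cdot> (y' \<cdot> y) = p \<cdot> (i' \<cdot> y)"
      using t(2) y'(2) y(1) D'(1-3) D(4-6) by (simp add: reassoc[OF t(3)])
    also have "\<dots> = ZeroArr C B2 A" unfolding y(2) using D(1-10) Dx(1-3,7) by (simp add: reassoc[OF D(10)])
    finally have "y' \<cdot> y = ZeroArr C B2 (Dom C t)"
      by (rule mono_Zero[OF t(1)]) (use t(2) y'(2) y(1) in simp_all)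
    then show "y' \<cdot> y = ZeroArr C B2 A2" using t(2) by simp
    fix T g assume g: "g \<in> Hom C T B'" "y' \<cdot> g = ZeroArr C T A2"
    have T: "T \<in> Obj C" using g(1) by auto
    have i'g: "i' \<cdot> g \<in> Hom C T M" using g(1) D'(1-3) by simp
    have "p \<cdot> (i' \<cdot> g) = t \<cdot> (y' \<cdot> g)"
      using t(2) y'(2) g(1) D'(1-3) D(4-6) by (simp add: reassoc[OF t(3)])
    also have "\<dots> = ZeroArr C T A" unfolding g(2) using t(2) T by simp
    finally obtain r where r: "r \<in> Hom C T B" "i \<cdot> r = i' \<cdot> g" by (rule sx_lift[OF s i'g])
    have "z \<cdot> (x' \<cdot> r) = p' \<cdot> (i \<cdot> r)"
      using r(1) D(1-3) D'(4-6) Dx(4-6) z(2) by (simp add: reassoc[OF z(3)])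
    also have "\<dots> = ZeroArr C T A'" unfolding r(2) using g(1) D'(1-10) T by (simp add: reassoc[OF D'(10)])
    finally have "x' \<cdot> r = ZeroArr C T (Dom C z)" by (rule mono_Zero[OF z(1)]) (use z(2) r(1) Dx(4-6) in simp_all)
    then have "x' \<cdot> r = ZeroArr C T B1" using z(2) by simp
    then obtain r' where r': "r' \<in> Hom C T B2" "x \<cdot> r' = r" by (rule sx_lift[OF x r(1)])
    have e: "i' \<cdot> (y \<cdot> r') = i' \<cdot> g"
      using r'(1) y(1) D'(1-3) D(1-3) Dx(1-3) r(2) by (simp add: reassoc[OF y(2)] r'(2))
    have "y \<cdot> r' = g" by (rule mono_cancel[OF D'(11) e]) (use r'(1) y(1) g(1) D'(2) in simp_all)
    then show "\<exists>u\<in>Hom C T B2. y \<cdot> u = g" using r'(1) by blast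
  qed
  then show ?thesis using y(2) by metis
qed

lemma cross_complete_op:
  assumes "sx C B M A i p" "sx C B' M A' i' p'" "sx C B1 A' A1 z z'"
    "is_epi C x'" "x' \<in> Hom C B B1" "z \<cdot> x' = p' \<cdot> i"
    "is_mono C t" "t \<in> Hom C A2 A" "is_epi C y'" "y' \<in> Hom C B' A2" "t \<cdot> y' = p \<cdot> i'"
  shows "\<exists>t'. sx C A2 A A1 t t' \<and> z' \<cdot> p' = t' \<cdot> p"
  by (rule abelian_category.cross_complete[OF abelian_category_op, of A' M B' p' i' A B p i A1 B1 z' z x' t A2 y',
        unfolded sx_op op_cat_sel Hom_op is_mono_op is_epi_op]) (fact assms)+

end

section \<open>Double counting of crosses\<close>

context finitary_lifting_category
begin

text \<open>By the universal properties of the pushout \<open>Y\<close> and the pullback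
  \<open>Xo\<close>, two crossing sequences on \<open>M\<close> with the given frame are the same as
  arrows from \<open>Y\<close> to \<open>M\<close> and from \<open>M\<close> to \<open>Xo\<close>
  with prescribed composite \<open>l0 \<cdot> \<pi>\<close>; \<open>gsum_lifts\<close> counts
  these.\<close>

lemma gsum_cross_left:
  assumes x: "sx C B2 B B1 x x'" and y: "sx C B2 B' A2 y y'" and z: "sx C B1 A' A1 z z'" and t: "sx C A2 A A1 t t'"
  shows "(\<Sum>\<^sub>g M. of_nat (card {\<omega> \<in> sesm A B M \<times> sesm A' B' M. cross \<omega> ((x, x'), (y, y'), (z, z'), (t, t'))})) =
    ennreal (1 / euler A1 B2)"
proof -
  note Dx = sxD[OF x] and Dy = sxD[OF y] and Dz = sxD[OF z] and Dt = sxD[OF t]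
  obtain Y j j' \<rho> \<theta> where Y: "sx C B' Y B1 j' \<rho>" "sx C B Y A2 j \<theta>" "\<rho> \<cdot> j = x'" "\<theta> \<cdot> j' = y'" "j \<cdot> x = j' \<cdot> y"
    and Yu: "\<forall>T. \<forall>u \<in> Hom C B T. \<forall>v \<in> Hom C B' T. u \<cdot> x = v \<cdot> y \<longrightarrow> (\<exists>w \<in> Hom C Y T. w \<cdot> j = u \<and> w \<cdot> j' = v)"
    and Ye: "\<forall>T. \<forall>w \<in> Hom C Y T. \<forall>w' \<in> Hom C Y T. w \<cdot> j = w' \<cdot> j \<longrightarrow> w \<cdot> j' = w' \<cdot> j' \<longrightarrow> w = w'"
    using pushout_cross[OF x y] by (elim exE conjE) (rule that)
  obtain Xo q' q l m where Xo: "sx C B1 Xo A l q" "sx C A2 Xo A' m q'" "q' \<cdot> l = z" "q \<cdot> m = t" "z' \<cdot> q' = t' \<cdot> q"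
    and Xu: "\<forall>T. \<forall>u \<in> Hom C T A'. \<forall>v \<in> Hom C T A. z' \<cdot> u = t' \<cdot> v \<longrightarrow> (\<exists>w \<in> Hom C T Xo. q' \<cdot> w = u \<and> q \<cdot> w = v)"
    and Xe: "\<forall>T. \<forall>w \<in> Hom C T Xo. \<forall>w' \<in> Hom C T Xo. q' \<cdot> w = q' \<cdot> w' \<longrightarrow> q \<cdot> w = q \<cdot> w' \<longrightarrow> w = w'"
    using pullback_cross[OF z t] by (elim exE conjE) (rule that)
  note Dj = sxD[OF Y(2)] and Dj' = sxD[OF Y(1)] and Dq = sxD[OF Xo(1)] and Dq' = sxD[OF Xo(2)]
  obtain S i1 i2 p1 p2 where S: "S \<in> Obj C" "i1 \<in> Hom C B1 S" "i2 \<in> Hom C A2 S" "p1 \<in> Hom C S B1"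
    "p2 \<in> Hom C S A2" and e: "p1 \<cdot> i1 = Idt C B1" "p2 \<cdot> i2 = Idt C A2" "p1 \<cdot> i2 = ZeroArr C A2 B1"
    "p2 \<cdot> i1 = ZeroArr C B1 A2" "Plus C (i1 \<cdot> p1) (i2 \<cdot> p2) = Idt C S"
    by (rule biprodE[OF Dx(9) Dy(9)])
  \<comment> \<open>The direct sum \<open>S\<close> of \<open>B1\<close> and \<open>A2\<close> is
    both the quotient of \<open>Y\<close> by \<open>B2\<close> and the kernel of the map from
    \<open>Xo\<close> to \<open>A1\<close>. So \<open>\<pi>\<close> and \<open>l0\<close> form the
    image factorization of the prescribed composite.\<close>
  define \<pi> where "\<pi> = Plus C (i1 \<cdot> \<rho>) (i2 \<cdot> \<theta>)"
  define l0 where "l0 = Plus C (l \<cdot> p1) (m \<cdot> p2)"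
  define \<xi> where "\<xi> = z' \<cdot> q'"
  have sY: "sx C B2 Y S (j \<cdot> x) \<pi>" unfolding \<pi>_def by (rule pushout_kernel[OF x y Y S(2-5) e])
  have sX: "sx C S Xo A1 l0 \<xi>" unfolding l0_def \<xi>_def
    by (rule pullback_cokernel[OF z t Xo S(4,5,2,3) e(1,2,4,3,5)])
  note DY = sxD[OF sY] and DX = sxD[OF sX]
  have \<xi>': "\<xi> = t' \<cdot> q" unfolding \<xi>_def by (rule Xo(5))
  have ql: "q \<cdot> l0 = t \<cdot> p2" unfolding l0_def using S(1,4,5) Dq(1-10) Dq'(1-3) Dt(1-3) Xo(4)
    by (simp add: reassoc[OF Xo(4)] reassoc[OF Dq(10)])
  have q'l: "q' \<cdot> l0 = z \<cdot> p1" unfolding l0_def using S(1,4,5) Dq'(1-10) Dq(1-3) Dz(1-3) Xo(3)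
    by (simp add: reassoc[OF Xo(3)] reassoc[OF Dq'(10)])
  have p\<pi>: "p1 \<cdot> \<pi> = \<rho>" "p2 \<cdot> \<pi> = \<theta>" unfolding \<pi>_def using S Dj(4-6,8,9) Dj'(4-6,8,9)
    by (simp_all add: reassoc[OF e(1)] reassoc[OF e(2)] reassoc[OF e(3)] reassoc[OF e(4)])
  have q\<pi>: "q \<cdot> (l0 \<cdot> \<pi>) = t \<cdot> \<theta>" "q' \<cdot> (l0 \<cdot> \<pi>) = z \<cdot> \<rho>"
    using Dq(4-6) Dq'(4-6) DX(1-3) DY(4-6) S(4,5) Dt(1-3) Dz(1-3)
    by (simp_all add: reassoc[OF ql] reassoc[OF q'l] p\<pi>)
  define UW where "UW = (\<lambda>M. {(u, w). u \<in> Hom C Y M \<and> w \<in> Hom C M Xo \<and> sx C Y M A1 u (\<xi> \<cdot> w) \<and> w \<cdot> u = l0 \<cdot> \<pi>})"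
  define W where "W = (\<lambda>M. {\<omega> \<in> sesm A B M \<times> sesm A' B' M. cross \<omega> ((x, x'), (y, y'), (z, z'), (t, t'))})"
  have "card (W M) = card (UW M)" for M
  proof -
    have "bij_betw (\<lambda>(u, w). ((u \<cdot> j, q \<cdot> w), (u \<cdot> j', q' \<cdot> w))) (UW M) (W M)"
      unfolding bij_betw_def
    proof
      show "inj_on (\<lambda>(u, w). ((u \<cdot> j, q \<cdot> w), (u \<cdot> j', q' \<cdot> w))) (UW M)"
      proof (rule inj_onI)
        fix a b assume "a \<in> UW M" "b \<in> UW M" and ab: "(\<lambda>(u, w). ((u \<cdot> j, q \<cdot> w), (u \<cdot> j', q' \<cdot> w))) a =
          (\<lambda>(u, w). ((u \<cdot> j, q \<cdot> w), (u \<cdot> j', q' \<cdot> w))) b"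
        then obtain u w u' w' where a: "a = (u, w)" "u \<in> Hom C Y M" "w \<in> Hom C M Xo"
          and b: "b = (u', w')" "u' \<in> Hom C Y M" "w' \<in> Hom C M Xo" unfolding UW_def by blast
        have eq: "u \<cdot> j = u' \<cdot> j" "u \<cdot> j' = u' \<cdot> j'" "q' \<cdot> w = q' \<cdot> w'" "q \<cdot> w = q \<cdot> w'"
          using ab unfolding a(1) b(1) by simp_all
        have "u = u'" by (rule Ye[rule_format, OF a(2) b(2) eq(1,2)])
        moreover have "w = w'" by (rule Xe[rule_format, OF a(3) b(3) eq(3,4)])
        ultimately show "a = b" using a(1) b(1) by simp
      qed
      show "(\<lambda>(u, w). ((u \<cdot> j, q \<cdot> w), (u \<cdot> j', q' \<cdot> w))) ` UW M = W M"
      proof (intro equalityI subsetI)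
        fix \<omega> assume "\<omega> \<in> (\<lambda>(u, w). ((u \<cdot> j, q \<cdot> w), (u \<cdot> j', q' \<cdot> w))) ` UW M"
        then obtain u w where \<omega>: "\<omega> = ((u \<cdot> j, q \<cdot> w), (u \<cdot> j', q' \<cdot> w))" and u: "u \<in> Hom C Y M" and w: "w \<in> Hom C M Xo"
          and s: "sx C Y M A1 u (\<xi> \<cdot> w)" and wu: "w \<cdot> u = l0 \<cdot> \<pi>" unfolding UW_def by auto
        \<comment> \<open>A map of extensions of \<open>A1\<close> that is \<open>\<pi>\<close> on
          the kernels and the identity on the quotients, so the four lemma applies.\<close>
        have we: "is_epi C w"
        proof (rule sx_map_epi[OF sX s w _ wu _ iso_epi _ DY(12)])
          show "\<xi> \<cdot> w = Idt C A1 \<cdot> (\<xi> \<cdot> w)" using w DX(4-6) by simp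
        qed (use DX(9) DY(4-6) in simp_all)
        have Ht: "t \<in> Hom C A2 A" "t' \<in> Hom C A A1" "z \<in> Hom C B1 A'" "z' \<in> Hom C A' A1" using Dt(1-6) Dz(1-6) by simp_all
        have e1: "q \<cdot> (w \<cdot> u) = t \<cdot> \<theta>" and e2: "q' \<cdot> (w \<cdot> u) = z \<cdot> \<rho>" unfolding wu by (rule q\<pi>)+
        have "sx C B M A (u \<cdot> j) (q \<cdot> w)" by (rule cross_forward[OF s w we Y(2) Xo(1) Ht(1) Dt(11) Ht(2) \<xi>' e1])
        moreover have "sx C B' M A' (u \<cdot> j') (q' \<cdot> w)"
          by (rule cross_forward[OF s w we Y(1) Xo(2) Ht(3) Dz(11) Ht(4) \<xi>_def e2])
        moreover have "(u \<cdot> j) \<cdot> x = (u \<cdot> j') \<cdot> y" using u Dj(1-3) Dj'(1-3) Dx(1-3) Dy(1-3) Y(5) by simp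
        moreover have "(q' \<cdot> w) \<cdot> (u \<cdot> j) = (q' \<cdot> (w \<cdot> u)) \<cdot> j" using u w Dq'(4-6) Dj(1-3) by simp
        moreover have "(z \<cdot> \<rho>) \<cdot> j = z \<cdot> x'" using Ht(3) Dj'(4-6) Dj(1-3) Y(3) by simp
        moreover have "(q \<cdot> w) \<cdot> (u \<cdot> j') = (q \<cdot> (w \<cdot> u)) \<cdot> j'" using u w Dq(4-6) Dj'(1-3) by simp
        moreover have "(t \<cdot> \<theta>) \<cdot> j' = t \<cdot> y'" using Ht(1) Dj(4-6) Dj'(1-3) Y(4) by simp
        moreover have "z' \<cdot> (q' \<cdot> w) = t' \<cdot> (q \<cdot> w)"
          using w Dq'(4-6) Dq(4-6) Ht(2,4) by (simp add: reassoc[OF Xo(5)])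
        ultimately show "\<omega> \<in> W M" unfolding W_def \<omega> sesm_def cross_def by (simp only: e1 e2) simp
      next
        fix \<omega> assume "\<omega> \<in> W M"
        then obtain i p i' p' where \<omega>: "\<omega> = ((i, p), (i', p'))" and s: "sx C B M A i p" and s': "sx C B' M A' i' p'"
          and c: "i \<cdot> x = i' \<cdot> y" "p' \<cdot> i = z \<cdot> x'" "p \<cdot> i' = t \<cdot> y'" "z' \<cdot> p' = t' \<cdot> p"
          unfolding W_def sesm_def cross_def by auto
        note D = sxD[OF s] and D' = sxD[OF s']
        have H: "i \<in> Hom C B M" "i' \<in> Hom C B' M" "p \<in> Hom C M A" "p' \<in> Hom C M A'" using D(1-6) D'(1-6) by simp_all
        obtain u where u: "u \<in> Hom C Y M" "u \<cdot> j = i" "u \<cdot> j' = i'" using Yu[rule_format, OF H(1,2) c(1)] by (elim bexE conjE) (rule that)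
        obtain w where w: "w \<in> Hom C M Xo" "q' \<cdot> w = p'" "q \<cdot> w = p" using Xu[rule_format, OF H(4,3) c(4)] by (elim bexE conjE) (rule that)
        have pu: "p \<cdot> u = t \<cdot> \<theta>"
        proof (rule Ye[rule_format])
          show "p \<cdot> u \<in> Hom C Y A" "t \<cdot> \<theta> \<in> Hom C Y A" using u(1) H(3) Dt(1-3) Dj(4-6) by simp_all
          show "(p \<cdot> u) \<cdot> j = (t \<cdot> \<theta>) \<cdot> j" using u(1,2) H(3) Dt(1-3) Dj(1-10) D(10) by simp
          show "(p \<cdot> u) \<cdot> j' = (t \<cdot> \<theta>) \<cdot> j'" using u(1,3) H(3) Dt(1-3) Dj(4-6) Dj'(1-3) c(3) Y(4) by simp
        qed
        have p'u: "p' \<cdot> u = z \<cdot> \<rho>"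
        proof (rule Ye[rule_format])
          show "p' \<cdot> u \<in> Hom C Y A'" "z \<cdot> \<rho> \<in> Hom C Y A'" using u(1) H(4) Dz(1-3) Dj'(4-6) by simp_all
          show "(p' \<cdot> u) \<cdot> j = (z \<cdot> \<rho>) \<cdot> j" using u(1,2) H(4) Dz(1-3) Dj(1-3) Dj'(4-6) c(2) Y(3) by simp
          show "(p' \<cdot> u) \<cdot> j' = (z \<cdot> \<rho>) \<cdot> j'" using u(1,3) H(4) Dz(1-3) Dj'(1-10) D'(10) by simp
        qed
        have "w \<cdot> u = l0 \<cdot> \<pi>"
        proof (rule Xe[rule_format])
          show "w \<cdot> u \<in> Hom C Y Xo" "l0 \<cdot> \<pi> \<in> Hom C Y Xo" using u(1) w(1) DX(1-3) DY(4-6) by simp_all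
          show "q' \<cdot> (w \<cdot> u) = q' \<cdot> (l0 \<cdot> \<pi>)" unfolding q\<pi> p'u[symmetric]
            using u(1) w(1) Dq'(4-6) by (simp add: reassoc[OF w(2)])
          show "q \<cdot> (w \<cdot> u) = q \<cdot> (l0 \<cdot> \<pi>)" unfolding q\<pi> pu[symmetric]
            using u(1) w(1) Dq(4-6) by (simp add: reassoc[OF w(3)])
        qed
        moreover have "sx C Y M A1 u (z' \<cdot> p')" by (rule cross_backward[OF s' Y(1) z u(1,3) p'u])
        moreover have "\<xi> \<cdot> w = z' \<cdot> p'" unfolding \<xi>_def using w(1) Dq'(4-6) Dz(4-6) by (simp add: w(2))
        ultimately have "(u, w) \<in> UW M" unfolding UW_def using u(1) w(1) by (simp del: Hom_iff)
        moreover have "\<omega> = (\<lambda>(u, w). ((u \<cdot> j, q \<cdot> w), (u \<cdot> j', q' \<cdot> w))) (u, w)"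
          unfolding \<omega> using u(2,3) w(2,3) by simp
        ultimately show "\<omega> \<in> (\<lambda>(u, w). ((u \<cdot> j, q \<cdot> w), (u \<cdot> j', q' \<cdot> w))) ` UW M" by (rule rev_image_eqI)
      qed
    qed
    from bij_betw_same_card[OF this, symmetric] show ?thesis .
  qed
  then show ?thesis using gsum_lifts[OF sY sX] unfolding W_def UW_def by simp
qed

text \<open>A frame is assembled from image factorizations of \<open>p' \<cdot> i\<close> through
  \<open>B1\<close> and of \<open>p \<cdot> i'\<close> through \<open>A2\<close>, a kernel of
  \<open>x'\<close> and a cokernel of \<open>z\<close>. Each of these choices has total weight 1. In
  this order of summation the kernels and cokernels are summed before the factorizations they depend
  on.\<close>

lemma gsum_cross_right:
  assumes s: "sx C B M A i p" and s': "sx C B' M A' i' p'"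
  shows "(\<Sum>\<^sub>g B1. \<Sum>\<^sub>g A2. \<Sum>\<^sub>g B2. \<Sum>\<^sub>g A1. of_nat (card {\<phi> \<in> sesm B1 B2 B \<times> sesm A2 B2 B' \<times> sesm A1 B1 A' \<times> sesm A1 A2 A.
    cross ((i, p), (i', p')) \<phi>})) = 1"
proof -
  note D = sxD[OF s] and D' = sxD[OF s']
  define F where "F = (\<lambda>B1. {(x', z). is_epi C x' \<and> x' \<in> Hom C B B1 \<and> is_mono C z \<and> z \<in> Hom C B1 A' \<and> z \<cdot> x' = p' \<cdot> i})"
  define F' where "F' = (\<lambda>A2. {(y', t). is_epi C y' \<and> y' \<in> Hom C B' A2 \<and> is_mono C t \<and> t \<in> Hom C A2 A \<and> t \<cdot> y' = p \<cdot> i'})"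
  define Kx where "Kx = (\<lambda>B2 B1 (v :: 'm \<times> 'm). {x. sx C B2 B B1 x (fst v)})"
  define Qz where "Qz = (\<lambda>A1 B1 (v :: 'm \<times> 'm). {z'. sx C B1 A' A1 (snd v) z'})"
  have finF: "finite (F B1)" if "B1 \<in> Obj C" for B1
    by (rule finite_subset[of _ "Hom C B B1 \<times> Hom C B1 A'"])
      (use fin_Hom that D(7) D'(9) in \<open>auto simp: F_def simp del: Hom_iff\<close>)
  have finF': "finite (F' A2)" if "A2 \<in> Obj C" for A2
    by (rule finite_subset[of _ "Hom C B' A2 \<times> Hom C A2 A"])
      (use fin_Hom that D'(7) D(9) in \<open>auto simp: F'_def simp del: Hom_iff\<close>)
  have c: "card {\<phi> \<in> sesm B1 B2 B \<times> sesm A2 B2 B' \<times> sesm A1 B1 A' \<times> sesm A1 A2 A. cross ((i, p), (i', p')) \<phi>} =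
      (\<Sum>v\<in>F B1. card (F' A2) * (card (Kx B2 B1 v) * card (Qz A1 B1 v)))" (is "card ?\<Phi> = _")
    if O: "B1 \<in> Obj C" "A2 \<in> Obj C" "B2 \<in> Obj C" "A1 \<in> Obj C" for B1 A2 B2 A1
  proof -
    \<comment> \<open>Only \<open>y\<close> and \<open>t'\<close> are forgotten: they are unique
      because \<open>i'\<close> is mono and \<open>p\<close> is epi, and they exist by
      \<open>cross_complete\<close> and its dual.\<close>
    let ?f = "\<lambda>((x :: 'm, x' :: 'm), (y :: 'm, y' :: 'm), (z :: 'm, z' :: 'm), (t :: 'm, t' :: 'm)). ((x', z), ((y', t), (x, z')))"
    let ?T = "SIGMA v:F B1. F' A2 \<times> (Kx B2 B1 v \<times> Qz A1 B1 v)"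
    have "bij_betw ?f ?\<Phi> ?T"
      unfolding bij_betw_def
    proof
      show "inj_on ?f ?\<Phi>"
      proof (rule inj_onI)
        fix a b assume a: "a \<in> ?\<Phi>" and b: "b \<in> ?\<Phi>" and ab: "?f a = ?f b"
        obtain x x' y y' z z' t t' where ae: "a = ((x, x'), (y, y'), (z, z'), (t, t'))" by (metis surj_pair)
        obtain x2 x2' y2 y2' z2 z2' t2 t2' where be: "b = ((x2, x2'), (y2, y2'), (z2, z2'), (t2, t2'))" by (metis surj_pair)
        have eq: "x2 = x" "x2' = x'" "y2' = y'" "z2 = z" "z2' = z'" "t2 = t" using ab unfolding ae be by simp_all
        have y: "sx C B2 B' A2 y y'" "i \<cdot> x = i' \<cdot> y" and t: "sx C A2 A A1 t t'" "z' \<cdot> p' = t' \<cdot> p"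
          using a unfolding ae sesm_def cross_def by auto
        have y2: "sx C B2 B' A2 y2 y'" "i \<cdot> x = i' \<cdot> y2" and t2: "sx C A2 A A1 t t2'" "z' \<cdot> p' = t2' \<cdot> p"
          using b unfolding be sesm_def cross_def eq by auto
        have e1: "i' \<cdot> y = i' \<cdot> y2" and e2: "t' \<cdot> p = t2' \<cdot> p" using y(2) y2(2) t(2) t2(2) by simp_all
        have "y = y2" by (rule mono_cancel[OF D'(11) e1]) (use sxD(1-3)[OF y(1)] sxD(1-3)[OF y2(1)] D'(2) in simp_all)
        moreover have "t' = t2'" by (rule epi_cancel[OF D(12) e2]) (use sxD(4-6)[OF t(1)] sxD(4-6)[OF t2(1)] D(6) in simp_all)
        ultimately show "a = b" unfolding ae be eq by simp
      qed
      show "?f ` ?\<Phi> = ?T"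
      proof (intro equalityI subsetI)
        fix a assume "a \<in> ?f ` ?\<Phi>"
        then obtain \<phi> where \<phi>: "\<phi> \<in> ?\<Phi>" "a = ?f \<phi>" by blast
        obtain x x' y y' z z' t t' where \<phi>e: "\<phi> = ((x, x'), (y, y'), (z, z'), (t, t'))" by (metis surj_pair)
        have s4: "sx C B2 B B1 x x'" "sx C B2 B' A2 y y'" "sx C B1 A' A1 z z'" "sx C A2 A A1 t t'"
          and e: "p' \<cdot> i = z \<cdot> x'" "p \<cdot> i' = t \<cdot> y'" using \<phi>(1) unfolding \<phi>e sesm_def cross_def by auto
        have "(x', z) \<in> F B1" unfolding F_def using sxD[OF s4(1)] sxD[OF s4(3)] e(1) by simp
        moreover have "(y', t) \<in> F' A2" unfolding F'_def using sxD[OF s4(2)] sxD[OF s4(4)] e(2) by simp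
        ultimately show "a \<in> ?T" unfolding \<phi>(2) \<phi>e using s4 by (simp add: Kx_def Qz_def)
      next
        fix a assume "a \<in> ?T"
        then obtain x' z y' t x z' where a: "a = ((x', z), ((y', t), (x, z')))" and F1: "(x', z) \<in> F B1"
          and F2: "(y', t) \<in> F' A2" and x: "sx C B2 B B1 x x'" and z': "sx C B1 A' A1 z z'"
          unfolding Kx_def Qz_def by (auto simp del: Hom_iff)
        have xz: "is_epi C x'" "x' \<in> Hom C B B1" "is_mono C z" "z \<in> Hom C B1 A'" "z \<cdot> x' = p' \<cdot> i"
          using F1 unfolding F_def by blast+
        have yt: "is_epi C y'" "y' \<in> Hom C B' A2" "is_mono C t" "t \<in> Hom C A2 A" "t \<cdot> y' = p \<cdot> i'"
          using F2 unfolding F'_def by blast+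
        obtain y where y: "sx C B2 B' A2 y y'" "i \<cdot> x = i' \<cdot> y"
          using cross_complete[OF s s' x xz(3,4,5) yt] by blast
        obtain t' where t': "sx C A2 A A1 t t'" "z' \<cdot> p' = t' \<cdot> p"
          using cross_complete_op[OF s s' z' xz(1,2,5) yt(3,4,1,2,5)] by blast
        have "((x, x'), (y, y'), (z, z'), (t, t')) \<in> ?\<Phi>"
          unfolding sesm_def cross_def using x y z' t' xz(5) yt(5) by simp
        moreover have "a = ?f ((x, x'), (y, y'), (z, z'), (t, t'))" unfolding a by simp
        ultimately show "a \<in> ?f ` ?\<Phi>" by (rule rev_image_eqI)
      qed
    qed
    then have "card ?\<Phi> = card ?T" by (rule bij_betw_same_card)
    also have "\<dots> = (\<Sum>v\<in>F B1. card (F' A2 \<times> (Kx B2 B1 v \<times> Qz A1 B1 v)))"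
    proof (rule card_SigmaI[OF finF[OF O(1)]], rule ballI)
      fix v assume "v \<in> F B1"
      have "Kx B2 B1 v \<subseteq> Hom C B2 B" "Qz A1 B1 v \<subseteq> Hom C A' A1"
        unfolding Kx_def Qz_def using sxD(1-3) sxD(4-6) by fastforce+
      then have "finite (Kx B2 B1 v)" "finite (Qz A1 B1 v)"
        using fin_Hom[OF O(3) D(7)] fin_Hom[OF D'(9) O(4)] finite_subset by blast+
      then show "finite (F' A2 \<times> (Kx B2 B1 v \<times> Qz A1 B1 v))" using finF'[OF O(2)] by simp
    qed
    finally show ?thesis by (simp only: card_cartesian_product)
  qed
  have K: "(\<Sum>\<^sub>g B2. of_nat (card (Kx B2 B1 v))) = 1" if "v \<in> F B1" for v B1
    unfolding Kx_def by (rule gsum_kernels) (use that in \<open>auto simp: F_def simp del: Hom_iff\<close>)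
  have Q: "(\<Sum>\<^sub>g A1. of_nat (card (Qz A1 B1 v))) = 1" if "v \<in> F B1" for v B1
    unfolding Qz_def by (rule gsum_cokernels) (use that in \<open>auto simp: F_def simp del: Hom_iff\<close>)
  have F: "(\<Sum>\<^sub>g B1. of_nat (card (F B1))) = 1" unfolding F_def
    by (rule gsum_images) (use D(1-3) D'(4-6) in simp)
  have F': "(\<Sum>\<^sub>g A2. of_nat (card (F' A2))) = 1" unfolding F'_def
    by (rule gsum_images) (use D'(1-3) D(4-6) in simp)
  have "(\<Sum>\<^sub>g B1. \<Sum>\<^sub>g A2. \<Sum>\<^sub>g B2. \<Sum>\<^sub>g A1. of_nat (card {\<phi> \<in> sesm B1 B2 B \<times> sesm A2 B2 B' \<times> sesm A1 B1 A' \<times> sesm A1 A2 A.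
      cross ((i, p), (i', p')) \<phi>})) =
    (\<Sum>\<^sub>g B1. \<Sum>\<^sub>g A2. \<Sum>\<^sub>g B2. \<Sum>\<^sub>g A1. \<Sum>v\<in>F B1. of_nat (card (F' A2)) * (of_nat (card (Kx B2 B1 v)) * of_nat (card (Qz A1 B1 v))))"
    by (intro gsum_cong) (simp add: c)
  also have "\<dots> = (\<Sum>\<^sub>g B1. \<Sum>\<^sub>g A2. \<Sum>\<^sub>g B2. \<Sum>v\<in>F B1. of_nat (card (F' A2)) * of_nat (card (Kx B2 B1 v)))"
    by (intro gsum_cong) (simp add: gsum_sum finF gsum_cmult Q)
  also have "\<dots> = (\<Sum>\<^sub>g B1. \<Sum>\<^sub>g A2. of_nat (card (F B1)) * of_nat (card (F' A2)))"
    by (intro gsum_cong) (simp add: gsum_sum finF gsum_cmult K)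
  also have "\<dots> = 1" by (simp add: gsum_cmult F' F)
  finally show ?thesis .
qed

text \<open>Stated for numbers of short exact sequences rather than Hall numbers, so that the
  automorphism factors are absorbed into the weights of the sums.\<close>

theorem Green_formula:
  assumes O: "A \<in> Obj C" "B \<in> Obj C" "A' \<in> Obj C" "B' \<in> Obj C"
  shows "(\<Sum>\<^sub>g M. of_nat (card (sesm A B M)) * of_nat (card (sesm A' B' M))) =
    (\<Sum>\<^sub>g B1. \<Sum>\<^sub>g A2. \<Sum>\<^sub>g B2. \<Sum>\<^sub>g A1. of_nat (card (sesm B1 B2 B)) * of_nat (card (sesm A2 B2 B')) *
      of_nat (card (sesm A1 B1 A')) * of_nat (card (sesm A1 A2 A)) * ennreal (1 / euler A1 B2))"
proof -
  define L where "L = (\<lambda>M. sesm A B M \<times> sesm A' B' M)"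
  define R where "R = (\<lambda>B1 A2 B2 A1. sesm B1 B2 B \<times> sesm A2 B2 B' \<times> sesm A1 B1 A' \<times> sesm A1 A2 A)"
  have fL: "finite (L M)" if "M \<in> Obj C" for M using that O by (simp add: L_def)
  have fR: "finite (R B1 A2 B2 A1)" if "B1 \<in> Obj C" "A2 \<in> Obj C" "B2 \<in> Obj C" "A1 \<in> Obj C" for B1 A2 B2 A1
    using that O by (simp add: R_def)
  have 1: "(\<Sum>\<^sub>g B1. \<Sum>\<^sub>g A2. \<Sum>\<^sub>g B2. \<Sum>\<^sub>g A1. of_nat (card {\<phi> \<in> R B1 A2 B2 A1. cross \<omega> \<phi>})) = 1"
    if o: "\<omega> \<in> L M" for \<omega> M
  proof -
    obtain i p i' p' where \<omega>: "\<omega> = ((i, p), (i', p'))" "sx C B M A i p" "sx C B' M A' i' p'"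
      using o unfolding L_def sesm_def by auto
    show ?thesis unfolding \<omega>(1) R_def by (rule gsum_cross_right[OF \<omega>(2,3)])
  qed
  have 2: "(\<Sum>\<^sub>g M. of_nat (card {\<omega> \<in> L M. cross \<omega> \<phi>})) = ennreal (1 / euler A1 B2)"
    if o: "\<phi> \<in> R B1 A2 B2 A1" for \<phi> B1 A2 B2 A1
  proof -
    obtain x x' y y' z z' t t' where \<phi>: "\<phi> = ((x, x'), (y, y'), (z, z'), (t, t'))" "sx C B2 B B1 x x'" "sx C B2 B' A2 y y'"
      "sx C B1 A' A1 z z'" "sx C A2 A A1 t t'" using o unfolding R_def sesm_def by auto
    show ?thesis unfolding \<phi>(1) L_def by (rule gsum_cross_left[OF \<phi>(2-5)])
  qed
  have dc: "(\<Sum>\<omega>\<in>L M. of_nat (card {\<phi> \<in> R B1 A2 B2 A1. cross \<omega> \<phi>})) =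
      (\<Sum>\<phi>\<in>R B1 A2 B2 A1. (of_nat (card {\<omega> \<in> L M. cross \<omega> \<phi>}) :: ennreal))"
    if "M \<in> Obj C" "B1 \<in> Obj C" "A2 \<in> Obj C" "B2 \<in> Obj C" "A1 \<in> Obj C" for M B1 A2 B2 A1
    using sum.swap_restrict[OF fL[OF that(1)] fR[OF that(2-5)], of "\<lambda>_ _. 1 :: ennreal" cross] by simp
  have sw: "(\<Sum>\<^sub>g M. \<Sum>\<^sub>g B1. \<Sum>\<^sub>g A2. \<Sum>\<^sub>g B2. \<Sum>\<^sub>g A1. f M B1 A2 B2 A1) =
      (\<Sum>\<^sub>g B1. \<Sum>\<^sub>g A2. \<Sum>\<^sub>g B2. \<Sum>\<^sub>g A1. \<Sum>\<^sub>g M. f M B1 A2 B2 A1)" for f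
    by (subst gsum_swap, rule gsum_cong, subst gsum_swap, rule gsum_cong, subst gsum_swap, rule gsum_cong, rule gsum_swap)
  have "(\<Sum>\<^sub>g M. of_nat (card (sesm A B M)) * of_nat (card (sesm A' B' M))) = (\<Sum>\<^sub>g M. of_nat (card (L M)))"
    by (simp add: L_def card_cartesian_product)
  also have "\<dots> = (\<Sum>\<^sub>g M. \<Sum>\<omega>\<in>L M. \<Sum>\<^sub>g B1. \<Sum>\<^sub>g A2. \<Sum>\<^sub>g B2. \<Sum>\<^sub>g A1. of_nat (card {\<phi> \<in> R B1 A2 B2 A1. cross \<omega> \<phi>}))"
    by (rule gsum_cong) (simp add: 1)
  also have "\<dots> = (\<Sum>\<^sub>g M. \<Sum>\<^sub>g B1. \<Sum>\<^sub>g A2. \<Sum>\<^sub>g B2. \<Sum>\<^sub>g A1. \<Sum>\<omega>\<in>L M. of_nat (card {\<phi> \<in> R B1 A2 B2 A1. cross \<omega> \<phi>}))"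
    by (rule gsum_cong) (simp add: gsum_sum fL)
  also have "\<dots> = (\<Sum>\<^sub>g M. \<Sum>\<^sub>g B1. \<Sum>\<^sub>g A2. \<Sum>\<^sub>g B2. \<Sum>\<^sub>g A1. \<Sum>\<phi>\<in>R B1 A2 B2 A1. of_nat (card {\<omega> \<in> L M. cross \<omega> \<phi>}))"
    by (intro gsum_cong dc)
  also have "\<dots> = (\<Sum>\<^sub>g B1. \<Sum>\<^sub>g A2. \<Sum>\<^sub>g B2. \<Sum>\<^sub>g A1. \<Sum>\<^sub>g M. \<Sum>\<phi>\<in>R B1 A2 B2 A1. of_nat (card {\<omega> \<in> L M. cross \<omega> \<phi>}))"
    by (rule sw)
  also have "\<dots> = (\<Sum>\<^sub>g B1. \<Sum>\<^sub>g A2. \<Sum>\<^sub>g B2. \<Sum>\<^sub>g A1. of_nat (card (R B1 A2 B2 A1)) * ennreal (1 / euler A1 B2))"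
    by (intro gsum_cong) (simp add: gsum_sum fR 2)
  finally show ?thesis by (simp add: R_def card_cartesian_product mult.assoc)
qed

end

section \<open>Associativity\<close>

context finitary_lifting_category
begin

definition nses :: "'o \<Rightarrow> 'o \<Rightarrow> 'o \<Rightarrow> ennreal" where
  "nses A B M = of_nat (card (sesm A B M))"

definition inv_euler :: "'o \<Rightarrow> 'o \<Rightarrow> ennreal" where
  "inv_euler M N = ennreal (1 / euler M N)"

lemma nses_nonzeroE:
  assumes "nses A B M \<noteq> 0"
  obtains i p where "sx C B M A i p"
proof -
  have "sesm A B M \<noteq> {}" using assms by (auto simp: nses_def)
  then show thesis using that by (auto simp: sesm_def)
qed

lemma inv_euler_mult_right:
  assumes "sx C N' N N'' \<alpha> \<beta>" "M \<in> Obj C"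
  shows "inv_euler M N = inv_euler M N' * inv_euler M N''"
  using euler_pos[OF assms(2) sxD(7)[OF assms(1)]] euler_pos[OF assms(2) sxD(9)[OF assms(1)]]
  by (simp add: inv_euler_def euler_mult_right[OF assms] flip: ennreal_mult)

lemma inv_euler_mult_left:
  assumes "sx C M' M M'' \<alpha> \<beta>" "N \<in> Obj C"
  shows "inv_euler M N = inv_euler M' N * inv_euler M'' N"
  using euler_pos[OF sxD(7)[OF assms(1)] assms(2)] euler_pos[OF sxD(9)[OF assms(1)] assms(2)]
  by (simp add: inv_euler_def euler_mult_left[OF assms] flip: ennreal_mult)

definition Delta_sum :: "'o \<Rightarrow> 'o \<Rightarrow> 'o \<Rightarrow> ennreal" where
  "Delta_sum A B M = (\<Sum>\<^sub>g L. \<Sum>\<^sub>g I. \<Sum>\<^sub>g N. inv_euler L N * (nses L I B * nses N L M * nses I N A))"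

text \<open>A weighted number of two-step filtrations of \<open>A\<close> with subquotients
  \<open>a\<close>, \<open>b\<close>, \<open>c\<close> from top to bottom, recorded by the larger
  subobject \<open>N\<close>. \<open>filt_alt\<close> records the same filtrations by the quotient
  of \<open>A\<close> by \<open>c\<close>.\<close>

definition filt :: "'o \<Rightarrow> 'o \<Rightarrow> 'o \<Rightarrow> 'o \<Rightarrow> ennreal" where
  "filt a b c A = (\<Sum>\<^sub>g N. nses a N A * nses b c N)"

lemma filt_alt: "a \<in> Obj C \<Longrightarrow> b \<in> Obj C \<Longrightarrow> c \<in> Obj C \<Longrightarrow> A \<in> Obj C \<Longrightarrow>
    filt a b c A = (\<Sum>\<^sub>g I. nses I c A * nses a b I)"
  unfolding filt_def nses_def by (rule gsum_sesm_assoc)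

lemma gsum_Green:
  "A \<in> Obj C \<Longrightarrow> B \<in> Obj C \<Longrightarrow> A' \<in> Obj C \<Longrightarrow> B' \<in> Obj C \<Longrightarrow>
    (\<Sum>\<^sub>g M. nses A B M * nses A' B' M) = (\<Sum>\<^sub>g B1. \<Sum>\<^sub>g A2. \<Sum>\<^sub>g B2. \<Sum>\<^sub>g A1. nses B1 B2 B * nses A2 B2 B' *
      nses A1 B1 A' * nses A1 A2 A * inv_euler A1 B2)"
  unfolding nses_def inv_euler_def by (rule Green_formula)

lemma gsum_swap2: "(\<Sum>\<^sub>g M. \<Sum>\<^sub>g a. \<Sum>\<^sub>g b. f M a b) = (\<Sum>\<^sub>g a. \<Sum>\<^sub>g b. \<Sum>\<^sub>g M. f M a b)"
  by (subst gsum_swap, rule gsum_cong, rule gsum_swap)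

lemma gsum_swap3: "(\<Sum>\<^sub>g M. \<Sum>\<^sub>g a. \<Sum>\<^sub>g b. \<Sum>\<^sub>g c. f M a b c) = (\<Sum>\<^sub>g a. \<Sum>\<^sub>g b. \<Sum>\<^sub>g c. \<Sum>\<^sub>g M. f M a b c)"
  by (subst gsum_swap, rule gsum_cong, rule gsum_swap2)

lemma gsum_swap4: "(\<Sum>\<^sub>g M. \<Sum>\<^sub>g a. \<Sum>\<^sub>g b. \<Sum>\<^sub>g c. \<Sum>\<^sub>g d. f M a b c d) =
    (\<Sum>\<^sub>g a. \<Sum>\<^sub>g b. \<Sum>\<^sub>g c. \<Sum>\<^sub>g d. \<Sum>\<^sub>g M. f M a b c d)"
  by (subst gsum_swap, rule gsum_cong, rule gsum_swap3)

lemma gsum_swap5: "(\<Sum>\<^sub>g M. \<Sum>\<^sub>g a. \<Sum>\<^sub>g b. \<Sum>\<^sub>g c. \<Sum>\<^sub>g d. \<Sum>\<^sub>g e. f M a b c d e) =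
    (\<Sum>\<^sub>g a. \<Sum>\<^sub>g b. \<Sum>\<^sub>g c. \<Sum>\<^sub>g d. \<Sum>\<^sub>g e. \<Sum>\<^sub>g M. f M a b c d e)"
  by (subst gsum_swap, rule gsum_cong, rule gsum_swap4)

lemma gsum_swap6: "(\<Sum>\<^sub>g M. \<Sum>\<^sub>g a. \<Sum>\<^sub>g b. \<Sum>\<^sub>g c. \<Sum>\<^sub>g d. \<Sum>\<^sub>g e. \<Sum>\<^sub>g g. f M a b c d e g) =
    (\<Sum>\<^sub>g a. \<Sum>\<^sub>g b. \<Sum>\<^sub>g c. \<Sum>\<^sub>g d. \<Sum>\<^sub>g e. \<Sum>\<^sub>g g. \<Sum>\<^sub>g M. f M a b c d e g)"
  by (subst gsum_swap, rule gsum_cong, rule gsum_swap5)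

text \<open>In the common form of both iterated products the factors \<open>A, B, D\<close> and the result \<open>Y\<close> are filtered
  with subquotients \<open>(a, b, c)\<close>, \<open>(d, e, a)\<close>, \<open>(f, b, d)\<close> and \<open>(c, e, f)\<close>, listed from top to
  bottom.\<close>

definition weight :: "'o \<Rightarrow> 'o \<Rightarrow> 'o \<Rightarrow> 'o \<Rightarrow> 'o \<Rightarrow> 'o \<Rightarrow> ennreal" where
  "weight a b c d e f = inv_euler f a * inv_euler b a * inv_euler d a * inv_euler d b * inv_euler d c *
     inv_euler e b * inv_euler e c * inv_euler f c * inv_euler f e * inv_euler b e"

text \<open>After Green's formula each of the four remaining intermediate objects occurs in one pair
  of factors only, so the fourfold sum is a product.\<close>

lemma gsum4_factor: "(\<Sum>\<^sub>g L. \<Sum>\<^sub>g N. \<Sum>\<^sub>g L'. \<Sum>\<^sub>g N'. k * (p N * q L * r L' * s N')) =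
    k * (gsum p * gsum q * gsum r * gsum s)"
proof -
  have "(\<Sum>\<^sub>g L. \<Sum>\<^sub>g N. \<Sum>\<^sub>g L'. \<Sum>\<^sub>g N'. k * (p N * q L * r L' * s N')) =
      (\<Sum>\<^sub>g L. \<Sum>\<^sub>g N. \<Sum>\<^sub>g L'. \<Sum>\<^sub>g N'. k * q L * p N * r L' * s N')"
    by (simp only: ac_simps)
  also have "\<dots> = k * gsum q * gsum p * gsum r * gsum s"
    by (simp only: gsum_cmult gsum_multc)
  finally show ?thesis by (simp only: ac_simps)
qed

text \<open>The factor \<open>inv_euler D I\<close> is the part of the square roots that depends on
  the summation indices. Green's formula removes \<open>M\<close>; then \<open>A\<close>,
  \<open>B\<close>, \<open>D\<close> and \<open>Y\<close> each carry two nested sequences, that is,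
  a filtration.\<close>

lemma Delta_sum_assoc_left:
  assumes O: "A \<in> Obj C" "B \<in> Obj C" "D \<in> Obj C" "Y \<in> Obj C"
  shows "(\<Sum>\<^sub>g M. \<Sum>\<^sub>g L. \<Sum>\<^sub>g I. \<Sum>\<^sub>g N. inv_euler D I * (inv_euler L N * (nses L I B * nses N L M * nses I N A)) * Delta_sum M D Y) =
    (\<Sum>\<^sub>g a. \<Sum>\<^sub>g f. \<Sum>\<^sub>g d. \<Sum>\<^sub>g c. \<Sum>\<^sub>g e. \<Sum>\<^sub>g b. weight a b c d e f * (filt a b c A * filt d e a B * filt f b d D * filt c e f Y))"
proof -
  have "(\<Sum>\<^sub>g M. \<Sum>\<^sub>g L. \<Sum>\<^sub>g I. \<Sum>\<^sub>g N. inv_euler D I * (inv_euler L N * (nses L I B * nses N L M * nses I N A)) * Delta_sum M D Y) =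
      (\<Sum>\<^sub>g M. \<Sum>\<^sub>g L. \<Sum>\<^sub>g I. \<Sum>\<^sub>g N. \<Sum>\<^sub>g L'. \<Sum>\<^sub>g I'. \<Sum>\<^sub>g N'. (inv_euler D I * inv_euler L N * inv_euler L' N' *
        (nses L I B * nses I N A * nses L' I' D * nses N' L' Y)) * (nses N L M * nses I' N' M))"
    unfolding Delta_sum_def by (intro gsum_cong) (simp only: gsum_cmult[symmetric] ac_simps)
  also have "\<dots> = (\<Sum>\<^sub>g L. \<Sum>\<^sub>g I. \<Sum>\<^sub>g N. \<Sum>\<^sub>g L'. \<Sum>\<^sub>g I'. \<Sum>\<^sub>g N'. \<Sum>\<^sub>g M. (inv_euler D I * inv_euler L N * inv_euler L' N' *
        (nses L I B * nses I N A * nses L' I' D * nses N' L' Y)) * (nses N L M * nses I' N' M))"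
    by (rule gsum_swap6)
  also have "\<dots> = (\<Sum>\<^sub>g L. \<Sum>\<^sub>g I. \<Sum>\<^sub>g N. \<Sum>\<^sub>g L'. \<Sum>\<^sub>g I'. \<Sum>\<^sub>g N'. \<Sum>\<^sub>g d. \<Sum>\<^sub>g c. \<Sum>\<^sub>g e. \<Sum>\<^sub>g b.
        (inv_euler D I * inv_euler L N * inv_euler L' N' *
        (nses L I B * nses I N A * nses L' I' D * nses N' L' Y)) *
        (nses d e L * nses c e N' * nses b d I' * nses b c N * inv_euler b e))"
    by (rule gsum_cong, rule gsum_cong, rule gsum_cong, rule gsum_cong, rule gsum_cong, rule gsum_cong)
      (simp only: gsum_cmult gsum_Green)
  also have "\<dots> = (\<Sum>\<^sub>g L. \<Sum>\<^sub>g I. \<Sum>\<^sub>g N. \<Sum>\<^sub>g L'. \<Sum>\<^sub>g I'. \<Sum>\<^sub>g N'. \<Sum>\<^sub>g d. \<Sum>\<^sub>g c. \<Sum>\<^sub>g e. \<Sum>\<^sub>g b. weight I b c d e L' *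
        ((nses I N A * nses b c N) * (nses L I B * nses d e L) * (nses L' I' D * nses b d I') * (nses N' L' Y * nses c e N')))"
  proof (intro gsum_cong)
    fix L I N L' I' N' d c e b
    assume O': "L \<in> Obj C" "I \<in> Obj C" "N \<in> Obj C" "L' \<in> Obj C" "I' \<in> Obj C" "N' \<in> Obj C" "d \<in> Obj C" "c \<in> Obj C" "e \<in> Obj C" "b \<in> Obj C"
    let ?S = "nses I N A * nses b c N * (nses L I B * nses d e L) * (nses L' I' D * nses b d I') * (nses N' L' Y * nses c e N')"
    \<comment> \<open>Splitting \<open>inv_euler\<close> needs actual short exact sequences. They
      exist when the product of counts is nonzero; otherwise both sides vanish.\<close>
    have "inv_euler D I * inv_euler L N * inv_euler L' N' * inv_euler b e * ?S = weight I b c d e L' * ?S"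
    proof (cases "?S = 0")
      case False
      then have nz: "nses L' I' D \<noteq> 0" "nses b d I' \<noteq> 0" "nses d e L \<noteq> 0" "nses b c N \<noteq> 0" "nses c e N' \<noteq> 0" by auto
      obtain i1 p1 where 1: "sx C I' D L' i1 p1" using nz(1) by (rule nses_nonzeroE)
      obtain i2 p2 where 2: "sx C d I' b i2 p2" using nz(2) by (rule nses_nonzeroE)
      obtain i3 p3 where 3: "sx C e L d i3 p3" using nz(3) by (rule nses_nonzeroE)
      obtain i4 p4 where 4: "sx C c N b i4 p4" using nz(4) by (rule nses_nonzeroE)
      obtain i5 p5 where 5: "sx C e N' c i5 p5" using nz(5) by (rule nses_nonzeroE)
      have "inv_euler D I * inv_euler L N * inv_euler L' N' * inv_euler b e = weight I b c d e L'"
        unfolding weight_def inv_euler_mult_left[OF 1 O'(2)] inv_euler_mult_left[OF 2 O'(2)]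
          inv_euler_mult_left[OF 3 O'(3)] inv_euler_mult_right[OF 4 O'(7)] inv_euler_mult_right[OF 4 O'(9)]
          inv_euler_mult_right[OF 5 O'(4)] by (simp only: ac_simps)
      then show ?thesis by simp
    qed (simp only: mult_zero_right)
    then show "inv_euler D I * inv_euler L N * inv_euler L' N' * (nses L I B * nses I N A * nses L' I' D * nses N' L' Y) *
        (nses d e L * nses c e N' * nses b d I' * nses b c N * inv_euler b e) = weight I b c d e L' * ?S"
      by (simp only: ac_simps)
  qed
  also have "\<dots> = (\<Sum>\<^sub>g L. \<Sum>\<^sub>g I. \<Sum>\<^sub>g N. \<Sum>\<^sub>g L'. \<Sum>\<^sub>g I'. \<Sum>\<^sub>g d. \<Sum>\<^sub>g c. \<Sum>\<^sub>g e. \<Sum>\<^sub>g b. \<Sum>\<^sub>g N'. weight I b c d e L' *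
        ((nses I N A * nses b c N) * (nses L I B * nses d e L) * (nses L' I' D * nses b d I') * (nses N' L' Y * nses c e N')))"
    by (rule gsum_cong, rule gsum_cong, rule gsum_cong, rule gsum_cong, rule gsum_cong, rule gsum_swap4)
  also have "\<dots> = (\<Sum>\<^sub>g L. \<Sum>\<^sub>g I. \<Sum>\<^sub>g N. \<Sum>\<^sub>g L'. \<Sum>\<^sub>g d. \<Sum>\<^sub>g c. \<Sum>\<^sub>g e. \<Sum>\<^sub>g b. \<Sum>\<^sub>g I'. \<Sum>\<^sub>g N'. weight I b c d e L' *
        ((nses I N A * nses b c N) * (nses L I B * nses d e L) * (nses L' I' D * nses b d I') * (nses N' L' Y * nses c e N')))"
    by (rule gsum_cong, rule gsum_cong, rule gsum_cong, rule gsum_cong, rule gsum_swap4)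
  also have "\<dots> = (\<Sum>\<^sub>g L. \<Sum>\<^sub>g I. \<Sum>\<^sub>g L'. \<Sum>\<^sub>g d. \<Sum>\<^sub>g c. \<Sum>\<^sub>g e. \<Sum>\<^sub>g b. \<Sum>\<^sub>g N. \<Sum>\<^sub>g I'. \<Sum>\<^sub>g N'. weight I b c d e L' *
        ((nses I N A * nses b c N) * (nses L I B * nses d e L) * (nses L' I' D * nses b d I') * (nses N' L' Y * nses c e N')))"
    by (rule gsum_cong, rule gsum_cong, rule gsum_swap5)
  \<comment> \<open>Here \<open>I\<close> is renamed to \<open>a\<close> and \<open>L'\<close> to
    \<open>f\<close>, the two subquotients that do not come from Green's formula.\<close>
  also have "\<dots> = (\<Sum>\<^sub>g a. \<Sum>\<^sub>g f. \<Sum>\<^sub>g d. \<Sum>\<^sub>g c. \<Sum>\<^sub>g e. \<Sum>\<^sub>g b. \<Sum>\<^sub>g L. \<Sum>\<^sub>g N. \<Sum>\<^sub>g I'. \<Sum>\<^sub>g N'. weight a b c d e f *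
        ((nses a N A * nses b c N) * (nses L a B * nses d e L) * (nses f I' D * nses b d I') * (nses N' f Y * nses c e N')))"
    by (rule gsum_swap6)
  also have "\<dots> = (\<Sum>\<^sub>g a. \<Sum>\<^sub>g f. \<Sum>\<^sub>g d. \<Sum>\<^sub>g c. \<Sum>\<^sub>g e. \<Sum>\<^sub>g b. weight a b c d e f * (filt a b c A * filt d e a B * filt f b d D * filt c e f Y))"
    by (intro gsum_cong) (simp only: gsum4_factor filt_def[of _ _ _ A] filt_def[of _ _ _ D] filt_alt[OF _ _ _ O(2)] filt_alt[OF _ _ _ O(4)])
  finally show ?thesis .
qed

lemma Delta_sum_assoc_right:
  assumes O: "A \<in> Obj C" "B \<in> Obj C" "D \<in> Obj C" "Y \<in> Obj C"
  shows "(\<Sum>\<^sub>g M. \<Sum>\<^sub>g L. \<Sum>\<^sub>g I. \<Sum>\<^sub>g N. inv_euler I A * (inv_euler L N * (nses L I D * nses N L M * nses I N B)) * Delta_sum A M Y) =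
    (\<Sum>\<^sub>g d. \<Sum>\<^sub>g c. \<Sum>\<^sub>g f. \<Sum>\<^sub>g a. \<Sum>\<^sub>g b. \<Sum>\<^sub>g e. weight a b c d e f * (filt a b c A * filt d e a B * filt f b d D * filt c e f Y))"
proof -
  have "(\<Sum>\<^sub>g M. \<Sum>\<^sub>g L. \<Sum>\<^sub>g I. \<Sum>\<^sub>g N. inv_euler I A * (inv_euler L N * (nses L I D * nses N L M * nses I N B)) * Delta_sum A M Y) =
      (\<Sum>\<^sub>g M. \<Sum>\<^sub>g L. \<Sum>\<^sub>g I. \<Sum>\<^sub>g N. \<Sum>\<^sub>g L'. \<Sum>\<^sub>g I'. \<Sum>\<^sub>g N'. (inv_euler I A * inv_euler L N * inv_euler L' N' *
        (nses L I D * nses I N B * nses N' L' Y * nses I' N' A)) * (nses N L M * nses L' I' M))"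
    unfolding Delta_sum_def by (intro gsum_cong) (simp only: gsum_cmult[symmetric] ac_simps)
  also have "\<dots> = (\<Sum>\<^sub>g L. \<Sum>\<^sub>g I. \<Sum>\<^sub>g N. \<Sum>\<^sub>g L'. \<Sum>\<^sub>g I'. \<Sum>\<^sub>g N'. \<Sum>\<^sub>g M. (inv_euler I A * inv_euler L N * inv_euler L' N' *
        (nses L I D * nses I N B * nses N' L' Y * nses I' N' A)) * (nses N L M * nses L' I' M))"
    by (rule gsum_swap6)
  also have "\<dots> = (\<Sum>\<^sub>g L. \<Sum>\<^sub>g I. \<Sum>\<^sub>g N. \<Sum>\<^sub>g L'. \<Sum>\<^sub>g I'. \<Sum>\<^sub>g N'. \<Sum>\<^sub>g f. \<Sum>\<^sub>g a. \<Sum>\<^sub>g b. \<Sum>\<^sub>g e.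
        (inv_euler I A * inv_euler L N * inv_euler L' N' *
        (nses L I D * nses I N B * nses N' L' Y * nses I' N' A)) *
        (nses f b L * nses a b I' * nses e f L' * nses e a N * inv_euler e b))"
    by (rule gsum_cong, rule gsum_cong, rule gsum_cong, rule gsum_cong, rule gsum_cong, rule gsum_cong)
      (simp only: gsum_cmult gsum_Green)
  also have "\<dots> = (\<Sum>\<^sub>g L. \<Sum>\<^sub>g I. \<Sum>\<^sub>g N. \<Sum>\<^sub>g L'. \<Sum>\<^sub>g I'. \<Sum>\<^sub>g N'. \<Sum>\<^sub>g f. \<Sum>\<^sub>g a. \<Sum>\<^sub>g b. \<Sum>\<^sub>g e. weight a b N' I e f *
        ((nses I N B * nses e a N) * (nses L I D * nses f b L) * (nses N' L' Y * nses e f L') * (nses I' N' A * nses a b I')))"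
  proof (intro gsum_cong)
    fix L I N L' I' N' f a b e
    assume O': "L \<in> Obj C" "I \<in> Obj C" "N \<in> Obj C" "L' \<in> Obj C" "I' \<in> Obj C" "N' \<in> Obj C" "f \<in> Obj C" "a \<in> Obj C" "b \<in> Obj C" "e \<in> Obj C"
    let ?S = "nses I N B * nses e a N * (nses L I D * nses f b L) * (nses N' L' Y * nses e f L') * (nses I' N' A * nses a b I')"
    have "inv_euler I A * inv_euler L N * inv_euler L' N' * inv_euler e b * ?S = weight a b N' I e f * ?S"
    proof (cases "?S = 0")
      case False
      then have nz: "nses I' N' A \<noteq> 0" "nses a b I' \<noteq> 0" "nses f b L \<noteq> 0" "nses e a N \<noteq> 0" "nses e f L' \<noteq> 0" by auto
      obtain i1 p1 where 1: "sx C N' A I' i1 p1" using nz(1) by (rule nses_nonzeroE)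
      obtain i2 p2 where 2: "sx C b I' a i2 p2" using nz(2) by (rule nses_nonzeroE)
      obtain i3 p3 where 3: "sx C b L f i3 p3" using nz(3) by (rule nses_nonzeroE)
      obtain i4 p4 where 4: "sx C a N e i4 p4" using nz(4) by (rule nses_nonzeroE)
      obtain i5 p5 where 5: "sx C f L' e i5 p5" using nz(5) by (rule nses_nonzeroE)
      have "inv_euler I A * inv_euler L N * inv_euler L' N' * inv_euler e b = weight a b N' I e f"
        unfolding weight_def inv_euler_mult_right[OF 1 O'(2)] inv_euler_mult_right[OF 2 O'(2)]
          inv_euler_mult_left[OF 3 O'(3)] inv_euler_mult_right[OF 4 O'(7)] inv_euler_mult_right[OF 4 O'(9)]
          inv_euler_mult_left[OF 5 O'(6)] by (simp only: ac_simps)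
      then show ?thesis by simp
    qed (simp only: mult_zero_right)
    then show "inv_euler I A * inv_euler L N * inv_euler L' N' * (nses L I D * nses I N B * nses N' L' Y * nses I' N' A) *
        (nses f b L * nses a b I' * nses e f L' * nses e a N * inv_euler e b) = weight a b N' I e f * ?S"
      by (simp only: ac_simps)
  qed
  also have "\<dots> = (\<Sum>\<^sub>g L. \<Sum>\<^sub>g I. \<Sum>\<^sub>g N. \<Sum>\<^sub>g L'. \<Sum>\<^sub>g N'. \<Sum>\<^sub>g f. \<Sum>\<^sub>g a. \<Sum>\<^sub>g b. \<Sum>\<^sub>g e. \<Sum>\<^sub>g I'. weight a b N' I e f *
        ((nses I N B * nses e a N) * (nses L I D * nses f b L) * (nses N' L' Y * nses e f L') * (nses I' N' A * nses a b I')))"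
    by (rule gsum_cong, rule gsum_cong, rule gsum_cong, rule gsum_cong, rule gsum_swap5)
  also have "\<dots> = (\<Sum>\<^sub>g L. \<Sum>\<^sub>g I. \<Sum>\<^sub>g N. \<Sum>\<^sub>g N'. \<Sum>\<^sub>g f. \<Sum>\<^sub>g a. \<Sum>\<^sub>g b. \<Sum>\<^sub>g e. \<Sum>\<^sub>g L'. \<Sum>\<^sub>g I'. weight a b N' I e f *
        ((nses I N B * nses e a N) * (nses L I D * nses f b L) * (nses N' L' Y * nses e f L') * (nses I' N' A * nses a b I')))"
    by (rule gsum_cong, rule gsum_cong, rule gsum_cong, rule gsum_swap5)
  also have "\<dots> = (\<Sum>\<^sub>g L. \<Sum>\<^sub>g I. \<Sum>\<^sub>g N'. \<Sum>\<^sub>g f. \<Sum>\<^sub>g a. \<Sum>\<^sub>g b. \<Sum>\<^sub>g e. \<Sum>\<^sub>g N. \<Sum>\<^sub>g L'. \<Sum>\<^sub>g I'. weight a b N' I e f *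
        ((nses I N B * nses e a N) * (nses L I D * nses f b L) * (nses N' L' Y * nses e f L') * (nses I' N' A * nses a b I')))"
    by (rule gsum_cong, rule gsum_cong, rule gsum_swap5)
  \<comment> \<open>On this side \<open>I\<close> plays the part of \<open>d\<close> and
    \<open>N'\<close> that of \<open>c\<close>; the other four subquotients come from Green's
    formula.\<close>
  also have "\<dots> = (\<Sum>\<^sub>g d. \<Sum>\<^sub>g c. \<Sum>\<^sub>g f. \<Sum>\<^sub>g a. \<Sum>\<^sub>g b. \<Sum>\<^sub>g e. \<Sum>\<^sub>g L. \<Sum>\<^sub>g N. \<Sum>\<^sub>g L'. \<Sum>\<^sub>g I'. weight a b c d e f *
        ((nses d N B * nses e a N) * (nses L d D * nses f b L) * (nses c L' Y * nses e f L') * (nses I' c A * nses a b I')))"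
    by (rule gsum_swap6)
  also have "\<dots> = (\<Sum>\<^sub>g d. \<Sum>\<^sub>g c. \<Sum>\<^sub>g f. \<Sum>\<^sub>g a. \<Sum>\<^sub>g b. \<Sum>\<^sub>g e. weight a b c d e f * (filt d e a B * filt f b d D * filt c e f Y * filt a b c A))"
    by (intro gsum_cong) (simp only: gsum4_factor filt_def[of _ _ _ B] filt_def[of _ _ _ Y] filt_alt[OF _ _ _ O(1)] filt_alt[OF _ _ _ O(3)])
  finally show ?thesis by (simp only: ac_simps)
qed

lemma Delta_sum_assoc:
  assumes O: "A \<in> Obj C" "B \<in> Obj C" "D \<in> Obj C" "Y \<in> Obj C"
  shows "(\<Sum>\<^sub>g M. \<Sum>\<^sub>g L. \<Sum>\<^sub>g I. \<Sum>\<^sub>g N. inv_euler D I * (inv_euler L N * (nses L I B * nses N L M * nses I N A)) * Delta_sum M D Y) =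
    (\<Sum>\<^sub>g M. \<Sum>\<^sub>g L. \<Sum>\<^sub>g I. \<Sum>\<^sub>g N. inv_euler I A * (inv_euler L N * (nses L I D * nses N L M * nses I N B)) * Delta_sum A M Y)"
proof -
  define t where "t = (\<lambda>a b c d e f. weight a b c d e f * (filt a b c A * filt d e a B * filt f b d D * filt c e f Y))"
  have "(\<Sum>\<^sub>g a. \<Sum>\<^sub>g f. \<Sum>\<^sub>g d. \<Sum>\<^sub>g c. \<Sum>\<^sub>g e. \<Sum>\<^sub>g b. t a b c d e f) = (\<Sum>\<^sub>g f. \<Sum>\<^sub>g d. \<Sum>\<^sub>g c. \<Sum>\<^sub>g a. \<Sum>\<^sub>g e. \<Sum>\<^sub>g b. t a b c d e f)"
    by (rule gsum_swap3)
  also have "\<dots> = (\<Sum>\<^sub>g d. \<Sum>\<^sub>g c. \<Sum>\<^sub>g f. \<Sum>\<^sub>g a. \<Sum>\<^sub>g e. \<Sum>\<^sub>g b. t a b c d e f)"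
    by (rule gsum_swap2)
  also have "\<dots> = (\<Sum>\<^sub>g d. \<Sum>\<^sub>g c. \<Sum>\<^sub>g f. \<Sum>\<^sub>g a. \<Sum>\<^sub>g b. \<Sum>\<^sub>g e. t a b c d e f)"
    by (rule gsum_cong, rule gsum_cong, rule gsum_cong, rule gsum_cong, rule gsum_swap)
  finally show ?thesis unfolding t_def Delta_sum_assoc_left[OF O] Delta_sum_assoc_right[OF O] .
qed

end

section \<open>Finiteness of the sums over isomorphism classes\<close>

lemma finite_functional_range:
  assumes "finite A" and "\<And>y. y \<in> B \<Longrightarrow> \<exists>x\<in>A. R x y"
    and "\<And>x y y'. y \<in> B \<Longrightarrow> y' \<in> B \<Longrightarrow> R x y \<Longrightarrow> R x y' \<Longrightarrow> y = y'"
  shows "finite B"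
proof -
  obtain g where g: "\<And>y. y \<in> B \<Longrightarrow> g y \<in> A \<and> R (g y) y" using assms(2) by metis
  have "inj_on g B" by (rule inj_onI) (metis g assms(3))
  moreover have "g ` B \<subseteq> A" using g by blast
  ultimately show ?thesis using assms(1) by (meson inj_on_finite)
qed

context abelian_category
begin

lemma isos_isomorphic: "f \<in> isos A B \<Longrightarrow> isomorphic C A B"
  unfolding isos_def isomorphic_def by blast

lemma rep_eq:
  assumes "m \<in> Iso C" "m' \<in> Iso C" "isomorphic C (rep m) (rep m')"
  shows "m = m'"
  using iso_class_eq_iff[OF rep_Iso(1)[OF assms(1)] rep_Iso(1)[OF assms(2)]] assms rep_Iso(2) by simp

end

context finitary_lifting_category
begin

lemma finite_cokernel_classes:
  assumes "I \<in> Obj C" "B \<in> Obj C"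
  shows "finite {l \<in> Iso C. \<exists>j p. sx C I B (rep l) j p}"
proof (rule finite_functional_range[OF fin_Hom[OF assms], where R = "\<lambda>j l. \<exists>p. sx C I B (rep l) j p"])
  fix l assume "l \<in> {l \<in> Iso C. \<exists>j p. sx C I B (rep l) j p}"
  then obtain j p where s: "sx C I B (rep l) j p" by blast
  then show "\<exists>j\<in>Hom C I B. \<exists>p. sx C I B (rep l) j p" using sxD(1-3)[OF s] by (intro bexI[of _ j] exI[of _ p]) simp_all
next
  fix j l l' assume l: "l \<in> {l \<in> Iso C. \<exists>j p. sx C I B (rep l) j p}" "l' \<in> {l \<in> Iso C. \<exists>j p. sx C I B (rep l) j p}"
    and "\<exists>p. sx C I B (rep l) j p" "\<exists>p. sx C I B (rep l') j p"
  then obtain p p' where s: "sx C I B (rep l) j p" "sx C I B (rep l') j p'" by blast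
  obtain g where "g \<in> isos (rep l) (rep l')" by (rule sx_coker_unique[OF s])
  then show "l = l'" using rep_eq isos_isomorphic l by simp
qed

lemma finite_kernel_classes:
  assumes "I \<in> Obj C" "A \<in> Obj C"
  shows "finite {n \<in> Iso C. \<exists>j p. sx C (rep n) A I j p}"
proof -
  interpret op: finitary_lifting_category K "op_cat C" by (rule finitary_lifting_category_op)
  have "{n \<in> Iso C. \<exists>j p. sx C (rep n) A I j p} = {n \<in> Iso (op_cat C). \<exists>j p. sx (op_cat C) I A (rep n) j p}"
    unfolding Iso_op sx_op by blast
  also have "finite \<dots>" by (rule op.finite_cokernel_classes) (use assms in simp_all)
  finally show ?thesis .
qed

text \<open>An object that is both a quotient of \<open>A\<close> and a subobject of
  \<open>B\<close> is the image of one of the finitely many arrows from \<open>A\<close> to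
  \<open>B\<close>, and images are unique up to isomorphism.\<close>

lemma finite_image_classes:
  assumes "A \<in> Obj C" "B \<in> Obj C"
  shows "finite {i \<in> Iso C. \<exists>N L k p j c. sx C N A (rep i) k p \<and> sx C (rep i) B L j c}" (is "finite ?S")
proof (rule finite_functional_range[OF fin_Hom[OF assms],
      where R = "\<lambda>f i. \<exists>N L k p j c. sx C N A (rep i) k p \<and> sx C (rep i) B L j c \<and> f = j \<cdot> p"])
  fix i assume "i \<in> ?S"
  then obtain N L k p j c where s: "sx C N A (rep i) k p" "sx C (rep i) B L j c" by blast
  have "j \<cdot> p \<in> Hom C A B" using sxD(4-6)[OF s(1)] sxD(1-3)[OF s(2)] by simp
  then show "\<exists>f\<in>Hom C A B. \<exists>N L k p j c. sx C N A (rep i) k p \<and> sx C (rep i) B L j c \<and> f = j \<cdot> p" using s by blast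
next
  fix f i i' assume i: "i \<in> ?S" "i' \<in> ?S"
  assume "\<exists>N L k p j c. sx C N A (rep i) k p \<and> sx C (rep i) B L j c \<and> f = j \<cdot> p"
    and "\<exists>N L k p j c. sx C N A (rep i') k p \<and> sx C (rep i') B L j c \<and> f = j \<cdot> p"
  then obtain N L k p j c N' L' k' p' j' c' where s: "sx C N A (rep i) k p" "sx C (rep i) B L j c" "f = j \<cdot> p"
    and s': "sx C N' A (rep i') k' p'" "sx C (rep i') B L' j' c'" "f = j' \<cdot> p'" by (elim exE conjE) (rule that)
  have O: "rep i \<in> Obj C" "rep i' \<in> Obj C" using i rep_Iso by blast+
  have jH: "j \<in> Hom C (rep i) B" using sxD(1-3)[OF s(2)] by simp
  let ?F = "{(e, m). is_epi C e \<and> e \<in> Hom C A (rep i') \<and> is_mono C m \<and> m \<in> Hom C (rep i') B \<and> m \<cdot> e = f}"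
  have "(p', j') \<in> ?F" using sxD[OF s'(1)] sxD[OF s'(2)] s'(3) by simp
  moreover have "finite ?F"
    by (rule finite_subset[of _ "Hom C A (rep i') \<times> Hom C (rep i') B"])
      (use fin_Hom assms O in \<open>auto simp del: Hom_iff\<close>)
  ultimately have "card ?F \<noteq> 0" by (auto simp: card_eq_0_iff simp del: Hom_iff)
  then have "isos (rep i) (rep i') \<noteq> {}"
    using image_factorizations[OF s(1) sxD(11)[OF s(2)] jH s(3)[symmetric] O(2)] by auto
  then show "i = i'" using rep_eq isos_isomorphic i by blast
qed

text \<open>Equivalent extensions have isomorphic middle terms, so there are at most as many classes
  as elements of \<open>Ext1 C N L\<close>.\<close>

lemma finite_extension_classes:
  assumes "N \<in> Obj C" "L \<in> Obj C"
  shows "finite {m \<in> Iso C. \<exists>i p. sx C L (rep m) N i p}" (is "finite ?S")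
proof (rule finite_functional_range[OF fin_Ext1[OF assms], where R = "\<lambda>c m. \<exists>i p. (i, p) \<in> c \<and> c \<in> Ext1 C N L \<and> sx C L (rep m) N i p"])
  fix m assume "m \<in> ?S"
  then obtain i p where s: "sx C L (rep m) N i p" by blast
  let ?c = "ses_equiv C N L `` {(i, p)}"
  have "?c \<in> Ext1 C N L" unfolding Ext1_def by (rule quotientI[OF sx_ses[OF s]])
  moreover have "(i, p) \<in> ?c" using ses_equiv_refl[OF sx_ses[OF s]] by blast
  ultimately show "\<exists>c\<in>Ext1 C N L. \<exists>i p. (i, p) \<in> c \<and> c \<in> Ext1 C N L \<and> sx C L (rep m) N i p" using s by blast
next
  fix c m m' assume m: "m \<in> ?S" "m' \<in> ?S"
  assume "\<exists>i p. (i, p) \<in> c \<and> c \<in> Ext1 C N L \<and> sx C L (rep m) N i p"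
    "\<exists>i p. (i, p) \<in> c \<and> c \<in> Ext1 C N L \<and> sx C L (rep m') N i p"
  then obtain i p i' p' where s: "(i, p) \<in> c" "sx C L (rep m) N i p" "(i', p') \<in> c" "sx C L (rep m') N i' p'"
    and c: "c \<in> ses C N L // ses_equiv C N L" unfolding Ext1_def by (elim exE conjE) (rule that)
  have "((i, p), (i', p')) \<in> ses_equiv C N L"
    by (rule in_quotient_imp_in_rel[OF equiv_ses c]) (use s in blast)
  then obtain h where "h \<in> Hom C (Dom C p) (Dom C p')" "is_iso C h" unfolding ses_equiv_def by auto
  then have "isomorphic C (rep m) (rep m')"
    using sxD(5)[OF s(2)] sxD(5)[OF s(4)] unfolding isomorphic_def by (auto simp del: Hom_iff)
  then show "m = m'" using rep_eq m by blast
qed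

lemma gsum_finite:
  assumes "finite F" "F \<subseteq> Iso C" "\<And>m. m \<in> Iso C \<Longrightarrow> m \<notin> F \<Longrightarrow> f (rep m) = 0"
  shows "gsum f = (\<Sum>m\<in>F. ennreal (1 / real (card (Aut C (rep m)))) * f (rep m))"
  unfolding gsum_def by (rule nn_integral_count_space'[OF assms(1) _ assms(2)]) (simp add: assms(3))

lemma gsum_0: "(\<And>m. m \<in> Iso C \<Longrightarrow> f (rep m) = 0) \<Longrightarrow> gsum f = 0"
  using gsum_finite[of "{}" f] by simp

lemma card_sesm_iso:
  assumes "isomorphic C M M'"
  shows "card (sesm A B M) = card (sesm A B M')"
proof -
  obtain k where "k \<in> Hom C M M'" "is_iso C k" using assms unfolding isomorphic_def by blast
  then obtain k' where k: "k \<in> isos M M'" "k' \<in> isos M' M" "k' \<cdot> k = Idt C M" "k \<cdot> k' = Idt C M'"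
    using iso_inv unfolding isos_def by (metis (mono_tags, lifting) mem_Collect_eq)
  have kH: "k \<in> Hom C M M'" "k' \<in> Hom C M' M" using k(1,2) by (simp_all add: isos_def)
  have "bij_betw (\<lambda>(i, p). (k \<cdot> i, p \<cdot> k')) (sesm A B M) (sesm A B M')"
  proof (rule bij_betwI[where g = "\<lambda>(i, p). (k' \<cdot> i, p \<cdot> k)"])
    show "(\<lambda>(i, p). (k \<cdot> i, p \<cdot> k')) \<in> sesm A B M \<rightarrow> sesm A B M'"
      using sx_iso_mid[OF _ k(1) kH(2) k(3,4)] by (auto simp: sesm_def)
    show "(\<lambda>(i, p). (k' \<cdot> i, p \<cdot> k)) \<in> sesm A B M' \<rightarrow> sesm A B M"
      using sx_iso_mid[OF _ k(2) kH(1) k(4,3)] by (auto simp: sesm_def)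
    show "(\<lambda>(i, p). (k' \<cdot> i, p \<cdot> k)) ((\<lambda>(i, p). (k \<cdot> i, p \<cdot> k')) x) = x" if x: "x \<in> sesm A B M" for x
    proof -
      obtain i p where e: "x = (i, p)" and s: "sx C B M A i p" using x by (auto simp: sesm_def)
      show ?thesis unfolding e using sxD(1-6)[OF s] kH by (simp add: k(3) reassoc[OF k(3)])
    qed
    show "(\<lambda>(i, p). (k \<cdot> i, p \<cdot> k')) ((\<lambda>(i, p). (k' \<cdot> i, p \<cdot> k)) x) = x" if x: "x \<in> sesm A B M'" for x
    proof -
      obtain i p where e: "x = (i, p)" and s: "sx C B M' A i p" using x by (auto simp: sesm_def)
      show ?thesis unfolding e using sxD(1-6)[OF s] kH by (simp add: k(4) reassoc[OF k(4)])
    qed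
  qed
  then show ?thesis by (rule bij_betw_same_card)
qed

end

section \<open>Delta-Hall numbers\<close>

context finitary_hereditary_category
begin

lemma sqrt_q_pos: "sqrt_q K > 0"
  using card_K_gt by (simp add: sqrt_q_def)

lemma Hall_number_sesm:
  assumes "A \<in> Obj C" "B \<in> Obj C" "M \<in> Obj C"
  shows "real (Hall_number C A B M) = real (card (sesm A B M)) / (real (card (Aut C B)) * real (card (Aut C A)))"
  using card_sesm[OF assms] card_Aut_pos[OF assms(1)] card_Aut_pos[OF assms(2)] by simp

lemma Delta_term_nonneg: "Delta_term K C A B M L I N \<ge> 0"
  unfolding Delta_term_def using sqrt_q_pos by (intro mult_nonneg_nonneg) simp_all

text \<open>The sequences for \<open>B\<close> and \<open>A\<close> give \<open>euler B A\<close> as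
  the product of \<open>euler L I\<close>, \<open>euler I I\<close>, \<open>euler I N\<close> and
  \<open>euler L N\<close>. In the twist the last factor is inverted, so the twist equals
  \<open>sqrt (euler B A) / euler L N\<close>. The three Hall numbers contribute each automorphism
  order inversely squared, and one power cancels.\<close>

lemma Delta_term_eq:
  assumes O: "A \<in> Obj C" "B \<in> Obj C" "M \<in> Obj C" "L \<in> Obj C" "I \<in> Obj C" "N \<in> Obj C"
  shows "Delta_term K C A B M L I N = sqrt (euler B A) / real (card (Aut C M)) *
    (real (card (sesm L I B)) * real (card (sesm N L M)) * real (card (sesm I N A)) /
      (real (card (Aut C L)) * real (card (Aut C I)) * real (card (Aut C N)) * euler L N))"
proof (cases "card (sesm L I B) = 0 \<or> card (sesm I N A) = 0")
  case True
  then show ?thesis unfolding Delta_term_def using O by (auto simp: Hall_number_sesm)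
next
  case False
  then have "sesm L I B \<noteq> {}" "sesm I N A \<noteq> {}" by auto
  then obtain i p j q where s: "sx C I B L i p" and s': "sx C N A I j q" by (auto simp: sesm_def)
  have "euler B A = euler B N * euler B I" by (rule euler_mult_right[OF s' O(2)])
  also have "\<dots> = (euler I N * euler L N) * (euler I I * euler L I)"
    by (simp only: euler_mult_left[OF s O(6)] euler_mult_left[OF s O(5)])
  finally have e: "euler B A = (euler I N * euler L N) * (euler I I * euler L I)" .
  have p: "euler I N > 0" "euler L N > 0" "euler I I > 0" "euler L I > 0" by (rule euler_pos; fact O)+
  have "sqrt_q K powi Euler_form3 K C L I N = sqrt (euler L I) * sqrt (euler I I) * sqrt (euler I N) / sqrt (euler L N)"
    unfolding Euler_form3_def using sqrt_q_pos O
    by (simp add: power_int_add power_int_diff sqrt_q_powi_Euler_form)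
  also have "\<dots> = sqrt (euler B A) / euler L N"
    unfolding e using p by (simp add: real_sqrt_mult field_simps)
  finally have v: "sqrt_q K powi Euler_form3 K C L I N = sqrt (euler B A) / euler L N" .
  have a: "real (card (Aut C L)) > 0" "real (card (Aut C I)) > 0" "real (card (Aut C N)) > 0" "real (card (Aut C M)) > 0"
    using card_Aut_pos O by simp_all
  show ?thesis
    unfolding Delta_term_def v using a p(2)
    by (simp add: Hall_number_sesm[OF O(4,5,2)] Hall_number_sesm[OF O(6,4,3)] Hall_number_sesm[OF O(5,6,1)] field_simps)
qed

text \<open>A finite bound for \<open>Delta_support\<close> that does not depend on
  \<open>M\<close>, obtained by dropping the condition on \<open>M\<close>. It therefore also bounds
  the possible classes of \<open>M\<close>.\<close>

definition Delta_triples :: "'o \<Rightarrow> 'o \<Rightarrow> ('o set \<times> 'o set \<times> 'o set) set" where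
  "Delta_triples A B = {(l, i, n). l \<in> Iso C \<and> i \<in> Iso C \<and> n \<in> Iso C \<and>
     sesm (rep l) (rep i) B \<noteq> {} \<and> sesm (rep i) (rep n) A \<noteq> {}}"

lemma finite_Delta_triples:
  assumes O: "A \<in> Obj C" "B \<in> Obj C"
  shows "finite (Delta_triples A B)"
proof (rule finite_subset)
  let ?I = "{i \<in> Iso C. \<exists>N L k p j c. sx C N A (rep i) k p \<and> sx C (rep i) B L j c}"
  let ?L = "\<lambda>i. {l \<in> Iso C. \<exists>j p. sx C (rep i) B (rep l) j p}"
  let ?N = "\<lambda>i. {n \<in> Iso C. \<exists>j p. sx C (rep n) A (rep i) j p}"
  let ?U = "\<Union>i\<in>?I. ?L i \<times> {i} \<times> ?N i"
  show "Delta_triples A B \<subseteq> ?U"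
  proof
    fix x assume "x \<in> Delta_triples A B"
    then obtain l i n where x: "x = (l, i, n)" "l \<in> Iso C" "i \<in> Iso C" "n \<in> Iso C"
      and ne: "sesm (rep l) (rep i) B \<noteq> {}" "sesm (rep i) (rep n) A \<noteq> {}"
      unfolding Delta_triples_def by blast
    obtain j p where s: "sx C (rep i) B (rep l) j p" using ne(1) unfolding sesm_def by auto
    obtain k q where s': "sx C (rep n) A (rep i) k q" using ne(2) unfolding sesm_def by auto
    have "i \<in> ?I" by (intro CollectI conjI x(3) exI) (rule s' s)+
    moreover have "l \<in> ?L i" by (intro CollectI conjI x(2) exI) (rule s)
    moreover have "n \<in> ?N i" by (intro CollectI conjI x(4) exI) (rule s')
    ultimately show "x \<in> ?U" unfolding x(1) by (intro UN_I[of i]) simp_all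
  qed
  show "finite ?U"
  proof (rule finite_UN_I[OF finite_image_classes[OF O]])
    fix i assume "i \<in> ?I"
    then have "rep i \<in> Obj C" using rep_Iso by blast
    then show "finite (?L i \<times> {i} \<times> ?N i)"
      using finite_cokernel_classes[OF _ O(2)] finite_kernel_classes[OF _ O(1)] by blast
  qed
qed

lemma Delta_support_subset:
  assumes O: "A \<in> Obj C" "B \<in> Obj C" "M \<in> Obj C"
  shows "Delta_support K C A B M \<subseteq> Delta_triples A B"
proof
  fix x assume "x \<in> Delta_support K C A B M"
  then obtain l i n where x: "x = (l, i, n)" "l \<in> Iso C" "i \<in> Iso C" "n \<in> Iso C"
    and t: "Delta_term K C A B M (rep l) (rep i) (rep n) \<noteq> 0" unfolding Delta_support_def by blast
  then have "sesm (rep l) (rep i) B \<noteq> {}" "sesm (rep i) (rep n) A \<noteq> {}"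
    using Delta_term_eq[OF O rep_Iso(1)[OF x(2)] rep_Iso(1)[OF x(3)] rep_Iso(1)[OF x(4)]] by auto
  then show "x \<in> Delta_triples A B" unfolding Delta_triples_def using x by blast
qed

lemma finite_Delta_support:
  assumes O: "A \<in> Obj C" "B \<in> Obj C" "M \<in> Obj C"
  shows "finite (Delta_support K C A B M)"
  by (rule finite_subset[OF Delta_support_subset[OF O] finite_Delta_triples[OF O(1,2)]])

lemma Delta_Hall_number_nonneg: "Delta_Hall_number K C A B M \<ge> 0"
  unfolding Delta_Hall_number_def by (rule sum_nonneg) (auto simp: Delta_term_nonneg)

text \<open>The bridge from the finite real sum over triples to the iterated weighted sum in which
  associativity is proved.\<close>

lemma Delta_Hall_number_ennreal:
  assumes O: "A \<in> Obj C" "B \<in> Obj C" "M \<in> Obj C"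
  shows "ennreal (Delta_Hall_number K C A B M) = ennreal (sqrt (euler B A) / real (card (Aut C M))) * Delta_sum A B M"
proof -
  \<comment> \<open>One finite set that contains every coordinate of every relevant triple, so that
    all three weighted sums can be restricted to it.\<close>
  define F where "F = fst ` Delta_triples A B \<union> (fst \<circ> snd) ` Delta_triples A B \<union> (snd \<circ> snd) ` Delta_triples A B"
  have F: "finite F" "F \<subseteq> Iso C" unfolding F_def using finite_Delta_triples[OF O(1,2)]
    by (auto simp: Delta_triples_def)
  have FI: "(l, i, n) \<in> Delta_triples A B \<Longrightarrow> l \<in> F \<and> i \<in> F \<and> n \<in> F" for l i n
    unfolding F_def by force
  let ?a = "\<lambda>m. real (card (Aut C (rep m)))"
  define r where "r = (\<lambda>l i n. real (card (sesm (rep l) (rep i) B)) * real (card (sesm (rep n) (rep l) M)) * real (card (sesm (rep i) (rep n) A)) /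
      (?a l * ?a i * ?a n * euler (rep l) (rep n)))"
  define g where "g = (\<lambda>L I N. inv_euler L N * (nses L I B * nses N L M * nses I N A))"
  have r0: "r l i n = 0" if "l \<in> Iso C" "i \<in> Iso C" "n \<in> Iso C" "(l, i, n) \<notin> Delta_triples A B" for l i n
    using that unfolding Delta_triples_def r_def by auto
  have g0: "g (rep l) (rep i) (rep n) = 0" if "l \<in> Iso C" "i \<in> Iso C" "n \<in> Iso C" "(l, i, n) \<notin> Delta_triples A B" for l i n
    using that unfolding Delta_triples_def g_def nses_def by auto
  have t: "Delta_term K C A B M (rep l) (rep i) (rep n) = sqrt (euler B A) / real (card (Aut C M)) * r l i n"
    if "l \<in> Iso C" "i \<in> Iso C" "n \<in> Iso C" for l i n
    unfolding r_def by (rule Delta_term_eq) (use O that rep_Iso in simp_all)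
  have e: "ennreal (1 / ?a l) * (ennreal (1 / ?a i) * (ennreal (1 / ?a n) * g (rep l) (rep i) (rep n))) = ennreal (r l i n)"
    if "l \<in> Iso C" "i \<in> Iso C" "n \<in> Iso C" for l i n
  proof -
    have "euler (rep l) (rep n) > 0" using euler_pos rep_Iso that by simp
    then show ?thesis unfolding g_def r_def nses_def inv_euler_def
      by (simp add: ennreal_of_nat_eq_real_of_nat field_simps flip: ennreal_mult)
  qed
  have "Delta_sum A B M = (\<Sum>\<^sub>g L. \<Sum>\<^sub>g I. \<Sum>\<^sub>g N. g L I N)"
    unfolding Delta_sum_def g_def ..
  also have "\<dots> = (\<Sum>l\<in>F. ennreal (1 / ?a l) * (\<Sum>\<^sub>g I. \<Sum>\<^sub>g N. g (rep l) I N))"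
  proof (rule gsum_finite[OF F])
    fix l assume l: "l \<in> Iso C" "l \<notin> F"
    have "g (rep l) (rep i) (rep n) = 0" if "i \<in> Iso C" "n \<in> Iso C" for i n
      by (rule g0[OF l(1) that]) (use FI l in blast)
    then show "(\<Sum>\<^sub>g I. \<Sum>\<^sub>g N. g (rep l) I N) = 0" by (intro gsum_0)
  qed
  also have "\<dots> = (\<Sum>l\<in>F. ennreal (1 / ?a l) * (\<Sum>i\<in>F. ennreal (1 / ?a i) * (\<Sum>\<^sub>g N. g (rep l) (rep i) N)))"
  proof (rule sum.cong[OF refl])
    fix l assume l: "l \<in> F"
    have "(\<Sum>\<^sub>g I. \<Sum>\<^sub>g N. g (rep l) I N) = (\<Sum>i\<in>F. ennreal (1 / ?a i) * (\<Sum>\<^sub>g N. g (rep l) (rep i) N))"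
    proof (rule gsum_finite[OF F])
      fix i assume i: "i \<in> Iso C" "i \<notin> F"
      have "g (rep l) (rep i) (rep n) = 0" if "n \<in> Iso C" for n
        by (rule g0[OF _ i(1) that]) (use FI l F(2) i in blast)+
      then show "(\<Sum>\<^sub>g N. g (rep l) (rep i) N) = 0" by (rule gsum_0)
    qed
    then show "ennreal (1 / ?a l) * (\<Sum>\<^sub>g I. \<Sum>\<^sub>g N. g (rep l) I N) =
      ennreal (1 / ?a l) * (\<Sum>i\<in>F. ennreal (1 / ?a i) * (\<Sum>\<^sub>g N. g (rep l) (rep i) N))" by simp
  qed
  also have "\<dots> = (\<Sum>l\<in>F. ennreal (1 / ?a l) * (\<Sum>i\<in>F. ennreal (1 / ?a i) * (\<Sum>n\<in>F. ennreal (1 / ?a n) * g (rep l) (rep i) (rep n))))"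
  proof (intro sum.cong[OF refl] arg_cong2[where f = times] refl)
    fix l i assume l: "l \<in> F" "i \<in> F"
    show "(\<Sum>\<^sub>g N. g (rep l) (rep i) N) = (\<Sum>n\<in>F. ennreal (1 / ?a n) * g (rep l) (rep i) (rep n))"
    proof (rule gsum_finite[OF F])
      fix n assume n: "n \<in> Iso C" "n \<notin> F"
      show "g (rep l) (rep i) (rep n) = 0" by (rule g0[OF _ _ n(1)]) (use FI l F(2) n in blast)+
    qed
  qed
  also have "\<dots> = (\<Sum>l\<in>F. \<Sum>i\<in>F. \<Sum>n\<in>F. ennreal (r l i n))"
    unfolding sum_distrib_left by (intro sum.cong[OF refl] e) (use F(2) in blast)+
  also have "\<dots> = (\<Sum>(l, i, n)\<in>F \<times> F \<times> F. ennreal (r l i n))"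
    by (simp only: sum.cartesian_product)
  also have "\<dots> = (\<Sum>(l, i, n)\<in>Delta_triples A B. ennreal (r l i n))"
    by (rule sum.mono_neutral_right) (use F(1) FI in \<open>auto simp: r0 subsetD[OF F(2)]\<close>)
  also have "\<dots> = ennreal (\<Sum>(l, i, n)\<in>Delta_triples A B. r l i n)"
  proof -
    have p: "(\<lambda>(l, i, n). r l i n) x \<ge> 0" if "x \<in> Delta_triples A B" for x
    proof -
      obtain l i n where x: "x = (l, i, n)" "l \<in> Iso C" "i \<in> Iso C" "n \<in> Iso C"
        using \<open>x \<in> Delta_triples A B\<close> unfolding Delta_triples_def by blast
      have "euler (rep l) (rep n) > 0" using euler_pos rep_Iso x by simp
      then show ?thesis unfolding x(1) r_def by simp
    qed
    have "(\<Sum>x\<in>Delta_triples A B. ennreal ((\<lambda>(l, i, n). r l i n) x)) = ennreal (\<Sum>x\<in>Delta_triples A B. (\<lambda>(l, i, n). r l i n) x)"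
      by (rule sum_ennreal) (rule p)
    then show ?thesis by (simp only: split_def)
  qed
  finally have D: "Delta_sum A B M = ennreal (\<Sum>(l, i, n)\<in>Delta_triples A B. r l i n)" .
  have "Delta_Hall_number K C A B M = (\<Sum>(l, i, n)\<in>Delta_triples A B. Delta_term K C A B M (rep l) (rep i) (rep n))"
    unfolding Delta_Hall_number_def
    by (rule sum.mono_neutral_left[OF finite_Delta_triples[OF O(1,2)] Delta_support_subset[OF O]])
      (auto simp: Delta_support_def Delta_triples_def)
  also have "\<dots> = (\<Sum>(l, i, n)\<in>Delta_triples A B. sqrt (euler B A) / real (card (Aut C M)) * r l i n)"
    by (rule sum.cong[OF refl]) (auto simp: Delta_triples_def t)
  also have "\<dots> = sqrt (euler B A) / real (card (Aut C M)) * (\<Sum>(l, i, n)\<in>Delta_triples A B. r l i n)"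
    by (simp only: sum_distrib_left split_def)
  finally have H: "Delta_Hall_number K C A B M = \<dots>" .
  have c: "0 \<le> sqrt (euler B A) / real (card (Aut C M))" using euler_pos[OF O(2,1)] by simp
  show ?thesis unfolding D H by (rule ennreal_mult'[OF c])
qed

text \<open>A nonzero term makes \<open>M\<close> an extension of \<open>N\<close> by
  \<open>L\<close> for one of finitely many triples, and there are finitely many such extensions up
  to isomorphism.\<close>

lemma finite_Delta_Hall_number_support:
  assumes O: "A \<in> Obj C" "B \<in> Obj C"
  shows "finite {m \<in> Iso C. Delta_Hall_number K C A B (rep m) \<noteq> 0}"
proof (rule finite_subset)
  let ?U = "\<Union>(l, i, n)\<in>Delta_triples A B. {m \<in> Iso C. \<exists>i p. sx C (rep l) (rep m) (rep n) i p}"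
  show "finite ?U"
  proof (rule finite_UN_I[OF finite_Delta_triples[OF O]])
    fix x assume "x \<in> Delta_triples A B"
    then obtain l i n where x: "x = (l, i, n)" "l \<in> Iso C" "n \<in> Iso C" unfolding Delta_triples_def by blast
    show "finite (case x of (l, i, n) \<Rightarrow> {m \<in> Iso C. \<exists>i p. sx C (rep l) (rep m) (rep n) i p})"
      unfolding x(1) case_prod_conv by (rule finite_extension_classes[OF rep_Iso(1)[OF x(3)] rep_Iso(1)[OF x(2)]])
  qed
  show "{m \<in> Iso C. Delta_Hall_number K C A B (rep m) \<noteq> 0} \<subseteq> ?U"
  proof
    fix m assume "m \<in> {m \<in> Iso C. Delta_Hall_number K C A B (rep m) \<noteq> 0}"
    then have m: "m \<in> Iso C" "Delta_Hall_number K C A B (rep m) \<noteq> 0" by auto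
    have OM: "rep m \<in> Obj C" using rep_Iso m(1) by blast
    have "Delta_support K C A B (rep m) \<noteq> {}"
    proof
      assume "Delta_support K C A B (rep m) = {}"
      then show False using m(2) by (simp add: Delta_Hall_number_def)
    qed
    then obtain x where x: "x \<in> Delta_support K C A B (rep m)" by blast
    then obtain l i n where xe: "x = (l, i, n)" "l \<in> Iso C" "i \<in> Iso C" "n \<in> Iso C"
      and t: "Delta_term K C A B (rep m) (rep l) (rep i) (rep n) \<noteq> 0" unfolding Delta_support_def by blast
    have "sesm (rep n) (rep l) (rep m) \<noteq> {}"
      using t Delta_term_eq[OF O OM rep_Iso(1)[OF xe(2)] rep_Iso(1)[OF xe(3)] rep_Iso(1)[OF xe(4)]] by auto
    then have "\<exists>i p. sx C (rep l) (rep m) (rep n) i p" by (auto simp: sesm_def)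
    moreover have "(l, i, n) \<in> Delta_triples A B" using x Delta_support_subset[OF O OM] xe(1) by blast
    ultimately show "m \<in> ?U" using m(1) by blast
  qed
qed

lemma Delta_Hall_number_iso:
  assumes "A \<in> Obj C" "B \<in> Obj C" "A' \<in> Obj C" "B' \<in> Obj C" "isomorphic C A A'" "isomorphic C B B'"
  shows "Delta_Hall_number K C A B M = Delta_Hall_number K C A' B' M"
proof -
  have "Delta_term K C A B M (rep l) (rep i) (rep n) = Delta_term K C A' B' M (rep l) (rep i) (rep n)"
    if "l \<in> Iso C" "i \<in> Iso C" "n \<in> Iso C" for l i n
  proof -
    have O: "rep l \<in> Obj C" "rep i \<in> Obj C" "rep n \<in> Obj C" using rep_Iso that by simp_all
    have "real (Hall_number C (rep l) (rep i) B) = real (Hall_number C (rep l) (rep i) B')"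
      "real (Hall_number C (rep i) (rep n) A) = real (Hall_number C (rep i) (rep n) A')"
      using Hall_number_sesm[OF O(1,2)] Hall_number_sesm[OF O(2,3)] card_sesm_iso[OF assms(5)] card_sesm_iso[OF assms(6)] assms(1-4)
      by simp_all
    then show ?thesis unfolding Delta_term_def by simp
  qed
  then show ?thesis unfolding Delta_Hall_number_def Delta_support_def by (intro sum.cong) auto
qed

end

section \<open>Zero objects\<close>

context abelian_category
begin

lemma zero_object_zero: "is_zero_object C (zero_object C)"
  unfolding zero_object_def by (rule someI_ex[OF zero_object_exists])

lemma Zero_Hom: "A \<in> Obj C \<Longrightarrow> B \<in> Obj C \<Longrightarrow> ZeroArr C A B \<in> Hom C A B"
  by simp

lemma isos_op: "abelian_category.isos (op_cat C) A B = isos B A"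
  unfolding abelian_category.isos_def[OF abelian_category_op] isos_def by (simp del: Hom_iff)

text \<open>\<open>card_isos\<close> counts by the automorphisms of the target. In the opposite
  category the target of an isomorphism from \<open>B\<close> to \<open>A\<close> is
  \<open>B\<close> as well.\<close>

lemma card_isos_sym:
  assumes "A \<in> Obj C" "B \<in> Obj C"
  shows "card (isos A B) = card (isos B A)"
proof -
  have 1: "isomorphic (op_cat C) A B \<longleftrightarrow> isomorphic C A B"
    using isomorphic_sym unfolding isomorphic_def by (auto simp del: Hom_iff)
  have 2: "Aut (op_cat C) B = Aut C B" unfolding Aut_def by (simp del: Hom_iff)
  show ?thesis
    using abelian_category.card_isos[OF abelian_category_op, of A B] card_isos[OF assms] assms
    unfolding isos_op 1 2 by simp
qed

lemma zero_objectD: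
  assumes "is_zero_object C Z"
  shows "Z \<in> Obj C" "A \<in> Obj C \<Longrightarrow> f \<in> Hom C Z A \<Longrightarrow> f = ZeroArr C Z A" "A \<in> Obj C \<Longrightarrow> f \<in> Hom C A Z \<Longrightarrow> f = ZeroArr C A Z"
proof -
  show Z: "Z \<in> Obj C" using assms unfolding is_zero_object_def by blast
  show "f = ZeroArr C Z A" if "A \<in> Obj C" "f \<in> Hom C Z A"
    using assms that Zero_Hom[OF Z that(1)] unfolding is_zero_object_def by (metis (no_types))
  show "f = ZeroArr C A Z" if "A \<in> Obj C" "f \<in> Hom C A Z"
    using assms that Zero_Hom[OF that(1) Z] unfolding is_zero_object_def by (metis (no_types))
qed

lemma zero_object_iff: "Z \<in> Obj C \<Longrightarrow> is_zero_object C Z \<longleftrightarrow> Idt C Z = ZeroArr C Z Z"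
proof
  assume Z: "Z \<in> Obj C"
  show "Idt C Z = ZeroArr C Z Z" if "is_zero_object C Z"
    by (rule zero_objectD(2)[OF that Z]) (rule Idt_in_Hom[OF Z])
  show "is_zero_object C Z" if e: "Idt C Z = ZeroArr C Z Z"
    unfolding is_zero_object_def
  proof (intro conjI ballI Z)
    fix A assume A: "A \<in> Obj C"
    show "\<exists>!f. f \<in> Hom C Z A"
    proof (rule ex1I[of _ "ZeroArr C Z A"])
      show "ZeroArr C Z A \<in> Hom C Z A" by (rule Zero_Hom[OF Z A])
      fix f assume f: "f \<in> Hom C Z A"
      have "f = f \<cdot> Idt C Z" using Comp_Idt[OF f] by simp
      also have "\<dots> = ZeroArr C Z A" unfolding e using f Z by simp
      finally show "f = ZeroArr C Z A" .
    qed
    show "\<exists>!f. f \<in> Hom C A Z"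
    proof (rule ex1I[of _ "ZeroArr C A Z"])
      show "ZeroArr C A Z \<in> Hom C A Z" by (rule Zero_Hom[OF A Z])
      fix f assume f: "f \<in> Hom C A Z"
      have "f = Idt C Z \<cdot> f" using Idt_Comp[OF f] by simp
      also have "\<dots> = ZeroArr C A Z" unfolding e using f A Z by simp
      finally show "f = ZeroArr C A Z" .
    qed
  qed
qed

lemma isos_zero:
  assumes Z: "is_zero_object C Z" and A: "A \<in> Obj C"
  shows "isos Z A = (if is_zero_object C A then {ZeroArr C Z A} else {})"
proof (cases "is_zero_object C A")
  case True
  note H = Zero_Hom[OF zero_objectD(1)[OF Z] A] Zero_Hom[OF A zero_objectD(1)[OF Z]]
  have "is_iso C (ZeroArr C Z A)"
  proof (rule isoI[of _ "ZeroArr C A Z"])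
    show "ZeroArr C A Z \<cdot> ZeroArr C Z A = Idt C (Dom C (ZeroArr C Z A))"
      using A zero_objectD(1)[OF Z] zero_object_iff Z by simp
    show "ZeroArr C Z A \<cdot> ZeroArr C A Z = Idt C (Cod C (ZeroArr C Z A))"
      using A zero_objectD(1)[OF Z] zero_object_iff True by simp
  qed (use H in simp_all)
  then have 1: "ZeroArr C Z A \<in> isos Z A" unfolding isos_def using H(1) by (simp del: Hom_iff)
  have 2: "f = ZeroArr C Z A" if "f \<in> isos Z A" for f
    by (rule zero_objectD(2)[OF Z A]) (use that in \<open>simp add: isos_def\<close>)
  have "isos Z A = {ZeroArr C Z A}"
  proof (intro equalityI subsetI)
    fix f assume "f \<in> isos Z A"
    then show "f \<in> {ZeroArr C Z A}" using 2 by blast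
  qed (use 1 in blast)
  then show ?thesis using True by simp
next
  case False
  have "isos Z A = {}"
  proof (rule ccontr)
    assume "isos Z A \<noteq> {}"
    then obtain f where f: "is_iso C f" "f \<in> Hom C Z A" unfolding isos_def by blast
    obtain g where g: "g \<in> Hom C A Z" "f \<cdot> g = Idt C A" by (rule iso_inv[OF f])
    have "f \<cdot> g = ZeroArr C A A"
      unfolding zero_objectD(2)[OF Z A f(2)] using g(1) A by simp
    then show False using False g(2) zero_object_iff[OF A] by simp
  qed
  then show ?thesis using False by simp
qed

text \<open>If the quotient is zero, the identity of \<open>M\<close> lifts through
  \<open>i\<close>, so \<open>i\<close> is invertible.\<close>

lemma sx_zero_left:
  assumes Z: "is_zero_object C Z" and O: "B \<in> Obj C" "M \<in> Obj C"
  shows "sx C B M Z i p \<longleftrightarrow> i \<in> isos B M \<and> p = ZeroArr C M Z"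
proof
  assume s: "sx C B M Z i p"
  note D = sxD[OF s]
  have p: "p = ZeroArr C M Z" by (rule zero_objectD(3)[OF Z O(2)]) (use D(4-6) in simp)
  have "p \<cdot> Idt C M = ZeroArr C M Z" using D(4-6) p O by simp
  then obtain g where g: "g \<in> Hom C M B" "i \<cdot> g = Idt C M" by (rule sx_lift[OF s Idt_in_Hom[OF O(2)]])
  have e: "i \<cdot> (g \<cdot> i) = i \<cdot> Idt C B" using g(1) D(1-3) O by (simp add: reassoc[OF g(2)])
  have "g \<cdot> i = Idt C B" by (rule mono_cancel[OF D(11) e]) (use g(1) D(1-3) O in simp_all)
  then have "is_iso C i" by (intro isoI[of _ g]) (use g D(1-3) in simp_all)
  then show "i \<in> isos B M \<and> p = ZeroArr C M Z" unfolding isos_def using D(1-3) p by simp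
next
  assume a: "i \<in> isos B M \<and> p = ZeroArr C M Z"
  then have i: "i \<in> Hom C B M" "is_iso C i" and p: "p = ZeroArr C M Z" unfolding isos_def by auto
  obtain g where g: "g \<in> Hom C M B" "g \<cdot> i = Idt C B" "i \<cdot> g = Idt C M" using iso_inv[OF i(2,1)] by blast
  have ZO: "Z \<in> Obj C" by (rule zero_objectD(1)[OF Z])
  show "sx C B M Z i p" unfolding p
  proof (rule sxI[OF iso_mono[OF i(2)] _ i(1) Zero_Hom[OF O(2) ZO]])
    show "is_epi C (ZeroArr C M Z)"
      unfolding is_epi_def
    proof (intro conjI ballI impI)
      show "ZeroArr C M Z \<in> Arr C" using Zero_Hom[OF O(2) ZO] by simp
      fix T g h assume T: "T \<in> Obj C" and "g \<in> Hom C (Cod C (ZeroArr C M Z)) T" "h \<in> Hom C (Cod C (ZeroArr C M Z)) T"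
      then have "g \<in> Hom C Z T" "h \<in> Hom C Z T" using Zero_Hom[OF O(2) ZO] by simp_all
      then show "g = h" using zero_objectD(2)[OF Z T] by metis
    qed
    show "ZeroArr C M Z \<cdot> i = ZeroArr C B Z" using i(1) ZO O by simp
    show "\<exists>u\<in>Hom C T B. i \<cdot> u = h" if "h \<in> Hom C T M" for T h
      by (rule bexI[of _ "g \<cdot> h"]) (use that g i(1) in \<open>simp_all add: reassoc[OF g(3)]\<close>)
  qed
qed

lemma sx_zero_mid:
  assumes Z: "is_zero_object C Z" and s: "sx C N Z I i p"
  shows "is_zero_object C N" "is_zero_object C I"
proof -
  note D = sxD[OF s]
  have i: "i = ZeroArr C N Z" by (rule zero_objectD(3)[OF Z D(7)]) (use D(1-3) in simp)
  have p: "p = ZeroArr C Z I" by (rule zero_objectD(2)[OF Z D(9)]) (use D(4-6) in simp)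
  have "i \<cdot> Idt C N = i \<cdot> ZeroArr C N N" using D(1-3,7) i by simp
  then have "Idt C N = ZeroArr C N N" by (rule mono_cancel[OF D(11)]) (use D(1-3,7) in simp_all)
  then show "is_zero_object C N" using zero_object_iff[OF D(7)] by simp
  have "Idt C I \<cdot> p = ZeroArr C I I \<cdot> p" using D(4-6,9) p D(8) by simp
  then have "Idt C I = ZeroArr C I I" by (rule epi_cancel[OF D(12)]) (use D(4-6,9) in simp_all)
  then show "is_zero_object C I" using zero_object_iff[OF D(9)] by simp
qed

lemma sx_zero_right:
  assumes Z: "is_zero_object C Z" and O: "A \<in> Obj C" "M \<in> Obj C"
  shows "sx C Z M A i p \<longleftrightarrow> p \<in> isos M A \<and> i = ZeroArr C Z M"
  using abelian_category.sx_zero_left[OF abelian_category_op, of Z A M p i] Z O unfolding isos_op by simp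

lemma card_sesm_zero_left:
  assumes "is_zero_object C Z" "B \<in> Obj C" "M \<in> Obj C"
  shows "card (sesm Z B M) = card (isos B M)"
proof -
  have "sesm Z B M = (\<lambda>i. (i, ZeroArr C M Z)) ` isos B M" unfolding sesm_def sx_zero_left[OF assms] by auto
  then show ?thesis by (simp add: card_image inj_on_def)
qed

lemma card_sesm_zero_right:
  assumes "is_zero_object C Z" "A \<in> Obj C" "M \<in> Obj C"
  shows "card (sesm A Z M) = card (isos M A)"
proof -
  have "sesm A Z M = (\<lambda>p. (ZeroArr C Z M, p)) ` isos M A" unfolding sesm_def sx_zero_right[OF assms] by auto
  then show ?thesis by (simp add: card_image inj_on_def)
qed

text \<open>A zero middle term forces both ends to be zero. The count is written with
  \<open>isos\<close> so that it can be summed by \<open>gsum_isos_one\<close> without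
  distinguishing cases.\<close>

lemma card_sesm_zero_mid:
  assumes "is_zero_object C Z" "A \<in> Obj C" "B \<in> Obj C"
  shows "card (sesm A B Z) = card (isos Z A) * card (isos Z B)"
proof (cases "is_zero_object C A \<and> is_zero_object C B")
  case True
  then show ?thesis
    using card_sesm_zero_left[of A B Z] isos_zero[of B Z] assms zero_objectD(1)[OF assms(1)] isos_zero[OF assms(1)] by simp
next
  case False
  then have "sesm A B Z = {}" using sx_zero_mid[OF assms(1)] unfolding sesm_def by blast
  moreover have "isos Z A = {} \<or> isos Z B = {}" using False isos_zero[OF assms(1)] assms(2,3) by auto
  ultimately show ?thesis by auto
qed

end

context finitary_lifting_category
begin

text \<open>The sequence with three terms \<open>Z\<close> makes the value equal to its own square,
  and it is positive.\<close>

lemma euler_zero: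
  assumes Z: "is_zero_object C Z" and M: "M \<in> Obj C"
  shows "euler M Z = 1" "euler Z M = 1"
proof -
  have ZO: "Z \<in> Obj C" by (rule zero_objectD(1)[OF Z])
  have s: "sx C Z Z Z (Idt C Z) (ZeroArr C Z Z)"
    unfolding sx_zero_left[OF Z ZO ZO] isos_def using ZO Idt_in_Hom by simp
  have "euler M Z = euler M Z * euler M Z" by (rule euler_mult_right[OF s M])
  then show "euler M Z = 1" using euler_pos[OF M ZO] by simp
  have "euler Z M = euler Z M * euler Z M" by (rule euler_mult_left[OF s M])
  then show "euler Z M = 1" using euler_pos[OF ZO M] by simp
qed

lemma gsum_isos_one: "A \<in> Obj C \<Longrightarrow> (\<Sum>\<^sub>g M. of_nat (card (isos A M))) = 1"
  by (rule gsum_torsor) simp_all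

lemma gsum_isos_isos:
  assumes "B \<in> Obj C" "M \<in> Obj C"
  shows "(\<Sum>\<^sub>g L. of_nat (card (isos B L)) * of_nat (card (isos L M))) = of_nat (card (isos B M))"
proof -
  have r: "rep (iso_class C B) \<in> Obj C" using rep_Iso iso_class_Iso assms(1) by blast
  have "isomorphic C (rep (iso_class C B)) M \<longleftrightarrow> isomorphic C B M"
    using isomorphic_rep[OF assms(1)] isomorphic_sym isomorphic_trans by blast
  then show ?thesis unfolding gsum_isos[OF assms(1)] card_isos[OF r assms(2)] card_isos[OF assms] by simp
qed

text \<open>With \<open>A\<close> zero, \<open>I\<close> and \<open>N\<close> have to be zero too;
  the remaining sequences are isomorphisms from \<open>B\<close> to \<open>L\<close> and from
  \<open>L\<close> to \<open>M\<close>.\<close>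

lemma Delta_sum_zero_left:
  assumes Z: "is_zero_object C Z" and O: "B \<in> Obj C" "M \<in> Obj C"
  shows "Delta_sum Z B M = of_nat (card (isos B M))"
proof -
  have ZO: "Z \<in> Obj C" by (rule zero_objectD(1)[OF Z])
  let ?n = "\<lambda>A B. of_nat (card (isos A B)) :: ennreal"
  have "Delta_sum Z B M = (\<Sum>\<^sub>g L. \<Sum>\<^sub>g I. \<Sum>\<^sub>g N. (?n B L * ?n L M * ?n Z I) * ?n Z N)"
    unfolding Delta_sum_def
  proof (intro gsum_cong)
    fix L I N assume O': "L \<in> Obj C" "I \<in> Obj C" "N \<in> Obj C"
    show "inv_euler L N * (nses L I B * nses N L M * nses I N Z) = (?n B L * ?n L M * ?n Z I) * ?n Z N"
    proof (cases "is_zero_object C I \<and> is_zero_object C N")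
      case True
      then show ?thesis
        using card_sesm_zero_mid[OF Z O'(2,3)] card_sesm_zero_right[of I L B] card_sesm_zero_left[of N L M] O O' euler_zero(1)[of N L]
        by (simp add: nses_def inv_euler_def isos_zero[OF Z])
    next
      case False
      then have "isos Z I = {} \<or> isos Z N = {}" using isos_zero[OF Z] O' by auto
      then show ?thesis using card_sesm_zero_mid[OF Z O'(2,3)] by (auto simp: nses_def)
    qed
  qed
  also have "\<dots> = ?n B M"
    by (simp add: gsum_cmult gsum_isos_one ZO gsum_isos_isos O)
  finally show ?thesis .
qed

lemma Delta_sum_zero_right:
  assumes Z: "is_zero_object C Z" and O: "A \<in> Obj C" "M \<in> Obj C"
  shows "Delta_sum A Z M = of_nat (card (isos M A))"
proof -
  have ZO: "Z \<in> Obj C" by (rule zero_objectD(1)[OF Z])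
  let ?n = "\<lambda>A B. of_nat (card (isos A B)) :: ennreal"
  have "Delta_sum A Z M = (\<Sum>\<^sub>g L. \<Sum>\<^sub>g I. \<Sum>\<^sub>g N. (?n Z L * ?n Z I) * (?n M N * ?n N A))"
    unfolding Delta_sum_def
  proof (intro gsum_cong)
    fix L I N assume O': "L \<in> Obj C" "I \<in> Obj C" "N \<in> Obj C"
    show "inv_euler L N * (nses L I Z * nses N L M * nses I N A) = (?n Z L * ?n Z I) * (?n M N * ?n N A)"
    proof (cases "is_zero_object C L \<and> is_zero_object C I")
      case True
      then show ?thesis
        using card_sesm_zero_mid[OF Z O'(1,2)] card_sesm_zero_right[of L N M] card_sesm_zero_left[of I N A] O O' euler_zero(2)[of L N]
        by (simp add: nses_def inv_euler_def isos_zero[OF Z])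
    next
      case False
      then have "isos Z L = {} \<or> isos Z I = {}" using isos_zero[OF Z] O' by auto
      then show ?thesis using card_sesm_zero_mid[OF Z O'(1,2)] by (auto simp: nses_def)
    qed
  qed
  also have "\<dots> = ?n M A"
    by (simp add: gsum_cmult gsum_multc gsum_isos_one ZO gsum_isos_isos O)
  finally show ?thesis .
qed

end

section \<open>The structure constants: unit and associativity\<close>

context finitary_hereditary_category
begin

lemma Delta_Hall_number_zero_left:
  assumes Z: "is_zero_object C Z" and O: "B \<in> Obj C" "M \<in> Obj C"
  shows "Delta_Hall_number K C Z B M = (if isomorphic C B M then 1 else 0)"
proof -
  have ZO: "Z \<in> Obj C" by (rule zero_objectD(1)[OF Z])
  have "ennreal (Delta_Hall_number K C Z B M) = ennreal (1 / real (card (Aut C M))) * of_nat (card (isos B M))"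
    unfolding Delta_Hall_number_ennreal[OF ZO O] Delta_sum_zero_left[OF Z O] by (simp add: euler_zero(1)[OF Z O(1)])
  also have "\<dots> = ennreal (if isomorphic C B M then 1 else 0)"
    using card_Aut_pos[OF O(2)] by (simp add: card_isos[OF O] ennreal_of_nat_eq_real_of_nat flip: ennreal_mult)
  finally show ?thesis by (subst (asm) ennreal_inj) (simp_all add: Delta_Hall_number_nonneg)
qed

lemma Delta_Hall_number_zero_right:
  assumes Z: "is_zero_object C Z" and O: "A \<in> Obj C" "M \<in> Obj C"
  shows "Delta_Hall_number K C A Z M = (if isomorphic C A M then 1 else 0)"
proof -
  have ZO: "Z \<in> Obj C" by (rule zero_objectD(1)[OF Z])
  have i: "card (isos M A) = card (isos A M)" by (rule card_isos_sym[OF O(2,1)])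
  have "ennreal (Delta_Hall_number K C A Z M) = ennreal (1 / real (card (Aut C M))) * of_nat (card (isos M A))"
    unfolding Delta_Hall_number_ennreal[OF O(1) ZO O(2)] Delta_sum_zero_right[OF Z O] by (simp add: euler_zero(2)[OF Z O(1)])
  also have "\<dots> = ennreal (if isomorphic C A M then 1 else 0)"
    unfolding i using card_Aut_pos[OF O(2)] by (simp add: card_isos[OF O] ennreal_of_nat_eq_real_of_nat flip: ennreal_mult)
  finally show ?thesis by (subst (asm) ennreal_inj) (simp_all add: Delta_Hall_number_nonneg)
qed

lemma Delta_Hall_number_assoc:
  assumes O: "A \<in> Obj C" "B \<in> Obj C" "D \<in> Obj C" "Y \<in> Obj C"
    and F: "finite F" "F \<subseteq> Iso C" "\<And>m. m \<in> Iso C \<Longrightarrow> m \<notin> F \<Longrightarrow> Delta_Hall_number K C A B (rep m) = 0"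
    and G: "finite G" "G \<subseteq> Iso C" "\<And>m. m \<in> Iso C \<Longrightarrow> m \<notin> G \<Longrightarrow> Delta_Hall_number K C B D (rep m) = 0"
  shows "(\<Sum>m\<in>F. Delta_Hall_number K C A B (rep m) * Delta_Hall_number K C (rep m) D Y) =
    (\<Sum>m\<in>G. Delta_Hall_number K C B D (rep m) * Delta_Hall_number K C A (rep m) Y)"
proof -
  let ?D = "Delta_Hall_number K C"
  let ?a = "\<lambda>M. real (card (Aut C M))"
  \<comment> \<open>The part of the square roots that depends only on the three factors, together
    with the weight of \<open>Y\<close>.\<close>
  let ?k = "ennreal (sqrt (euler B A) * sqrt (euler D A) * sqrt (euler D B) / ?a Y)"
  have p: "euler B A > 0" "euler D A > 0" "euler D B > 0" using euler_pos O by simp_all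
  have a: "?a M > 0" if "M \<in> Obj C" for M using card_Aut_pos[OF that] by simp
  have z: "Delta_sum A' B' M = 0" if "?D A' B' M = 0" "A' \<in> Obj C" "B' \<in> Obj C" "M \<in> Obj C" for A' B' M
  proof -
    have "ennreal (sqrt (euler B' A') / ?a M) * Delta_sum A' B' M = 0"
      using Delta_Hall_number_ennreal[OF that(2-4)] that(1) by simp
    moreover have "sqrt (euler B' A') / ?a M > 0" using euler_pos that(2,3) a[OF that(4)] by simp
    ultimately show ?thesis by (simp add: ennreal_eq_0_iff)
  qed
  have "ennreal (\<Sum>m\<in>F. ?D A B (rep m) * ?D (rep m) D Y) =
    (\<Sum>m\<in>F. ennreal (1 / ?a (rep m)) * (ennreal (sqrt (euler B A)) * Delta_sum A B (rep m) * ennreal (sqrt (euler D (rep m)) / ?a Y) * Delta_sum (rep m) D Y))"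
    (is "_ = (\<Sum>m\<in>F. _ * ?l (rep m))")
  proof -
    have "ennreal (?D A B (rep m) * ?D (rep m) D Y) = ennreal (1 / ?a (rep m)) * ?l (rep m)" if "m \<in> F" for m
    proof -
      have M: "rep m \<in> Obj C" using that F(2) rep_Iso by blast
      have "ennreal (sqrt (euler B A) / ?a (rep m)) = ennreal (1 / ?a (rep m)) * ennreal (sqrt (euler B A))"
        by (subst ennreal_mult'[symmetric]) simp_all
      then show ?thesis
        unfolding ennreal_mult[OF Delta_Hall_number_nonneg Delta_Hall_number_nonneg]
          Delta_Hall_number_ennreal[OF O(1,2) M] Delta_Hall_number_ennreal[OF M O(3,4)] by (simp only: ac_simps)
    qed
    then show ?thesis
      by (subst sum_ennreal[symmetric]) (simp_all add: Delta_Hall_number_nonneg)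
  qed
  also have "\<dots> = (\<Sum>\<^sub>g M. ?l M)"
    by (rule gsum_finite[symmetric, OF F(1,2)]) (use z F(3) O rep_Iso in simp)
  also have "\<dots> = (\<Sum>\<^sub>g M. ?k * (\<Sum>\<^sub>g L. \<Sum>\<^sub>g I. \<Sum>\<^sub>g N. inv_euler D I * (inv_euler L N * (nses L I B * nses N L M * nses I N A)) * Delta_sum M D Y))"
  proof (rule gsum_cong)
    fix M assume M: "M \<in> Obj C"
    have "?l M = (\<Sum>\<^sub>g L. \<Sum>\<^sub>g I. \<Sum>\<^sub>g N. (ennreal (sqrt (euler B A)) * (ennreal (sqrt (euler D M) / ?a Y) * Delta_sum M D Y)) *
        (inv_euler L N * (nses L I B * nses N L M * nses I N A)))"
      unfolding gsum_cmult Delta_sum_def[of A B] by (simp only: ac_simps)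
    also have "\<dots> = (\<Sum>\<^sub>g L. \<Sum>\<^sub>g I. \<Sum>\<^sub>g N. ?k * (inv_euler D I * (inv_euler L N * (nses L I B * nses N L M * nses I N A)) * Delta_sum M D Y))"
    proof (intro gsum_cong)
      fix L I N assume O': "L \<in> Obj C" "I \<in> Obj C" "N \<in> Obj C"
      let ?S = "nses L I B * nses N L M * nses I N A"
      have "ennreal (sqrt (euler B A)) * ennreal (sqrt (euler D M) / ?a Y) * ?S = ?k * inv_euler D I * ?S"
      proof (cases "?S = 0")
        case False
        then have nz: "nses L I B \<noteq> 0" "nses N L M \<noteq> 0" "nses I N A \<noteq> 0" by auto
        obtain i1 p1 where 1: "sx C I B L i1 p1" using nz(1) by (rule nses_nonzeroE)
        obtain i2 p2 where 2: "sx C L M N i2 p2" using nz(2) by (rule nses_nonzeroE)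
        obtain i3 p3 where 3: "sx C N A I i3 p3" using nz(3) by (rule nses_nonzeroE)
        have q: "euler D L > 0" "euler D I > 0" "euler D N > 0" using euler_pos O O' by simp_all
        \<comment> \<open>Among the subquotients of \<open>A\<close> and \<open>B\<close> the object
          \<open>I\<close> occurs twice, while \<open>M\<close> has only \<open>L\<close> and
          \<open>N\<close>. So \<open>euler D M\<close> is \<open>euler D A * euler D B\<close>
          divided by the square of \<open>euler D I\<close>.\<close>
        have "sqrt (euler B A) * (sqrt (euler D M) / ?a Y) = sqrt (euler B A) * sqrt (euler D A) * sqrt (euler D B) / ?a Y * (1 / euler D I)"
          unfolding euler_mult_right[OF 1 O(3)] euler_mult_right[OF 2 O(3)] euler_mult_right[OF 3 O(3)]
          using q a[OF O(4)] by (simp add: real_sqrt_mult field_simps)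
        then have "ennreal (sqrt (euler B A)) * ennreal (sqrt (euler D M) / ?a Y) = ?k * inv_euler D I"
          unfolding inv_euler_def using p q euler_pos[OF O(3) M] by (simp flip: ennreal_mult)
        then show ?thesis by simp
      qed (simp only: mult_zero_right)
      from arg_cong[OF this, of "\<lambda>x. x * (inv_euler L N * Delta_sum M D Y)"]
      show "(ennreal (sqrt (euler B A)) * (ennreal (sqrt (euler D M) / ?a Y) * Delta_sum M D Y)) * (inv_euler L N * ?S) =
        ?k * (inv_euler D I * (inv_euler L N * ?S) * Delta_sum M D Y)" by (simp only: ac_simps)
    qed
    finally show "?l M = ?k * (\<Sum>\<^sub>g L. \<Sum>\<^sub>g I. \<Sum>\<^sub>g N. inv_euler D I * (inv_euler L N * (nses L I B * nses N L M * nses I N A)) * Delta_sum M D Y)"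
      by (simp only: gsum_cmult)
  qed
  also have "\<dots> = ?k * (\<Sum>\<^sub>g M. \<Sum>\<^sub>g L. \<Sum>\<^sub>g I. \<Sum>\<^sub>g N. inv_euler D I * (inv_euler L N * (nses L I B * nses N L M * nses I N A)) * Delta_sum M D Y)"
    by (rule gsum_cmult)
  also have "\<dots> = ?k * (\<Sum>\<^sub>g M. \<Sum>\<^sub>g L. \<Sum>\<^sub>g I. \<Sum>\<^sub>g N. inv_euler I A * (inv_euler L N * (nses L I D * nses N L M * nses I N B)) * Delta_sum A M Y)"
    by (simp only: Delta_sum_assoc[OF O])
  also have "\<dots> = (\<Sum>\<^sub>g M. ?k * (\<Sum>\<^sub>g L. \<Sum>\<^sub>g I. \<Sum>\<^sub>g N. inv_euler I A * (inv_euler L N * (nses L I D * nses N L M * nses I N B)) * Delta_sum A M Y))"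
    by (rule gsum_cmult[symmetric])
  also have "\<dots> = (\<Sum>\<^sub>g M. ennreal (sqrt (euler D B)) * Delta_sum B D M * ennreal (sqrt (euler M A) / ?a Y) * Delta_sum A M Y)"
    (is "_ = gsum ?r")
  proof (rule gsum_cong)
    fix M assume M: "M \<in> Obj C"
    have "?r M = (\<Sum>\<^sub>g L. \<Sum>\<^sub>g I. \<Sum>\<^sub>g N. (ennreal (sqrt (euler D B)) * (ennreal (sqrt (euler M A) / ?a Y) * Delta_sum A M Y)) *
        (inv_euler L N * (nses L I D * nses N L M * nses I N B)))"
      unfolding gsum_cmult Delta_sum_def[of B D] by (simp only: ac_simps)
    also have "\<dots> = (\<Sum>\<^sub>g L. \<Sum>\<^sub>g I. \<Sum>\<^sub>g N. ?k * (inv_euler I A * (inv_euler L N * (nses L I D * nses N L M * nses I N B)) * Delta_sum A M Y))"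
    proof (intro gsum_cong)
      fix L I N assume O': "L \<in> Obj C" "I \<in> Obj C" "N \<in> Obj C"
      let ?S = "nses L I D * nses N L M * nses I N B"
      have "ennreal (sqrt (euler D B)) * ennreal (sqrt (euler M A) / ?a Y) * ?S = ?k * inv_euler I A * ?S"
      proof (cases "?S = 0")
        case False
        then have nz: "nses L I D \<noteq> 0" "nses N L M \<noteq> 0" "nses I N B \<noteq> 0" by auto
        obtain i1 p1 where 1: "sx C I D L i1 p1" using nz(1) by (rule nses_nonzeroE)
        obtain i2 p2 where 2: "sx C L M N i2 p2" using nz(2) by (rule nses_nonzeroE)
        obtain i3 p3 where 3: "sx C N B I i3 p3" using nz(3) by (rule nses_nonzeroE)
        have q: "euler L A > 0" "euler I A > 0" "euler N A > 0" using euler_pos O O' by simp_all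
        \<comment> \<open>The same comparison in the first argument: \<open>I\<close> occurs both in
          \<open>D\<close> and in \<open>B\<close> but is missing in \<open>M\<close>.\<close>
        have "sqrt (euler D B) * (sqrt (euler M A) / ?a Y) = sqrt (euler B A) * sqrt (euler D A) * sqrt (euler D B) / ?a Y * (1 / euler I A)"
          unfolding euler_mult_left[OF 1 O(1)] euler_mult_left[OF 2 O(1)] euler_mult_left[OF 3 O(1)]
          using q a[OF O(4)] by (simp add: real_sqrt_mult field_simps)
        then have "ennreal (sqrt (euler D B)) * ennreal (sqrt (euler M A) / ?a Y) = ?k * inv_euler I A"
          unfolding inv_euler_def using p q euler_pos[OF M O(1)] by (simp flip: ennreal_mult)
        then show ?thesis by simp
      qed (simp only: mult_zero_right)
      from arg_cong[OF this, of "\<lambda>x. x * (inv_euler L N * Delta_sum A M Y)"]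
      show "(ennreal (sqrt (euler D B)) * (ennreal (sqrt (euler M A) / ?a Y) * Delta_sum A M Y)) * (inv_euler L N * ?S) =
        ?k * (inv_euler I A * (inv_euler L N * ?S) * Delta_sum A M Y)" by (simp only: ac_simps)
    qed
    finally show "?k * (\<Sum>\<^sub>g L. \<Sum>\<^sub>g I. \<Sum>\<^sub>g N. inv_euler I A * (inv_euler L N * (nses L I D * nses N L M * nses I N B)) * Delta_sum A M Y) = ?r M"
      by (simp only: gsum_cmult)
  qed
  also have "\<dots> = (\<Sum>m\<in>G. ennreal (1 / ?a (rep m)) * ?r (rep m))"
    by (rule gsum_finite[OF G(1,2)]) (use z G(3) O rep_Iso in simp)
  also have "\<dots> = ennreal (\<Sum>m\<in>G. ?D B D (rep m) * ?D A (rep m) Y)"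
  proof -
    have "ennreal (?D B D (rep m) * ?D A (rep m) Y) = ennreal (1 / ?a (rep m)) * ?r (rep m)" if "m \<in> G" for m
    proof -
      have M: "rep m \<in> Obj C" using that G(2) rep_Iso by blast
      have "ennreal (sqrt (euler D B) / ?a (rep m)) = ennreal (1 / ?a (rep m)) * ennreal (sqrt (euler D B))"
        by (subst ennreal_mult'[symmetric]) simp_all
      then show ?thesis
        unfolding ennreal_mult[OF Delta_Hall_number_nonneg Delta_Hall_number_nonneg]
          Delta_Hall_number_ennreal[OF O(2,3) M] Delta_Hall_number_ennreal[OF O(1) M O(4)] by (simp only: ac_simps)
    qed
    then show ?thesis
      by (subst sum_ennreal[symmetric]) (simp_all add: Delta_Hall_number_nonneg)
  qed
  finally show ?thesis
    by (subst (asm) ennreal_inj) (simp_all add: sum_nonneg Delta_Hall_number_nonneg)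
qed

end

section \<open>The Delta-Hall algebra\<close>

lemma Qv_sel [simp]:
  "zero (Qv K) = 0" "one (Qv K) = 1" "add (Qv K) = (+)" "monoid.mult (Qv K) = times"
  by (simp_all add: Qv_def ring_of_type_algebra_def fun_eq_iff)

lemma Qv_field: "field (Qv K)"
  unfolding Qv_def
  by (rule field.generate_field_is_field[OF field_from_type_algebra]) (simp add: ring_of_type_algebra_def)

lemma Qv_sqrt_q: "sqrt_q K \<in> carrier (Qv K)"
  by (simp add: Qv_def generate_field.incl)

lemma Qv_plus: "x \<in> carrier (Qv K) \<Longrightarrow> y \<in> carrier (Qv K) \<Longrightarrow> x + y \<in> carrier (Qv K)"
  using ring.ring_simprules(1)[OF field.is_ring[OF Qv_field]] by simp

lemma Qv_mult: "x \<in> carrier (Qv K) \<Longrightarrow> y \<in> carrier (Qv K) \<Longrightarrow> x * y \<in> carrier (Qv K)"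
  using ring.ring_simprules(5)[OF field.is_ring[OF Qv_field]] by simp

lemma Qv_0: "0 \<in> carrier (Qv K)"
  using ring.ring_simprules(2)[OF field.is_ring[OF Qv_field]] by simp

lemma Qv_1: "1 \<in> carrier (Qv K)"
  using ring.ring_simprules(6)[OF field.is_ring[OF Qv_field]] by simp

lemma Qv_uminus:
  assumes "x \<in> carrier (Qv K)"
  shows "- x \<in> carrier (Qv K)"
proof -
  interpret Q: field "Qv K" by (rule Qv_field)
  have "a_inv (Qv K) x + x = 0" using Q.l_neg[OF assms] by simp
  then show ?thesis using Q.a_inv_closed[OF assms] by (simp add: eq_neg_iff_add_eq_0[symmetric])
qed

lemma Qv_inverse:
  assumes "x \<in> carrier (Qv K)"
  shows "inverse x \<in> carrier (Qv K)"
proof (cases "x = 0")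
  case False
  interpret Q: field "Qv K" by (rule Qv_field)
  have u: "x \<in> Units (Qv K)" using assms False Q.field_Units by simp
  then have "m_inv (Qv K) x * x = 1" using Q.Units_l_inv by simp
  then have "m_inv (Qv K) x = inverse x" using False by (simp add: field_simps)
  then show ?thesis using Q.Units_inv_closed[OF u] by simp
qed (use Qv_0 in simp)

lemma Qv_of_nat: "of_nat n \<in> carrier (Qv K)"
  by (induction n) (simp_all add: Qv_0 Qv_1 Qv_plus)

lemma Qv_power: "x \<in> carrier (Qv K) \<Longrightarrow> x ^ n \<in> carrier (Qv K)"
  by (induction n) (simp_all add: Qv_1 Qv_mult)

lemma Qv_power_int: "x \<in> carrier (Qv K) \<Longrightarrow> x powi n \<in> carrier (Qv K)"
  by (simp add: power_int_def Qv_power Qv_inverse)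

lemma Qv_sum: "(\<And>i. i \<in> S \<Longrightarrow> f i \<in> carrier (Qv K)) \<Longrightarrow> sum f S \<in> carrier (Qv K)"
  by (induction S rule: infinite_finite_induct) (simp_all add: Qv_0 Qv_plus)

text \<open>Before its square roots are split, each term is built from v and natural numbers by
  field operations, with only integral powers of v.\<close>

lemma Delta_Hall_number_Qv: "Delta_Hall_number K C A B M \<in> carrier (Qv K)"
proof -
  have "Delta_term K C A B M L I N \<in> carrier (Qv K)" for L I N
    unfolding Delta_term_def divide_inverse
    by (intro Qv_mult Qv_power_int Qv_sqrt_q Qv_of_nat Qv_inverse)
  then show ?thesis unfolding Delta_Hall_number_def by (intro Qv_sum) (simp add: split_def)
qed

section \<open>Vectors of finite support and their product\<close>

context finitary_hereditary_category
begin

definition fin_fun :: "('o set \<Rightarrow> real) set" where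
  "fin_fun = {x. finite {c. x c \<noteq> 0} \<and> {c. x c \<noteq> 0} \<subseteq> Iso C \<and> range x \<subseteq> carrier (Qv K)}"

abbreviation Dn :: "'o set \<Rightarrow> 'o set \<Rightarrow> 'o set \<Rightarrow> real" where
  "Dn a b c \<equiv> Delta_Hall_number K C (rep a) (rep b) (rep c)"

definition hall_mult :: "('o set \<Rightarrow> real) \<Rightarrow> ('o set \<Rightarrow> real) \<Rightarrow> 'o set \<Rightarrow> real" where
  "hall_mult = (\<lambda>x y c. if c \<in> Iso C then \<Sum>a | x a \<noteq> 0. \<Sum>b | y b \<noteq> 0. x a * y b * Dn a b c else 0)"

lemma Delta_Hall_algebra_sel [simp]:
  "carrier (Delta_Hall_algebra K C) = fin_fun"
  "monoid.mult (Delta_Hall_algebra K C) = hall_mult"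
  "one (Delta_Hall_algebra K C) = class_vec C (zero_object C)"
  "zero (Delta_Hall_algebra K C) = (\<lambda>c. 0)"
  "add (Delta_Hall_algebra K C) = (\<lambda>x y c. x c + y c)"
  "module.smult (Delta_Hall_algebra K C) = (\<lambda>r x c. r * x c)"
  by (simp_all add: Delta_Hall_algebra_def fin_fun_def hall_mult_def)

lemma fin_funI:
  assumes "finite F" "F \<subseteq> Iso C" "\<And>c. c \<notin> F \<Longrightarrow> x c = 0" "\<And>c. x c \<in> carrier (Qv K)"
  shows "x \<in> fin_fun"
proof -
  have "{c. x c \<noteq> 0} \<subseteq> F" using assms(3) by blast
  then show ?thesis unfolding fin_fun_def using assms finite_subset by blast
qed

lemma fin_funD:
  assumes "x \<in> fin_fun"
  shows "finite {c. x c \<noteq> 0}" "{c. x c \<noteq> 0} \<subseteq> Iso C" "x c \<in> carrier (Qv K)" "c \<notin> Iso C \<Longrightarrow> x c = 0"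
  using assms unfolding fin_fun_def by auto

text \<open>Enlarging the index sets adds only zero terms. Sums and products of vectors with
  different supports can thus be compared over common finite sets.\<close>

lemma hall_mult_eq:
  assumes "finite F" "{a. x a \<noteq> 0} \<subseteq> F" "finite G" "{b. y b \<noteq> 0} \<subseteq> G" "c \<in> Iso C"
  shows "hall_mult x y c = (\<Sum>a\<in>F. \<Sum>b\<in>G. x a * y b * Dn a b c)"
proof -
  have "hall_mult x y c = (\<Sum>a | x a \<noteq> 0. \<Sum>b\<in>G. x a * y b * Dn a b c)"
    unfolding hall_mult_def using assms(5)
    by (simp, intro sum.cong[OF refl] sum.mono_neutral_left) (use assms(3,4) in auto)
  also have "\<dots> = (\<Sum>a\<in>F. \<Sum>b\<in>G. x a * y b * Dn a b c)"
    by (rule sum.mono_neutral_left) (use assms(1,2) in auto)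
  finally show ?thesis .
qed

definition hall_supp :: "'o set set \<Rightarrow> 'o set set \<Rightarrow> 'o set set" where
  "hall_supp F G = (\<Union>a\<in>F. \<Union>b\<in>G. {m \<in> Iso C. Dn a b m \<noteq> 0})"

lemma finite_hall_supp: "finite F \<Longrightarrow> finite G \<Longrightarrow> F \<subseteq> Iso C \<Longrightarrow> G \<subseteq> Iso C \<Longrightarrow> finite (hall_supp F G)"
  unfolding hall_supp_def by (intro finite_UN_I finite_Delta_Hall_number_support) (use rep_Iso in blast)+

lemma hall_mult_supp: "{c. hall_mult x y c \<noteq> 0} \<subseteq> hall_supp {a. x a \<noteq> 0} {b. y b \<noteq> 0}"
proof
  fix c assume "c \<in> {c. hall_mult x y c \<noteq> 0}"
  then have c: "c \<in> Iso C" and s: "(\<Sum>a | x a \<noteq> 0. \<Sum>b | y b \<noteq> 0. x a * y b * Dn a b c) \<noteq> 0"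
    unfolding hall_mult_def by (auto split: if_splits)
  obtain a where a: "x a \<noteq> 0" "(\<Sum>b | y b \<noteq> 0. x a * y b * Dn a b c) \<noteq> 0"
    using sum.not_neutral_contains_not_neutral[OF s] by blast
  obtain b where "y b \<noteq> 0" "Dn a b c \<noteq> 0"
    using sum.not_neutral_contains_not_neutral[OF a(2)] by auto
  then show "c \<in> hall_supp {a. x a \<noteq> 0} {b. y b \<noteq> 0}" unfolding hall_supp_def using a(1) c by blast
qed

lemma hall_mult_closed:
  assumes x: "x \<in> fin_fun" and y: "y \<in> fin_fun"
  shows "hall_mult x y \<in> fin_fun"
proof (rule fin_funI)
  show "finite (hall_supp {a. x a \<noteq> 0} {b. y b \<noteq> 0})"
    by (rule finite_hall_supp) (rule fin_funD[OF x] fin_funD[OF y])+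
  show "hall_supp {a. x a \<noteq> 0} {b. y b \<noteq> 0} \<subseteq> Iso C" unfolding hall_supp_def by blast
  show "hall_mult x y c = 0" if "c \<notin> hall_supp {a. x a \<noteq> 0} {b. y b \<noteq> 0}" for c
    using that hall_mult_supp by blast
  show "hall_mult x y c \<in> carrier (Qv K)" for c
    unfolding hall_mult_def
    by (simp add: Qv_0 Qv_sum Qv_mult Delta_Hall_number_Qv fin_funD(3)[OF x] fin_funD(3)[OF y])
qed

text \<open>After all finite sums are exchanged, the identity holds for each triple of basis
  elements by \<open>Delta_Hall_number_assoc\<close>, with \<open>?F\<close> and \<open>?G\<close>
  as the common finite sets of intermediate classes.\<close>

lemma hall_mult_assoc:
  assumes x: "x \<in> fin_fun" and y: "y \<in> fin_fun" and z: "z \<in> fin_fun"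
  shows "hall_mult (hall_mult x y) z = hall_mult x (hall_mult y z)"
proof
  fix c
  show "hall_mult (hall_mult x y) z c = hall_mult x (hall_mult y z) c"
  proof (cases "c \<in> Iso C")
    case True
    let ?A = "{a. x a \<noteq> 0}" and ?B = "{b. y b \<noteq> 0}" and ?E = "{e. z e \<noteq> 0}"
    let ?F = "hall_supp ?A ?B" and ?G = "hall_supp ?B ?E"
    note A = fin_funD[OF x] and B = fin_funD[OF y] and E = fin_funD[OF z]
    have F: "finite ?F" "?F \<subseteq> Iso C" and G: "finite ?G" "?G \<subseteq> Iso C"
      using finite_hall_supp[OF A(1) B(1) A(2) B(2)] finite_hall_supp[OF B(1) E(1) B(2) E(2)]
      unfolding hall_supp_def by auto
    have "hall_mult (hall_mult x y) z c = (\<Sum>m\<in>?F. \<Sum>e\<in>?E. hall_mult x y m * z e * Dn m e c)"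
      by (rule hall_mult_eq[OF F(1) hall_mult_supp E(1) subset_refl True])
    also have "\<dots> = (\<Sum>m\<in>?F. \<Sum>e\<in>?E. \<Sum>a\<in>?A. \<Sum>b\<in>?B. x a * y b * z e * (Dn a b m * Dn m e c))"
      by (intro sum.cong[OF refl], subst hall_mult_eq[OF A(1) subset_refl B(1) subset_refl])
        (use F(2) in \<open>auto simp: sum_distrib_right sum_distrib_left ac_simps\<close>)
    also have "\<dots> = (\<Sum>e\<in>?E. \<Sum>a\<in>?A. \<Sum>b\<in>?B. \<Sum>m\<in>?F. x a * y b * z e * (Dn a b m * Dn m e c))"
      by (subst sum.swap, rule sum.cong[OF refl], subst sum.swap, rule sum.cong[OF refl], rule sum.swap)
    also have "\<dots> = (\<Sum>e\<in>?E. \<Sum>a\<in>?A. \<Sum>b\<in>?B. \<Sum>m\<in>?G. x a * y b * z e * (Dn b e m * Dn a m c))"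
    proof (intro sum.cong[OF refl])
      fix e a b assume e: "e \<in> ?E" and a: "a \<in> ?A" and b: "b \<in> ?B"
      have O: "rep a \<in> Obj C" "rep b \<in> Obj C" "rep e \<in> Obj C" "rep c \<in> Obj C"
        using rep_Iso(1) A(2) B(2) E(2) a b e True by blast+
      have "(\<Sum>m\<in>?F. Dn a b m * Dn m e c) = (\<Sum>m\<in>?G. Dn b e m * Dn a m c)"
        by (rule Delta_Hall_number_assoc[OF O F _ G]) (use a b e in \<open>auto simp: hall_supp_def\<close>)
      then show "(\<Sum>m\<in>?F. x a * y b * z e * (Dn a b m * Dn m e c)) = (\<Sum>m\<in>?G. x a * y b * z e * (Dn b e m * Dn a m c))"
        by (simp only: sum_distrib_left[symmetric])
    qed
    also have "\<dots> = (\<Sum>a\<in>?A. \<Sum>b\<in>?B. \<Sum>e\<in>?E. \<Sum>m\<in>?G. x a * y b * z e * (Dn b e m * Dn a m c))"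
      by (subst sum.swap, rule sum.cong[OF refl], rule sum.swap)
    also have "\<dots> = (\<Sum>a\<in>?A. \<Sum>m\<in>?G. \<Sum>b\<in>?B. \<Sum>e\<in>?E. x a * y b * z e * (Dn b e m * Dn a m c))"
    proof (rule sum.cong[OF refl])
      fix a
      have "(\<Sum>b\<in>?B. \<Sum>e\<in>?E. \<Sum>m\<in>?G. x a * y b * z e * (Dn b e m * Dn a m c)) =
        (\<Sum>b\<in>?B. \<Sum>m\<in>?G. \<Sum>e\<in>?E. x a * y b * z e * (Dn b e m * Dn a m c))"
        by (rule sum.cong[OF refl], rule sum.swap)
      also have "\<dots> = (\<Sum>m\<in>?G. \<Sum>b\<in>?B. \<Sum>e\<in>?E. x a * y b * z e * (Dn b e m * Dn a m c))" by (rule sum.swap)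
      finally show "(\<Sum>b\<in>?B. \<Sum>e\<in>?E. \<Sum>m\<in>?G. x a * y b * z e * (Dn b e m * Dn a m c)) = \<dots>" .
    qed
    also have "\<dots> = (\<Sum>a\<in>?A. \<Sum>m\<in>?G. x a * hall_mult y z m * Dn a m c)"
      by (intro sum.cong[OF refl], subst hall_mult_eq[OF B(1) subset_refl E(1) subset_refl])
        (use G(2) in \<open>auto simp: sum_distrib_right sum_distrib_left ac_simps\<close>)
    also have "\<dots> = hall_mult x (hall_mult y z) c"
      by (rule hall_mult_eq[symmetric, OF A(1) subset_refl G(1) hall_mult_supp True])
    finally show ?thesis .
  qed (simp add: hall_mult_def)
qed

lemma class_vec_rep: "m \<in> Iso C \<Longrightarrow> class_vec C (rep m) = (\<lambda>c. if c = m then 1 else 0)"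
  unfolding class_vec_def by (simp add: rep_Iso(2))

lemma class_vec_fin_fun: "A \<in> Obj C \<Longrightarrow> class_vec C A \<in> fin_fun"
  by (rule fin_funI[of "{iso_class C A}"]) (auto simp: class_vec_def iso_class_Iso Qv_0 Qv_1)

lemma class_vec_supp: "{c. class_vec C A c \<noteq> 0} = {iso_class C A}"
  by (auto simp: class_vec_def)

text \<open>The chosen representative of the zero class need not be the chosen zero object, but it
  is isomorphic to it.\<close>

lemma rep_zero: "is_zero_object C (rep (iso_class C (zero_object C)))"
proof -
  note Z = zero_object_zero
  have O: "zero_object C \<in> Obj C" by (rule zero_objectD(1)[OF Z])
  then have R: "rep (iso_class C (zero_object C)) \<in> Obj C" using rep_Iso(1) iso_class_Iso by blast
  have "isos (zero_object C) (rep (iso_class C (zero_object C))) \<noteq> {}"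
    using isomorphic_rep[OF O] unfolding isomorphic_def isos_def by blast
  then show ?thesis using isos_zero[OF Z R] by (auto split: if_splits)
qed

lemma isomorphic_rep_iff: "m \<in> Iso C \<Longrightarrow> m' \<in> Iso C \<Longrightarrow> isomorphic C (rep m) (rep m') \<longleftrightarrow> m = m'"
  using rep_eq isomorphic_refl rep_Iso(1) by blast

lemma hall_mult_one:
  assumes x: "x \<in> fin_fun"
  shows "hall_mult (class_vec C (zero_object C)) x = x" "hall_mult x (class_vec C (zero_object C)) = x"
proof -
  note D = fin_funD[OF x]
  let ?z = "iso_class C (zero_object C)"
  have s: "{c. class_vec C (zero_object C) c \<noteq> 0} \<subseteq> {?z}" by (simp add: class_vec_supp)
  have v: "class_vec C (zero_object C) ?z = 1" by (simp add: class_vec_def)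
  have d: "x b * (if b = c then 1 else 0) = (if b = c then x b else 0)" for b c by simp
  show "hall_mult (class_vec C (zero_object C)) x = x"
  proof
    fix c
    show "hall_mult (class_vec C (zero_object C)) x c = x c"
    proof (cases "c \<in> Iso C")
      case True
      have "hall_mult (class_vec C (zero_object C)) x c = (\<Sum>b | x b \<noteq> 0. x b * Dn ?z b c)"
        by (subst hall_mult_eq[OF _ s D(1) subset_refl True]) (simp_all add: v)
      also have "\<dots> = (\<Sum>b | x b \<noteq> 0. if b = c then x b else 0)"
      proof (rule sum.cong[OF refl])
        fix b assume "b \<in> {b. x b \<noteq> 0}"
        then have b: "b \<in> Iso C" using D(2) by blast
        have "Dn ?z b c = (if b = c then 1 else 0)"
          using Delta_Hall_number_zero_left[OF rep_zero rep_Iso(1)[OF b] rep_Iso(1)[OF True]] isomorphic_rep_iff[OF b True] by simp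
        then show "x b * Dn ?z b c = (if b = c then x b else 0)" by simp
      qed
      also have "\<dots> = x c" using D(1) by (simp add: sum.delta)
      finally show ?thesis .
    next
      case False
      then show ?thesis using D(4)[OF False] by (simp add: hall_mult_def)
    qed
  qed
  show "hall_mult x (class_vec C (zero_object C)) = x"
  proof
    fix c
    show "hall_mult x (class_vec C (zero_object C)) c = x c"
    proof (cases "c \<in> Iso C")
      case True
      have "hall_mult x (class_vec C (zero_object C)) c = (\<Sum>b | x b \<noteq> 0. x b * Dn b ?z c)"
        by (subst hall_mult_eq[OF D(1) subset_refl _ s True]) (simp_all add: v)
      also have "\<dots> = (\<Sum>b | x b \<noteq> 0. if b = c then x b else 0)"
      proof (rule sum.cong[OF refl])
        fix b assume "b \<in> {b. x b \<noteq> 0}"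
        then have b: "b \<in> Iso C" using D(2) by blast
        have "Dn b ?z c = (if b = c then 1 else 0)"
          using Delta_Hall_number_zero_right[OF rep_zero rep_Iso(1)[OF b] rep_Iso(1)[OF True]] isomorphic_rep_iff[OF b True] by simp
        then show "x b * Dn b ?z c = (if b = c then x b else 0)" by simp
      qed
      also have "\<dots> = x c" using D(1) by (simp add: sum.delta)
      finally show ?thesis .
    next
      case False
      then show ?thesis using D(4)[OF False] by (simp add: hall_mult_def)
    qed
  qed
qed

lemma fin_fun_plus:
  assumes x: "x \<in> fin_fun" and y: "y \<in> fin_fun"
  shows "(\<lambda>c. x c + y c) \<in> fin_fun"
  by (rule fin_funI[of "{c. x c \<noteq> 0} \<union> {c. y c \<noteq> 0}"])
    (use fin_funD[OF x] fin_funD[OF y] in \<open>auto intro: Qv_plus\<close>)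

lemma fin_fun_smult:
  assumes x: "x \<in> fin_fun" and r: "r \<in> carrier (Qv K)"
  shows "(\<lambda>c. r * x c) \<in> fin_fun"
  by (rule fin_funI[of "{c. x c \<noteq> 0}"]) (use fin_funD[OF x] Qv_mult[OF r] in auto)

lemma abelian_group_H: "abelian_group (Delta_Hall_algebra K C)"
proof (rule abelian_groupI)
  show "\<exists>y\<in>carrier (Delta_Hall_algebra K C). y \<oplus>\<^bsub>Delta_Hall_algebra K C\<^esub> x = \<zero>\<^bsub>Delta_Hall_algebra K C\<^esub>"
    if "x \<in> carrier (Delta_Hall_algebra K C)" for x
    using fin_fun_smult[OF _ Qv_uminus[OF Qv_1], of x] that by (intro bexI[of _ "\<lambda>c. - 1 * x c"]) simp_all
qed (simp_all add: fin_fun_plus ac_simps fin_funI[of "{}"] Qv_0)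

lemma module_H: "module (Qv K) (Delta_Hall_algebra K C)"
proof (rule moduleI)
  show "cring (Qv K)" by (rule domain.axioms(1)[OF field.axioms(1)[OF Qv_field]])
qed (simp_all add: abelian_group_H fin_fun_smult algebra_simps)

lemma vectorspace_H: "vectorspace (Qv K) (Delta_Hall_algebra K C)"
  by (intro vectorspace.intro module_H Qv_field)

lemma hall_mult_plus:
  assumes x: "x \<in> fin_fun" and y: "y \<in> fin_fun" and z: "z \<in> fin_fun"
  shows "hall_mult (\<lambda>c. x c + y c) z = (\<lambda>c. hall_mult x z c + hall_mult y z c)"
    "hall_mult z (\<lambda>c. x c + y c) = (\<lambda>c. hall_mult z x c + hall_mult z y c)"
proof -
  let ?F = "{c. x c \<noteq> 0} \<union> {c. y c \<noteq> 0}"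
  have F: "finite ?F" "{c. x c + y c \<noteq> 0} \<subseteq> ?F" "{c. x c \<noteq> 0} \<subseteq> ?F" "{c. y c \<noteq> 0} \<subseteq> ?F"
    using fin_funD(1)[OF x] fin_funD(1)[OF y] by auto
  note Z = fin_funD(1)[OF z] subset_refl
  show "hall_mult (\<lambda>c. x c + y c) z = (\<lambda>c. hall_mult x z c + hall_mult y z c)"
  proof
    fix c show "hall_mult (\<lambda>c. x c + y c) z c = hall_mult x z c + hall_mult y z c"
    proof (cases "c \<in> Iso C")
      case True
      show ?thesis
        unfolding hall_mult_eq[OF F(1,2) Z True] hall_mult_eq[OF F(1,3) Z True] hall_mult_eq[OF F(1,4) Z True]
        by (simp only: distrib_right sum.distrib)
    qed (simp add: hall_mult_def)
  qed
  show "hall_mult z (\<lambda>c. x c + y c) = (\<lambda>c. hall_mult z x c + hall_mult z y c)"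
  proof
    fix c show "hall_mult z (\<lambda>c. x c + y c) c = hall_mult z x c + hall_mult z y c"
    proof (cases "c \<in> Iso C")
      case True
      show ?thesis
        unfolding hall_mult_eq[OF Z F(1,2) True] hall_mult_eq[OF Z F(1,3) True] hall_mult_eq[OF Z F(1,4) True]
        by (simp only: distrib_left distrib_right sum.distrib)
    qed (simp add: hall_mult_def)
  qed
qed

lemma hall_mult_smult:
  assumes x: "x \<in> fin_fun" and y: "y \<in> fin_fun"
  shows "hall_mult (\<lambda>c. r * x c) y = (\<lambda>c. r * hall_mult x y c)"
    "hall_mult x (\<lambda>c. r * y c) = (\<lambda>c. r * hall_mult x y c)"
proof -
  note X1 = fin_funD(1)[OF x] subset_refl and Y1 = fin_funD(1)[OF y] subset_refl
  have s: "{c. r * x c \<noteq> 0} \<subseteq> {c. x c \<noteq> 0}" "{c. r * y c \<noteq> 0} \<subseteq> {c. y c \<noteq> 0}" by auto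
  show "hall_mult (\<lambda>c. r * x c) y = (\<lambda>c. r * hall_mult x y c)"
  proof
    fix c show "hall_mult (\<lambda>c. r * x c) y c = r * hall_mult x y c"
    proof (cases "c \<in> Iso C")
      case True
      show ?thesis unfolding hall_mult_eq[OF X1(1) s(1) Y1 True] hall_mult_eq[OF X1 Y1 True]
        by (simp only: sum_distrib_left ac_simps)
    qed (simp add: hall_mult_def)
  qed
  show "hall_mult x (\<lambda>c. r * y c) = (\<lambda>c. r * hall_mult x y c)"
  proof
    fix c show "hall_mult x (\<lambda>c. r * y c) c = r * hall_mult x y c"
    proof (cases "c \<in> Iso C")
      case True
      show ?thesis unfolding hall_mult_eq[OF X1 Y1(1) s(2) True] hall_mult_eq[OF X1 Y1 True]
        by (simp only: sum_distrib_left ac_simps)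
    qed (simp add: hall_mult_def)
  qed
qed

lemma associative_algebra_H: "associative_algebra (Qv K) (Delta_Hall_algebra K C)"
proof (intro associative_algebra.intro module_H associative_algebra_axioms.intro)
  show "ring (Delta_Hall_algebra K C)"
  proof (rule ringI)
    show "monoid (Delta_Hall_algebra K C)"
      by (rule monoidI) (simp_all add: hall_mult_closed hall_mult_assoc hall_mult_one
          class_vec_fin_fun zero_objectD(1)[OF zero_object_zero])
  qed (simp_all add: abelian_group_H hall_mult_plus)
qed (simp_all add: hall_mult_smult)

lemma finsum_H:
  assumes "finite S" "\<And>i. i \<in> S \<Longrightarrow> f i \<in> fin_fun"
  shows "finsum (Delta_Hall_algebra K C) f S = (\<lambda>c. \<Sum>i\<in>S. f i c)"
proof -
  interpret H: module "Qv K" "Delta_Hall_algebra K C" by (rule module_H)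
  show ?thesis using assms
  proof (induction S rule: finite_induct)
    case (insert i S)
    have "finsum (Delta_Hall_algebra K C) f (insert i S) = f i \<oplus>\<^bsub>Delta_Hall_algebra K C\<^esub> finsum (Delta_Hall_algebra K C) f S"
      by (rule H.finsum_insert) (use insert in auto)
    then show ?case using insert by (simp add: fun_eq_iff)
  qed simp
qed

lemma class_vec_inj: "inj_on (\<lambda>m. class_vec C (rep m)) (Iso C)"
proof (rule inj_onI)
  fix m m' assume m: "m \<in> Iso C" "m' \<in> Iso C" and "class_vec C (rep m) = class_vec C (rep m')"
  then have "class_vec C (rep m) m = class_vec C (rep m') m" by simp
  then show "m = m'" using class_vec_rep[OF m(1)] class_vec_rep[OF m(2)] by (simp split: if_splits)
qed

text \<open>Evaluation at a class isolates the coefficient of its basis vector, which gives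
  independence; a finitely supported function is the combination of basis vectors with its own
  values as coefficients.\<close>

lemma basis_H: "vectorspace.basis (Qv K) (Delta_Hall_algebra K C) ((\<lambda>m. class_vec C (rep m)) ` Iso C)"
proof -
  interpret H: vectorspace "Qv K" "Delta_Hall_algebra K C" by (rule vectorspace_H)
  let ?g = "\<lambda>m. class_vec C (rep m)"
  have gH: "?g m \<in> fin_fun" if "m \<in> Iso C" for m by (rule class_vec_fin_fun[OF rep_Iso(1)[OF that]])
  have lc: "H.lincomb a A = (\<lambda>c. \<Sum>v\<in>A. a v * v c)" if "finite A" "A \<subseteq> fin_fun" "a \<in> A \<rightarrow> carrier (Qv K)" for a A
    unfolding H.lincomb_def by (subst finsum_H) (use that fin_fun_smult in auto)
  have "\<not> H.lin_dep (?g ` Iso C)"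
  proof
    assume "H.lin_dep (?g ` Iso C)"
    then obtain A a v where A: "finite A" "A \<subseteq> ?g ` Iso C" "a \<in> A \<rightarrow> carrier (Qv K)"
      "H.lincomb a A = (\<lambda>c. 0)" "v \<in> A" "a v \<noteq> 0" unfolding H.lin_dep_def by auto
    obtain m where m: "m \<in> Iso C" "v = ?g m" using A(2,5) by blast
    \<comment> \<open>At \<open>m\<close> every basis vector other than \<open>v\<close> vanishes,
      so evaluating the relation there leaves the coefficient of \<open>v\<close>.\<close>
    have w: "w m = (if w = v then 1 else 0)" if wA: "w \<in> A" for w
    proof -
      obtain m' where m': "m' \<in> Iso C" "w = ?g m'" using A(2) wA by blast
      have "w = v \<longleftrightarrow> m' = m" unfolding m'(2) m(2) by (rule inj_on_eq_iff[OF class_vec_inj m'(1) m(1)])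
      then show ?thesis unfolding m'(2) class_vec_rep[OF m'(1)] using m'(2) class_vec_rep[OF m'(1)] by auto
    qed
    have AF: "A \<subseteq> fin_fun" using A(2) gH by blast
    have "(\<Sum>w\<in>A. a w * w m) = 0" using lc[OF A(1) AF A(3)] A(4) by (simp add: fun_eq_iff)
    moreover have "(\<Sum>w\<in>A. a w * w m) = (\<Sum>w\<in>A. if w = v then a w else 0)"
      by (rule sum.cong[OF refl]) (simp add: w)
    ultimately show False using A(1,5,6) by (simp add: sum.delta)
  qed
  moreover have "H.span (?g ` Iso C) = fin_fun"
  proof
    show "H.span (?g ` Iso C) \<subseteq> fin_fun"
    proof
      fix x assume "x \<in> H.span (?g ` Iso C)"
      then obtain a A where x: "x = H.lincomb a A" "finite A" "A \<subseteq> ?g ` Iso C" "a \<in> A \<rightarrow> carrier (Qv K)"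
        unfolding H.span_def by blast
      have AF: "A \<subseteq> carrier (Delta_Hall_algebra K C)" using x(3) gH by auto
      show "x \<in> fin_fun" using H.lincomb_closed[OF AF x(4)] unfolding x(1) by simp
    qed
    show "fin_fun \<subseteq> H.span (?g ` Iso C)"
    proof
      fix x assume x: "x \<in> fin_fun"
      note D = fin_funD[OF x]
      let ?S = "{c. x c \<noteq> 0}"
      \<comment> \<open>Linear combinations are indexed by vectors, so the value of \<open>x\<close>
        at a class has to be read off from its basis vector.\<close>
      define a where "a = (\<lambda>v. x (the_inv_into (Iso C) ?g v))"
      have ag: "a (?g m) = x m" if "m \<in> Iso C" for m
        unfolding a_def by (simp add: the_inv_into_f_f[OF class_vec_inj that])
      have a: "a \<in> ?g ` ?S \<rightarrow> carrier (Qv K)" unfolding a_def using D(3) by blast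
      have SF: "?g ` ?S \<subseteq> fin_fun" using D(2) gH by blast
      have inj: "inj_on ?g ?S" by (rule inj_on_subset[OF class_vec_inj D(2)])
      have "H.lincomb a (?g ` ?S) = (\<lambda>c. \<Sum>v\<in>?g ` ?S. a v * v c)" by (rule lc[OF finite_imageI[OF D(1)] SF a])
      also have "\<dots> = (\<lambda>c. \<Sum>m\<in>?S. if m = c then x m else 0)"
      proof
        fix c
        show "(\<Sum>v\<in>?g ` ?S. a v * v c) = (\<Sum>m\<in>?S. if m = c then x m else 0)"
          unfolding sum.reindex[OF inj] o_def
        proof (rule sum.cong[OF refl])
          fix m assume "m \<in> ?S"
          then have m: "m \<in> Iso C" using D(2) by blast
          have "?g m c = (if m = c then 1 else 0)" unfolding class_vec_rep[OF m] by auto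
          then show "a (?g m) * ?g m c = (if m = c then x m else 0)" by (simp only: ag[OF m]) simp
        qed
      qed
      also have "\<dots> = x" using D(1) by (simp add: fun_eq_iff sum.delta)
      finally have "x = H.lincomb a (?g ` ?S)" by simp
      then show "x \<in> H.span (?g ` Iso C)" unfolding H.span_def using a D(1,2) by blast
    qed
  qed
  moreover have "?g ` Iso C \<subseteq> fin_fun" using gH by blast
  ultimately show ?thesis unfolding H.basis_def by simp
qed

text \<open>The product of the algebra is defined through chosen representatives of the classes;
  \<open>Delta_Hall_number_iso\<close> passes from these to the given objects.\<close>

lemma class_vec_mult:
  assumes O: "A \<in> Obj C" "B \<in> Obj C"
  shows "hall_mult (class_vec C A) (class_vec C B) =
    (\<Oplus>\<^bsub>Delta_Hall_algebra K C\<^esub>m \<in> {m \<in> Iso C. Delta_Hall_number K C A B (rep m) \<noteq> 0}.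
      Delta_Hall_number K C A B (rep m) \<odot>\<^bsub>Delta_Hall_algebra K C\<^esub> class_vec C (rep m))"
proof -
  let ?S = "{m \<in> Iso C. Delta_Hall_number K C A B (rep m) \<noteq> 0}"
  have fS: "finite ?S" by (rule finite_Delta_Hall_number_support[OF O])
  let ?f = "\<lambda>m c. Delta_Hall_number K C A B (rep m) * class_vec C (rep m) c"
  have "(\<Oplus>\<^bsub>Delta_Hall_algebra K C\<^esub>m \<in> ?S. Delta_Hall_number K C A B (rep m) \<odot>\<^bsub>Delta_Hall_algebra K C\<^esub> class_vec C (rep m)) =
    (\<lambda>c. \<Sum>m\<in>?S. ?f m c)"
    unfolding Delta_Hall_algebra_sel
    by (rule finsum_H[OF fS]) (auto intro!: fin_fun_smult class_vec_fin_fun rep_Iso(1) Delta_Hall_number_Qv)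
  also have "\<dots> = hall_mult (class_vec C A) (class_vec C B)"
  proof
    fix c
    have "(\<Sum>m\<in>?S. ?f m c) = (\<Sum>m\<in>?S. if m = c then Delta_Hall_number K C A B (rep m) else 0)"
      by (rule sum.cong[OF refl]) (auto simp: class_vec_rep)
    also have "\<dots> = (if c \<in> Iso C then Delta_Hall_number K C A B (rep c) else 0)"
      using fS by (simp add: sum.delta)
    also have "\<dots> = hall_mult (class_vec C A) (class_vec C B) c"
    proof (cases "c \<in> Iso C")
      case True
      have R: "rep (iso_class C A) \<in> Obj C" "rep (iso_class C B) \<in> Obj C" using rep_Iso(1) iso_class_Iso O by blast+
      have "Delta_Hall_number K C A B (rep c) = Dn (iso_class C A) (iso_class C B) c"
        by (rule Delta_Hall_number_iso[OF O R isomorphic_rep[OF O(1)] isomorphic_rep[OF O(2)]])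
      then show ?thesis unfolding hall_mult_def using True by (simp add: class_vec_supp) (simp add: class_vec_def)
    qed (simp add: hall_mult_def)
    finally show "(\<Sum>m\<in>?S. ?f m c) = hall_mult (class_vec C A) (class_vec C B) c" .
  qed
  finally show ?thesis by simp
qed

end

theorem theorem2p2:
  fixes K :: "'k ring" and C :: "('o, 'm, 'k) lincat"
  assumes "finitary_hereditary_category K C"
  shows
    "(\<forall>A \<in> Obj C. \<forall>B \<in> Obj C. \<forall>M \<in> Obj C.
        finite (Delta_support K C A B M) \<and> Delta_Hall_number K C A B M \<in> carrier (Qv K)) \<and>
     (let H = Delta_Hall_algebra K C in
        vectorspace (Qv K) H \<and>
        inj_on (\<lambda>m. class_vec C (rep m)) (Iso C) \<and>
        vectorspace.basis (Qv K) H ((\<lambda>m. class_vec C (rep m)) ` Iso C) \<and>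
        (\<forall>A \<in> Obj C. \<forall>B \<in> Obj C.
           finite {m \<in> Iso C. Delta_Hall_number K C A B (rep m) \<noteq> 0} \<and>
           class_vec C A \<otimes>\<^bsub>H\<^esub> class_vec C B =
             (\<Oplus>\<^bsub>H\<^esub>m \<in> {m \<in> Iso C. Delta_Hall_number K C A B (rep m) \<noteq> 0}.
                Delta_Hall_number K C A B (rep m) \<odot>\<^bsub>H\<^esub> class_vec C (rep m))) \<and>
        associative_algebra (Qv K) H \<and>
        \<one>\<^bsub>H\<^esub> = class_vec C (zero_object C))"
proof -
  interpret finitary_hereditary_category K C by fact
  have "class_vec C A \<otimes>\<^bsub>Delta_Hall_algebra K C\<^esub> class_vec C B = hall_mult (class_vec C A) (class_vec C B)" for A B
    by simp
  then show ?thesis unfolding Let_def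
    by (intro conjI ballI finite_Delta_support Delta_Hall_number_Qv vectorspace_H class_vec_inj basis_H
        finite_Delta_Hall_number_support associative_algebra_H Delta_Hall_algebra_sel(3))
      (simp_all only: class_vec_mult)
qed

end
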